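(* Assume $X_t\in\mathcal{L}^p$ with some $p>4$, $\mathbb{E}X_t=0$, and $\Theta_p(m)=O(m^{-\alpha})$, $\Delta_p(m)=O(m^{-\alpha'})$ for some $\alpha\ge\alpha'>0$. If $$\alpha>1/2\qquad\text{or}\qquad \alpha'p>2,$$ then $$\lambda(\hat\Gamma_{T,A_T}-\Sigma_T)=O_P\left[\left(\frac{\log T}{T}\right)^{\frac{\alpha}{2(1+\alpha)}}\right],$$ where $A_T=2c_p'\sqrt{\log T/T}$ with $c_p'=6(p+4)e^{p/4}\|X_0\|_4\Theta_4$.
   Context: Let $\varepsilon_t$, $t\in\mathbb{Z}$, be i.i.d. random variables and let $g$ be a measurable real-valued function such that $X_t = g(\varepsilon_t,\varepsilon_{t-1},\ldots)$ is well defined; $(X_t)_{t\in\mathbb{Z}}$ is then a stationary process. Write $\|X\|_p = (\mathbb{E}|X|^p)^{1/p}$ and $X\in\mathcal{L}^p$ if $\|X\|_p<\infty$. Let $(\varepsilon_t')_{t\in\mathbb{Z}}$ be an independent i.i.d. copy of $(\varepsilon_t)_{t\in\mathbb{Z}}$. For $t\ge 0$ let $X_t' = g(\varepsilon_t,\ldots,\varepsilon_1,\varepsilon_0',\varepsilon_{-1},\ldots)$, i.e. $\varepsilon_0$ is replaced by $\varepsilon_0'$. For $p>0$ define $\delta_p(t) = \|X_t-X_t'\|_p$ for $t\ge 0$, and $\Theta_p(m) = \sum_{t=m}^\infty \delta_p(t)$ for $m\ge 0$, $\Theta_p = \Theta_p(0)$. Standing assumption: $\Theta_p<\infty$. For $p>2$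 define further $$\Psi_p(m)=\left(\sum_{t=m}^\infty\delta_p(t)^2\right)^{1/2},\qquad \Delta_p(m)=\sum_{t=0}^\infty\min\{\mathcal{C}_p\Psi_p(m),\delta_p(t)\},\qquad \mathcal{C}_p=\sqrt{p-1}.$$ Autocovariances (mean zero): $\gamma_k = \mathbb{E}(X_0X_k)$; $\Sigma_T=(\gamma_{s-t})_{1\le s,t\le T}$. Sample autocovariances from $X_1,\ldots,X_T$: $\hat\gamma_k = \frac1T\sum_{t=|k|+1}^{T} X_{t-|k|}X_t$ for $|k|\le T-1$. The thresholded sample autocovariance matrix is $$\hat\Gamma_{T,A_T}=\left(\hat\gamma_{s-t}\mathbf{1}_{|\hat\gamma_{s-t}|\ge A_T}\right)_{1\le s,t\le T},$$ with the convention that the diagonal elements are never thresholded (the diagonal entries are always $\hat\gamma_0$). For a symmetric real matrix $A$, $\lambda(A) = \max_{|\mathbf{x}|=1}|A\mathbf{x}|$ is the operator norm (spectral radius), $|\cdot|$ being the Euclidean norm. $O_P$ is as $T\to\infty$. *)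

theory Defs
  imports "HOL-Probability.Probability" "Jordan_Normal_Form.Matrix"
begin

definition Lp_norm :: "'a measure \<Rightarrow> real \<Rightarrow> ('a \<Rightarrow> real) \<Rightarrow> real" where
  "Lp_norm M p X = (LINT \<omega>|M. \<bar>X \<omega>\<bar> powr p) powr (1 / p)"

text \<open>
  Since \<^const>\<open>Lp_norm\<close> is real-valued, it is only meaningful for functions satisfying the
  following predicate.
\<close>

definition in_Lp :: "'a measure \<Rightarrow> real \<Rightarrow> ('a \<Rightarrow> real) \<Rightarrow> bool" where
  "in_Lp M p X \<longleftrightarrow> X \<in> borel_measurable M \<and> integrable M (\<lambda>\<omega>. \<bar>X \<omega>\<bar> powr p)"

text \<open>
  The argument of \<open>g\<close> lists the innovations backwards in time: its \<open>i\<close>-th component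
  is the innovation at time \<open>t - i\<close>.
\<close>

definition process ::
  "((nat \<Rightarrow> real) \<Rightarrow> real) \<Rightarrow> (int \<Rightarrow> 'a \<Rightarrow> real) \<Rightarrow> int \<Rightarrow> 'a \<Rightarrow> real" where
  "process g eps t \<omega> = g (\<lambda>i. eps (t - int i) \<omega>)"

definition coupled_process ::
  "((nat \<Rightarrow> real) \<Rightarrow> real) \<Rightarrow> (int \<Rightarrow> 'a \<Rightarrow> real) \<Rightarrow> (int \<Rightarrow> 'a \<Rightarrow> real) \<Rightarrow> int \<Rightarrow> 'a \<Rightarrow> real" where
  "coupled_process g eps eps' = process g (eps(0 := eps' 0))"

text \<open>
  The functions below take the sequence \<open>\<delta>\<close> of dependence coefficients as an argument. The
  infinite sums are real-valued, hence meaningful only if \<open>\<delta>\<close> is summable.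
\<close>

definition dep_coeff ::
  "'a measure \<Rightarrow> ((nat \<Rightarrow> real) \<Rightarrow> real) \<Rightarrow> (int \<Rightarrow> 'a \<Rightarrow> real) \<Rightarrow> (int \<Rightarrow> 'a \<Rightarrow> real)
    \<Rightarrow> real \<Rightarrow> nat \<Rightarrow> real" where
  "dep_coeff M g eps eps' p t =
     Lp_norm M p (\<lambda>\<omega>. process g eps (int t) \<omega> - coupled_process g eps eps' (int t) \<omega>)"

definition Theta_tail :: "(nat \<Rightarrow> real) \<Rightarrow> nat \<Rightarrow> real" where
  "Theta_tail \<delta> m = (\<Sum>t. \<delta> (t + m))"

definition Psi_tail :: "(nat \<Rightarrow> real) \<Rightarrow> nat \<Rightarrow> real" where
  "Psi_tail \<delta> m = sqrt (\<Sum>t. (\<delta> (t + m))\<^sup>2)"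

definition Delta_tail :: "real \<Rightarrow> (nat \<Rightarrow> real) \<Rightarrow> nat \<Rightarrow> real" where
  "Delta_tail p \<delta> m = (\<Sum>t. min (sqrt (p - 1) * Psi_tail \<delta> m) (\<delta> t))"

definition autocov :: "'a measure \<Rightarrow> (int \<Rightarrow> 'a \<Rightarrow> real) \<Rightarrow> int \<Rightarrow> real" where
  "autocov M X k = (LINT \<omega>|M. X 0 \<omega> * X k \<omega>)"

definition sample_autocov :: "(int \<Rightarrow> 'a \<Rightarrow> real) \<Rightarrow> nat \<Rightarrow> int \<Rightarrow> 'a \<Rightarrow> real" where
  "sample_autocov X T k \<omega> =
     (1 / real T) * (\<Sum>t = \<bar>k\<bar> + 1..int T. X (t - \<bar>k\<bar>) \<omega> * X t \<omega>)"

text \<open>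
  Row and column indices of \<^const>\<open>mat\<close> run from 0 to \<open>T - 1\<close>; the entries below depend only
  on index differences, so the shift is immaterial.
\<close>

definition autocov_mat :: "'a measure \<Rightarrow> (int \<Rightarrow> 'a \<Rightarrow> real) \<Rightarrow> nat \<Rightarrow> real mat" where
  "autocov_mat M X T = mat T T (\<lambda>(s, t). autocov M X (int s - int t))"

definition thresholded_autocov_mat ::
  "(int \<Rightarrow> 'a \<Rightarrow> real) \<Rightarrow> nat \<Rightarrow> real \<Rightarrow> 'a \<Rightarrow> real mat" where
  "thresholded_autocov_mat X T A \<omega> = mat T T (\<lambda>(s, t).
     if s = t \<or> \<bar>sample_autocov X T (int s - int t) \<omega>\<bar> \<ge> A
     then sample_autocov X T (int s - int t) \<omega> else 0)"

definition vec_eucl_norm :: "real vec \<Rightarrow> real" where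
  "vec_eucl_norm x = sqrt (scalar_prod x x)"

definition mat_op_norm :: "real mat \<Rightarrow> real" where
  "mat_op_norm A =
     Sup {vec_eucl_norm (A *\<^sub>v x) | x. x \<in> carrier_vec (dim_col A) \<and> vec_eucl_norm x = 1}"

text \<open>
  Stochastic boundedness of the random variables \<open>Y T / r T\<close> as \<open>T\<close> tends to infinity.
  Measurability is part of the definition because \<^const>\<open>measure\<close> is 0 on non-measurable sets.
\<close>

definition bigO_P :: "'a measure \<Rightarrow> (nat \<Rightarrow> 'a \<Rightarrow> real) \<Rightarrow> (nat \<Rightarrow> real) \<Rightarrow> bool" where
  "bigO_P M Y r \<longleftrightarrow> (\<forall>T. Y T \<in> borel_measurable M) \<and>
     (\<forall>e>0. \<exists>C>0. \<forall>\<^sub>F T in sequentially.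
        measure M {\<omega> \<in> space M. \<bar>Y T \<omega>\<bar> > C * r T} < e)"

end

theory Submission imports Defs "HOL-Real_Asymp.Real_Asymp" begin

text \<open>
  The error matrix is a symmetric Toeplitz matrix, so Schur's test bounds its operator norm by twice the
  sum over the lags \<open>k < T\<close> of the errors of the thresholded sample autocovariances
  (\<open>abs_mat_op_norm_le\<close>, \<open>Toeplitz_row_sum_le\<close>). That sum is split at the lag
  \<open>m = (T / ln T) powr (1 / (2 (1 + \<alpha>)))\<close>.

  Below \<open>m\<close> only the order \<open>1 / sqrt T\<close> of each single deviation is used (\<open>lag_sum_moment\<close>); together
  with the threshold the first \<open>m\<close> lags cost \<open>m sqrt (ln T / T)\<close>. Above \<open>m\<close> all deviations are, with
  probability tending to one, simultaneously below half the threshold. Then an entry that is set to zero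
  costs its true value, and an entry that survives costs no more than that
  (\<open>thresholded_sac_error_good_lag\<close>). Orthogonality of the contributions of different innovations bounds
  the autocovariances by products of dependence coefficients (\<open>abs_acov_le\<close>), so those above \<open>m\<close> sum to
  the order \<open>m powr (- \<alpha>)\<close>. The choice of \<open>m\<close> balances the two costs
  (\<open>thresholded_sac_total_error\<close>).

  The hard part is the simultaneous control of the deviations at the large lags. It takes place on the
  product space of the innovations, where conditioning is integration over some of the coordinates and a
  dependence coefficient is the effect of resampling one coordinate; that effect dominates the change of
  a conditional expectation when the coordinate is revealed (\<open>Lp_norm_cexp_insert_diff\<close>). Revealing the
  coordinates backwards in time yields martingale differences and thereby moment bounds of order \<open>sqrt T\<close>
  for all stationary sums (\<open>Lp_norm_stationary_sum\<close>). At lag \<open>k\<close> both factors of \<open>X t * X (t - k)\<close> are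
  replaced by their conditional expectations given the last \<open>2 ^ n\<close> innovations, where
  \<open>k / 4 < 2 ^ n \<le> k / 2\<close>. This leaves a main part and a remainder.

  In the main part the factor at time \<open>t\<close> is a sum of layers, the \<open>i\<close>-th one collecting the innovations of
  age about \<open>2 ^ i\<close>. Over a block of \<open>2 ^ i\<close> consecutive times a layer is independent of the earlier
  factors, so the block sums are martingale differences whose conditional variances are controlled by the
  sum of the squares of the approximations, hence uniformly in the lag (\<open>approx_square_sum_tail\<close>). An exponential
  inequality (\<open>block_sum_tail\<close>) applies after truncation of the blocks. Because the two factors are
  independent, a block keeps all \<open>p > 4\<close> moments, and because \<open>\<alpha> p > 2\<close> in both regimes, the truncation
  level can be chosen so that a union bound over \<open>T\<close> lags is affordable (\<open>main_part_large_lags\<close>). The resulting constant 20 is below the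
  one in the threshold.

  The remainder has only \<open>p / 2\<close> moments. If \<open>\<alpha>' p > 2\<close>, its norm at lag \<open>k\<close> is at most of the order
  \<open>sqrt T * k powr (- \<alpha>')\<close>, and Markov's inequality gives probabilities that are summable over the lags
  (\<open>lag_rest_tail_Delta\<close>). If \<open>\<alpha> > 1 / 2\<close>, the remainder is decomposed by doubling the memory. At
  each memory length all lags share one bound for the truncation of the blocks, so that only the
  exponentially small probabilities are summed over the lags (\<open>increment_sum_tail\<close>, \<open>block_bound_tail\<close>,
  \<open>lag_rest_tail_Theta\<close>).
\<close>

section \<open>Norms in \<open>L\<^sup>p\<close>\<close>

lemma in_Lp_measurable [measurable_dest]: "in_Lp N q f \<Longrightarrow> f \<in> borel_measurable N"
  by (simp add: in_Lp_def)

lemma in_Lp_integrable: "in_Lp N q f \<Longrightarrow> integrable N (\<lambda>x. \<bar>f x\<bar> powr q)"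
  by (simp add: in_Lp_def)

lemma Lp_norm_nonneg [simp]: "0 \<le> Lp_norm N q f"
  by (simp add: Lp_norm_def)

lemma Lp_norm_powr: "q > 0 \<Longrightarrow> Lp_norm N q f powr q = (LINT x|N. \<bar>f x\<bar> powr q)"
  by (simp add: Lp_norm_def powr_powr)

lemma Lp_norm_le_iff:
  assumes "q > 0" "0 \<le> c"
  shows "Lp_norm N q f \<le> c \<longleftrightarrow> (LINT x|N. \<bar>f x\<bar> powr q) \<le> c powr q"
proof -
  have "Lp_norm N q f \<le> c \<longleftrightarrow> Lp_norm N q f powr q \<le> c powr q"
    using powr_mono2[of q "Lp_norm N q f" c] powr_less_mono2[of q c "Lp_norm N q f"] assms
    by (auto simp: not_le[symmetric])
  thus ?thesis using assms by (simp add: Lp_norm_powr)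
qed

lemma in_Lp_bound:
  assumes "in_Lp N q g" "f \<in> borel_measurable N" "AE x in N. \<bar>f x\<bar> \<le> \<bar>g x\<bar>" "q > 0"
  shows "in_Lp N q f"
proof -
  have "integrable N (\<lambda>x. \<bar>f x\<bar> powr q)"
  proof (rule Bochner_Integration.integrable_bound)
    show "integrable N (\<lambda>x. \<bar>g x\<bar> powr q)" using assms by (simp add: in_Lp_def)
    show "(\<lambda>x. \<bar>f x\<bar> powr q) \<in> borel_measurable N" using assms(2) by measurable
    show "AE x in N. norm (\<bar>f x\<bar> powr q) \<le> norm (\<bar>g x\<bar> powr q)"
      using assms(3) by eventually_elim (use assms(4) in \<open>auto intro: powr_mono2\<close>)
  qed
  with assms(2) show ?thesis by (simp add: in_Lp_def)
qed

lemma Lp_norm_mono: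
  assumes "in_Lp N q g" "f \<in> borel_measurable N" "AE x in N. \<bar>f x\<bar> \<le> \<bar>g x\<bar>" "q > 0"
  shows "Lp_norm N q f \<le> Lp_norm N q g"
  unfolding Lp_norm_def
proof (rule powr_mono2)
  show "(LINT x|N. \<bar>f x\<bar> powr q) \<le> (LINT x|N. \<bar>g x\<bar> powr q)"
  proof (rule integral_mono_AE)
    show "integrable N (\<lambda>x. \<bar>f x\<bar> powr q)" using in_Lp_bound[OF assms] by (simp add: in_Lp_def)
    show "integrable N (\<lambda>x. \<bar>g x\<bar> powr q)" using assms by (simp add: in_Lp_def)
    show "AE x in N. \<bar>f x\<bar> powr q \<le> \<bar>g x\<bar> powr q"
      using assms(3) by eventually_elim (use assms(4) in \<open>auto intro: powr_mono2\<close>)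
  qed
qed (use assms in auto)

lemma in_Lp_cmult: "in_Lp N q f \<Longrightarrow> in_Lp N q (\<lambda>x. c * f x)"
  unfolding in_Lp_def by (auto simp: abs_mult powr_mult)

lemma Lp_norm_cmult: "q > 0 \<Longrightarrow> Lp_norm N q (\<lambda>x. c * f x) = \<bar>c\<bar> * Lp_norm N q f"
  unfolding Lp_norm_def by (simp add: abs_mult powr_mult powr_powr)

lemma in_Lp_uminus: "in_Lp N q f \<Longrightarrow> in_Lp N q (\<lambda>x. - f x)"
  unfolding in_Lp_def by simp

lemma Lp_norm_uminus: "Lp_norm N q (\<lambda>x. - f x) = Lp_norm N q f"
  unfolding Lp_norm_def by simp

lemma in_Lp_zero [simp]: "in_Lp N q (\<lambda>x. 0)"
  unfolding in_Lp_def by simp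

lemma Lp_norm_zero [simp]: "Lp_norm N q (\<lambda>x. 0) = 0"
  unfolding Lp_norm_def by simp

lemma in_Lp_add:
  assumes "in_Lp N q f" "in_Lp N q g" "q > 0"
  shows "in_Lp N q (\<lambda>x. f x + g x)"
proof -
  have m: "f \<in> borel_measurable N" "g \<in> borel_measurable N" using assms by (auto simp: in_Lp_def)
  have "integrable N (\<lambda>x. \<bar>f x + g x\<bar> powr q)"
  proof (rule Bochner_Integration.integrable_bound)
    show "integrable N (\<lambda>x. 2 powr q * (\<bar>f x\<bar> powr q + \<bar>g x\<bar> powr q))" using assms by (simp add: in_Lp_def)
    show "(\<lambda>x. \<bar>f x + g x\<bar> powr q) \<in> borel_measurable N" using m by measurable
    have "\<bar>a + b\<bar> powr q \<le> 2 powr q * (\<bar>a\<bar> powr q + \<bar>b\<bar> powr q)" for a b :: real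
    proof -
      have "\<bar>a + b\<bar> powr q \<le> (2 * max \<bar>a\<bar> \<bar>b\<bar>) powr q" using assms(3) by (intro powr_mono2) auto
      also have "\<dots> = 2 powr q * max \<bar>a\<bar> \<bar>b\<bar> powr q" by (simp add: powr_mult)
      also have "\<dots> \<le> 2 powr q * (\<bar>a\<bar> powr q + \<bar>b\<bar> powr q)" by (intro mult_left_mono) (auto simp: max_def)
      finally show ?thesis .
    qed
    thus "AE x in N. norm (\<bar>f x + g x\<bar> powr q) \<le> norm (2 powr q * (\<bar>f x\<bar> powr q + \<bar>g x\<bar> powr q))"
      by simp
  qed
  with m show ?thesis by (simp add: in_Lp_def)
qed

lemma in_Lp_diff: "in_Lp N q f \<Longrightarrow> in_Lp N q g \<Longrightarrow> q > 0 \<Longrightarrow> in_Lp N q (\<lambda>x. f x - g x)"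
  using in_Lp_add[of N q f "\<lambda>x. - g x"] in_Lp_uminus[of N q g] by simp

lemma in_Lp_sum: "q > 0 \<Longrightarrow> (\<And>i. i \<in> I \<Longrightarrow> in_Lp N q (f i)) \<Longrightarrow> in_Lp N q (\<lambda>x. \<Sum>i\<in>I. f i x)"
  by (induction I rule: infinite_finite_induct) (auto intro: in_Lp_add)

lemma powr_convex_ineq:
  fixes a b t q :: real
  assumes "q \<ge> 1" "0 \<le> a" "0 \<le> b" "0 \<le> t" "t \<le> 1"
  shows "(t * a + (1 - t) * b) powr q \<le> t * a powr q + (1 - t) * b powr q"
proof -
  have *: "(u * c) powr q \<le> u * c powr q" if "0 \<le> u" "u \<le> 1" "0 \<le> c" for u c :: real
  proof -
    have "u powr q \<le> u powr 1" using that assms(1)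
      using powr_mono'[of 1 q u] by auto
    thus ?thesis using that by (simp add: powr_mult mult_right_mono)
  qed
  show ?thesis
  proof (cases "a = 0 \<or> b = 0")
    case True thus ?thesis using *[of t a] *[of "1 - t" b] assms by auto
  next
    case False
    hence "a > 0" "b > 0" using assms by auto
    thus ?thesis using convex_onD[OF powr_convex[OF assms(1)], of "1 - t" a b] assms by simp
  qed
qed

text \<open>
  Normalising by bounds strictly above the two norms keeps the denominators positive; the norms
  themselves are reached in the limit.
\<close>

lemma Lp_norm_triangle:
  assumes f: "in_Lp N q f" and g: "in_Lp N q g" and q: "q \<ge> 1"
  shows "Lp_norm N q (\<lambda>x. f x + g x) \<le> Lp_norm N q f + Lp_norm N q g"
proof (rule field_le_epsilon)
  fix e :: real assume e: "e > 0"
  define A where "A = Lp_norm N q f + e / 2"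
  define B where "B = Lp_norm N q g + e / 2"
  have AB: "A > 0" "B > 0" "Lp_norm N q f \<le> A" "Lp_norm N q g \<le> B"
    using e by (auto simp: A_def B_def add_nonneg_pos)
  define t where "t = A / (A + B)"
  have t: "0 \<le> t" "t \<le> 1" "1 - t = B / (A + B)" using AB by (auto simp: t_def field_simps)
  have pt: "\<bar>f x + g x\<bar> powr q \<le> (A + B) powr q * (t * (\<bar>f x\<bar> powr q / A powr q) + (1 - t) * (\<bar>g x\<bar> powr q / B powr q))" for x
  proof -
    have "\<bar>f x + g x\<bar> \<le> \<bar>f x\<bar> + \<bar>g x\<bar>" by simp
    also have "\<dots> = (A + B) * (t * (\<bar>f x\<bar> / A) + (1 - t) * (\<bar>g x\<bar> / B))"
    proof -
      have "(A + B) * (t * (\<bar>f x\<bar> / A)) = \<bar>f x\<bar>" "(A + B) * ((1 - t) * (\<bar>g x\<bar> / B)) = \<bar>g x\<bar>"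
        unfolding t(3) using AB by (simp_all add: t_def)
      thus ?thesis by (simp add: distrib_left)
    qed
    finally have "\<bar>f x + g x\<bar> powr q \<le> ((A + B) * (t * (\<bar>f x\<bar> / A) + (1 - t) * (\<bar>g x\<bar> / B))) powr q"
      using q by (intro powr_mono2) auto
    also have "\<dots> = (A + B) powr q * (t * (\<bar>f x\<bar> / A) + (1 - t) * (\<bar>g x\<bar> / B)) powr q"
      by (rule powr_mult)
    also have "\<dots> \<le> (A + B) powr q * (t * (\<bar>f x\<bar> / A) powr q + (1 - t) * (\<bar>g x\<bar> / B) powr q)"
      using AB t q by (intro mult_left_mono powr_convex_ineq) auto
    finally show ?thesis using AB by (simp add: powr_divide)
  qed
  have i: "integrable N (\<lambda>x. \<bar>f x\<bar> powr q)" "integrable N (\<lambda>x. \<bar>g x\<bar> powr q)"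
    using f g by (auto simp: in_Lp_def)
  have "(LINT x|N. \<bar>f x + g x\<bar> powr q) \<le> (LINT x|N. (A + B) powr q * (t * (\<bar>f x\<bar> powr q / A powr q) + (1 - t) * (\<bar>g x\<bar> powr q / B powr q)))"
  proof (rule integral_mono)
    show "integrable N (\<lambda>x. \<bar>f x + g x\<bar> powr q)" using in_Lp_add[OF f g] q by (simp add: in_Lp_def)
  qed (use pt i in auto)
  also have "\<dots> = (A + B) powr q * (t * ((LINT x|N. \<bar>f x\<bar> powr q) / A powr q) + (1 - t) * ((LINT x|N. \<bar>g x\<bar> powr q) / B powr q))"
    using i by simp
  also have "\<dots> \<le> (A + B) powr q * (t * 1 + (1 - t) * 1)"
    using t AB Lp_norm_le_iff[of q A N f] Lp_norm_le_iff[of q B N g] q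
    by (intro mult_left_mono add_mono) (auto simp: divide_simps)
  finally have "(LINT x|N. \<bar>f x + g x\<bar> powr q) \<le> (A + B) powr q" by simp
  hence "Lp_norm N q (\<lambda>x. f x + g x) \<le> A + B" using AB q by (subst Lp_norm_le_iff) auto
  thus "Lp_norm N q (\<lambda>x. f x + g x) \<le> Lp_norm N q f + Lp_norm N q g + e" by (simp add: A_def B_def)
qed

lemma Lp_norm_triangle_diff:
  assumes "in_Lp N q f" "in_Lp N q g" "q \<ge> 1"
  shows "Lp_norm N q (\<lambda>x. f x - g x) \<le> Lp_norm N q f + Lp_norm N q g"
  using Lp_norm_triangle[OF assms(1) in_Lp_uminus[OF assms(2)] assms(3)] by (simp add: Lp_norm_uminus)

lemma Lp_norm_sum:
  assumes "q \<ge> 1" "\<And>i. i \<in> I \<Longrightarrow> in_Lp N q (f i)"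
  shows "Lp_norm N q (\<lambda>x. \<Sum>i\<in>I. f i x) \<le> (\<Sum>i\<in>I. Lp_norm N q (f i))"
  using assms(2)
proof (induction I rule: infinite_finite_induct)
  case (insert i I)
  have "Lp_norm N q (\<lambda>x. f i x + (\<Sum>i\<in>I. f i x)) \<le> Lp_norm N q (f i) + Lp_norm N q (\<lambda>x. \<Sum>i\<in>I. f i x)"
    using insert assms(1) by (intro Lp_norm_triangle in_Lp_sum) auto
  with insert show ?case by auto
qed auto

text \<open>
  Bounds strictly above the two norms are used as normalising constants, as in the triangle inequality,
  to avoid a case distinction for vanishing norms.
\<close>

lemma Holder_integral:
  fixes u v :: "'a \<Rightarrow> real"
  assumes u: "u \<in> borel_measurable N" "\<And>x. u x \<ge> 0" "integrable N (\<lambda>x. u x powr a)"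
    and v: "v \<in> borel_measurable N" "\<And>x. v x \<ge> 0" "integrable N (\<lambda>x. v x powr b)"
    and ab: "a > 1" "b > 1" "1 / a + 1 / b = 1"
  shows "integrable N (\<lambda>x. u x * v x)"
    and "(LINT x|N. u x * v x) \<le> (LINT x|N. u x powr a) powr (1 / a) * (LINT x|N. v x powr b) powr (1 / b)"
proof -
  have uv: "u x * v x \<le> u x powr a / a + v x powr b / b" for x
    by (rule Youngs_inequality) (use assms in auto)
  show int: "integrable N (\<lambda>x. u x * v x)"
  proof (rule Bochner_Integration.integrable_bound)
    show "integrable N (\<lambda>x. u x powr a / a + v x powr b / b)" using assms by auto
    show "(\<lambda>x. u x * v x) \<in> borel_measurable N" using u v by measurable
    show "AE x in N. norm (u x * v x) \<le> norm (u x powr a / a + v x powr b / b)"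
      using uv u v by (auto intro: order_trans[OF _ abs_ge_self])
  qed
  define A where "A = (LINT x|N. u x powr a) powr (1 / a)"
  define B where "B = (LINT x|N. v x powr b) powr (1 / b)"
  have AB0: "A \<ge> 0" "B \<ge> 0" by (auto simp: A_def B_def)
  have main: "(LINT x|N. u x * v x) \<le> A' * B'" if "A' > A" "B' > B" for A' B'
  proof -
    have p: "A' > 0" "B' > 0" using that AB0 by auto
    have "(LINT x|N. u x powr a) = A powr a" "(LINT x|N. v x powr b) = B powr b"
      using ab u v by (auto simp: A_def B_def powr_powr)
    hence le: "(LINT x|N. u x powr a) \<le> A' powr a" "(LINT x|N. v x powr b) \<le> B' powr b"
      using that ab AB0 by (auto intro: powr_mono2)
    have "u x * v x \<le> A' * B' * ((u x powr a / A' powr a) / a + (v x powr b / B' powr b) / b)" for x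
    proof -
      have "(u x / A') * (v x / B') \<le> (u x / A') powr a / a + (v x / B') powr b / b"
        by (rule Youngs_inequality) (use assms p in auto)
      hence "A' * B' * ((u x / A') * (v x / B')) \<le> A' * B' * ((u x / A') powr a / a + (v x / B') powr b / b)"
        using p by (intro mult_left_mono) auto
      thus ?thesis using p u v by (simp add: powr_divide)
    qed
    hence "(LINT x|N. u x * v x) \<le> (LINT x|N. A' * B' * ((u x powr a / A' powr a) / a + (v x powr b / B' powr b) / b))"
      using int u v by (intro integral_mono) auto
    also have "\<dots> = A' * B' * (((LINT x|N. u x powr a) / A' powr a) / a + ((LINT x|N. v x powr b) / B' powr b) / b)"
      using u v by simp
    also have "\<dots> \<le> A' * B' * (1 / a + 1 / b)"
      using p ab le by (intro mult_left_mono add_mono divide_right_mono) (auto simp: divide_simps)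
    finally show ?thesis using ab by simp
  qed
  have "(LINT x|N. u x * v x) \<le> A * B"
  proof (rule tendsto_lowerbound)
    show "((\<lambda>e. (A + e) * (B + e)) \<longlongrightarrow> A * B) (at_right 0)" by (auto intro!: tendsto_eq_intros)
    show "\<forall>\<^sub>F e in at_right 0. (LINT x|N. u x * v x) \<le> (A + e) * (B + e)"
      using eventually_at_right_less[of "0::real"] by eventually_elim (auto intro!: main)
  qed simp
  thus "(LINT x|N. u x * v x) \<le> (LINT x|N. u x powr a) powr (1 / a) * (LINT x|N. v x powr b) powr (1 / b)"
    by (simp add: A_def B_def)
qed

lemma
  assumes f: "in_Lp N (2 * q) f" and g: "in_Lp N (2 * q) g" and q: "q > 0"
  shows in_Lp_mult: "in_Lp N q (\<lambda>x. f x * g x)"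
    and Lp_norm_mult: "Lp_norm N q (\<lambda>x. f x * g x) \<le> Lp_norm N (2 * q) f * Lp_norm N (2 * q) g"
proof -
  have m: "f \<in> borel_measurable N" "g \<in> borel_measurable N" using f g by (auto simp: in_Lp_def)
  have e: "(\<bar>x\<bar> powr q) powr 2 = \<bar>x\<bar> powr (2 * q)" for x :: real by (simp add: powr_powr mult.commute)
  have I: "integrable N (\<lambda>x. (\<bar>f x\<bar> powr q) powr 2)" "integrable N (\<lambda>x. (\<bar>g x\<bar> powr q) powr 2)"
    unfolding e using f g by (auto simp: in_Lp_def)
  have mm: "(\<lambda>x. \<bar>f x\<bar> powr q) \<in> borel_measurable N" "(\<lambda>x. \<bar>g x\<bar> powr q) \<in> borel_measurable N"
    using m by measurable
  note H = Holder_integral[OF mm(1) _ I(1) mm(2) _ I(2)]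
  have i: "integrable N (\<lambda>x. \<bar>f x\<bar> powr q * \<bar>g x\<bar> powr q)" using H(1) by simp
  thus "in_Lp N q (\<lambda>x. f x * g x)" using m by (auto simp: in_Lp_def abs_mult powr_mult)
  have "(LINT x|N. \<bar>f x * g x\<bar> powr q) = (LINT x|N. \<bar>f x\<bar> powr q * \<bar>g x\<bar> powr q)"
    by (simp add: abs_mult powr_mult)
  also have "\<dots> \<le> (LINT x|N. (\<bar>f x\<bar> powr q) powr 2) powr (1/2) * (LINT x|N. (\<bar>g x\<bar> powr q) powr 2) powr (1/2)"
    using H(2) by simp
  also have "\<dots> = (Lp_norm N (2*q) f * Lp_norm N (2*q) g) powr q"
    unfolding e using q by (simp add: Lp_norm_def powr_mult powr_powr)
  finally show "Lp_norm N q (\<lambda>x. f x * g x) \<le> Lp_norm N (2 * q) f * Lp_norm N (2 * q) g"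
    using q by (subst Lp_norm_le_iff) auto
qed

lemma
  assumes f: "in_Lp N q f" and g: "in_Lp N q g" and q: "q > 2"
  shows integrable_powr_mult_square: "integrable N (\<lambda>x. \<bar>f x\<bar> powr (q - 2) * \<bar>g x\<bar> powr 2)"
    and integral_powr_mult_square: "(LINT x|N. \<bar>f x\<bar> powr (q - 2) * \<bar>g x\<bar> powr 2)
       \<le> Lp_norm N q f powr (q - 2) * Lp_norm N q g powr 2"
proof -
  have e: "(\<bar>x\<bar> powr (q - 2)) powr (q / (q - 2)) = \<bar>x\<bar> powr q" "(\<bar>x\<bar> powr 2) powr (q / 2) = \<bar>x\<bar> powr q" for x :: real
    using q unfolding powr_powr by simp_all
  have m: "f \<in> borel_measurable N" "g \<in> borel_measurable N" using f g by (auto simp: in_Lp_def)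
  have mm: "(\<lambda>x. \<bar>f x\<bar> powr (q - 2)) \<in> borel_measurable N" "(\<lambda>x. \<bar>g x\<bar> powr 2) \<in> borel_measurable N"
    using m by measurable
  have I: "integrable N (\<lambda>x. (\<bar>f x\<bar> powr (q - 2)) powr (q / (q - 2)))" "integrable N (\<lambda>x. (\<bar>g x\<bar> powr 2) powr (q / 2))"
    unfolding e using f g by (auto simp: in_Lp_def)
  have ab: "q / (q - 2) > 1" "q / 2 > 1" "1 / (q / (q - 2)) + 1 / (q / 2) = 1"
    using q by (auto simp: divide_simps)
  note H = Holder_integral[OF mm(1) _ I(1) mm(2) _ I(2) ab]
  show "integrable N (\<lambda>x. \<bar>f x\<bar> powr (q - 2) * \<bar>g x\<bar> powr 2)" using H(1) by simp
  have "(LINT x|N. \<bar>f x\<bar> powr (q - 2) * \<bar>g x\<bar> powr 2) \<le> (LINT x|N. \<bar>f x\<bar> powr q) powr (1 / (q / (q - 2))) * (LINT x|N. \<bar>g x\<bar> powr q) powr (1 / (q / 2))"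
    using H(2) unfolding e by simp
  also have "\<dots> = Lp_norm N q f powr (q - 2) * Lp_norm N q g powr 2"
    using q by (simp add: Lp_norm_def powr_powr del: powr_numeral)
  finally show "(LINT x|N. \<bar>f x\<bar> powr (q - 2) * \<bar>g x\<bar> powr 2)
       \<le> Lp_norm N q f powr (q - 2) * Lp_norm N q g powr 2" .
qed

lemma (in prob_space)
  assumes f: "in_Lp M q f" and r: "0 < r" "r \<le> q"
  shows in_Lp_less: "in_Lp M r f" and Lp_norm_less: "Lp_norm M r f \<le> Lp_norm M q f"
proof -
  have "in_Lp M r f \<and> Lp_norm M r f \<le> Lp_norm M q f"
  proof (cases "r = q")
    case False
    hence rq: "r < q" using r by simp
    have m: "f \<in> borel_measurable M" using f by (auto simp: in_Lp_def)
    have e: "(\<bar>x\<bar> powr r) powr (q / r) = \<bar>x\<bar> powr q" for x :: real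
      using r by (simp add: powr_powr)
    have mm: "(\<lambda>x. \<bar>f x\<bar> powr r) \<in> borel_measurable M" using m by measurable
    have I: "integrable M (\<lambda>x. (\<bar>f x\<bar> powr r) powr (q / r))" unfolding e using f by (auto simp: in_Lp_def)
    have ab: "q / r > 1" "q / (q - r) > 1" "1 / (q / r) + 1 / (q / (q - r)) = 1"
      using r rq by (auto simp: divide_simps)
    note H = Holder_integral[OF mm _ I _ _ _ ab, of "\<lambda>_. 1"]
    have "integrable M (\<lambda>x. \<bar>f x\<bar> powr r)" using H(1) by simp
    moreover have "(LINT x|M. \<bar>f x\<bar> powr r) \<le> (LINT x|M. \<bar>f x\<bar> powr q) powr (1 / (q / r))"
      using H(2) unfolding e by (simp add: prob_space)
    hence "Lp_norm M r f \<le> Lp_norm M q f"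
      using r by (subst Lp_norm_le_iff) (auto simp: Lp_norm_def powr_powr)
    ultimately show ?thesis using m by (auto simp: in_Lp_def)
  qed (use f in auto)
  thus "in_Lp M r f" "Lp_norm M r f \<le> Lp_norm M q f" by auto
qed

lemma (in prob_space) in_Lp_imp_integrable:
  assumes "in_Lp M q f" "1 \<le> q" shows "integrable M f"
  using in_Lp_less[OF assms(1), of 1] assms by (auto simp: in_Lp_def integrable_abs_iff)

lemma (in prob_space) abs_integral_le_Lp_norm:
  assumes "in_Lp M q f" "1 \<le> q" shows "(LINT x|M. \<bar>f x\<bar>) \<le> Lp_norm M q f"
  using Lp_norm_less[OF assms(1), of 1] assms by (auto simp: Lp_norm_def)

lemma (in prob_space) Jensen_powr:
  assumes "in_Lp M q f" "1 \<le> q" shows "\<bar>LINT x|M. f x\<bar> powr q \<le> (LINT x|M. \<bar>f x\<bar> powr q)"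
proof -
  have "\<bar>LINT x|M. f x\<bar> \<le> Lp_norm M q f"
    using integral_abs_bound[of M f] abs_integral_le_Lp_norm[OF assms] by linarith
  hence "\<bar>LINT x|M. f x\<bar> powr q \<le> Lp_norm M q f powr q" using assms by (intro powr_mono2) auto
  thus ?thesis using assms by (simp add: Lp_norm_powr)
qed

lemma (in prob_space) Lp_norm_const: "q > 0 \<Longrightarrow> Lp_norm M q (\<lambda>_. c) = \<bar>c\<bar>"
  by (simp add: Lp_norm_def prob_space powr_powr)

lemma (in prob_space) in_Lp_const [simp]: "in_Lp M q (\<lambda>_. c)"
  by (simp add: in_Lp_def)

lemma (in prob_space) Lp_Markov:
  assumes f: "in_Lp M q f" and "q > 0" "c > 0"
  shows "prob {x \<in> space M. \<bar>f x\<bar> \<ge> c} \<le> (Lp_norm M q f / c) powr q"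
proof -
  have m[measurable]: "f \<in> borel_measurable M" using f by (auto simp: in_Lp_def)
  have "{x \<in> space M. \<bar>f x\<bar> \<ge> c} = {x \<in> space M. \<bar>f x\<bar> powr q \<ge> c powr q}"
  proof -
    have "c \<le> y \<longleftrightarrow> c powr q \<le> y powr q" if "y \<ge> 0" for y
      using assms that powr_mono2[of q c y] powr_less_mono2[of q y c] by linarith
    thus ?thesis by auto
  qed
  also have "prob \<dots> \<le> (LINT x|M. \<bar>f x\<bar> powr q) / c powr q"
    by (rule integral_Markov_inequality_measure[where A = "space M"]) (use assms in \<open>auto simp: in_Lp_def\<close>)
  also have "\<dots> = (Lp_norm M q f / c) powr q"
    using assms by (simp add: powr_divide Lp_norm_powr)
  finally show ?thesis .
qed

lemma in_Lp_2: "in_Lp N 2 f \<longleftrightarrow> f \<in> borel_measurable N \<and> integrable N (\<lambda>x. (f x)\<^sup>2)"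
  by (simp add: in_Lp_def)

lemma Lp_norm_2: "(Lp_norm N 2 f)\<^sup>2 = (LINT x|N. (f x)\<^sup>2)"
proof -
  have "Lp_norm N 2 f powr 2 = (LINT x|N. \<bar>f x\<bar> powr 2)" by (rule Lp_norm_powr) simp
  thus ?thesis by simp
qed

lemma (in prob_space) abs_integral_mult_le:
  assumes "in_Lp M 2 f" "in_Lp M 2 g"
  shows "\<bar>LINT x|M. f x * g x\<bar> \<le> Lp_norm M 2 f * Lp_norm M 2 g"
proof -
  have "\<bar>LINT x|M. f x * g x\<bar> \<le> (LINT x|M. \<bar>f x * g x\<bar>)" by (rule integral_abs_bound)
  also have "\<dots> \<le> Lp_norm M 1 (\<lambda>x. f x * g x)" by (simp add: Lp_norm_def)
  also have "\<dots> \<le> Lp_norm M 2 f * Lp_norm M 2 g" using Lp_norm_mult[of M 1 f g] assms by simp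
  finally show ?thesis .
qed

text \<open>An \<open>L\<^sup>q\<close> bound survives \<open>L\<^sup>1\<close> limits: pass to an almost surely convergent subsequence and
  apply Fatou's lemma.\<close>

lemma Lp_norm_L1_limit:
  fixes f :: "'a \<Rightarrow> real"
  assumes u: "\<And>n. in_Lp N q (u n)" "\<And>n. Lp_norm N q (u n) \<le> B" and q: "q > 0"
    and ui: "\<And>n. integrable N (u n)" and f: "integrable N f"
    and lim: "(\<lambda>n. LINT x|N. \<bar>u n x - f x\<bar>) \<longlonglongrightarrow> 0"
  shows "in_Lp N q f" "Lp_norm N q f \<le> B"
proof -
  obtain r where r: "strict_mono r" "AE x in N. (\<lambda>n. u (r n) x - f x) \<longlonglongrightarrow> 0"
    using tendsto_L1_AE_subseq[of N "\<lambda>n x. u n x - f x"] ui f lim by auto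
  have m[measurable]: "f \<in> borel_measurable N" "\<And>n. u n \<in> borel_measurable N" using ui f by auto
  have B: "B \<ge> 0" using u(2)[of 0] Lp_norm_nonneg[of N q "u 0"] by linarith
  have "(\<integral>\<^sup>+x. ennreal (\<bar>f x\<bar> powr q) \<partial>N) = (\<integral>\<^sup>+x. liminf (\<lambda>n. ennreal (\<bar>u (r n) x\<bar> powr q)) \<partial>N)"
  proof (rule nn_integral_cong_AE)
    show "AE x in N. ennreal (\<bar>f x\<bar> powr q) = liminf (\<lambda>n. ennreal (\<bar>u (r n) x\<bar> powr q))"
      using r(2)
    proof eventually_elim
      case (elim x)
      hence "(\<lambda>n. (u (r n) x - f x) + f x) \<longlonglongrightarrow> 0 + f x" by (intro tendsto_intros)
      hence "(\<lambda>n. u (r n) x) \<longlonglongrightarrow> f x" by simp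
      hence "(\<lambda>n. \<bar>u (r n) x\<bar> powr q) \<longlonglongrightarrow> \<bar>f x\<bar> powr q"
        using q by (intro tendsto_powr' tendsto_intros) auto
      hence "(\<lambda>n. ennreal (\<bar>u (r n) x\<bar> powr q)) \<longlonglongrightarrow> ennreal (\<bar>f x\<bar> powr q)" by simp
      thus ?case using lim_imp_Liminf[OF sequentially_bot] by metis
    qed
  qed
  also have "\<dots> \<le> liminf (\<lambda>n. \<integral>\<^sup>+x. ennreal (\<bar>u (r n) x\<bar> powr q) \<partial>N)"
    by (rule nn_integral_liminf) measurable
  also have "\<dots> \<le> liminf (\<lambda>n. ennreal (B powr q))"
  proof (rule Liminf_mono, rule always_eventually, rule allI)
    fix n
    have "(\<integral>\<^sup>+x. ennreal (\<bar>u (r n) x\<bar> powr q) \<partial>N) = ennreal (LINT x|N. \<bar>u (r n) x\<bar> powr q)"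
      using u(1) by (intro nn_integral_eq_integral) (auto simp: in_Lp_def)
    thus "(\<integral>\<^sup>+x. ennreal (\<bar>u (r n) x\<bar> powr q) \<partial>N) \<le> ennreal (B powr q)"
      using u(2)[of "r n"] q B by (simp add: Lp_norm_le_iff ennreal_leI)
  qed
  also have "\<dots> = ennreal (B powr q)" by (simp add: Liminf_const)
  finally have fin: "(\<integral>\<^sup>+x. ennreal (\<bar>f x\<bar> powr q) \<partial>N) \<le> ennreal (B powr q)" .
  hence i: "integrable N (\<lambda>x. \<bar>f x\<bar> powr q)"
    by (intro integrableI_nonneg) (auto simp: less_top[symmetric] top_unique)
  thus L: "in_Lp N q f" by (simp add: in_Lp_def)
  have "ennreal (LINT x|N. \<bar>f x\<bar> powr q) \<le> ennreal (B powr q)"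
    using fin i by (subst (asm) nn_integral_eq_integral) auto
  hence "(LINT x|N. \<bar>f x\<bar> powr q) \<le> B powr q" by simp
  thus "Lp_norm N q f \<le> B" using q B by (subst Lp_norm_le_iff)
qed

lemma
  assumes t: "t \<in> measurable N K" and f: "f \<in> borel_measurable K"
  shows in_Lp_distr: "in_Lp (distr N K t) q f \<longleftrightarrow> in_Lp N q (\<lambda>x. f (t x))"
    and Lp_norm_distr: "Lp_norm (distr N K t) q f = Lp_norm N q (\<lambda>x. f (t x))"
proof -
  have m: "(\<lambda>x. \<bar>f x\<bar> powr q) \<in> borel_measurable K" using f by measurable
  show "in_Lp (distr N K t) q f \<longleftrightarrow> in_Lp N q (\<lambda>x. f (t x))"
    unfolding in_Lp_def using f measurable_comp[OF t f] by (simp add: integrable_distr_eq[OF t m] o_def)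
  show "Lp_norm (distr N K t) q f = Lp_norm N q (\<lambda>x. f (t x))"
    unfolding Lp_norm_def by (simp add: integral_distr[OF t m])
qed

section \<open>Martingale increments in \<open>L\<^sup>p\<close>\<close>

lemma powr_one_plus_upper:
  fixes u q :: real
  assumes q: "q \<ge> 2" and u: "\<bar>u\<bar> \<le> 1/2"
  shows "(1 + u) powr q \<le> 1 + q * u + q * (q - 1) * 2 powr q * u\<^sup>2"
proof (cases "u = 0")
  case False
  define df where "df m v = (if m = 0 then (1 + v) powr q else if m = 1 then q * (1 + v) powr (q - 1)
      else q * (q - 1) * (1 + v) powr (q - 2))" for m :: nat and v :: real
  have d: "DERIV (df m) v :> df (Suc m) v" if "m < 2" "- 1/2 \<le> v" for m v
  proof -
    have "m = 0 \<or> m = 1" using that by auto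
    thus ?thesis
    proof
      assume m: "m = 0"
      have "((\<lambda>v. (1 + v) powr q) has_real_derivative q * (1 + v) powr (q - 1)) (at v)"
        using that by (auto intro!: derivative_eq_intros)
      thus ?thesis unfolding m df_def by simp
    next
      assume m: "m = 1"
      have "((\<lambda>v. q * (1 + v) powr (q - 1)) has_real_derivative q * ((q - 1) * (1 + v) powr (q - 1 - 1))) (at v)"
        using that by (auto intro!: derivative_eq_intros)
      thus ?thesis unfolding m df_def by (simp add: algebra_simps)
    qed
  qed
  have "\<exists>t. (if u < 0 then u < t \<and> t < 0 else 0 < t \<and> t < u) \<and>
      (1 + u) powr q = (\<Sum>m<2. df m 0 / fact m * (u - 0) ^ m) + df 2 t / fact 2 * (u - 0) ^ 2"
    by (rule Taylor[of 2 df _ "-1/2" "1/2"]) (use d u False in \<open>auto simp: df_def\<close>)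
  then obtain t where t0: "if u < 0 then u < t \<and> t < 0 else 0 < t \<and> t < u"
    and t2: "(1 + u) powr q = (\<Sum>m<2. df m 0 / fact m * u ^ m) + df 2 t / fact 2 * u\<^sup>2"
    by auto
  have t1: "\<bar>t\<bar> \<le> 1/2" using t0 u by (auto split: if_splits)
  note t = t1 t2
  have "(1 + u) powr q = 1 + q * u + q * (q - 1) * (1 + t) powr (q - 2) / 2 * u\<^sup>2"
    using t(2) by (simp add: df_def numeral_2_eq_2)
  also have "(1 + t) powr (q - 2) \<le> 2 powr (q - 2)" using t q by (intro powr_mono2) auto
  also have "(2::real) powr (q - 2) \<le> 2 powr q" by (intro powr_mono) auto
  also have "q * (q - 1) * 2 powr q / 2 \<le> q * (q - 1) * 2 powr q" using q by simp
  finally show ?thesis using q by (simp add: mult_right_mono mult_left_mono divide_right_mono)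
qed (use q in auto)

definition powr_increment_const :: "real \<Rightarrow> real" where
  "powr_increment_const q = 3 powr q + q * 2 powr q + q * (q - 1) * 2 powr q"

lemma powr_increment_const_nonneg: "q \<ge> 2 \<Longrightarrow> powr_increment_const q \<ge> 0"
  unfolding powr_increment_const_def by (intro add_nonneg_nonneg mult_nonneg_nonneg) auto

text \<open>
  The second-order Taylor bound when the increment is small against \<open>s\<close>; a large increment
  dominates every term by itself.
\<close>

lemma abs_powr_increment:
  fixes s d q :: real
  assumes q: "q > 2"
  shows "\<bar>s + d\<bar> powr q \<le> \<bar>s\<bar> powr q + q * (sgn s * \<bar>s\<bar> powr (q - 1)) * d
           + powr_increment_const q * (\<bar>s\<bar> powr (q - 2) * \<bar>d\<bar> powr 2 + \<bar>d\<bar> powr q)"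
proof (cases "\<bar>d\<bar> \<ge> \<bar>s\<bar> / 2")
  case True
  have 1: "\<bar>s + d\<bar> powr q \<le> 3 powr q * \<bar>d\<bar> powr q"
  proof -
    have "\<bar>s + d\<bar> powr q \<le> (3 * \<bar>d\<bar>) powr q" using True q by (intro powr_mono2) auto
    thus ?thesis by (simp add: powr_mult)
  qed
  have 2: "\<bar>q * (sgn s * \<bar>s\<bar> powr (q - 1)) * d\<bar> \<le> q * 2 powr q * \<bar>d\<bar> powr q"
  proof (cases "d = 0")
    case False
    have "\<bar>s\<bar> powr (q - 1) \<le> (2 * \<bar>d\<bar>) powr (q - 1)" using True q by (intro powr_mono2) auto
    also have "\<dots> = 2 powr (q - 1) * \<bar>d\<bar> powr (q - 1)" by (simp add: powr_mult)
    also have "\<dots> \<le> 2 powr q * \<bar>d\<bar> powr (q - 1)" by (intro mult_right_mono powr_mono) auto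
    finally have "\<bar>s\<bar> powr (q - 1) * \<bar>d\<bar> \<le> 2 powr q * (\<bar>d\<bar> powr (q - 1) * \<bar>d\<bar>)"
      by (metis mult.assoc mult_right_mono abs_ge_zero)
    also have "\<bar>d\<bar> powr (q - 1) * \<bar>d\<bar> = \<bar>d\<bar> powr q" using False by (simp add: powr_diff)
    finally have "q * (\<bar>s\<bar> powr (q - 1) * \<bar>d\<bar>) \<le> q * (2 powr q * \<bar>d\<bar> powr q)" using q by (intro mult_left_mono) auto
    moreover have "\<bar>q * (sgn s * \<bar>s\<bar> powr (q - 1)) * d\<bar> \<le> q * (\<bar>s\<bar> powr (q - 1) * \<bar>d\<bar>)"
      using q by (cases "s = 0") (auto simp: abs_mult sgn_real_def)
    ultimately show ?thesis by (simp add: mult.assoc)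
  qed auto
  have "powr_increment_const q * (\<bar>s\<bar> powr (q - 2) * \<bar>d\<bar> powr 2 + \<bar>d\<bar> powr q) \<ge> powr_increment_const q * \<bar>d\<bar> powr q"
    using powr_increment_const_nonneg[of q] q by (intro mult_left_mono) auto
  moreover have "powr_increment_const q * \<bar>d\<bar> powr q \<ge> 3 powr q * \<bar>d\<bar> powr q + q * 2 powr q * \<bar>d\<bar> powr q"
    unfolding powr_increment_const_def using q by (simp add: distrib_right)
  moreover have "\<bar>s\<bar> powr q \<ge> 0" by simp
  ultimately show ?thesis using 1 2 by linarith
next
  case False
  hence s: "s \<noteq> 0" by auto
  define u where "u = d / s"
  have u: "\<bar>u\<bar> \<le> 1/2" using False s by (simp add: u_def abs_div divide_simps)
  have d: "d = u * s" using s by (simp add: u_def)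
  have "s + d = s * (1 + u)" by (simp add: d algebra_simps)
  moreover have "\<bar>1 + u\<bar> = 1 + u" using u by linarith
  ultimately have "\<bar>s + d\<bar> = \<bar>s\<bar> * (1 + u)" by (simp add: abs_mult)
  hence "\<bar>s + d\<bar> powr q = \<bar>s\<bar> powr q * (1 + u) powr q" by (simp add: powr_mult)
  also have "\<dots> \<le> \<bar>s\<bar> powr q * (1 + q * u + q * (q - 1) * 2 powr q * u\<^sup>2)"
    using powr_one_plus_upper[of q u] q u by (intro mult_left_mono) auto
  also have "\<dots> = \<bar>s\<bar> powr q + q * (\<bar>s\<bar> powr q * u) + q * (q - 1) * 2 powr q * (\<bar>s\<bar> powr q * u\<^sup>2)"
    by (simp add: algebra_simps)
  also have "\<bar>s\<bar> powr q * u = (sgn s * \<bar>s\<bar> powr (q - 1)) * d"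
    using s by (simp add: d powr_diff sgn_real_def)
  also have "\<bar>s\<bar> powr q * u\<^sup>2 = \<bar>s\<bar> powr (q - 2) * \<bar>d\<bar> powr 2"
    using s by (simp add: u_def powr_diff power_divide)
  also have "q * (q - 1) * 2 powr q * (\<bar>s\<bar> powr (q - 2) * \<bar>d\<bar> powr 2)
      \<le> powr_increment_const q * (\<bar>s\<bar> powr (q - 2) * \<bar>d\<bar> powr 2 + \<bar>d\<bar> powr q)"
    using q by (intro mult_mono) (auto simp: powr_increment_const_def)
  finally show ?thesis by (simp add: mult.assoc)
qed

text \<open>The value 1 at \<open>q = 2\<close> is orthogonality of the increments.\<close>

definition martingale_const :: "real \<Rightarrow> real" where
  "martingale_const q = (if q = 2 then 1 else 2 * powr_increment_const q + 1)"

lemma martingale_const_2 [simp]: "martingale_const 2 = 1"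
  by (simp add: martingale_const_def)

lemma martingale_const_ge_1: "q \<ge> 2 \<Longrightarrow> martingale_const q \<ge> 1"
  using powr_increment_const_nonneg[of q] by (simp add: martingale_const_def)

lemma powr_superadditive:
  fixes x y r :: real
  assumes "x \<ge> 0" "y \<ge> 0" "r \<ge> 1"
  shows "x powr r + y powr r \<le> (x + y) powr r"
    and "x powr r + y * x powr (r - 1) \<le> (x + y) powr r"
proof -
  have *: "z powr r = z * z powr (r - 1)" if "z \<ge> 0" for z :: real
    using that by (cases "z = 0") (auto simp: powr_diff)
  have "x powr r + y powr r = x * x powr (r - 1) + y * y powr (r - 1)" using assms * by simp
  also have "\<dots> \<le> x * (x + y) powr (r - 1) + y * (x + y) powr (r - 1)"
    using assms by (intro add_mono mult_left_mono powr_mono2) auto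
  also have "\<dots> = (x + y) powr r" using assms *[of "x + y"] by (simp add: algebra_simps)
  finally show "x powr r + y powr r \<le> (x + y) powr r" .
  have "x powr r + y * x powr (r - 1) = x * x powr (r - 1) + y * x powr (r - 1)" using assms * by simp
  also have "\<dots> \<le> x * (x + y) powr (r - 1) + y * (x + y) powr (r - 1)"
    using assms by (intro add_mono mult_left_mono powr_mono2) auto
  also have "\<dots> = (x + y) powr r" using assms *[of "x + y"] by (simp add: algebra_simps)
  finally show "x powr r + y * x powr (r - 1) \<le> (x + y) powr r" .
qed

lemma integrable_sgn_powr_mult:
  assumes S: "in_Lp N q S" and d: "in_Lp N q d" and q: "q \<ge> 2"
  shows "integrable N (\<lambda>x. (sgn (S x) * \<bar>S x\<bar> powr (q - 1)) * d x)"
proof -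
  have [measurable]: "S \<in> borel_measurable N" "d \<in> borel_measurable N" using S d by (auto simp: in_Lp_def)
  have e: "(\<bar>x\<bar> powr (q - 1)) powr (q / (q - 1)) = \<bar>x\<bar> powr q" for x :: real
    using q by (simp add: powr_powr)
  have "integrable N (\<lambda>x. \<bar>S x\<bar> powr (q - 1) * \<bar>d x\<bar>)"
  proof (rule Holder_integral)
    show "integrable N (\<lambda>x. (\<bar>S x\<bar> powr (q - 1)) powr (q / (q - 1)))" "integrable N (\<lambda>x. \<bar>d x\<bar> powr q)"
      unfolding e using S d by (auto simp: in_Lp_def)
    show "q / (q - 1) > 1" "q > 1" "1 / (q / (q - 1)) + 1 / q = 1" using q by (auto simp: divide_simps)
  qed auto
  thus ?thesis
    by (rule Bochner_Integration.integrable_bound) (auto simp: abs_mult sgn_real_def)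
qed

text \<open>
  Integrating the Taylor bound kills the linear term, and the remaining terms are absorbed into
  \<open>(A\<^sup>2 + K D\<^sup>2) powr (q / 2)\<close>, where \<open>A\<close> and \<open>D\<close> are the norms of \<open>S\<close> and \<open>d\<close>.
\<close>

lemma Lp_norm_martingale_step:
  assumes S: "in_Lp N q S" and d: "in_Lp N q d" and q: "q \<ge> 2"
    and orth: "(LINT x|N. (sgn (S x) * \<bar>S x\<bar> powr (q - 1)) * d x) = 0"
  shows "(Lp_norm N q (\<lambda>x. S x + d x))\<^sup>2 \<le> (Lp_norm N q S)\<^sup>2 + martingale_const q * (Lp_norm N q d)\<^sup>2"
proof (cases "q = 2")
  case True
  have [measurable]: "S \<in> borel_measurable N" "d \<in> borel_measurable N" using S d by (auto simp: in_Lp_def)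
  have e: "sgn s * \<bar>s\<bar> powr 1 = s" for s :: real by (auto simp: sgn_real_def)
  have i: "integrable N (\<lambda>x. (S x)\<^sup>2)" "integrable N (\<lambda>x. (d x)\<^sup>2)" "integrable N (\<lambda>x. S x * d x)"
    using S d integrable_sgn_powr_mult[OF S d q] True e by (auto simp: in_Lp_2)
  have "(LINT x|N. (S x + d x)\<^sup>2) = (LINT x|N. (S x)\<^sup>2 + 2 * (S x * d x) + (d x)\<^sup>2)"
    by (rule Bochner_Integration.integral_cong) (auto simp: power2_eq_square algebra_simps)
  also have "\<dots> = (LINT x|N. (S x)\<^sup>2) + 2 * (LINT x|N. S x * d x) + (LINT x|N. (d x)\<^sup>2)"
    using i by simp
  also have "(LINT x|N. S x * d x) = 0" using orth True e by simp
  finally show ?thesis unfolding True Lp_norm_2 by simp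
next
  case False
  hence q2: "q > 2" using q by simp
  define A D B C where "A = Lp_norm N q S" and "D = Lp_norm N q d"
    and "B = Lp_norm N q (\<lambda>x. S x + d x)" and "C = powr_increment_const q"
  have C: "C \<ge> 0" using powr_increment_const_nonneg q by (simp add: C_def)
  have nn: "A \<ge> 0" "D \<ge> 0" "B \<ge> 0" by (auto simp: A_def B_def D_def)
  note i = in_Lp_integrable[OF S] in_Lp_integrable[OF d] integrable_powr_mult_square[OF S d q2]
    integrable_sgn_powr_mult[OF S d q]
  have "B powr q = (LINT x|N. \<bar>S x + d x\<bar> powr q)" using q by (simp add: B_def Lp_norm_powr)
  also have "\<dots> \<le> (LINT x|N. \<bar>S x\<bar> powr q + q * ((sgn (S x) * \<bar>S x\<bar> powr (q - 1)) * d x)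
           + C * (\<bar>S x\<bar> powr (q - 2) * \<bar>d x\<bar> powr 2 + \<bar>d x\<bar> powr q))"
  proof (rule integral_mono)
    show "integrable N (\<lambda>x. \<bar>S x + d x\<bar> powr q)" using in_Lp_add[OF S d] q by (simp add: in_Lp_def)
    show "integrable N (\<lambda>x. \<bar>S x\<bar> powr q + q * ((sgn (S x) * \<bar>S x\<bar> powr (q - 1)) * d x)
           + C * (\<bar>S x\<bar> powr (q - 2) * \<bar>d x\<bar> powr 2 + \<bar>d x\<bar> powr q))"
      by (intro Bochner_Integration.integrable_add integrable_mult_right i)
    fix x show "\<bar>S x + d x\<bar> powr q \<le> \<bar>S x\<bar> powr q + q * ((sgn (S x) * \<bar>S x\<bar> powr (q - 1)) * d x)
           + C * (\<bar>S x\<bar> powr (q - 2) * \<bar>d x\<bar> powr 2 + \<bar>d x\<bar> powr q)"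
      using abs_powr_increment[OF q2, of "S x" "d x"] by (simp add: C_def mult.assoc)
  qed
  also have "\<dots> = (LINT x|N. \<bar>S x\<bar> powr q) + q * (LINT x|N. (sgn (S x) * \<bar>S x\<bar> powr (q - 1)) * d x)
           + C * ((LINT x|N. \<bar>S x\<bar> powr (q - 2) * \<bar>d x\<bar> powr 2) + (LINT x|N. \<bar>d x\<bar> powr q))"
  proof -
    have "(LINT x|N. a x + q * b x + C * (c x + e x)) =
        (LINT x|N. a x) + q * (LINT x|N. b x) + C * ((LINT x|N. c x) + (LINT x|N. e x))"
      if "integrable N a" "integrable N b" "integrable N c" "integrable N e" for a b c e :: "'a \<Rightarrow> real"
      using that by simp
    from this[OF i(1,4,3,2)] show ?thesis .
  qed
  also have "\<dots> \<le> A powr q + q * 0 + C * (A powr (q - 2) * D powr 2 + D powr q)"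
    unfolding orth using integral_powr_mult_square[OF S d q2] q C
    by (intro add_mono mult_left_mono) (auto simp: A_def D_def Lp_norm_powr)
  finally have B: "B powr q \<le> A powr q + C * (A powr (q - 2) * D powr 2) + C * D powr q" by (simp add: algebra_simps)
  define K where "K = 2 * C + 1"
  define r where "r = q / 2"
  have K: "K \<ge> 1" "K \<ge> 2 * C" using C by (auto simp: K_def)
  have r: "r > 1" using q2 by (simp add: r_def)
  define u where "u = K * D\<^sup>2"
  have u: "u \<ge> 0" using K by (simp add: u_def)
  have sq: "(z\<^sup>2) powr a = z powr (2 * a)" if "z \<ge> 0" for z a :: real
    using that by (cases "z = 0") (auto simp: powr_powr simp flip: powr_numeral)
  have A2: "(A\<^sup>2) powr r = A powr q" "(A\<^sup>2) powr (r - 1) = A powr (q - 2)"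
    using sq[OF nn(1)] by (auto simp: r_def right_diff_distrib)
  have "A powr q + u powr r \<le> (A\<^sup>2 + u) powr r" "A powr q + u * A powr (q - 2) \<le> (A\<^sup>2 + u) powr r"
    using powr_superadditive[of "A\<^sup>2" u r] u r unfolding A2 by auto
  moreover have "u * A powr (q - 2) \<ge> 2 * (C * (A powr (q - 2) * D powr 2))"
  proof -
    have "K * (D\<^sup>2 * A powr (q - 2)) \<ge> 2 * C * (D\<^sup>2 * A powr (q - 2))"
      using K by (intro mult_right_mono) auto
    thus ?thesis using nn by (simp add: u_def algebra_simps)
  qed
  moreover have "u powr r \<ge> 2 * (C * D powr q)"
  proof -
    have "u powr r = K powr r * D powr q" using sq[OF nn(2), of r] K by (simp add: u_def powr_mult r_def)
    moreover have "K powr r \<ge> K powr 1" using K r by (intro powr_mono) auto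
    hence "K powr r \<ge> 2 * C" using K by simp
    hence "K powr r * D powr q \<ge> 2 * C * D powr q" by (intro mult_right_mono) auto
    ultimately show ?thesis by simp
  qed
  ultimately have "B powr q \<le> (A\<^sup>2 + u) powr r" using B by linarith
  hence "(B\<^sup>2) powr r \<le> (A\<^sup>2 + u) powr r" using sq[OF nn(3), of r] by (simp add: r_def)
  hence "B\<^sup>2 \<le> A\<^sup>2 + u" using r u powr_less_mono2[of r "A\<^sup>2 + u" "B\<^sup>2"] by (auto simp: not_le[symmetric])
  thus ?thesis using False by (simp add: A_def B_def D_def u_def K_def C_def martingale_const_def)
qed

section \<open>Independent and identically distributed innovations\<close>

text \<open>
  The coordinates in \<open>J\<close> come from the first argument, the others from the second: with two independent
  copies as arguments, the innovations outside \<open>J\<close> are resampled.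
\<close>

definition patch :: "int set \<Rightarrow> (int \<Rightarrow> real) \<Rightarrow> (int \<Rightarrow> real) \<Rightarrow> (int \<Rightarrow> real)" where
  "patch J x y = (\<lambda>i. if i \<in> J then x i else y i)"

definition depends_on :: "((int \<Rightarrow> real) \<Rightarrow> 'b) \<Rightarrow> int set \<Rightarrow> bool" where
  "depends_on f J \<longleftrightarrow> (\<forall>x y. (\<forall>i\<in>J. x i = y i) \<longrightarrow> f x = f y)"

lemma depends_onD: "depends_on f J \<Longrightarrow> (\<And>i. i \<in> J \<Longrightarrow> x i = y i) \<Longrightarrow> f x = f y"
  by (auto simp: depends_on_def)

lemma depends_on_mono: "depends_on f J \<Longrightarrow> J \<subseteq> K \<Longrightarrow> depends_on f K"
  unfolding depends_on_def by blast

lemma depends_on_const [simp]: "depends_on (\<lambda>_. c) J"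
  by (auto simp: depends_on_def)

lemma depends_on_comp: "depends_on f J \<Longrightarrow> depends_on (\<lambda>x. h (f x)) J"
  unfolding depends_on_def by metis

lemma depends_on_comp2: "depends_on f J \<Longrightarrow> depends_on g J \<Longrightarrow> depends_on (\<lambda>x. h (f x) (g x)) J"
  unfolding depends_on_def by metis

lemma depends_on_sum: "(\<And>i. i \<in> I \<Longrightarrow> depends_on (f i) J) \<Longrightarrow> depends_on (\<lambda>x. \<Sum>i\<in>I. f i x :: real) J"
  unfolding depends_on_def by (auto intro!: sum.cong)

lemma depends_on_patch: "depends_on f J \<Longrightarrow> f (patch J x y) = f x"
  by (rule depends_onD) (auto simp: patch_def)

lemma depends_on_patch_compl: "depends_on f K \<Longrightarrow> K \<inter> J = {} \<Longrightarrow> f (patch J x y) = f y"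
  by (rule depends_onD) (auto simp: patch_def)

lemma patch_UNIV [simp]: "patch UNIV x y = x"
  by (simp add: patch_def)

lemma patch_patch: "patch K (patch J x y) z = patch (K \<inter> J) x (patch K y z)"
  by (auto simp: patch_def)

locale innovations = prob_space \<nu> for \<nu> :: "real measure" +
  assumes sets_nu: "sets \<nu> = sets borel"
begin

definition P :: "(int \<Rightarrow> real) measure" where
  "P = (\<Pi>\<^sub>M i\<in>UNIV. \<nu>)"

lemma space_nu: "space \<nu> = UNIV"
  using sets_eq_imp_space_eq[OF sets_nu] by simp

lemma space_P [simp]: "space P = UNIV"
  by (auto simp: P_def space_PiM space_nu)

sublocale PP: prob_space P
  unfolding P_def by (intro prob_space_PiM prob_space_axioms)

lemma prob_P_UNIV [simp]: "measure P UNIV = 1"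
  using PP.prob_space by simp

sublocale P2: pair_prob_space P P ..

lemma measurable_P_component [measurable]: "(\<lambda>x. x i) \<in> borel_measurable P"
proof -
  have "(\<lambda>x. x i) \<in> measurable P \<nu>" unfolding P_def by measurable
  thus ?thesis by (simp add: measurable_cong_sets[OF refl sets_nu])
qed

lemma measurable_into_P:
  assumes "\<And>i. (\<lambda>x. h x i) \<in> borel_measurable N"
  shows "h \<in> measurable N P"
  unfolding P_def
proof (rule measurable_PiM_single')
  fix i :: int show "(\<lambda>x. h x i) \<in> measurable N \<nu>"
    using assms by (simp add: measurable_cong_sets[OF refl sets_nu])
qed (simp add: space_nu)

lemma measurable_patch [measurable]:
  "(\<lambda>(x, y). patch J x y) \<in> measurable (P \<Otimes>\<^sub>M P) P"
  "patch J x \<in> measurable P P"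
  by (auto intro!: measurable_into_P simp: patch_def case_prod_unfold)

lemma distr_join_pair:
  "distr (P \<Otimes>\<^sub>M P) (\<Pi>\<^sub>M i\<in>(UNIV :: (int + int) set). \<nu>) (\<lambda>(x, y). case_sum x y) = (\<Pi>\<^sub>M i\<in>UNIV. \<nu>)"
  (is "distr _ ?W ?j = _")
proof -
  interpret W: product_prob_space "\<lambda>_. \<nu>" "UNIV :: (int + int) set" ..
  have j: "?j \<in> measurable (P \<Otimes>\<^sub>M P) ?W"
  proof (rule measurable_PiM_single')
    fix i :: "int + int"
    show "(\<lambda>z. (case z of (x, y) \<Rightarrow> case_sum x y) i) \<in> measurable (P \<Otimes>\<^sub>M P) \<nu>"
      by (cases i) (auto simp: case_prod_unfold measurable_cong_sets[OF refl sets_nu])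
  qed (simp add: space_nu)
  show ?thesis
  proof (rule W.PiM_eq)
    fix K :: "(int + int) set" and F :: "int + int \<Rightarrow> real set"
    assume K: "finite K" "K \<subseteq> UNIV" and F: "\<And>k. k \<in> K \<Longrightarrow> F k \<in> sets \<nu>"
    let ?A = "{i. Inl i \<in> K}" and ?B = "{i. Inr i \<in> K}"
    have fin: "finite ?A" "finite ?B"
      using K(1) by (auto intro!: finite_vimageI[of K Inl, unfolded vimage_def] finite_vimageI[of K Inr, unfolded vimage_def])
    define CA where "CA = prod_emb UNIV (\<lambda>_. \<nu>) ?A (Pi\<^sub>E ?A (\<lambda>i. F (Inl i)))"
    define CB where "CB = prod_emb UNIV (\<lambda>_. \<nu>) ?B (Pi\<^sub>E ?B (\<lambda>i. F (Inr i)))"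
    have C: "CA \<in> sets P" "CB \<in> sets P"
      unfolding CA_def CB_def P_def using fin F by (auto intro!: sets_PiM_I)
    have "emeasure (distr (P \<Otimes>\<^sub>M P) ?W ?j) (prod_emb UNIV (\<lambda>_. \<nu>) K (Pi\<^sub>E K F))
        = emeasure (P \<Otimes>\<^sub>M P) (?j -` (prod_emb UNIV (\<lambda>_. \<nu>) K (Pi\<^sub>E K F)) \<inter> space (P \<Otimes>\<^sub>M P))"
      using j K F by (intro emeasure_distr sets_PiM_I) auto
    also have "?j -` (prod_emb UNIV (\<lambda>_. \<nu>) K (Pi\<^sub>E K F)) \<inter> space (P \<Otimes>\<^sub>M P) = CA \<times> CB"
    proof (intro equalityI subsetI)
      fix z assume "z \<in> ?j -` (prod_emb UNIV (\<lambda>_. \<nu>) K (Pi\<^sub>E K F)) \<inter> space (P \<Otimes>\<^sub>M P)"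
      hence k: "case_sum (fst z) (snd z) k \<in> F k" if "k \<in> K" for k
        using that by (auto simp: prod_emb_def PiE_iff case_prod_unfold)
      have "fst z \<in> CA" using k[of "Inl _"] by (auto simp: CA_def prod_emb_def PiE_iff space_nu)
      moreover have "snd z \<in> CB" using k[of "Inr _"] by (auto simp: CB_def prod_emb_def PiE_iff space_nu)
      ultimately show "z \<in> CA \<times> CB" by (simp add: mem_Times_iff)
    next
      fix z assume "z \<in> CA \<times> CB"
      then obtain x y where z: "z = (x, y)" and "x \<in> CA" "y \<in> CB" by auto
      hence "Inl i \<in> K \<Longrightarrow> x i \<in> F (Inl i)" "Inr i \<in> K \<Longrightarrow> y i \<in> F (Inr i)" for i
        by (auto simp: CA_def CB_def prod_emb_def PiE_iff)
      hence "k \<in> K \<Longrightarrow> case_sum x y k \<in> F k" for k by (cases k) auto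
      thus "z \<in> ?j -` (prod_emb UNIV (\<lambda>_. \<nu>) K (Pi\<^sub>E K F)) \<inter> space (P \<Otimes>\<^sub>M P)"
        by (auto simp: z prod_emb_def PiE_iff space_nu extensional_def space_pair_measure)
    qed
    also have "emeasure (P \<Otimes>\<^sub>M P) (CA \<times> CB) = emeasure P CA * emeasure P CB"
      using C by (rule PP.emeasure_pair_measure_Times)
    also have "\<dots> = (\<Prod>i\<in>?A. emeasure \<nu> (F (Inl i))) * (\<Prod>i\<in>?B. emeasure \<nu> (F (Inr i)))"
      unfolding CA_def CB_def P_def using fin F
      by (subst (1 2) emeasure_PiM_emb) (auto intro: prob_space_axioms)
    also have "\<dots> = (\<Prod>k\<in>Inl ` ?A. emeasure \<nu> (F k)) * (\<Prod>k\<in>Inr ` ?B. emeasure \<nu> (F k))"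
      by (simp add: prod.reindex)
    also have "\<dots> = (\<Prod>k\<in>Inl ` ?A \<union> Inr ` ?B. emeasure \<nu> (F k))"
      using fin by (intro prod.union_disjoint[symmetric]) auto
    also have "Inl ` ?A \<union> Inr ` ?B = K"
    proof (intro equalityI subsetI)
      fix k assume "k \<in> K" thus "k \<in> Inl ` ?A \<union> Inr ` ?B" by (cases k) auto
    qed auto
    finally show "emeasure (distr (P \<Otimes>\<^sub>M P) ?W ?j) (prod_emb UNIV (\<lambda>_. \<nu>) K (Pi\<^sub>E K F)) = (\<Prod>k\<in>K. emeasure \<nu> (F k))" .
  qed simp
qed

lemma measurable_join_pair:
  "(\<lambda>(x, y). case_sum x y) \<in> measurable (P \<Otimes>\<^sub>M P) (\<Pi>\<^sub>M i\<in>(UNIV :: (int + int) set). \<nu>)"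
proof (rule measurable_PiM_single')
  fix i :: "int + int"
  show "(\<lambda>z. (case z of (x, y) \<Rightarrow> case_sum x y) i) \<in> measurable (P \<Otimes>\<^sub>M P) \<nu>"
    by (cases i) (auto simp: case_prod_unfold measurable_cong_sets[OF refl sets_nu])
qed (simp add: space_nu)

lemma measurable_split_pair:
  "(\<lambda>w. (\<lambda>i. w (Inl i), \<lambda>i. w (Inr i))) \<in> measurable (\<Pi>\<^sub>M i\<in>(UNIV :: (int + int) set). \<nu>) (P \<Otimes>\<^sub>M P)"
proof (intro measurable_Pair measurable_into_P)
  have "(\<lambda>w. w k) \<in> borel_measurable (\<Pi>\<^sub>M i\<in>(UNIV :: (int + int) set). \<nu>)" for k
  proof -
    have "(\<lambda>w. w k) \<in> measurable (\<Pi>\<^sub>M i\<in>(UNIV :: (int + int) set). \<nu>) \<nu>" by measurable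
    thus ?thesis by (simp add: measurable_cong_sets[OF refl sets_nu])
  qed
  thus "\<And>i. (\<lambda>x. x (Inl i)) \<in> borel_measurable (\<Pi>\<^sub>M i\<in>(UNIV :: (int + int) set). \<nu>)"
    "\<And>i. (\<lambda>x. x (Inr i)) \<in> borel_measurable (\<Pi>\<^sub>M i\<in>(UNIV :: (int + int) set). \<nu>)" by auto
qed

lemma distr_split_pair:
  "distr (\<Pi>\<^sub>M i\<in>(UNIV :: (int + int) set). \<nu>) (P \<Otimes>\<^sub>M P) (\<lambda>w. (\<lambda>i. w (Inl i), \<lambda>i. w (Inr i))) = P \<Otimes>\<^sub>M P"
  (is "distr ?W _ ?s = _")
proof -
  have "distr ?W (P \<Otimes>\<^sub>M P) ?s = distr (distr (P \<Otimes>\<^sub>M P) ?W (\<lambda>(x, y). case_sum x y)) (P \<Otimes>\<^sub>M P) ?s"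
    by (simp add: distr_join_pair)
  also have "\<dots> = distr (P \<Otimes>\<^sub>M P) (P \<Otimes>\<^sub>M P) (?s \<circ> (\<lambda>(x, y). case_sum x y))"
    by (rule distr_distr[OF measurable_split_pair measurable_join_pair])
  also have "?s \<circ> (\<lambda>(x, y). case_sum x y) = (\<lambda>z. z)" by (auto simp: fun_eq_iff)
  finally show ?thesis by simp
qed

text \<open>
  Exchanging the coordinates outside \<open>J\<close> between two independent copies permutes an i.i.d. family,
  so it preserves the joint law.
\<close>

lemma distr_exchange:
  "distr (P \<Otimes>\<^sub>M P) (P \<Otimes>\<^sub>M P) (\<lambda>(x, y). (patch J x y, patch J y x)) = P \<Otimes>\<^sub>M P"
proof -
  let ?W = "\<Pi>\<^sub>M i\<in>(UNIV :: (int + int) set). \<nu>" and ?s = "\<lambda>w :: int + int \<Rightarrow> real. (\<lambda>i. w (Inl i), \<lambda>i. w (Inr i))"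
  define \<pi> :: "int + int \<Rightarrow> int + int" where
    "\<pi> k = (case k of Inl i \<Rightarrow> if i \<in> J then Inl i else Inr i | Inr i \<Rightarrow> if i \<in> J then Inr i else Inl i)" for k
  have inj: "inj \<pi>" by (auto simp: inj_def \<pi>_def split: sum.splits if_splits)
  have perm: "distr ?W ?W (\<lambda>w k. w (\<pi> k)) = ?W"
    using distr_PiM_reindex[of UNIV "\<lambda>_. \<nu>" \<pi> UNIV] inj prob_space_axioms by (simp add: restrict_def)
  have pm: "(\<lambda>w k. w (\<pi> k)) \<in> measurable ?W ?W"
    by (intro measurable_PiM_single') (auto simp: space_nu)
  have "P \<Otimes>\<^sub>M P = distr (distr (distr (P \<Otimes>\<^sub>M P) ?W (\<lambda>(x, y). case_sum x y)) ?W (\<lambda>w k. w (\<pi> k))) (P \<Otimes>\<^sub>M P) ?s"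
    by (simp add: distr_join_pair perm distr_split_pair)
  also have "\<dots> = distr (P \<Otimes>\<^sub>M P) (P \<Otimes>\<^sub>M P) (?s \<circ> (\<lambda>w k. w (\<pi> k)) \<circ> (\<lambda>(x, y). case_sum x y))"
    by (subst distr_distr[OF pm measurable_join_pair],
        subst distr_distr[OF measurable_split_pair measurable_comp[OF measurable_join_pair pm]])
       (simp add: o_assoc)
  also have "(?s \<circ> (\<lambda>w k. w (\<pi> k)) \<circ> (\<lambda>(x, y). case_sum x y)) = (\<lambda>(x, y). (patch J x y, patch J y x))"
    by (auto simp: fun_eq_iff patch_def \<pi>_def)
  finally show ?thesis by simp
qed

lemma measurable_exchange:
  "(\<lambda>(x, y). (patch J x y, patch J y x)) \<in> measurable (P \<Otimes>\<^sub>M P) (P \<Otimes>\<^sub>M P)"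
  unfolding case_prod_unfold by (intro measurable_Pair measurable_into_P) (auto simp: patch_def)

lemma distr_patch: "distr (P \<Otimes>\<^sub>M P) P (\<lambda>(x, y). patch J x y) = P"
proof -
  have "distr (P \<Otimes>\<^sub>M P) P fst = P"
  proof (rule measure_eqI)
    fix A assume "A \<in> sets (distr (P \<Otimes>\<^sub>M P) P fst)"
    hence A: "A \<in> sets P" by simp
    have "fst -` A \<inter> space (P \<Otimes>\<^sub>M P) = A \<times> space P" by (auto simp: space_pair_measure)
    thus "emeasure (distr (P \<Otimes>\<^sub>M P) P fst) A = emeasure P A"
      using A PP.emeasure_pair_measure_Times[of A P "space P"] sets.top[of P] PP.emeasure_space_1 by (simp add: emeasure_distr PP.emeasure_space_1)
  qed simp
  hence "P = distr (distr (P \<Otimes>\<^sub>M P) (P \<Otimes>\<^sub>M P) (\<lambda>(x, y). (patch J x y, patch J y x))) P fst"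
    by (simp add: distr_exchange)
  also have "\<dots> = distr (P \<Otimes>\<^sub>M P) P (\<lambda>(x, y). patch J x y)"
    by (subst distr_distr[OF _ measurable_exchange]) (auto simp: o_def case_prod_unfold)
  finally show ?thesis by simp
qed

lemma
  assumes "integrable P f"
  shows integrable_patch: "integrable (P \<Otimes>\<^sub>M P) (\<lambda>(x, y). f (patch J x y) :: real)"
    and integral_patch: "(LINT z|(P \<Otimes>\<^sub>M P). f (patch J (fst z) (snd z))) = (LINT x|P. f x)"
    and AE_integrable_patch: "AE x in P. integrable P (\<lambda>y. f (patch J x y))"
proof -
  have m: "f \<in> borel_measurable P" using assms by auto
  show i: "integrable (P \<Otimes>\<^sub>M P) (\<lambda>(x, y). f (patch J x y))"
    using integrable_distr_eq[OF measurable_patch(1)[of J] m] assms distr_patch[of J]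
    by (simp add: case_prod_unfold)
  show "(LINT z|(P \<Otimes>\<^sub>M P). f (patch J (fst z) (snd z))) = (LINT x|P. f x)"
    using integral_distr[OF measurable_patch(1)[of J] m] distr_patch[of J] by (simp add: case_prod_unfold)
  show "AE x in P. integrable P (\<lambda>y. f (patch J x y))"
    using P2.AE_integrable_fst[of "\<lambda>x y. f (patch J x y)"] i by simp
qed

subsection \<open>Conditional expectation given a set of coordinates\<close>

text \<open>
  This version of the conditional expectation is a genuine function of the coordinates in \<open>J\<close> at every
  point, so that measurability with respect to sub-\<open>\<sigma>\<close>-algebras becomes the pointwise predicate
  \<open>depends_on\<close>. Almost everywhere statements are left only where integrability of a section is needed.
\<close>

definition cexp :: "int set \<Rightarrow> ((int \<Rightarrow> real) \<Rightarrow> real) \<Rightarrow> (int \<Rightarrow> real) \<Rightarrow> real" where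
  "cexp J f x = (LINT y|P. f (patch J x y))"

lemma measurable_cexp [measurable]:
  assumes [measurable]: "f \<in> borel_measurable P"
  shows "cexp J f \<in> borel_measurable P"
proof -
  have "(\<lambda>(x, y). f (patch J x y)) \<in> borel_measurable (P \<Otimes>\<^sub>M P)"
    using measurable_comp[OF measurable_patch(1)[of J] assms] by (simp add: o_def case_prod_unfold)
  thus ?thesis unfolding cexp_def using PP.borel_measurable_lebesgue_integral by blast
qed

lemma integrable_cexp: "integrable P f \<Longrightarrow> integrable P (cexp J f)"
  unfolding cexp_def using P2.integrable_fst[OF integrable_patch[of f J]] by simp

lemma integral_cexp: "integrable P f \<Longrightarrow> (LINT x|P. cexp J f x) = (LINT x|P. f x)"
  unfolding cexp_def using P2.integral_fst[OF integrable_patch[of f J]] integral_patch[of f J]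
  by (simp add: case_prod_unfold)

lemma depends_on_cexp: "depends_on (cexp J f) J"
proof (unfold depends_on_def, intro allI impI)
  fix x y :: "int \<Rightarrow> real" assume "\<forall>i\<in>J. x i = y i"
  hence "patch J x z = patch J y z" for z by (auto simp: patch_def)
  thus "cexp J f x = cexp J f y" by (simp add: cexp_def)
qed

lemma depends_on_cexp_Int:
  assumes f: "depends_on f D" shows "depends_on (cexp J f) (J \<inter> D)"
proof (unfold depends_on_def, intro allI impI)
  fix x y :: "int \<Rightarrow> real" assume "\<forall>i\<in>J \<inter> D. x i = y i"
  hence "f (patch J x z) = f (patch J y z)" for z
    using f by (intro depends_onD[OF f]) (auto simp: patch_def)
  thus "cexp J f x = cexp J f y" by (simp add: cexp_def)
qed

lemma cexp_depends_on: "depends_on f J \<Longrightarrow> cexp J f x = f x"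
  unfolding cexp_def by (simp add: depends_on_patch PP.prob_space)

lemma cexp_indep: "depends_on f K \<Longrightarrow> K \<inter> J = {} \<Longrightarrow> cexp J f x = (LINT y|P. f y)"
  unfolding cexp_def by (simp add: depends_on_patch_compl)

lemma cexp_mult_depends_on: "depends_on h J \<Longrightarrow> cexp J (\<lambda>x. h x * f x) x = h x * cexp J f x"
  unfolding cexp_def by (simp add: depends_on_patch)

lemma AE_cexp_diff:
  assumes "integrable P f" "integrable P g"
  shows "AE x in P. cexp J (\<lambda>x. f x - g x) x = cexp J f x - cexp J g x"
  using AE_integrable_patch[OF assms(1), of J] AE_integrable_patch[OF assms(2), of J]
  by eventually_elim (simp add: cexp_def)

lemma cexp_cmult: "cexp J (\<lambda>x. c * f x) x = c * cexp J f x"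
  by (simp add: cexp_def)

text \<open>
  Independence of the coordinates makes conditional expectations commute for arbitrary sets of
  coordinates, not only for nested ones: resampling twice resamples the coordinates outside \<open>J \<inter> K\<close>.
\<close>

lemma AE_cexp_cexp:
  assumes f: "integrable P f"
  shows "AE x in P. cexp J (cexp K f) x = cexp (J \<inter> K) f x"
  using AE_integrable_patch[OF f, of "J \<inter> K"]
proof eventually_elim
  case (elim x)
  have i: "integrable P (\<lambda>y. f (patch (J \<inter> K) x y))" by fact
  have "cexp J (cexp K f) x = (LINT y|P. LINT z|P. f (patch (J \<inter> K) x (patch K y z)))"
    unfolding cexp_def by (simp add: patch_patch Int_commute)
  also have "\<dots> = (LINT z|(P \<Otimes>\<^sub>M P). f (patch (J \<inter> K) x (patch K (fst z) (snd z))))"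
    using P2.integral_fst[OF integrable_patch[OF i, of K]] by (simp add: case_prod_unfold)
  also have "\<dots> = cexp (J \<inter> K) f x"
    unfolding cexp_def by (rule integral_patch[OF i])
  finally show ?case .
qed

lemma integral_mult_cexp_eq_0:
  assumes "depends_on h J" "integrable P (\<lambda>x. h x * f x)" "AE x in P. cexp J f x = 0"
  shows "(LINT x|P. h x * f x) = 0"
proof -
  have m: "(\<lambda>x. h x * f x) \<in> borel_measurable P" using assms(2) by auto
  have "(LINT x|P. h x * f x) = (LINT x|P. cexp J (\<lambda>x. h x * f x) x)"
    by (rule integral_cexp[OF assms(2), symmetric])
  also have "\<dots> = (LINT x|P. 0)"
  proof (rule integral_cong_AE)
    show "AE x in P. cexp J (\<lambda>x. h x * f x) x = 0"
      using assms(3) by eventually_elim (simp add: cexp_mult_depends_on[OF assms(1)])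
  qed (use m in auto)
  finally show ?thesis by simp
qed

lemma
  assumes f: "in_Lp P q f" and q: "q \<ge> 1"
  shows in_Lp_cexp: "in_Lp P q (cexp J f)"
    and Lp_norm_cexp_le: "Lp_norm P q (cexp J f) \<le> Lp_norm P q f"
proof -
  have m: "f \<in> borel_measurable P" using f by (auto simp: in_Lp_def)
  have iq: "integrable P (\<lambda>x. \<bar>f x\<bar> powr q)" using f by (auto simp: in_Lp_def)
  have mono: "AE x in P. \<bar>cexp J f x\<bar> powr q \<le> cexp J (\<lambda>x. \<bar>f x\<bar> powr q) x"
    using AE_integrable_patch[OF iq, of J]
  proof eventually_elim
    case (elim x)
    have "in_Lp P q (\<lambda>y. f (patch J x y))"
      using elim measurable_compose[OF measurable_patch(2) m] by (simp add: in_Lp_def)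
    thus ?case unfolding cexp_def using PP.Jensen_powr q by blast
  qed
  have i: "integrable P (\<lambda>x. \<bar>cexp J f x\<bar> powr q)"
  proof (rule Bochner_Integration.integrable_bound[OF integrable_cexp[OF iq, of J]])
    show "AE x in P. norm (\<bar>cexp J f x\<bar> powr q) \<le> norm (cexp J (\<lambda>x. \<bar>f x\<bar> powr q) x)"
      using mono by eventually_elim auto
  qed (use m in measurable)
  thus "in_Lp P q (cexp J f)" using m by (simp add: in_Lp_def)
  have "(LINT x|P. \<bar>cexp J f x\<bar> powr q) \<le> (LINT x|P. cexp J (\<lambda>x. \<bar>f x\<bar> powr q) x)"
    by (rule integral_mono_AE[OF i integrable_cexp[OF iq] mono])
  also have "\<dots> = (LINT x|P. \<bar>f x\<bar> powr q)" by (rule integral_cexp[OF iq])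
  finally show "Lp_norm P q (cexp J f) \<le> Lp_norm P q f"
    using q by (subst Lp_norm_le_iff) (auto simp: Lp_norm_powr)
qed

subsection \<open>Coupling coefficients\<close>

text \<open>
  For a stationary causal process at time 0 and \<open>s = - t\<close> this is the dependence coefficient \<open>\<delta>\<^sub>q(t)\<close>.
\<close>

definition coupling :: "real \<Rightarrow> ((int \<Rightarrow> real) \<Rightarrow> real) \<Rightarrow> int \<Rightarrow> real" where
  "coupling q f s = Lp_norm (P \<Otimes>\<^sub>M P) q (\<lambda>(x, y). f x - f (patch (- {s}) x y))"

lemma
  assumes f: "f \<in> borel_measurable P"
  shows in_Lp_patch_iff: "in_Lp (P \<Otimes>\<^sub>M P) q (\<lambda>z. f (patch J (fst z) (snd z))) \<longleftrightarrow> in_Lp P q f"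
    and Lp_norm_patch: "Lp_norm (P \<Otimes>\<^sub>M P) q (\<lambda>z. f (patch J (fst z) (snd z))) = Lp_norm P q f"
  using in_Lp_distr[OF measurable_patch(1)[of J] f, of q] Lp_norm_distr[OF measurable_patch(1)[of J] f, of q]
  using distr_patch[of J] by (simp_all add: case_prod_unfold)

lemma coupling_nonneg [simp]: "0 \<le> coupling q f s"
  by (simp add: coupling_def)

lemma in_Lp_pair_patch:
  assumes "in_Lp P q f"
  shows "in_Lp (P \<Otimes>\<^sub>M P) q (\<lambda>z. f (patch J (fst z) (snd z)))" "in_Lp (P \<Otimes>\<^sub>M P) q (\<lambda>z. f (fst z))"
proof -
  have m: "f \<in> borel_measurable P" using assms by (auto simp: in_Lp_def)
  show "in_Lp (P \<Otimes>\<^sub>M P) q (\<lambda>z. f (patch J (fst z) (snd z)))"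
    using assms by (simp add: in_Lp_patch_iff[OF m])
  show "in_Lp (P \<Otimes>\<^sub>M P) q (\<lambda>z. f (fst z))"
    using in_Lp_patch_iff[OF m, of q UNIV] assms by simp
qed

lemma Lp_norm_pair_fst: "f \<in> borel_measurable P \<Longrightarrow> Lp_norm (P \<Otimes>\<^sub>M P) q (\<lambda>z. f (fst z)) = Lp_norm P q f"
  using Lp_norm_patch[of f q UNIV] by simp

lemma in_Lp_coupling:
  assumes "in_Lp P q f" "q > 0"
  shows "in_Lp (P \<Otimes>\<^sub>M P) q (\<lambda>(x, y). f x - f (patch J x y))"
  using in_Lp_diff[OF in_Lp_pair_patch(2)[OF assms(1)] in_Lp_pair_patch(1)[OF assms(1)] assms(2)]
  by (simp add: case_prod_unfold)

lemma coupling_le_2_norm: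
  assumes "in_Lp P q f" "q \<ge> 1"
  shows "coupling q f s \<le> 2 * Lp_norm P q f"
proof -
  have m: "f \<in> borel_measurable P" using assms by (auto simp: in_Lp_def)
  show ?thesis
    using Lp_norm_triangle_diff[OF in_Lp_pair_patch(2)[OF assms(1)] in_Lp_pair_patch(1)[OF assms(1)] assms(2)]
    by (simp add: coupling_def case_prod_unfold Lp_norm_patch[OF m] Lp_norm_pair_fst[OF m])
qed

lemma coupling_add_le:
  assumes "in_Lp P q f" "in_Lp P q g" "q \<ge> 1"
  shows "coupling q (\<lambda>x. f x + g x) s \<le> coupling q f s + coupling q g s"
  using Lp_norm_triangle[OF in_Lp_coupling[OF assms(1), of "- {s}"] in_Lp_coupling[OF assms(2), of "- {s}"]] assms(3)
  by (simp add: coupling_def case_prod_unfold algebra_simps)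

lemma coupling_diff_le:
  assumes "in_Lp P q f" "in_Lp P q g" "q \<ge> 1"
  shows "coupling q (\<lambda>x. f x - g x) s \<le> coupling q f s + coupling q g s"
  using Lp_norm_triangle_diff[OF in_Lp_coupling[OF assms(1), of "- {s}"] in_Lp_coupling[OF assms(2), of "- {s}"]] assms(3)
  by (simp add: coupling_def case_prod_unfold algebra_simps)

lemma coupling_eq_0: "depends_on f J \<Longrightarrow> s \<notin> J \<Longrightarrow> coupling q f s = 0"
proof -
  assume f: "depends_on f J" "s \<notin> J"
  have "f x - f (patch (- {s}) x y) = 0" for x y
  proof -
    have "f x = f (patch (- {s}) x y)" by (rule depends_onD[OF f(1)]) (use f(2) in \<open>auto simp: patch_def\<close>)
    thus ?thesis by simp
  qed
  thus ?thesis by (simp add: coupling_def case_prod_unfold)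
qed

lemma coupling_mult_le:
  assumes f: "in_Lp P (2 * q) f" and g: "in_Lp P (2 * q) g" and q: "q \<ge> 1"
  shows "coupling q (\<lambda>x. f x * g x) s
    \<le> Lp_norm P (2 * q) f * coupling (2 * q) g s + Lp_norm P (2 * q) g * coupling (2 * q) f s"
proof -
  let ?J = "- {s}"
  have m: "f \<in> borel_measurable P" "g \<in> borel_measurable P" using f g by (auto simp: in_Lp_def)
  have q2: "2 * q > 0" "q > 0" using q by auto
  let ?a = "\<lambda>z. f (fst z) * (case z of (x, y) \<Rightarrow> g x - g (patch ?J x y))"
  let ?b = "\<lambda>z. g (patch ?J (fst z) (snd z)) * (case z of (x, y) \<Rightarrow> f x - f (patch ?J x y))"
  have a: "in_Lp (P \<Otimes>\<^sub>M P) q ?a"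
    by (rule in_Lp_mult[OF in_Lp_pair_patch(2)[OF f] in_Lp_coupling[OF g q2(1)] q2(2)])
  have b: "in_Lp (P \<Otimes>\<^sub>M P) q ?b"
    by (rule in_Lp_mult[OF in_Lp_pair_patch(1)[OF g] in_Lp_coupling[OF f q2(1)] q2(2)])
  have "coupling q (\<lambda>x. f x * g x) s = Lp_norm (P \<Otimes>\<^sub>M P) q (\<lambda>z. ?a z + ?b z)"
    unfolding coupling_def by (rule arg_cong[where f = "Lp_norm _ q"]) (auto simp: fun_eq_iff algebra_simps)
  also have "\<dots> \<le> Lp_norm (P \<Otimes>\<^sub>M P) q ?a + Lp_norm (P \<Otimes>\<^sub>M P) q ?b"
    by (rule Lp_norm_triangle[OF a b q])
  also have "Lp_norm (P \<Otimes>\<^sub>M P) q ?a \<le> Lp_norm P (2 * q) f * coupling (2 * q) g s"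
    using Lp_norm_mult[OF in_Lp_pair_patch(2)[OF f] in_Lp_coupling[OF g q2(1), of ?J] q2(2)]
    by (simp add: coupling_def Lp_norm_pair_fst[OF m(1)])
  also have "Lp_norm (P \<Otimes>\<^sub>M P) q ?b \<le> Lp_norm P (2 * q) g * coupling (2 * q) f s"
    using Lp_norm_mult[OF in_Lp_pair_patch(1)[OF g, of ?J] in_Lp_coupling[OF f q2(1), of ?J] q2(2)]
    by (simp add: coupling_def Lp_norm_patch[OF m(2)])
  finally show ?thesis by simp
qed

text \<open>
  Revealing one more coordinate \<open>s\<close>: averaging over the unrevealed coordinates turns the change of
  the conditional expectation into a mean of \<open>f\<close> minus its copy with \<open>s\<close> resampled.
\<close>

lemma Lp_norm_cexp_insert_diff:
  assumes f: "in_Lp P q f" and q: "q \<ge> 1" and s: "s \<notin> J"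
  shows "Lp_norm P q (\<lambda>x. cexp (insert s J) f x - cexp J f x) \<le> coupling q f s"
proof -
  let ?D = "\<lambda>x y. f x - f (patch (- {s}) x y)"
  let ?K = "insert s J"
  have fm[measurable]: "f \<in> borel_measurable P" using f by (auto simp: in_Lp_def)
  have q0: "q > 0" using q by simp
  have Dq: "integrable (P \<Otimes>\<^sub>M P) (\<lambda>(x, y). \<bar>?D x y\<bar> powr q)"
    using in_Lp_coupling[OF f q0, of "- {s}"] by (simp add: in_Lp_def case_prod_unfold)
  have Dm: "(\<lambda>(x, y). \<bar>?D x y\<bar> powr q) \<in> borel_measurable (P \<Otimes>\<^sub>M P)" using Dq by auto
  have ex: "(\<lambda>(x, y). \<bar>?D (patch ?K x y) (patch ?K y x)\<bar> powr q)
      = (\<lambda>z. (\<lambda>(x, y). \<bar>?D x y\<bar> powr q) ((\<lambda>(x, y). (patch ?K x y, patch ?K y x)) z))"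
    by (auto simp: fun_eq_iff)
  have Iex: "integrable (P \<Otimes>\<^sub>M P) (\<lambda>(x, y). \<bar>?D (patch ?K x y) (patch ?K y x)\<bar> powr q)"
    unfolding ex using integrable_distr_eq[OF measurable_exchange[of ?K] Dm] Dq distr_exchange[of ?K] by simp
  have Lex: "integral\<^sup>L (P \<Otimes>\<^sub>M P) (\<lambda>(x, y). \<bar>?D (patch ?K x y) (patch ?K y x)\<bar> powr q)
      = integral\<^sup>L (P \<Otimes>\<^sub>M P) (\<lambda>(x, y). \<bar>?D x y\<bar> powr q)"
    unfolding ex using integral_distr[OF measurable_exchange[of ?K] Dm] distr_exchange[of ?K] by simp
  have up: "patch (- {s}) (patch ?K x y) (patch ?K y x) = patch J x y" for x y
    using s by (auto simp: patch_def)
  have "integrable P f" using PP.in_Lp_imp_integrable[OF f q] .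
  have mono: "AE x in P. \<bar>cexp ?K f x - cexp J f x\<bar> powr q \<le> (LINT y|P. \<bar>?D (patch ?K x y) (patch ?K y x)\<bar> powr q)"
    using AE_integrable_patch[OF \<open>integrable P f\<close>, of ?K] AE_integrable_patch[OF \<open>integrable P f\<close>, of J]
      P2.AE_integrable_fst[OF Iex]
  proof eventually_elim
    case (elim x)
    have eq: "cexp ?K f x - cexp J f x = (LINT y|P. ?D (patch ?K x y) (patch ?K y x))"
      unfolding up cexp_def using elim(1,2) by simp
    have L: "in_Lp P q (\<lambda>y. ?D (patch ?K x y) (patch ?K y x))"
      using elim(3) unfolding up in_Lp_def
      by (intro conjI borel_measurable_diff measurable_compose[OF measurable_patch(2) fm]) auto
    show ?case unfolding eq by (rule PP.Jensen_powr[OF L q])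
  qed
  have i: "integrable P (\<lambda>x. \<bar>cexp ?K f x - cexp J f x\<bar> powr q)"
    using in_Lp_diff[OF in_Lp_cexp[OF f q, of ?K] in_Lp_cexp[OF f q, of J] q0] by (simp add: in_Lp_def)
  have "(LINT x|P. \<bar>cexp ?K f x - cexp J f x\<bar> powr q) \<le> (LINT x|P. LINT y|P. \<bar>?D (patch ?K x y) (patch ?K y x)\<bar> powr q)"
    by (rule integral_mono_AE[OF i P2.integrable_fst[OF Iex] mono])
  also have "\<dots> = integral\<^sup>L (P \<Otimes>\<^sub>M P) (\<lambda>(x, y). \<bar>?D x y\<bar> powr q)"
    using P2.integral_fst[OF Iex] Lex by simp
  also have "\<dots> = coupling q f s powr q"
    using q0 by (simp add: coupling_def Lp_norm_powr case_prod_unfold)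
  finally show ?thesis using q0 by (subst Lp_norm_le_iff) auto
qed

text \<open>
  Averaging over other coordinates commutes with resampling \<open>s\<close>, so Jensen's inequality applies inside
  the coupling. If \<open>s\<close> itself is averaged out, nothing is left to resample.
\<close>

lemma coupling_cexp_le:
  assumes f: "in_Lp P q f" and q: "q \<ge> 1"
  shows "coupling q (cexp J f) s \<le> coupling q f s"
proof (cases "s \<in> J")
  case False
  thus ?thesis using coupling_eq_0[OF depends_on_cexp] by simp
next
  case True
  let ?D = "\<lambda>x y. f x - f (patch (- {s}) x y)"
  let ?U = "patch (- {s})"
  have fm[measurable]: "f \<in> borel_measurable P" using f by (auto simp: in_Lp_def)
  have q0: "q > 0" using q by simp
  have fi: "integrable P f" using PP.in_Lp_imp_integrable[OF f q] .
  have Dq: "integrable (P \<Otimes>\<^sub>M P) (\<lambda>(x, y). \<bar>?D x y\<bar> powr q)"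
    using in_Lp_coupling[OF f q0, of "- {s}"] by (simp add: in_Lp_def case_prod_unfold)
  let ?c = "\<lambda>y' x. \<bar>?D x y'\<bar> powr q"
  have Dsec: "AE y' in P. integrable P (?c y')"
    using P2.AE_integrable_snd[of "\<lambda>x y. \<bar>?D x y\<bar> powr q"] Dq by simp
  have secm: "?c y' \<in> borel_measurable P" for y'
  proof -
    have "(\<lambda>x. ?U x y') \<in> measurable P P" by (auto intro!: measurable_into_P simp: patch_def)
    thus ?thesis using measurable_compose[OF _ fm] by measurable
  qed
  have sw: "patch J (?U x y') z = ?U (patch J x z) y'" for x y' z
    using True by (auto simp: patch_def)
  have ae1: "AE z in P \<Otimes>\<^sub>M P. integrable P (\<lambda>y. f (patch J (fst z) y)) \<and> integrable P (\<lambda>y. f (patch J (?U (fst z) (snd z)) y))"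
  proof -
    have "AE z in distr (P \<Otimes>\<^sub>M P) P (\<lambda>(x, y). patch K x y). integrable P (\<lambda>y. f (patch J z y))" for K
      unfolding distr_patch by (rule AE_integrable_patch[OF fi])
    hence "AE z in P \<Otimes>\<^sub>M P. integrable P (\<lambda>y. f (patch J (patch K (fst z) (snd z)) y))" for K
      using AE_distrD[OF measurable_patch(1)] by (auto simp: case_prod_unfold)
    from this[of UNIV] this[of "- {s}"] show ?thesis by auto
  qed
  have i: "integrable (P \<Otimes>\<^sub>M P) (\<lambda>(x, y). \<bar>cexp J f x - cexp J f (?U x y)\<bar> powr q)"
    using in_Lp_coupling[OF in_Lp_cexp[OF f q] q0, of J "- {s}"] by (simp add: in_Lp_def case_prod_unfold)
  have "integral\<^sup>L (P \<Otimes>\<^sub>M P) (\<lambda>(x, y). \<bar>cexp J f x - cexp J f (?U x y)\<bar> powr q)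
      = (LINT y'|P. LINT x|P. \<bar>cexp J f x - cexp J f (?U x y')\<bar> powr q)"
    using P2.integral_snd[OF i] by simp
  also have "\<dots> \<le> (LINT y'|P. LINT x|P. ?c y' x)"
  proof (rule integral_mono_AE)
    show "integrable P (\<lambda>y'. LINT x|P. \<bar>cexp J f x - cexp J f (?U x y')\<bar> powr q)"
      by (rule P2.integrable_snd[OF i])
    show "integrable P (\<lambda>y'. LINT x|P. ?c y' x)" using P2.integrable_snd[of "\<lambda>x y. \<bar>?D x y\<bar> powr q"] Dq by simp
    have ae2: "AE y' in P. AE x in P. integrable P (\<lambda>y. f (patch J x y)) \<and> integrable P (\<lambda>y. f (patch J (?U x y') y))"
    proof -
      have "AE z in P \<Otimes>\<^sub>M P. integrable P (\<lambda>y. f (patch J (snd z) y)) \<and> integrable P (\<lambda>y. f (patch J (?U (snd z) (fst z)) y))"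
        using ae1 by (subst (asm) P2.distr_pair_swap, subst (asm) AE_distr_iff)
          (auto simp: case_prod_unfold intro!: sets.sets_Collect_conj)
      from P2.AE_pair[OF this] show ?thesis by simp
    qed
    show "AE y' in P. (LINT x|P. \<bar>cexp J f x - cexp J f (?U x y')\<bar> powr q) \<le> (LINT x|P. ?c y' x)"
      using Dsec ae2 P2.AE_integrable_snd[OF i]
    proof eventually_elim
      case (elim y')
      have "(LINT x|P. \<bar>cexp J f x - cexp J f (?U x y')\<bar> powr q) \<le> (LINT x|P. cexp J (?c y') x)"
      proof (rule integral_mono_AE)
        show "AE x in P. \<bar>cexp J f x - cexp J f (?U x y')\<bar> powr q \<le> cexp J (?c y') x"
          using elim(2) AE_integrable_patch[OF elim(1), of J]
        proof eventually_elim
          case (elim x)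
          have eq: "cexp J f x - cexp J f (?U x y') = (LINT z|P. ?D (patch J x z) y')"
            unfolding cexp_def using elim(1) by (simp add: sw)
          have L: "in_Lp P q (\<lambda>z. ?D (patch J x z) y')"
            using elim(2) unfolding in_Lp_def sw[symmetric]
            by (intro conjI borel_measurable_diff measurable_compose[OF measurable_patch(2) fm]) auto
          show ?case unfolding eq unfolding cexp_def by (rule PP.Jensen_powr[OF L q])
        qed
      qed (use elim integrable_cexp in auto)
      also have "\<dots> = (LINT x|P. ?c y' x)" by (rule integral_cexp[OF elim(1)])
      finally show ?case .
    qed
  qed
  also have "\<dots> = integral\<^sup>L (P \<Otimes>\<^sub>M P) (\<lambda>(x, y). \<bar>?D x y\<bar> powr q)"
    using P2.integral_snd[of "\<lambda>x y. \<bar>?D x y\<bar> powr q"] Dq by simp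
  also have "\<dots> = coupling q f s powr q"
    using q0 by (simp add: coupling_def Lp_norm_powr case_prod_unfold)
  finally show ?thesis using q0 unfolding coupling_def[of _ "cexp J f"]
    by (subst Lp_norm_le_iff) (auto simp: case_prod_unfold)
qed

end

subsection \<open>Time shifts\<close>

definition tshift :: "int \<Rightarrow> (int \<Rightarrow> real) \<Rightarrow> (int \<Rightarrow> real)" where
  "tshift t x = (\<lambda>i. x (i + t))"

lemma depends_on_shift: "depends_on f J \<Longrightarrow> depends_on (\<lambda>x. f (tshift t x)) ((\<lambda>i. i + t) ` J)"
  by (auto simp: depends_on_def tshift_def)

lemma depends_on_shift_atMost: "depends_on f {..a} \<Longrightarrow> depends_on (\<lambda>x. f (tshift t x)) {..a + t}"
  by (drule depends_on_shift[of _ _ t]) (auto elim!: depends_on_mono)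

lemma atLeast_int_insert: "{s..} = insert s {s + 1..}" for s :: int
  by auto

context innovations begin

lemma distr_shift: "distr P P (tshift t) = P"
  using distr_PiM_reindex[of UNIV "\<lambda>_. \<nu>" "\<lambda>i. i + t" UNIV] prob_space_axioms
  by (simp add: P_def tshift_def[abs_def] restrict_def)

lemma measurable_shift [measurable]: "tshift t \<in> measurable P P"
  by (auto intro!: measurable_into_P simp: tshift_def)

lemma distr_shift_pair:
  "distr (P \<Otimes>\<^sub>M P) (P \<Otimes>\<^sub>M P) (\<lambda>(x, y). (tshift t x, tshift t y)) = P \<Otimes>\<^sub>M P"
  using pair_measure_distr[OF measurable_shift[of t] measurable_shift[of t]]
  by (simp add: distr_shift PP.sigma_finite_measure_axioms)

lemma measurable_shift_comp [measurable]: "f \<in> borel_measurable P \<Longrightarrow> (\<lambda>x. f (tshift t x)) \<in> borel_measurable P"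
  by (rule measurable_compose[OF measurable_shift])

lemma integral_shift: "f \<in> borel_measurable P \<Longrightarrow> (LINT x|P. f (tshift t x) :: real) = (LINT x|P. f x)"
  using integral_distr[OF measurable_shift[of t], of f] distr_shift[of t] by simp

lemma in_Lp_shift_iff: "f \<in> borel_measurable P \<Longrightarrow> in_Lp P q (\<lambda>x. f (tshift t x)) \<longleftrightarrow> in_Lp P q f"
  using in_Lp_distr[OF measurable_shift[of t], of f q] distr_shift[of t] by simp

lemma in_Lp_shift: "in_Lp P q f \<Longrightarrow> in_Lp P q (\<lambda>x. f (tshift t x))"
  using in_Lp_shift_iff in_Lp_measurable by blast

lemma Lp_norm_shift: "f \<in> borel_measurable P \<Longrightarrow> Lp_norm P q (\<lambda>x. f (tshift t x)) = Lp_norm P q f"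
  using Lp_norm_distr[OF measurable_shift[of t], of f q] distr_shift[of t] by simp

lemma coupling_shift:
  assumes [measurable]: "f \<in> borel_measurable P"
  shows "coupling q (\<lambda>x. f (tshift t x)) s = coupling q f (s - t)"
proof -
  let ?g = "\<lambda>(x, y). f x - f (patch (- {s - t}) x y)"
  have "?g \<in> borel_measurable (P \<Otimes>\<^sub>M P)"
    using measurable_compose[OF measurable_patch(1)[of "- {s - t}"] assms]
    by (simp add: case_prod_unfold)
  moreover have "(\<lambda>(x, y). (tshift t x, tshift t y)) \<in> measurable (P \<Otimes>\<^sub>M P) (P \<Otimes>\<^sub>M P)"
    by (auto intro!: measurable_Pair measurable_into_P simp: case_prod_unfold tshift_def)
  ultimately have "Lp_norm (distr (P \<Otimes>\<^sub>M P) (P \<Otimes>\<^sub>M P) (\<lambda>(x, y). (tshift t x, tshift t y))) q ?g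
      = Lp_norm (P \<Otimes>\<^sub>M P) q (\<lambda>z. ?g ((\<lambda>(x, y). (tshift t x, tshift t y)) z))"
    by (intro Lp_norm_distr)
  moreover have "tshift t (patch (- {s}) x y) = patch (- {s - t}) (tshift t x) (tshift t y)" for x y
    by (auto simp: tshift_def patch_def)
  ultimately show ?thesis using distr_shift_pair[of t] by (simp add: coupling_def case_prod_unfold)
qed

lemma cexp_shift:
  assumes [measurable]: "f \<in> borel_measurable P"
  shows "cexp J (\<lambda>x. f (tshift t x)) x = cexp ((\<lambda>i. i - t) ` J) f (tshift t x)"
proof -
  let ?J = "(\<lambda>i. i - t) ` J"
  have "i + t \<in> J \<longleftrightarrow> i \<in> ?J" for i by (auto intro: image_eqI[of _ _ "i + t"])
  hence "tshift t (patch J x y) = patch ?J (tshift t x) (tshift t y)" for y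
    unfolding tshift_def patch_def by auto
  hence "cexp J (\<lambda>x. f (tshift t x)) x = (LINT y|P. f (patch ?J (tshift t x) (tshift t y)))"
    by (simp add: cexp_def)
  also have "\<dots> = cexp ?J f (tshift t x)"
    unfolding cexp_def
    by (rule integral_shift[OF measurable_compose[OF measurable_patch(2) assms]])
  finally show ?thesis .
qed

subsection \<open>Reversed martingale differences\<close>

text \<open>
  Time runs backwards in this decomposition: the innovations are revealed starting with the most recent
  one. Resampling a single innovation, which is what the dependence coefficients measure, then bounds
  each difference directly, and for a causal process only finitely many differences lie between two
  truncations of its memory.
\<close>

definition innov :: "int \<Rightarrow> ((int \<Rightarrow> real) \<Rightarrow> real) \<Rightarrow> (int \<Rightarrow> real) \<Rightarrow> real" where
  "innov s f x = cexp {s..} f x - cexp {s + 1..} f x"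

lemma measurable_innov [measurable]: "f \<in> borel_measurable P \<Longrightarrow> innov s f \<in> borel_measurable P"
  unfolding innov_def[abs_def] by (intro borel_measurable_diff measurable_cexp)

lemma depends_on_innov: "depends_on (innov s f) {s..}"
  unfolding innov_def
  by (rule depends_on_comp2; rule depends_on_mono[OF depends_on_cexp]) auto

lemma depends_on_innov_Int: "depends_on f D \<Longrightarrow> depends_on (innov s f) ({s..} \<inter> D)"
  unfolding innov_def
  by (rule depends_on_comp2; rule depends_on_mono[OF depends_on_cexp_Int]) auto

lemma in_Lp_innov: "in_Lp P q f \<Longrightarrow> q \<ge> 1 \<Longrightarrow> in_Lp P q (innov s f)"
  unfolding innov_def[abs_def] by (intro in_Lp_diff in_Lp_cexp) auto

lemma Lp_norm_innov_le: "in_Lp P q f \<Longrightarrow> q \<ge> 1 \<Longrightarrow> Lp_norm P q (innov s f) \<le> coupling q f s"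
  using Lp_norm_cexp_insert_diff[of q f s "{s + 1..}"] unfolding innov_def[abs_def]
  by (simp add: atLeast_int_insert[of s])

lemma AE_cexp_innov:
  assumes f: "integrable P f"
  shows "AE x in P. cexp {s + 1..} (innov s f) x = 0"
proof -
  have a: "{s + 1..} \<inter> {s..} = {s + 1..}" "{s + 1..} \<inter> {s + 1..} = {s + 1..}" by auto
  show ?thesis unfolding innov_def[abs_def]
    using AE_cexp_diff[OF integrable_cexp[OF f, of "{s..}"] integrable_cexp[OF f, of "{s + 1..}"], of "{s + 1..}"]
      AE_cexp_cexp[OF f, of "{s + 1..}" "{s..}"] AE_cexp_cexp[OF f, of "{s + 1..}" "{s + 1..}"]
    unfolding a by eventually_elim simp
qed

lemma sum_innov:
  "(\<Sum>j<n. innov (a - int j) f x) = cexp {a - int n + 1..} f x - cexp {a + 1..} f x"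
proof (induction n)
  case (Suc n)
  have e: "a - int (Suc n) + 1 = a - int n" by simp
  show ?case unfolding sum.lessThan_Suc Suc e by (simp add: innov_def)
qed simp

text \<open>
  The terms are added in the order of decreasing times, that is, as their innovations are revealed.
\<close>

lemma Lp_norm_reversed_martingale:
  assumes q: "q \<ge> 2" and I: "finite I"
    and d: "\<And>s. s \<in> I \<Longrightarrow> in_Lp P q (d s)" "\<And>s. s \<in> I \<Longrightarrow> depends_on (d s) {s..}"
      "\<And>s. s \<in> I \<Longrightarrow> AE x in P. cexp {s + 1..} (d s) x = 0"
  shows "(Lp_norm P q (\<lambda>x. \<Sum>s\<in>I. d s x))\<^sup>2 \<le> martingale_const q * (\<Sum>s\<in>I. (Lp_norm P q (d s))\<^sup>2)"
  using I d
proof (induction I rule: finite_linorder_min_induct)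
  case (insert b A)
  let ?S = "\<lambda>x. \<Sum>s\<in>A. d s x"
  have S: "in_Lp P q ?S" using insert.prems(1) q by (intro in_Lp_sum) auto
  have db: "in_Lp P q (d b)" using insert.prems(1) by auto
  have dep: "depends_on ?S {b + 1..}"
  proof (rule depends_on_sum)
    fix s assume s: "s \<in> A"
    hence "b < s" using insert.hyps by auto
    thus "depends_on (d s) {b + 1..}" using s insert.prems(2)[of s]
      by (auto elim!: depends_on_mono)
  qed
  have "(LINT x|P. (sgn (?S x) * \<bar>?S x\<bar> powr (q - 1)) * d b x) = 0"
    by (rule integral_mult_cexp_eq_0[OF depends_on_comp[OF dep, of "\<lambda>z. sgn z * \<bar>z\<bar> powr (q - 1)"]
          integrable_sgn_powr_mult[OF S db q]]) (use insert.prems(3) in auto)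
  note step = Lp_norm_martingale_step[OF S db q this]
  have "(Lp_norm P q ?S)\<^sup>2 \<le> martingale_const q * (\<Sum>s\<in>A. (Lp_norm P q (d s))\<^sup>2)"
    by (rule insert.IH) (use insert.prems in auto)
  with step have "(Lp_norm P q (\<lambda>x. ?S x + d b x))\<^sup>2 \<le> martingale_const q * (\<Sum>s\<in>A. (Lp_norm P q (d s))\<^sup>2)
      + martingale_const q * (Lp_norm P q (d b))\<^sup>2"
    by linarith
  moreover have "b \<notin> A" using insert.hyps by auto
  ultimately show ?case using insert.hyps by (simp add: add.commute distrib_left)
qed simp

text \<open>
  The differences of the functions \<open>f t\<close> at the same lag \<open>j\<close> belong to different coordinates, so their
  weighted sum is again a sum of martingale differences. The weights later become factors frozen by conditioning.
\<close>

lemma Lp_norm_weighted_innov_sum: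
  fixes I :: "int set"
  assumes q: "q \<ge> 2" and I: "finite I" and \<omega>: "\<omega> \<ge> 0"
    and f: "\<And>t. t \<in> I \<Longrightarrow> in_Lp P q (f t)" "\<And>t. t \<in> I \<Longrightarrow> coupling q (f t) (t - j) \<le> \<omega>"
  shows "Lp_norm P q (\<lambda>x. \<Sum>t\<in>I. a t * innov (t - j) (f t) x)
    \<le> sqrt (martingale_const q) * sqrt (\<Sum>t\<in>I. (a t)\<^sup>2) * \<omega>"
proof -
  have q1: "q \<ge> 1" "q > 0" using q by auto
  let ?d = "\<lambda>s x. a (s + j) * innov s (f (s + j)) x"
  let ?S = "(\<lambda>t. t - j) ` I"
  have inj: "inj_on (\<lambda>t. t - j) I" by (auto simp: inj_on_def)
  have "(Lp_norm P q (\<lambda>x. \<Sum>t\<in>I. a t * innov (t - j) (f t) x))\<^sup>2 = (Lp_norm P q (\<lambda>x. \<Sum>s\<in>?S. ?d s x))\<^sup>2"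
    by (simp add: sum.reindex[OF inj])
  also have "\<dots> \<le> martingale_const q * (\<Sum>s\<in>?S. (Lp_norm P q (?d s))\<^sup>2)"
  proof (rule Lp_norm_reversed_martingale[OF q])
    fix s assume s: "s \<in> ?S"
    hence sj: "in_Lp P q (f (s + j))" using f by auto
    show "in_Lp P q (?d s)" by (rule in_Lp_cmult[OF in_Lp_innov[OF sj q1(1)]])
    show "depends_on (?d s) {s..}" by (rule depends_on_comp[OF depends_on_innov])
    show "AE x in P. cexp {s + 1..} (?d s) x = 0"
      using AE_cexp_innov[OF PP.in_Lp_imp_integrable[OF sj q1(1)], of s] by (simp add: cexp_cmult)
  qed (use I in auto)
  also have "(\<Sum>s\<in>?S. (Lp_norm P q (?d s))\<^sup>2) = (\<Sum>t\<in>I. (\<bar>a t\<bar> * Lp_norm P q (innov (t - j) (f t)))\<^sup>2)"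
    using q1 by (simp add: sum.reindex[OF inj] Lp_norm_cmult)
  also have "martingale_const q * \<dots> \<le> martingale_const q * (\<Sum>t\<in>I. (a t)\<^sup>2 * \<omega>\<^sup>2)"
  proof (intro mult_left_mono sum_mono)
    fix t assume t: "t \<in> I"
    have "Lp_norm P q (innov (t - j) (f t)) \<le> \<omega>"
      using Lp_norm_innov_le[OF f(1)[OF t] q1(1), of "t - j"] f(2)[OF t] by simp
    thus "(\<bar>a t\<bar> * Lp_norm P q (innov (t - j) (f t)))\<^sup>2 \<le> (a t)\<^sup>2 * \<omega>\<^sup>2"
      by (simp add: power_mult_distrib power_mono mult_left_mono)
  qed (use martingale_const_ge_1[OF q] in auto)
  also have "\<dots> = (sqrt (martingale_const q) * sqrt (\<Sum>t\<in>I. (a t)\<^sup>2) * \<omega>)\<^sup>2"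
    using martingale_const_ge_1[OF q] by (simp add: power_mult_distrib sum_nonneg sum_distrib_right)
  finally show ?thesis
    by (rule power2_le_imp_le) (use martingale_const_ge_1[OF q] \<omega> in \<open>auto intro!: mult_nonneg_nonneg sum_nonneg\<close>)
qed

subsection \<open>Convergence as all coordinates are revealed\<close>

lemma integral_abs_cexp_diff_le:
  assumes "integrable P f" "integrable P g"
  shows "(LINT x|P. \<bar>cexp J f x - cexp J g x\<bar>) \<le> (LINT x|P. \<bar>f x - g x\<bar>)"
proof -
  have [measurable]: "f \<in> borel_measurable P" "g \<in> borel_measurable P" using assms by auto
  have L: "in_Lp P 1 (\<lambda>x. f x - g x)" using assms by (simp add: in_Lp_def)
  have "(LINT x|P. \<bar>cexp J f x - cexp J g x\<bar>) = (LINT x|P. \<bar>cexp J (\<lambda>x. f x - g x) x\<bar>)"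
    by (rule integral_cong_AE) (use AE_cexp_diff[OF assms, of J] in auto)
  also have "\<dots> \<le> (LINT x|P. \<bar>f x - g x\<bar>)" using Lp_norm_cexp_le[OF L, of J] by (simp add: Lp_norm_def)
  finally show ?thesis .
qed

context
  fixes K :: "nat \<Rightarrow> int set"
  assumes K: "\<And>i. \<forall>\<^sub>F n in sequentially. i \<in> K n"
begin

text \<open>
  Functions with this property form a closed linear space; it contains the indicators of measurable sets
  by a monotone class argument.
\<close>

definition revealed :: "((int \<Rightarrow> real) \<Rightarrow> real) \<Rightarrow> bool" where
  "revealed f \<longleftrightarrow> integrable P f \<and> (\<lambda>n. LINT x|P. \<bar>cexp (K n) f x - f x\<bar>) \<longlonglongrightarrow> 0"

lemma revealed_closed:
  assumes f: "integrable P f"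
    and g: "\<And>e. e > 0 \<Longrightarrow> \<exists>g. revealed g \<and> (LINT x|P. \<bar>f x - g x\<bar>) < e"
  shows "revealed f"
  unfolding revealed_def
proof (intro conjI f)
  show "(\<lambda>n. LINT x|P. \<bar>cexp (K n) f x - f x\<bar>) \<longlonglongrightarrow> 0"
  proof (rule LIMSEQ_I)
    fix r :: real assume r: "r > 0"
    obtain g where g: "revealed g" "(LINT x|P. \<bar>f x - g x\<bar>) < r / 3" using g[of "r / 3"] r by auto
    have gi: "integrable P g" using g by (simp add: revealed_def)
    have "(\<lambda>n. LINT x|P. \<bar>cexp (K n) g x - g x\<bar>) \<longlonglongrightarrow> 0" using g by (simp add: revealed_def)
    then obtain N where N: "\<And>n. n \<ge> N \<Longrightarrow> \<bar>LINT x|P. \<bar>cexp (K n) g x - g x\<bar>\<bar> < r / 3"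
      using LIMSEQ_D[of _ 0 "r / 3"] r by fastforce
    have "norm ((LINT x|P. \<bar>cexp (K n) f x - f x\<bar>) - 0) < r" if n: "n \<ge> N" for n
    proof -
      note c = integrable_cexp[OF f, of "K n"] integrable_cexp[OF gi, of "K n"]
      have "(LINT x|P. \<bar>cexp (K n) f x - f x\<bar>)
        \<le> (LINT x|P. \<bar>cexp (K n) f x - cexp (K n) g x\<bar> + \<bar>cexp (K n) g x - g x\<bar> + \<bar>f x - g x\<bar>)"
        using f gi c by (intro integral_mono) auto
      also have "\<dots> = (LINT x|P. \<bar>cexp (K n) f x - cexp (K n) g x\<bar>) + (LINT x|P. \<bar>cexp (K n) g x - g x\<bar>)
          + (LINT x|P. \<bar>f x - g x\<bar>)"
        using f gi c by simp
      also have "\<dots> < r"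
        using integral_abs_cexp_diff_le[OF f gi, of "K n"] N[OF n] g(2) by linarith
      finally show ?thesis by (simp add: integral_nonneg_AE)
    qed
    thus "\<exists>no. \<forall>n\<ge>no. norm ((LINT x|P. \<bar>cexp (K n) f x - f x\<bar>) - 0) < r" by blast
  qed
qed

lemma revealed_add:
  assumes f: "revealed f" and g: "revealed g"
  shows "revealed (\<lambda>x. f x + c * g x)"
proof -
  have i: "integrable P f" "integrable P g" using f g by (auto simp: revealed_def)
  have cg: "AE x in P. cexp J (\<lambda>x. f x + c * g x) x = cexp J f x + c * cexp J g x" for J
    using AE_cexp_diff[of f "\<lambda>x. - c * g x" J] cexp_cmult[of J "- c" g] i by simp
  have "(\<lambda>n. LINT x|P. \<bar>cexp (K n) (\<lambda>x. f x + c * g x) x - (f x + c * g x)\<bar>) \<longlonglongrightarrow> 0"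
  proof (rule tendsto_sandwich[OF _ _ tendsto_const])
    show "\<forall>\<^sub>F n in sequentially. (LINT x|P. \<bar>cexp (K n) (\<lambda>x. f x + c * g x) x - (f x + c * g x)\<bar>)
        \<le> (LINT x|P. \<bar>cexp (K n) f x - f x\<bar>) + \<bar>c\<bar> * (LINT x|P. \<bar>cexp (K n) g x - g x\<bar>)"
    proof (rule always_eventually, rule allI)
      fix n
      have "(LINT x|P. \<bar>cexp (K n) (\<lambda>x. f x + c * g x) x - (f x + c * g x)\<bar>)
         \<le> (LINT x|P. \<bar>cexp (K n) f x - f x\<bar> + \<bar>c\<bar> * \<bar>cexp (K n) g x - g x\<bar>)"
      proof (rule integral_mono_AE)
        show "AE x in P. \<bar>cexp (K n) (\<lambda>x. f x + c * g x) x - (f x + c * g x)\<bar>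
          \<le> \<bar>cexp (K n) f x - f x\<bar> + \<bar>c\<bar> * \<bar>cexp (K n) g x - g x\<bar>"
          using cg[of "K n"]
        proof eventually_elim
          case (elim x)
          have "cexp (K n) f x + c * cexp (K n) g x - (f x + c * g x) = (cexp (K n) f x - f x) + c * (cexp (K n) g x - g x)"
            by (simp add: algebra_simps)
          thus ?case unfolding elim using abs_triangle_ineq[of "cexp (K n) f x - f x" "c * (cexp (K n) g x - g x)"]
            by (simp add: abs_mult)
        qed
      qed (use i integrable_cexp in auto)
      also have "\<dots> = (LINT x|P. \<bar>cexp (K n) f x - f x\<bar>) + \<bar>c\<bar> * (LINT x|P. \<bar>cexp (K n) g x - g x\<bar>)"
        using i integrable_cexp by simp
      finally show "(LINT x|P. \<bar>cexp (K n) (\<lambda>x. f x + c * g x) x - (f x + c * g x)\<bar>)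
        \<le> (LINT x|P. \<bar>cexp (K n) f x - f x\<bar>) + \<bar>c\<bar> * (LINT x|P. \<bar>cexp (K n) g x - g x\<bar>)" .
    qed
    show "(\<lambda>n. (LINT x|P. \<bar>cexp (K n) f x - f x\<bar>) + \<bar>c\<bar> * (LINT x|P. \<bar>cexp (K n) g x - g x\<bar>)) \<longlonglongrightarrow> 0"
      using f g by (auto simp: revealed_def intro!: tendsto_eq_intros)
  qed (auto simp: integral_nonneg_AE)
  thus ?thesis using i by (simp add: revealed_def)
qed

lemma revealed_const: "revealed (\<lambda>_. c)"
  by (simp add: revealed_def cexp_depends_on)

lemma revealed_indicator:
  assumes "A \<in> sets P" shows "revealed (indicator A)"
proof -
  have "Int_stable (prod_algebra UNIV (\<lambda>_::int. \<nu>))" by (rule Int_stable_prod_algebra)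
  moreover have "prod_algebra UNIV (\<lambda>_::int. \<nu>) \<subseteq> Pow (space P)" by simp
  moreover have "A \<in> sigma_sets (space P) (prod_algebra UNIV (\<lambda>_::int. \<nu>))"
    using assms unfolding P_def by (simp add: sets_PiM space_PiM)
  ultimately show ?thesis
  proof (induction rule: sigma_sets_induct_disjoint[consumes 3, case_names basic empty compl union])
    case (basic A)
    then obtain J E where J: "A = prod_emb UNIV (\<lambda>_. \<nu>) J (Pi\<^sub>E J E)" "finite J" "\<And>i. i \<in> J \<Longrightarrow> E i \<in> sets \<nu>"
      by (auto elim!: prod_algebraE)
    have A: "A \<in> sets P" unfolding J P_def using J by (intro sets_PiM_I) auto
    have dep: "depends_on (indicator A :: _ \<Rightarrow> real) J"
      unfolding depends_on_def by (auto simp: J prod_emb_def PiE_iff space_nu indicator_def)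
    have "\<forall>\<^sub>F n in sequentially. J \<subseteq> K n"
      unfolding subset_eq by (rule eventually_ball_finite[OF J(2)]) (use K in blast)
    hence "\<forall>\<^sub>F n in sequentially. (LINT x|P. \<bar>cexp (K n) (indicator A) x - indicator A x\<bar>) = 0"
      by eventually_elim (simp add: cexp_depends_on[OF depends_on_mono[OF dep]])
    hence "(\<lambda>n. LINT x|P. \<bar>cexp (K n) (indicator A) x - indicator A x\<bar>) \<longlonglongrightarrow> 0"
      by (rule tendsto_eventually)
    thus ?case using A by (simp add: revealed_def PP.emeasure_eq_measure)
  next
    case empty show ?case using revealed_const[of 0] by (simp add: indicator_def[abs_def])
  next
    case (compl A)
    have "(\<lambda>x. 1 + (-1) * indicator A x :: real) = indicator (space P - A)" by (auto simp: indicator_def)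
    with revealed_add[OF revealed_const[of 1] compl(2), of "-1"] show ?case by simp
  next
    case (union A)
    have As: "A i \<in> sets P" for i
      using union(2) unfolding P_def by (auto simp: sets_PiM space_PiM)
    have rev: "revealed (\<lambda>x. \<Sum>i<n. indicator (A i) x)" for n
    proof (induction n)
      case (Suc n)
      from revealed_add[OF Suc union(3)[of n], of 1] show ?case by simp
    qed (use revealed_const[of 0] in simp)
    show ?case
    proof (rule revealed_closed)
      show "integrable P (indicator (\<Union>i. A i) :: _ \<Rightarrow> real)" 
      proof -
        have "(\<Union>i. A i) \<in> sets P" using As by auto
        thus ?thesis by (simp add: PP.emeasure_eq_measure)
      qed
      fix e :: real assume e: "e > 0"
      have "(\<lambda>n. measure P (\<Union>i<n. A i)) \<longlonglongrightarrow> measure P (\<Union>n. \<Union>i<n. A i)"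
        using As by (intro PP.finite_Lim_measure_incseq) (auto simp: incseq_def lessThan_def intro: less_le_trans)
      also have "(\<Union>n. \<Union>i<n. A i) = (\<Union>i. A i)" by blast
      finally obtain n where n: "\<bar>measure P (\<Union>i<n. A i) - measure P (\<Union>i. A i)\<bar> < e"
        using LIMSEQ_D[OF _ e] by (metis order_refl real_norm_def)
      have sumeq: "(\<Sum>i<n. indicator (A i) x) = (indicator (\<Union>i<n. A i) x :: real)" for x
        using union(1) by (subst indicator_UN_disjoint) (auto simp: disjoint_family_on_def)
      have "(LINT x|P. \<bar>indicator (\<Union>i. A i) x - (\<Sum>i<n. indicator (A i) x) :: real\<bar>)
          = (LINT x|P. indicator ((\<Union>i. A i) - (\<Union>i<n. A i)) x)"
        unfolding sumeq by (rule Bochner_Integration.integral_cong) (auto simp: indicator_def)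
      also have "\<dots> = measure P ((\<Union>i. A i) - (\<Union>i<n. A i))" by (simp)
      also have "\<dots> = measure P (\<Union>i. A i) - measure P (\<Union>i<n. A i)"
        using As by (intro PP.finite_measure_Diff) auto
      also have "\<dots> < e" using n by linarith
      finally show "\<exists>g. revealed g \<and> (LINT x|P. \<bar>indicator (\<Union>i. A i) x - g x\<bar>) < e" using rev[of n] by blast
    qed
  qed
qed

lemma revealed_integrable:
  assumes "integrable P f" shows "revealed f"
  using assms
proof (induction rule: integrable_induct)
  case (base A c)
  have "(\<lambda>x. 0 + c * indicator A x) = (\<lambda>x. indicator A x *\<^sub>R c)" by (auto simp: indicator_def)
  with revealed_add[OF revealed_const[of 0] revealed_indicator[OF base(1)], of c] show ?case by simp
next
  case (add f g) thus ?case using revealed_add[of f g 1] by simp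
next
  case (lim f s)
  show ?case
  proof (rule revealed_closed[OF lim.hyps(4)])
    fix e :: real assume e: "e > 0"
    have "(\<lambda>i. LINT x|P. \<bar>f x - s i x\<bar>) \<longlonglongrightarrow> (LINT x|P. \<bar>f x - f x\<bar>)"
    proof (rule integral_dominated_convergence[where w = "\<lambda>x. 3 * \<bar>f x\<bar>"])
      show "AE x in P. (\<lambda>i. \<bar>f x - s i x\<bar>) \<longlonglongrightarrow> \<bar>f x - f x\<bar>"
        by (intro AE_I2 tendsto_intros lim.hyps(2)) auto
      show "AE x in P. norm \<bar>f x - s i x\<bar> \<le> 3 * \<bar>f x\<bar>" for i
      proof (rule AE_I2)
        fix x assume "x \<in> space P"
        hence "\<bar>s i x\<bar> \<le> 2 * \<bar>f x\<bar>" using lim.hyps(3)[of x i] by simp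
        thus "norm \<bar>f x - s i x\<bar> \<le> 3 * \<bar>f x\<bar>" by simp
      qed
    qed (use lim.hyps(1,4) in auto)
    hence "(\<lambda>i. LINT x|P. \<bar>f x - s i x\<bar>) \<longlonglongrightarrow> 0" by simp
    then obtain i where "\<bar>LINT x|P. \<bar>f x - s i x\<bar>\<bar> < e"
      using LIMSEQ_D[of _ 0 e] e by fastforce
    thus "\<exists>g. revealed g \<and> (LINT x|P. \<bar>f x - g x\<bar>) < e" using lim.IH[of i] by (intro exI[of _ "s i"]) auto
  qed
qed

end

text \<open>
  Levy's upward theorem in \<open>L\<^sup>1\<close>: it is trivial for functions of finitely many coordinates, and these
  are dense.
\<close>

lemma cexp_tendsto_L1:
  assumes "integrable P f"
  shows "(\<lambda>n. LINT x|P. \<bar>cexp {a - int n..} f x - f x\<bar>) \<longlonglongrightarrow> 0"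
proof -
  have "\<forall>\<^sub>F n in sequentially. i \<in> {a - int n..}" for i
    using eventually_ge_at_top[of "nat (a - i)"] by eventually_elim auto
  from revealed_integrable[of "\<lambda>n. {a - int n..}", OF this assms]
  show ?thesis by (simp add: revealed_def[of "\<lambda>n. {a - int n..}", OF \<open>\<And>i. \<forall>\<^sub>F n in sequentially. i \<in> {a - int n..}\<close>])
qed

lemma cexp_tendsto_L1':
  assumes "integrable P f"
  shows "(\<lambda>n. LINT x|P. \<bar>cexp {a - int n + 1..} f x - f x\<bar>) \<longlonglongrightarrow> 0"
  using cexp_tendsto_L1[OF assms, of "a + 1"] by (simp add: algebra_simps)

end

section \<open>Moments of stationary sums\<close>

context innovations begin

text \<open>
  The innovations of the remote past add up to what the recent coordinates leave undetermined, in
  \<open>L\<^sup>1\<close>; a uniform bound on the partial sums passes to the limit.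
\<close>

lemma Lp_norm_cexp_remainder:
  assumes f: "in_Lp P q f" and q: "q \<ge> 1"
    and B: "\<And>n. Lp_norm P q (\<lambda>x. \<Sum>j<n. innov (a - 1 - int j) f x) \<le> B"
  shows "Lp_norm P q (\<lambda>x. f x - cexp {a..} f x) \<le> B"
proof -
  have fi: "integrable P f" by (rule PP.in_Lp_imp_integrable[OF f q])
  have q0: "q > 0" using q by simp
  let ?u = "\<lambda>n x. \<Sum>j<n. innov (a - 1 - int j) f x"
  have u: "?u n x = cexp {a - 1 - int n + 1..} f x - cexp {a..} f x" for n x
    using sum_innov[of "a - 1" f x n] by simp
  show ?thesis
  proof (rule Lp_norm_L1_limit(2)[where u = ?u])
    show "in_Lp P q (?u n)" for n using f q by (intro in_Lp_sum in_Lp_innov) auto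
    show "integrable P (?u n)" for n
      unfolding u by (intro Bochner_Integration.integrable_diff integrable_cexp fi)
    show "integrable P (\<lambda>x. f x - cexp {a..} f x)"
      by (intro Bochner_Integration.integrable_diff integrable_cexp fi)
    show "(\<lambda>n. LINT x|P. \<bar>?u n x - (f x - cexp {a..} f x)\<bar>) \<longlonglongrightarrow> 0"
      unfolding u using cexp_tendsto_L1'[OF fi, of "a - 1"] by simp
  qed (use B q0 in auto)
qed

lemma Lp_norm_cexp_remainder_sum:
  assumes f: "in_Lp P q f" and q: "q \<ge> 1" and S: "summable (\<lambda>j. coupling q f (a - 1 - int j))"
  shows "Lp_norm P q (\<lambda>x. f x - cexp {a..} f x) \<le> (\<Sum>j. coupling q f (a - 1 - int j))"
proof (rule Lp_norm_cexp_remainder[OF f q])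
  fix n
  have "Lp_norm P q (\<lambda>x. \<Sum>j<n. innov (a - 1 - int j) f x) \<le> (\<Sum>j<n. Lp_norm P q (innov (a - 1 - int j) f))"
    using f q by (intro Lp_norm_sum in_Lp_innov) auto
  also have "\<dots> \<le> (\<Sum>j<n. coupling q f (a - 1 - int j))"
    using f q by (intro sum_mono Lp_norm_innov_le)
  also have "\<dots> \<le> (\<Sum>j. coupling q f (a - 1 - int j))"
    using S by (intro sum_le_suminf) auto
  finally show "Lp_norm P q (\<lambda>x. \<Sum>j<n. innov (a - 1 - int j) f x) \<le> (\<Sum>j. coupling q f (a - 1 - int j))" .
qed

text \<open>
  Using the martingale structure instead of the triangle inequality replaces the tail of \<open>\<Theta>\<close> by that
  of \<open>\<Psi>\<close>.
\<close>

lemma Lp_norm_cexp_remainder_square_sum: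
  assumes f: "in_Lp P q f" and q: "q \<ge> 2" and S: "summable (\<lambda>j. (coupling q f (a - 1 - int j))\<^sup>2)"
  shows "Lp_norm P q (\<lambda>x. f x - cexp {a..} f x)
    \<le> sqrt (martingale_const q) * sqrt (\<Sum>j. (coupling q f (a - 1 - int j))\<^sup>2)"
proof (rule Lp_norm_cexp_remainder[OF f])
  fix n
  have q1: "q \<ge> 1" using q by simp
  let ?I = "(\<lambda>j. a - 1 - int j) ` {..<n}"
  have inj: "inj_on (\<lambda>j. a - 1 - int j) {..<n}" by (auto simp: inj_on_def)
  have "(Lp_norm P q (\<lambda>x. \<Sum>j<n. innov (a - 1 - int j) f x))\<^sup>2 = (Lp_norm P q (\<lambda>x. \<Sum>s\<in>?I. innov s f x))\<^sup>2"
    by (simp add: sum.reindex[OF inj])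
  also have "\<dots> \<le> martingale_const q * (\<Sum>s\<in>?I. (Lp_norm P q (innov s f))\<^sup>2)"
    by (rule Lp_norm_reversed_martingale[OF q _ in_Lp_innov[OF f q1] depends_on_innov
          AE_cexp_innov[OF PP.in_Lp_imp_integrable[OF f q1]]]) auto
  also have "\<dots> \<le> martingale_const q * (\<Sum>s\<in>?I. (coupling q f s)\<^sup>2)"
    using martingale_const_ge_1[OF q]
    by (intro mult_left_mono sum_mono power_mono Lp_norm_innov_le[OF f q1]) auto
  also have "(\<Sum>s\<in>?I. (coupling q f s)\<^sup>2) = (\<Sum>j<n. (coupling q f (a - 1 - int j))\<^sup>2)"
    by (simp add: sum.reindex[OF inj])
  also have "martingale_const q * \<dots> \<le> martingale_const q * (\<Sum>j. (coupling q f (a - 1 - int j))\<^sup>2)"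
    using martingale_const_ge_1[OF q] S by (intro mult_left_mono sum_le_suminf) auto
  also have "\<dots> = (sqrt (martingale_const q) * sqrt (\<Sum>j. (coupling q f (a - 1 - int j))\<^sup>2))\<^sup>2"
    using martingale_const_ge_1[OF q] S by (simp add: power_mult_distrib suminf_nonneg)
  finally show "Lp_norm P q (\<lambda>x. \<Sum>j<n. innov (a - 1 - int j) f x)
      \<le> sqrt (martingale_const q) * sqrt (\<Sum>j. (coupling q f (a - 1 - int j))\<^sup>2)"
    by (rule power2_le_imp_le) (use martingale_const_ge_1[OF q] S in \<open>auto intro!: mult_nonneg_nonneg suminf_nonneg\<close>)
qed (use q in simp)

text \<open>
  For a fixed lag \<open>j\<close> the differences \<open>innov (t - j)\<close> of the summands at the times \<open>t\<close> form reversed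
  martingale differences, so the sum over \<open>t\<close> costs only the square root of the number of terms.
\<close>

theorem Lp_norm_stationary_sum:
  fixes I :: "int set"
  assumes f: "in_Lp P q f" and q: "q \<ge> 2" and D: "depends_on f {..0}" and I: "finite I"
    and S: "summable (\<lambda>j. coupling q f (- int j))"
  shows "Lp_norm P q (\<lambda>x. \<Sum>t\<in>I. f (tshift t x) - (LINT x|P. f x))
    \<le> sqrt (martingale_const q) * sqrt (real (card I)) * (\<Sum>j. coupling q f (- int j))"
proof -
  have q1: "q \<ge> 1" "q > 0" using q by auto
  have fm[measurable]: "f \<in> borel_measurable P" using f by (auto simp: in_Lp_def)
  define F where "F t = (\<lambda>x. f (tshift t x))" for t
  have F: "in_Lp P q (F t)" for t unfolding F_def by (rule in_Lp_shift[OF f])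
  have Fi: "integrable P (F t)" for t by (rule PP.in_Lp_imp_integrable[OF F q1(1)])
  have FD: "depends_on (F t) {..t}" for t
    unfolding F_def using depends_on_shift_atMost[OF D] by simp
  have Fint: "(LINT x|P. F t x) = (LINT x|P. f x)" for t unfolding F_def by (rule integral_shift) measurable
  let ?u = "\<lambda>n x. \<Sum>t\<in>I. cexp {t - int n + 1..} (F t) x - (LINT x|P. f x)"
  have u: "?u n x = (\<Sum>j<n. \<Sum>t\<in>I. 1 * innov (t - int j) (F t) x)" for n x
  proof -
    have "cexp {t + 1..} (F t) x = (LINT x|P. f x)" for t
    proof -
      have "{..t} \<inter> {t + 1..} = {}" by auto
      thus ?thesis using cexp_indep[OF FD[of t], of "{t + 1..}" x] by (simp add: Fint)
    qed
    hence "?u n x = (\<Sum>t\<in>I. \<Sum>j<n. innov (t - int j) (F t) x)" by (simp add: sum_innov)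
    also have "\<dots> = (\<Sum>j<n. \<Sum>t\<in>I. innov (t - int j) (F t) x)" by (rule sum.swap)
    finally show ?thesis by simp
  qed
  have bound: "Lp_norm P q (?u n) \<le> sqrt (martingale_const q) * sqrt (real (card I)) * (\<Sum>j. coupling q f (- int j))" for n
  proof -
    have cF: "coupling q (F t) (t - j) = coupling q f (- j)" for t j
      unfolding F_def by (simp add: coupling_shift[OF fm])
    have "Lp_norm P q (?u n) \<le> (\<Sum>j<n. Lp_norm P q (\<lambda>x. \<Sum>t\<in>I. 1 * innov (t - int j) (F t) x))"
      unfolding u using q1 by (intro Lp_norm_sum in_Lp_sum in_Lp_cmult in_Lp_innov F) auto
    also have "\<dots> \<le> (\<Sum>j<n. sqrt (martingale_const q) * sqrt (\<Sum>t\<in>I. 1\<^sup>2) * coupling q f (- int j))"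
      by (intro sum_mono Lp_norm_weighted_innov_sum[OF q I] F) (auto simp: cF)
    also have "\<dots> = sqrt (martingale_const q) * sqrt (real (card I)) * (\<Sum>j<n. coupling q f (- int j))"
      by (simp add: sum_distrib_left)
    also have "\<dots> \<le> sqrt (martingale_const q) * sqrt (real (card I)) * (\<Sum>j. coupling q f (- int j))"
      using martingale_const_ge_1[OF q] S by (intro mult_left_mono sum_le_suminf) auto
    finally show ?thesis .
  qed
  show ?thesis
  proof (rule Lp_norm_L1_limit(2)[where u = ?u])
    show "in_Lp P q (?u n)" for n
      using q1 by (intro in_Lp_sum in_Lp_diff in_Lp_cexp F PP.in_Lp_const) auto
    show "integrable P (?u n)" for n
      by (intro Bochner_Integration.integrable_sum Bochner_Integration.integrable_diff integrable_cexp Fi) simp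
    show "integrable P (\<lambda>x. \<Sum>t\<in>I. f (tshift t x) - (LINT x|P. f x))"
      using Fi unfolding F_def by (intro Bochner_Integration.integrable_sum Bochner_Integration.integrable_diff) auto
    show "(\<lambda>n. LINT x|P. \<bar>?u n x - (\<Sum>t\<in>I. f (tshift t x) - (LINT x|P. f x))\<bar>) \<longlonglongrightarrow> 0"
    proof (rule tendsto_sandwich[OF _ _ tendsto_const])
      show "\<forall>\<^sub>F n in sequentially. (LINT x|P. \<bar>?u n x - (\<Sum>t\<in>I. f (tshift t x) - (LINT x|P. f x))\<bar>)
          \<le> (\<Sum>t\<in>I. LINT x|P. \<bar>cexp {t - int n + 1..} (F t) x - F t x\<bar>)"
      proof (rule always_eventually, rule allI)
        fix n
        have i: "integrable P (\<lambda>x. \<bar>cexp {t - int n + 1..} (F t) x - F t x\<bar>)" for t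
          using Fi integrable_cexp by auto
        have "(LINT x|P. \<bar>?u n x - (\<Sum>t\<in>I. f (tshift t x) - (LINT x|P. f x))\<bar>)
            \<le> (LINT x|P. (\<Sum>t\<in>I. \<bar>cexp {t - int n + 1..} (F t) x - F t x\<bar>))"
        proof (rule integral_mono)
          fix x
          have "?u n x - (\<Sum>t\<in>I. f (tshift t x) - (LINT x|P. f x)) = (\<Sum>t\<in>I. cexp {t - int n + 1..} (F t) x - F t x)"
            by (simp add: F_def flip: sum_subtractf)
          thus "\<bar>?u n x - (\<Sum>t\<in>I. f (tshift t x) - (LINT x|P. f x))\<bar> \<le> (\<Sum>t\<in>I. \<bar>cexp {t - int n + 1..} (F t) x - F t x\<bar>)"
            by (simp only: sum_abs)
        next
          have "integrable P (\<lambda>x. ?u n x - (\<Sum>t\<in>I. f (tshift t x) - (LINT x|P. f x)))"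
            using Fi integrable_cexp[OF Fi] unfolding F_def by (intro Bochner_Integration.integrable_sum Bochner_Integration.integrable_diff) auto
          thus "integrable P (\<lambda>x. \<bar>?u n x - (\<Sum>t\<in>I. f (tshift t x) - (LINT x|P. f x))\<bar>)" by (rule integrable_abs)
        qed (use i in auto)
        also have "\<dots> = (\<Sum>t\<in>I. LINT x|P. \<bar>cexp {t - int n + 1..} (F t) x - F t x\<bar>)"
          using i by (intro Bochner_Integration.integral_sum)
        finally show "(LINT x|P. \<bar>?u n x - (\<Sum>t\<in>I. f (tshift t x) - (LINT x|P. f x))\<bar>)
          \<le> (\<Sum>t\<in>I. LINT x|P. \<bar>cexp {t - int n + 1..} (F t) x - F t x\<bar>)" .
      qed
      have "(\<lambda>n. \<Sum>t\<in>I. LINT x|P. \<bar>cexp {t - int n + 1..} (F t) x - F t x\<bar>) \<longlonglongrightarrow> (\<Sum>t\<in>I. 0)"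
        by (intro tendsto_sum cexp_tendsto_L1' Fi)
      thus "(\<lambda>n. \<Sum>t\<in>I. LINT x|P. \<bar>cexp {t - int n + 1..} (F t) x - F t x\<bar>) \<longlonglongrightarrow> 0" by simp
    qed (auto simp: integral_nonneg_AE)
  qed (use bound q1 in auto)
qed

text \<open>
  Of all the innovations of \<open>g\<close>, only the one at \<open>s\<close> is correlated with the innovation of \<open>f\<close> at \<open>s\<close>.
\<close>

lemma integral_innov_mult:
  assumes f: "in_Lp P 2 f" and g: "in_Lp P 2 g"
  shows "(LINT x|P. innov s f x * g x) = (LINT x|P. innov s f x * innov s g x)"
proof -
  have i: "integrable P (\<lambda>x. u x * v x)" if "in_Lp P 2 u" "in_Lp P 2 v" for u v
    using in_Lp_mult[of P 1 u v] that by (intro PP.in_Lp_imp_integrable[of 1]) auto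
  have If: "in_Lp P 2 (innov s f)" by (rule in_Lp_innov[OF f]) simp
  have c: "in_Lp P 2 (cexp K g)" for K by (rule in_Lp_cexp[OF g]) simp
  have "(LINT x|P. innov s f x * g x) = (LINT x|P. cexp {s..} (\<lambda>x. innov s f x * g x) x)"
    by (rule integral_cexp[symmetric, OF i[OF If g]])
  also have "\<dots> = (LINT x|P. innov s f x * cexp {s..} g x)"
    by (simp add: cexp_mult_depends_on[OF depends_on_innov])
  also have "\<dots> = (LINT x|P. innov s f x * innov s g x + cexp {s + 1..} g x * innov s f x)"
    by (rule Bochner_Integration.integral_cong) (auto simp: innov_def[of s g] algebra_simps)
  also have "\<dots> = (LINT x|P. innov s f x * innov s g x) + (LINT x|P. cexp {s + 1..} g x * innov s f x)"
    by (intro Bochner_Integration.integral_add i If c in_Lp_innov g) simp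
  also have "(LINT x|P. cexp {s + 1..} g x * innov s f x) = 0"
    by (rule integral_mult_cexp_eq_0[OF depends_on_cexp i[OF c If] AE_cexp_innov])
       (use PP.in_Lp_imp_integrable[OF f] in simp)
  finally show ?thesis by simp
qed

text \<open>
  Two functions interact only through innovations that both of them use: differences of \<open>f\<close> and \<open>g\<close>
  at distinct innovations are orthogonal.
\<close>

lemma abs_integral_mult_le_coupling:
  assumes f: "in_Lp P 2 f" and g: "in_Lp P 2 g" and D: "depends_on f {..0}" and z: "(LINT x|P. f x) = 0"
    and S: "summable (\<lambda>j. coupling 2 f (- int j))"
    and S2: "summable (\<lambda>j. coupling 2 f (- int j) * coupling 2 g (- int j))"
  shows "\<bar>LINT x|P. f x * g x\<bar> \<le> (\<Sum>j. coupling 2 f (- int j) * coupling 2 g (- int j))"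
proof -
  have i: "integrable P (\<lambda>x. u x * v x)" if "in_Lp P 2 u" "in_Lp P 2 v" for u v
    using in_Lp_mult[of P 1 u v] that by (intro PP.in_Lp_imp_integrable[of 1]) auto
  let ?fn = "\<lambda>n. cexp {0 - int n + 1..} f"
  have fn: "?fn n x = (\<Sum>j<n. innov (0 - int j) f x)" for n x
  proof -
    have "{..0::int} \<inter> {1..} = {}" by auto
    thus ?thesis using sum_innov[of 0 f x n] cexp_indep[OF D, of "{1..}" x] z by simp
  qed
  have fnL: "in_Lp P 2 (?fn n)" for n by (rule in_Lp_cexp[OF f]) simp
  have le: "\<bar>LINT x|P. ?fn n x * g x\<bar> \<le> (\<Sum>j. coupling 2 f (- int j) * coupling 2 g (- int j))" for n
  proof -
    have "(LINT x|P. ?fn n x * g x) = (\<Sum>j<n. LINT x|P. innov (0 - int j) f x * g x)"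
      unfolding fn sum_distrib_right using f g by (intro Bochner_Integration.integral_sum i in_Lp_innov) auto
    also have "\<dots> = (\<Sum>j<n. LINT x|P. innov (0 - int j) f x * innov (0 - int j) g x)"
      by (simp only: integral_innov_mult[OF f g])
    also have "\<bar>\<dots>\<bar> \<le> (\<Sum>j<n. coupling 2 f (- int j) * coupling 2 g (- int j))"
    proof (rule order_trans[OF sum_abs], rule sum_mono)
      fix j
      have "\<bar>LINT x|P. innov (0 - int j) f x * innov (0 - int j) g x\<bar>
          \<le> Lp_norm P 2 (innov (0 - int j) f) * Lp_norm P 2 (innov (0 - int j) g)"
        using f g by (intro PP.abs_integral_mult_le in_Lp_innov) auto
      also have "\<dots> \<le> coupling 2 f (- int j) * coupling 2 g (- int j)"
        using f g Lp_norm_innov_le[of 2 f "0 - int j"] Lp_norm_innov_le[of 2 g "0 - int j"]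
        by (intro mult_mono) auto
      finally show "\<bar>LINT x|P. innov (0 - int j) f x * innov (0 - int j) g x\<bar> \<le> coupling 2 f (- int j) * coupling 2 g (- int j)" .
    qed
    also have "\<dots> \<le> (\<Sum>j. coupling 2 f (- int j) * coupling 2 g (- int j))"
      using S2 by (intro sum_le_suminf) auto
    finally show ?thesis .
  qed
  have err: "\<bar>(LINT x|P. ?fn n x * g x) - (LINT x|P. f x * g x)\<bar> \<le> (\<Sum>j. coupling 2 f (- int (j + n))) * Lp_norm P 2 g" for n
  proof -
    have "(LINT x|P. ?fn n x * g x) - (LINT x|P. f x * g x) = - (LINT x|P. (f x - ?fn n x) * g x)"
      using i[OF f g] i[OF fnL g] by (simp add: left_diff_distrib)
    also have "\<bar>\<dots>\<bar> \<le> Lp_norm P 2 (\<lambda>x. f x - ?fn n x) * Lp_norm P 2 g"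
      using PP.abs_integral_mult_le[OF in_Lp_diff[OF f fnL[of n]] g] by simp
    also have "\<dots> \<le> (\<Sum>j. coupling 2 f (- int (j + n))) * Lp_norm P 2 g"
    proof (intro mult_right_mono)
      have e: "0 - int n + 1 - 1 - int j = - int (j + n)" for j by simp
      show "Lp_norm P 2 (\<lambda>x. f x - ?fn n x) \<le> (\<Sum>j. coupling 2 f (- int (j + n)))"
        using Lp_norm_cexp_remainder_sum[OF f, of "0 - int n + 1"] summable_ignore_initial_segment[OF S, of n]
        unfolding e by simp
    qed simp
    finally show ?thesis .
  qed
  have "(\<lambda>n. (\<Sum>j. coupling 2 f (- int (j + n))) * Lp_norm P 2 g) \<longlonglongrightarrow> 0 * Lp_norm P 2 g"
    by (intro tendsto_mult suminf_exist_split2[OF S] tendsto_const)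
  hence "(\<lambda>n. (LINT x|P. ?fn n x * g x) - (LINT x|P. f x * g x)) \<longlonglongrightarrow> 0"
    by (intro Lim_null_comparison[OF _ \<open>_ \<longlonglongrightarrow> 0 * _\<close>[simplified]]) (use err in auto)
  hence "(\<lambda>n. LINT x|P. ?fn n x * g x) \<longlonglongrightarrow> (LINT x|P. f x * g x)" by (simp add: LIM_zero_iff)
  hence "(\<lambda>n. \<bar>LINT x|P. ?fn n x * g x\<bar>) \<longlonglongrightarrow> \<bar>LINT x|P. f x * g x\<bar>" by (intro tendsto_intros)
  thus ?thesis by (rule LIMSEQ_le_const2) (use le in auto)
qed

end

section \<open>An exponential inequality for block sums\<close>

lemma exp_le_quadratic:
  fixes z :: real assumes "z \<le> 1" shows "exp z \<le> 1 + z + z\<^sup>2"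
proof (cases "z \<ge> 0")
  case True thus ?thesis using exp_bound assms by simp
next
  case False
  have "exp z * (1 - z) \<le> exp z * exp (- z)" using exp_ge_add_one_self[of "- z"] by (intro mult_left_mono) auto
  hence "exp z * (1 - z) \<le> 1" by (simp add: exp_minus_inverse)
  also have "1 \<le> (1 + z + z\<^sup>2) * (1 - z)"
  proof -
    have "(1 + z + z\<^sup>2) * (1 - z) = 1 + z\<^sup>2 * (- z)" by (simp add: algebra_simps power2_eq_square)
    moreover have "z\<^sup>2 * (- z) \<ge> 0" using False by (intro mult_nonneg_nonneg) auto
    ultimately show ?thesis by linarith
  qed
  finally show ?thesis using False by (simp add: mult_le_cancel_right)
qed

lemma exp_min_le_quadratic:
  fixes u y \<theta> :: real
  assumes "\<theta> \<ge> 0" "y \<ge> 0" "\<theta> * y \<le> 1"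
  shows "exp (\<theta> * min u y) \<le> 1 + \<theta> * u + \<theta>\<^sup>2 * u\<^sup>2"
proof (cases "u \<le> y")
  case True
  hence "\<theta> * u \<le> 1" using assms by (meson mult_left_mono order_trans)
  thus ?thesis using True exp_le_quadratic[of "\<theta> * u"] by (simp add: min_def power_mult_distrib)
next
  case False
  have "exp (\<theta> * y) \<le> 1 + \<theta> * y + \<theta>\<^sup>2 * y\<^sup>2" using exp_le_quadratic[of "\<theta> * y"] assms by (simp add: power_mult_distrib)
  also have "\<dots> \<le> 1 + \<theta> * u + \<theta>\<^sup>2 * u\<^sup>2" using False assms by (intro add_mono mult_left_mono power_mono) auto
  finally show ?thesis using False by (simp add: min_def)
qed

context innovations begin

text \<open>
  Truncating the blocks from above only, through \<open>min\<close>, leaves no bias to correct: the quadratic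
  bound for the truncated exponential contains the untruncated first and second moments.
\<close>

lemma exponential_supermartingale:
  fixes B v :: "nat \<Rightarrow> (int \<Rightarrow> real) \<Rightarrow> real" and J :: "nat \<Rightarrow> int set"
  assumes lam: "\<theta> \<ge> 0" "y \<ge> 0" "\<theta> * y \<le> 1"
    and B: "\<And>b. b < L \<Longrightarrow> in_Lp P 2 (B b)"
    and v: "\<And>b. b < L \<Longrightarrow> v b \<in> borel_measurable P" "\<And>b x. b < L \<Longrightarrow> v b x \<ge> 0"
    and dB: "\<And>b b'. b' < b \<Longrightarrow> b < L \<Longrightarrow> depends_on (B b') (J b)"
    and dv: "\<And>b b'. b' \<le> b \<Longrightarrow> b < L \<Longrightarrow> depends_on (v b') (J b)"
    and m1: "\<And>b. b < L \<Longrightarrow> AE x in P. cexp (J b) (B b) x = 0"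
    and m2: "\<And>b. b < L \<Longrightarrow> AE x in P. cexp (J b) (\<lambda>x. (B b x)\<^sup>2) x \<le> v b x"
  shows "integrable P (\<lambda>x. exp (\<theta> * (\<Sum>b<L. min (B b x) y) - \<theta>\<^sup>2 * (\<Sum>b<L. v b x)))"
    and "(LINT x|P. exp (\<theta> * (\<Sum>b<L. min (B b x) y) - \<theta>\<^sup>2 * (\<Sum>b<L. v b x))) \<le> 1"
proof -
  let ?Z = "\<lambda>L x. exp (\<theta> * (\<Sum>b<L. min (B b x) y) - \<theta>\<^sup>2 * (\<Sum>b<L. v b x))"
  have Bm: "\<And>b. b < L \<Longrightarrow> B b \<in> borel_measurable P" using B by (auto simp: in_Lp_def)
  have "integrable P (?Z n) \<and> (LINT x|P. ?Z n x) \<le> 1" if "n \<le> L" for n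
    using that
  proof (induction n)
    case (Suc n)
    hence n: "n < L" by simp
    have IH: "integrable P (?Z n)" "(LINT x|P. ?Z n x) \<le> 1" using Suc by auto
    let ?h = "\<lambda>x. ?Z n x * exp (- (\<theta>\<^sup>2 * v n x))" and ?G = "\<lambda>x. exp (\<theta> * min (B n x) y)"
    have Z: "?Z (Suc n) x = ?h x * ?G x" for x
      by (simp add: exp_add[symmetric] algebra_simps)
    have hm: "?h \<in> borel_measurable P" "?G \<in> borel_measurable P"
      using v Bm n by (auto intro!: borel_measurable_times borel_measurable_exp borel_measurable_sum borel_measurable_diff borel_measurable_min)
    have dh: "depends_on ?h (J n)"
    proof -
      have "depends_on (\<lambda>x. \<Sum>b<n. min (B b x) y) (J n)" "depends_on (\<lambda>x. \<Sum>b<n. v b x) (J n)" "depends_on (v n) (J n)"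
        using dB dv n by (auto intro!: depends_on_sum depends_on_comp[of _ _ "\<lambda>u. min u y"])
      hence "depends_on (\<lambda>x. ((\<Sum>b<n. min (B b x) y, \<Sum>b<n. v b x), v n x)) (J n)"
        by (intro depends_on_comp2[where h = Pair])
      from depends_on_comp[OF this, of "\<lambda>((a, b), c). exp (\<theta> * a - \<theta>\<^sup>2 * b) * exp (- (\<theta>\<^sup>2 * c))"]
      show ?thesis by simp
    qed
    have Gle: "?G x \<le> exp 1" for x
    proof -
      have "\<theta> * min (B n x) y \<le> \<theta> * y" using lam by (intro mult_left_mono) auto
      thus ?thesis using lam by simp
    qed
    have hi: "integrable P ?h"
    proof (rule Bochner_Integration.integrable_bound[OF IH(1) hm(1)], rule AE_I2)
      fix x
      have "exp (- (\<theta>\<^sup>2 * v n x)) \<le> 1" using v(2)[OF n, of x] by simp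
      hence "?h x \<le> ?Z n x * 1" by (intro mult_left_mono) auto
      thus "norm (?h x) \<le> norm (?Z n x)" by simp
    qed
    have hGi: "integrable P (\<lambda>x. ?h x * ?G x)"
    proof (rule Bochner_Integration.integrable_bound)
      show "integrable P (\<lambda>x. ?h x * exp 1)" using hi by simp
      show "AE x in P. norm (?h x * ?G x) \<le> norm (?h x * exp 1)"
      proof (rule AE_I2)
        fix x
        have "?h x * ?G x \<le> ?h x * exp 1" by (rule mult_left_mono[OF Gle]) simp
        thus "norm (?h x * ?G x) \<le> norm (?h x * exp 1)" by simp
      qed
    qed (rule borel_measurable_times[OF hm])
    have B2: "integrable P (\<lambda>x. (B n x)\<^sup>2)" "integrable P (B n)"
      using B[OF n] PP.in_Lp_imp_integrable[OF B[OF n]] by (auto simp: in_Lp_2)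
    have Gi: "integrable P ?G"
    proof (rule PP.integrable_const_bound)
      show "AE x in P. norm (?G x) \<le> exp 1" by (rule AE_I2) (simp only: real_norm_def abs_exp_cancel Gle)
    qed (rule hm(2))
    have cG: "AE x in P. cexp (J n) ?G x \<le> exp (\<theta>\<^sup>2 * v n x)"
      using AE_integrable_patch[OF B2(1), of "J n"] AE_integrable_patch[OF B2(2), of "J n"]
        AE_integrable_patch[OF Gi, of "J n"] m1[OF n] m2[OF n]
    proof eventually_elim
      case (elim x)
      have "cexp (J n) ?G x \<le> (LINT z|P. 1 + \<theta> * B n (patch (J n) x z) + \<theta>\<^sup>2 * (B n (patch (J n) x z))\<^sup>2)"
        unfolding cexp_def using elim by (intro integral_mono exp_min_le_quadratic lam) auto
      also have "\<dots> = 1 + \<theta> * cexp (J n) (B n) x + \<theta>\<^sup>2 * cexp (J n) (\<lambda>x. (B n x)\<^sup>2) x"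
        unfolding cexp_def using elim by simp
      also have "\<dots> \<le> 1 + \<theta>\<^sup>2 * v n x" using elim by (simp add: mult_left_mono)
      also have "\<dots> \<le> exp (\<theta>\<^sup>2 * v n x)" by (rule exp_ge_add_one_self)
      finally show ?case .
    qed
    have "(LINT x|P. ?Z (Suc n) x) = (LINT x|P. cexp (J n) (\<lambda>x. ?h x * ?G x) x)"
      unfolding Z by (rule integral_cexp[OF hGi, symmetric])
    also have "\<dots> \<le> (LINT x|P. ?Z n x)"
    proof (rule integral_mono_AE[OF integrable_cexp[OF hGi] IH(1)])
      show "AE x in P. cexp (J n) (\<lambda>x. ?h x * ?G x) x \<le> ?Z n x"
        using cG
      proof eventually_elim
        case (elim x)
        have "cexp (J n) (\<lambda>x. ?h x * ?G x) x = ?h x * cexp (J n) ?G x" by (rule cexp_mult_depends_on[OF dh])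
        also have "\<dots> \<le> ?h x * exp (\<theta>\<^sup>2 * v n x)" using elim by (intro mult_left_mono) auto
        also have "\<dots> = ?Z n x" by (simp add: exp_minus)
        finally show ?case .
      qed
    qed
    finally show ?case using hGi IH(2) unfolding Z by auto
  qed simp
  thus "integrable P (?Z L)" "(LINT x|P. ?Z L x) \<le> 1" by auto
qed

text \<open>
  Exceptional events are combined by union bounds only, so an outer bound on their probability is all
  that matters; it spares a measurability argument for each of them.
\<close>

definition prob_le :: "((int \<Rightarrow> real) \<Rightarrow> bool) \<Rightarrow> real \<Rightarrow> bool" where
  "prob_le Q e \<longleftrightarrow> (\<exists>S\<in>sets P. {x. Q x} \<subseteq> S \<and> measure P S \<le> e)"

lemma prob_leI: "{x. R x} \<in> sets P \<Longrightarrow> measure P {x. R x} \<le> e \<Longrightarrow> (\<And>x. Q x \<Longrightarrow> R x) \<Longrightarrow> prob_le Q e"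
  unfolding prob_le_def by blast

lemma prob_le_mono: "prob_le R e \<Longrightarrow> (\<And>x. Q x \<Longrightarrow> R x) \<Longrightarrow> e \<le> e' \<Longrightarrow> prob_le Q e'"
  unfolding prob_le_def
proof (elim bexE conjE, intro bexI conjI)
  fix S assume "{x. R x} \<subseteq> S" "\<And>x. Q x \<Longrightarrow> R x" thus "{x. Q x} \<subseteq> S" by auto
qed auto

lemma prob_le_disj: "prob_le Q e \<Longrightarrow> prob_le R e' \<Longrightarrow> prob_le (\<lambda>x. Q x \<or> R x) (e + e')"
proof -
  assume "prob_le Q e" "prob_le R e'"
  then obtain S S' where S: "S \<in> sets P" "{x. Q x} \<subseteq> S" "measure P S \<le> e"
    and S': "S' \<in> sets P" "{x. R x} \<subseteq> S'" "measure P S' \<le> e'"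
    by (auto simp: prob_le_def)
  have "measure P (S \<union> S') \<le> e + e'" using measure_Un_le[OF S(1) S'(1)] S S' by linarith
  thus ?thesis unfolding prob_le_def using S S' by (intro bexI[of _ "S \<union> S'"]) auto
qed

lemma prob_le_ex:
  "finite I \<Longrightarrow> (\<And>i. i \<in> I \<Longrightarrow> prob_le (Q i) (e i)) \<Longrightarrow> prob_le (\<lambda>x. \<exists>i\<in>I. Q i x) (\<Sum>i\<in>I. e i)"
proof (induction I rule: finite_induct)
  case empty show ?case unfolding prob_le_def by (intro bexI[of _ "{}"]) auto
next
  case (insert i I)
  have "prob_le (\<lambda>x. Q i x \<or> (\<exists>i\<in>I. Q i x)) (e i + (\<Sum>i\<in>I. e i))"
    using insert by (intro prob_le_disj) auto
  thus ?case using insert.hyps by (elim prob_le_mono) auto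
qed

lemma prob_le_Markov:
  assumes f: "in_Lp P q f" and q: "q > 0" "c > 0"
  shows "prob_le (\<lambda>x. \<bar>f x\<bar> \<ge> c) ((Lp_norm P q f / c) powr q)"
proof -
  have "f \<in> borel_measurable P" using f by (auto simp: in_Lp_def)
  hence "{x \<in> space P. \<bar>f x\<bar> \<ge> c} \<in> sets P" by measurable
  thus ?thesis using PP.Lp_Markov[OF f q] by (intro prob_leI[where R = "\<lambda>x. \<bar>f x\<bar> \<ge> c"]) auto
qed

text \<open>
  Exponential Markov inequality for the supermartingale. On the event in question the truncation is void
  and the compensator is at most \<open>V\<close>.
\<close>

lemma block_sum_tail:
  fixes B v :: "nat \<Rightarrow> (int \<Rightarrow> real) \<Rightarrow> real" and J :: "nat \<Rightarrow> int set"
  assumes lam: "\<theta> \<ge> 0" "y \<ge> 0" "\<theta> * y \<le> 1"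
    and B: "\<And>b. b < L \<Longrightarrow> in_Lp P 2 (B b)"
    and v: "\<And>b. b < L \<Longrightarrow> v b \<in> borel_measurable P" "\<And>b x. b < L \<Longrightarrow> v b x \<ge> 0"
    and dB: "\<And>b b'. b' < b \<Longrightarrow> b < L \<Longrightarrow> depends_on (B b') (J b)"
    and dv: "\<And>b b'. b' \<le> b \<Longrightarrow> b < L \<Longrightarrow> depends_on (v b') (J b)"
    and m1: "\<And>b. b < L \<Longrightarrow> AE x in P. cexp (J b) (B b) x = 0"
    and m2: "\<And>b. b < L \<Longrightarrow> AE x in P. cexp (J b) (\<lambda>x. (B b x)\<^sup>2) x \<le> v b x"
  shows "prob_le (\<lambda>x. (\<Sum>b<L. B b x) \<ge> c \<and> (\<forall>b<L. B b x \<le> y) \<and> (\<Sum>b<L. v b x) \<le> V)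
    (exp (\<theta>\<^sup>2 * V - \<theta> * c))"
proof -
  let ?Z = "\<lambda>x. exp (\<theta> * (\<Sum>b<L. min (B b x) y) - \<theta>\<^sup>2 * (\<Sum>b<L. v b x))"
  have Zi: "integrable P ?Z" by (rule exponential_supermartingale(1)[OF lam B v dB dv m1 m2])
  have Z1: "(LINT x|P. ?Z x) \<le> 1" by (rule exponential_supermartingale(2)[OF lam B v dB dv m1 m2])
  have Zm: "{x \<in> space P. ?Z x \<ge> exp (\<theta> * c - \<theta>\<^sup>2 * V)} \<in> sets P"
    using borel_measurable_integrable[OF Zi] by measurable
  show ?thesis
  proof (rule prob_leI[where R = "\<lambda>x. ?Z x \<ge> exp (\<theta> * c - \<theta>\<^sup>2 * V)"])
    show "{x. ?Z x \<ge> exp (\<theta> * c - \<theta>\<^sup>2 * V)} \<in> sets P" using Zm by simp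
    have "measure P {x \<in> space P. ?Z x \<ge> exp (\<theta> * c - \<theta>\<^sup>2 * V)} \<le> (LINT x|P. ?Z x) / exp (\<theta> * c - \<theta>\<^sup>2 * V)"
      by (rule integral_Markov_inequality_measure[OF Zi, where A = "space P"]) (intro AE_I2 sets.top exp_ge_zero exp_gt_zero)+
    also have "\<dots> \<le> 1 / exp (\<theta> * c - \<theta>\<^sup>2 * V)" using Z1 by (intro divide_right_mono) auto
    also have "\<dots> = exp (\<theta>\<^sup>2 * V - \<theta> * c)" by (simp add: exp_minus[symmetric] divide_inverse)
    finally show "measure P {x. ?Z x \<ge> exp (\<theta> * c - \<theta>\<^sup>2 * V)} \<le> exp (\<theta>\<^sup>2 * V - \<theta> * c)" by simp
    fix x assume x: "(\<Sum>b<L. B b x) \<ge> c \<and> (\<forall>b<L. B b x \<le> y) \<and> (\<Sum>b<L. v b x) \<le> V"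
    have "(\<Sum>b<L. min (B b x) y) = (\<Sum>b<L. B b x)" using x by (intro sum.cong) auto
    hence "\<theta> * c \<le> \<theta> * (\<Sum>b<L. min (B b x) y)" using x lam by (intro mult_left_mono) auto
    moreover have "\<theta>\<^sup>2 * (\<Sum>b<L. v b x) \<le> \<theta>\<^sup>2 * V" using x by (intro mult_left_mono) auto
    ultimately show "exp (\<theta> * c - \<theta>\<^sup>2 * V) \<le> ?Z x" by simp
  qed
qed

end

section \<open>Sums over alternating blocks\<close>

text \<open>
  The last block is cut off at \<open>T\<close>, and later ones are empty, so that sums over any sufficiently large
  number of blocks exhaust the sample.
\<close>

definition time_block :: "int \<Rightarrow> int \<Rightarrow> int \<Rightarrow> nat \<Rightarrow> int set" where
  "time_block k T l b = {t \<in> {k + 1..T}. (t - k - 1) div l = int b}"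

lemma finite_time_block [simp]: "finite (time_block k T l b)"
  by (rule finite_subset[of _ "{k + 1..T}"]) (auto simp: time_block_def)

lemma time_blockD:
  assumes "t \<in> time_block k T l b" "l \<ge> 1"
  shows "k + int b * l + 1 \<le> t" "t \<le> k + (int b + 1) * l" "k + 1 \<le> t" "t \<le> T"
proof -
  have t: "(t - k - 1) div l = int b" "k + 1 \<le> t" "t \<le> T" using assms by (auto simp: time_block_def)
  have "l * int b \<le> t - k - 1" "t - k - 1 < l * int b + l"
    using mult_div_mod_eq[of l "t - k - 1"] pos_mod_sign[of l "t - k - 1"] pos_mod_bound[of l "t - k - 1"] assms(2)
    unfolding t(1) by linarith+
  thus "k + int b * l + 1 \<le> t" "t \<le> k + (int b + 1) * l" "k + 1 \<le> t" "t \<le> T"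
    using t by (auto simp: algebra_simps)
qed

lemma card_time_block_le:
  assumes "l \<ge> 1" shows "int (card (time_block k T l b)) \<le> l"
proof -
  have "time_block k T l b \<subseteq> {k + int b * l + 1..k + (int b + 1) * l}"
    using time_blockD[OF _ assms] by auto
  hence "card (time_block k T l b) \<le> card {k + int b * l + 1..k + (int b + 1) * l}"
    by (intro card_mono) auto
  thus ?thesis using assms by (simp add: algebra_simps)
qed

lemma sum_time_blocks:
  fixes f :: "int \<Rightarrow> real"
  assumes l: "l \<ge> 1" and L: "T - k \<le> int n"
  shows "(\<Sum>b<n. \<Sum>t\<in>time_block k T l b. f t) = (\<Sum>t\<in>{k + 1..T}. f t)"
proof -
  define g where "g t = nat ((t - k - 1) div l)" for t
  have "g t < n" if "t \<in> {k + 1..T}" for t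
  proof -
    have "(t - k - 1) div l \<le> t - k - 1" using zdiv_mono2[of "t - k - 1" 1 l] that l by simp
    thus ?thesis using that L l by (auto simp: g_def)
  qed
  hence "g ` {k + 1..T} \<subseteq> {..<n}" by auto
  from sum.group[OF _ _ this, of f]
  have "(\<Sum>b<n. \<Sum>t | t \<in> {k + 1..T} \<and> g t = b. f t) = (\<Sum>t\<in>{k + 1..T}. f t)" by simp
  moreover have "{t \<in> {k + 1..T}. g t = b} = time_block k T l b" for b
    using l by (auto simp: g_def time_block_def pos_imp_zdiv_nonneg_iff)
  ultimately show ?thesis by simp
qed

lemma sum_even_odd: "(\<Sum>b<2 * (n::nat). f b) = (\<Sum>m<n. f (2 * m + 0)) + (\<Sum>m<n. f (2 * m + 1) :: real)"
  by (induction n) (auto simp: algebra_simps)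

context innovations begin

text \<open>
  Blocks of the same parity are separated by a gap, so that such a block is centred given everything
  up to the beginning of the gap, which includes the preceding blocks of its parity.
\<close>

lemma alternating_block_tail:
  fixes Z :: "int \<Rightarrow> (int \<Rightarrow> real) \<Rightarrow> real" and k T l :: int and v :: "nat \<Rightarrow> (int \<Rightarrow> real) \<Rightarrow> real"
  defines "B \<equiv> \<lambda>b x. \<Sum>t\<in>time_block k T l b. Z t x"
  assumes l: "l \<ge> 1" and L: "T - k \<le> 2 * int L"
    and lam: "\<theta> \<ge> 0" "y \<ge> 0" "\<theta> * y \<le> 1"
    and Z: "\<And>t. t \<in> {k + 1..T} \<Longrightarrow> in_Lp P 2 (Z t)" "\<And>t. t \<in> {k + 1..T} \<Longrightarrow> depends_on (Z t) {..t}"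
    and v: "\<And>b. v b \<in> borel_measurable P" "\<And>b x. v b x \<ge> 0"
    and dv: "\<And>b. depends_on (v b) {..k + (int b - 1) * l}"
    and m1: "\<And>b. AE x in P. cexp {..k + (int b - 1) * l} (B b) x = 0"
    and m2: "\<And>b. AE x in P. cexp {..k + (int b - 1) * l} (\<lambda>x. (B b x)\<^sup>2) x \<le> v b x"
  shows "prob_le (\<lambda>x. \<bar>\<Sum>t\<in>{k + 1..T}. Z t x\<bar> \<ge> 2 * c \<and> (\<forall>b<2 * L. \<bar>B b x\<bar> \<le> y) \<and> (\<Sum>b<2 * L. v b x) \<le> V)
    (4 * exp (\<theta>\<^sup>2 * V - \<theta> * c))"
proof -
  let ?Q = "\<lambda>e s x. (\<Sum>m<L. s * B (2 * m + e) x) \<ge> c \<and> (\<forall>m<L. s * B (2 * m + e) x \<le> y) \<and> (\<Sum>m<L. v (2 * m + e) x) \<le> V"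
  have one: "prob_le (?Q e s) (exp (\<theta>\<^sup>2 * V - \<theta> * c))" if s: "s \<in> {1, - 1 :: real}" for e :: nat and s :: real
  proof (rule block_sum_tail[OF lam, where J = "\<lambda>m. {..k + (int (2 * m + e) - 1) * l}"])
    fix b assume "b < L"
    have "in_Lp P 2 (Z t)" if "t \<in> time_block k T l b'" for t b'
      using Z(1) that by (auto simp: time_block_def)
    hence "in_Lp P 2 (B b')" for b' unfolding B_def by (intro in_Lp_sum) auto
    thus "in_Lp P 2 (\<lambda>x. s * B (2 * b + e) x)" by (rule in_Lp_cmult)
    show "AE x in P. cexp {..k + (int (2 * b + e) - 1) * l} (\<lambda>x. s * B (2 * b + e) x) x = 0"
      using m1[of "2 * b + e"] by (simp add: cexp_cmult)
    have "(\<lambda>x. (s * B (2 * b + e) x)\<^sup>2) = (\<lambda>x. (B (2 * b + e) x)\<^sup>2)" using s by (auto simp: power_mult_distrib)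
    thus "AE x in P. cexp {..k + (int (2 * b + e) - 1) * l} (\<lambda>x. (s * B (2 * b + e) x)\<^sup>2) x \<le> v (2 * b + e) x"
      using m2[of "2 * b + e"] by simp
  next
    fix b b' :: nat assume b: "b' < b"
    have "depends_on (B (2 * b' + e)) {..k + (int (2 * b + e) - 1) * l}"
      unfolding B_def
    proof (rule depends_on_sum)
      fix t assume t: "t \<in> time_block k T l (2 * b' + e)"
      have "(int (2 * b' + e) + 1) * l \<le> (int (2 * b + e) - 1) * l"
        using b l by (intro mult_right_mono) auto
      hence "t \<le> k + (int (2 * b + e) - 1) * l" using time_blockD(2)[OF t l] by linarith
      moreover have "depends_on (Z t) {..t}" using t by (intro Z(2)) (auto simp: time_block_def)
      ultimately show "depends_on (Z t) {..k + (int (2 * b + e) - 1) * l}" by (auto elim: depends_on_mono)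
    qed
    thus "depends_on (\<lambda>x. s * B (2 * b' + e) x) {..k + (int (2 * b + e) - 1) * l}" by (rule depends_on_comp)
  next
    fix b b' :: nat assume b: "b' \<le> b"
    have "(int (2 * b' + e) - 1) * l \<le> (int (2 * b + e) - 1) * l"
      using b l by (intro mult_right_mono) auto
    thus "depends_on (v (2 * b' + e)) {..k + (int (2 * b + e) - 1) * l}"
      by (intro depends_on_mono[OF dv[of "2 * b' + e"]]) auto
  qed (use v in auto)
  have "prob_le (\<lambda>x. (?Q 0 1 x \<or> ?Q 0 (-1) x) \<or> (?Q 1 1 x \<or> ?Q 1 (-1) x))
     ((exp (\<theta>\<^sup>2 * V - \<theta> * c) + exp (\<theta>\<^sup>2 * V - \<theta> * c)) + (exp (\<theta>\<^sup>2 * V - \<theta> * c) + exp (\<theta>\<^sup>2 * V - \<theta> * c)))"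
    by (intro prob_le_disj one) auto
  thus ?thesis
  proof (rule prob_le_mono)
    fix x assume x: "\<bar>\<Sum>t\<in>{k + 1..T}. Z t x\<bar> \<ge> 2 * c \<and> (\<forall>b<2 * L. \<bar>B b x\<bar> \<le> y) \<and> (\<Sum>b<2 * L. v b x) \<le> V"
    have "(\<Sum>t\<in>{k + 1..T}. Z t x) = (\<Sum>b<2 * L. B b x)"
      unfolding B_def using sum_time_blocks[OF l, of T k "2 * L" "\<lambda>t. Z t x"] L by simp
    also have "\<dots> = (\<Sum>m<L. B (2 * m + 0) x) + (\<Sum>m<L. B (2 * m + 1) x)" by (rule sum_even_odd)
    finally have S: "(\<Sum>t\<in>{k + 1..T}. Z t x) = (\<Sum>m<L. B (2 * m + 0) x) + (\<Sum>m<L. B (2 * m + 1) x)" .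
    have v': "(\<Sum>m<L. v (2 * m + 0) x) \<le> V" "(\<Sum>m<L. v (2 * m + 1) x) \<le> V"
      using x sum_even_odd[of "\<lambda>b. v b x" L] sum_nonneg[of "{..<L}" "\<lambda>m. v (2 * m + 0) x"]
        sum_nonneg[of "{..<L}" "\<lambda>m. v (2 * m + 1) x"] v(2) by auto
    have y: "B (2 * m + 0) x \<le> y" "B (2 * m + 1) x \<le> y" "- B (2 * m + 0) x \<le> y" "- B (2 * m + 1) x \<le> y" if "m < L" for m
    proof -
      have "2 * m + 0 < 2 * L" "2 * m + 1 < 2 * L" using that by auto
      hence "\<bar>B (2 * m + 0) x\<bar> \<le> y" "\<bar>B (2 * m + 1) x\<bar> \<le> y" using x by blast+
      thus "B (2 * m + 0) x \<le> y" "B (2 * m + 1) x \<le> y" "- B (2 * m + 0) x \<le> y" "- B (2 * m + 1) x \<le> y" by linarith+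
    qed
    have "(\<Sum>m<L. B (2 * m + 0) x) \<ge> c \<or> - (\<Sum>m<L. B (2 * m + 0) x) \<ge> c
        \<or> (\<Sum>m<L. B (2 * m + 1) x) \<ge> c \<or> - (\<Sum>m<L. B (2 * m + 1) x) \<ge> c"
      using x S by linarith
    thus "(?Q 0 1 x \<or> ?Q 0 (-1) x) \<or> (?Q 1 1 x \<or> ?Q 1 (-1) x)"
      using y v' by (auto simp: sum_negf)
  qed simp
qed

text \<open>
  Conditioning on \<open>J\<close> freezes the coefficients; the remaining integral is a moment of a weighted sum.
\<close>

lemma cexp_frozen:
  assumes "\<And>t. t \<in> A \<Longrightarrow> depends_on (a t) J" "\<And>t. t \<in> A \<Longrightarrow> depends_on (Y t) K" "K \<inter> J = {}"
  shows "cexp J (\<lambda>x. \<phi> (\<Sum>t\<in>A. a t x * Y t x)) x = (LINT z|P. \<phi> (\<Sum>t\<in>A. a t x * Y t z))"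
proof -
  have "(\<Sum>t\<in>A. a t (patch J x z) * Y t (patch J x z)) = (\<Sum>t\<in>A. a t x * Y t z)" for z
    using assms by (intro sum.cong) (auto simp: depends_on_patch depends_on_patch_compl[OF assms(2,3)])
  thus ?thesis by (simp add: cexp_def)
qed

text \<open>
  For dependent factors only \<open>q / 2\<close> moments of the product would be left.
\<close>

lemma in_Lp_mult_indep:
  assumes a: "in_Lp P q a" and Y: "in_Lp P q Y" and d: "depends_on a J" "depends_on Y K" "K \<inter> J = {}"
  shows "in_Lp P q (\<lambda>x. a x * Y x)"
proof -
  have [measurable]: "a \<in> borel_measurable P" "Y \<in> borel_measurable P" using a Y by (auto simp: in_Lp_def)
  let ?F = "\<lambda>x. \<bar>a x * Y x\<bar> powr q"
  have Fm: "?F \<in> borel_measurable P" by measurable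
  have e: "(\<lambda>z. ?F (case z of (x, y) \<Rightarrow> patch J x y)) = (\<lambda>(x, y). \<bar>a x\<bar> powr q * \<bar>Y y\<bar> powr q)"
    using d by (auto simp: fun_eq_iff depends_on_patch depends_on_patch_compl[OF d(2,3)] abs_mult powr_mult)
  have "integrable (P \<Otimes>\<^sub>M P) (\<lambda>(x, y). \<bar>a x\<bar> powr q * \<bar>Y y\<bar> powr q)"
    by (rule P2.Fubini_integrable) (use a Y in \<open>auto simp: in_Lp_def\<close>)
  hence "integrable (distr (P \<Otimes>\<^sub>M P) P (\<lambda>(x, y). patch J x y)) ?F"
    by (subst integrable_distr_eq[OF measurable_patch(1) Fm]) (simp only: e)
  thus ?thesis unfolding distr_patch by (simp add: in_Lp_def)
qed

lemma coupling_less: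
  assumes "in_Lp P q f" "0 < r" "r \<le> q" shows "coupling r f s \<le> coupling q f s"
  unfolding coupling_def using assms by (intro P2.Lp_norm_less in_Lp_coupling) auto

lemma integral_innov: "integrable P f \<Longrightarrow> (LINT x|P. innov s f x) = 0"
  unfolding innov_def by (simp add: integrable_cexp integral_cexp)

end

section \<open>Causal processes and their finite-memory approximations\<close>

locale causal_process = innovations +
  fixes G :: "(int \<Rightarrow> real) \<Rightarrow> real" and p :: real
  assumes causal: "depends_on G {..0}" and Lp: "in_Lp P p G" and p4: "p > 4"
    and centred: "(LINT x|P. G x) = 0"
    and summable_coupling: "summable (\<lambda>j. coupling p G (- int j))"
begin

definition X :: "int \<Rightarrow> (int \<Rightarrow> real) \<Rightarrow> real" where
  "X t x = G (tshift t x)"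

definition dep :: "real \<Rightarrow> nat \<Rightarrow> real" where
  "dep q j = coupling q G (- int j)"

lemma dep_nonneg [simp]: "0 \<le> dep q j"
  by (simp add: dep_def)

lemma in_Lp_G: "0 < q \<Longrightarrow> q \<le> p \<Longrightarrow> in_Lp P q G"
  by (rule PP.in_Lp_less[OF Lp])

lemma measurable_G [measurable]: "G \<in> borel_measurable P"
  using Lp by (simp add: in_Lp_def)

lemma dep_mono: "0 < r \<Longrightarrow> r \<le> q \<Longrightarrow> q \<le> p \<Longrightarrow> dep r j \<le> dep q j"
  unfolding dep_def by (intro coupling_less in_Lp_G) auto

lemma summable_dep: "0 < q \<Longrightarrow> q \<le> p \<Longrightarrow> summable (dep q)"
  by (rule summable_comparison_test'[of "dep p" 0]) (use summable_coupling dep_mono[of q p] in \<open>auto simp: dep_def[abs_def]\<close>)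

lemma in_Lp_X: "0 < q \<Longrightarrow> q \<le> p \<Longrightarrow> in_Lp P q (X t)"
  unfolding X_def[abs_def] by (intro in_Lp_shift in_Lp_G)

lemma integrable_X: "integrable P (X t)"
  using in_Lp_X[of 1 t] p4 PP.in_Lp_imp_integrable by auto

lemma Lp_norm_X: "Lp_norm P q (X t) = Lp_norm P q G"
  unfolding X_def[abs_def] by (rule Lp_norm_shift) measurable

lemma depends_on_X: "depends_on (X t) {..t}"
  unfolding X_def[abs_def] using depends_on_shift_atMost[OF causal, of t] by simp

lemma coupling_X: "coupling q (X t) (t - int j) = dep q j"
  unfolding X_def[abs_def] dep_def by (simp add: coupling_shift)

lemma integral_X: "(LINT x|P. X t x) = 0"
  unfolding X_def using integral_shift[of G t] centred by simp

text \<open>The memory of \<open>approx i t\<close> consists of the \<open>2 ^ i\<close> most recent innovations.\<close>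

definition approx :: "nat \<Rightarrow> int \<Rightarrow> (int \<Rightarrow> real) \<Rightarrow> real" where
  "approx i t = cexp {t - 2 ^ i + 1..} (X t)"

text \<open>
  The innovations with age in \<open>scale i\<close>, taken together, are those by which the approximation with memory
  \<open>2 ^ i\<close> improves on the one with half that memory; the scale 0 consists of the age 0 alone, because
  \<open>1 div 2 = 0\<close>.
\<close>

definition scale :: "nat \<Rightarrow> nat set" where
  "scale i = {2 ^ i div 2..<2 ^ i}"

definition layer :: "nat \<Rightarrow> int \<Rightarrow> (int \<Rightarrow> real) \<Rightarrow> real" where
  "layer i t x = (\<Sum>j\<in>scale i. innov (t - int j) (X t) x)"

definition scale_dep :: "real \<Rightarrow> nat \<Rightarrow> real" where
  "scale_dep q i = (\<Sum>j\<in>scale i. dep q j)"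

lemma scale_dep_nonneg [simp]: "0 \<le> scale_dep q i"
  by (simp add: scale_dep_def sum_nonneg)

lemma sum_scale: "(\<Sum>i\<le>n. \<Sum>j\<in>scale i. f j) = (\<Sum>j<2 ^ n. f j :: real)"
proof (induction n)
  case (Suc n)
  have "(\<Sum>i\<le>Suc n. \<Sum>j\<in>scale i. f j) = (\<Sum>j<2 ^ n. f j) + (\<Sum>j\<in>{2 ^ n..<2 ^ Suc n}. f j)"
    using Suc by (simp add: scale_def)
  also have "\<dots> = (\<Sum>j<2 ^ Suc n. f j)"
    by (subst sum.union_disjoint[symmetric]) (auto intro!: sum.cong)
  finally show ?case .
qed (simp add: scale_def)

lemma approx_eq_sum_innov: "approx i t x = (\<Sum>j<2 ^ i. innov (t - int j) (X t) x)"
proof -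
  have "{..t} \<inter> {t + 1..} = {}" by auto
  hence "cexp {t + 1..} (X t) x = 0" using cexp_indep[OF depends_on_X] integral_X by simp
  thus ?thesis using sum_innov[of t "X t" x "2 ^ i"] by (simp add: approx_def)
qed

lemma approx_eq_sum_layer: "approx n t x = (\<Sum>i\<le>n. layer i t x)"
  unfolding layer_def sum_scale approx_eq_sum_innov ..

lemma in_Lp_approx: "1 \<le> q \<Longrightarrow> q \<le> p \<Longrightarrow> in_Lp P q (approx i t)"
  unfolding approx_def by (intro in_Lp_cexp in_Lp_X) auto

lemma measurable_approx [measurable]: "approx i t \<in> borel_measurable P"
  using in_Lp_approx[of 1 i t] p4 by (auto simp: in_Lp_def)

lemma Lp_norm_approx_le: "1 \<le> q \<Longrightarrow> q \<le> p \<Longrightarrow> Lp_norm P q (approx i t) \<le> Lp_norm P q G"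
  unfolding approx_def using Lp_norm_cexp_le[OF in_Lp_X[of q t]] Lp_norm_X[of q t] by auto

lemma depends_on_approx: "depends_on (approx i t) {t - 2 ^ i + 1..t}"
  unfolding approx_def using depends_on_cexp_Int[OF depends_on_X]
  by (rule depends_on_mono) auto

lemma coupling_approx_le: "1 \<le> q \<Longrightarrow> q \<le> p \<Longrightarrow> coupling q (approx i t) s \<le> coupling q (X t) s"
  unfolding approx_def by (intro coupling_cexp_le in_Lp_X) auto

lemma in_Lp_layer: "1 \<le> q \<Longrightarrow> q \<le> p \<Longrightarrow> in_Lp P q (layer i t)"
  unfolding layer_def[abs_def] by (intro in_Lp_sum in_Lp_innov in_Lp_X) auto

lemma integral_layer: "(LINT x|P. layer i t x) = 0"
proof -
  have "integrable P (innov s (X t))" for s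
    using PP.in_Lp_imp_integrable[OF in_Lp_innov[OF in_Lp_X[of 1]]] p4 by auto
  thus ?thesis unfolding layer_def
    by (subst Bochner_Integration.integral_sum) (auto simp: integral_innov integrable_X)
qed

lemma depends_on_layer: "depends_on (layer i t) {t - 2 ^ i + 1..t}"
  unfolding layer_def[abs_def]
proof (rule depends_on_sum)
  fix j assume "j \<in> scale i"
  hence "int j < 2 ^ i" by (simp add: scale_def)
  hence j: "int j + 1 \<le> 2 ^ i" by (rule zless_imp_add1_zle)
  have "{t - int j..} \<inter> {..t} \<subseteq> {t - 2 ^ i + 1..t}"
  proof
    fix x assume "x \<in> {t - int j..} \<inter> {..t}"
    hence "t - int j \<le> x" "x \<le> t" by auto
    moreover from this j have "t - 2 ^ i + 1 \<le> x" by linarith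
    ultimately show "x \<in> {t - 2 ^ i + 1..t}" by simp
  qed
  thus "depends_on (innov (t - int j) (X t)) {t - 2 ^ i + 1..t}"
    by (rule depends_on_mono[OF depends_on_innov_Int[OF depends_on_X]])
qed

lemma Lp_norm_weighted_layer_sum:
  assumes q: "2 \<le> q" "q \<le> p" and I: "finite I"
  shows "Lp_norm P q (\<lambda>x. \<Sum>t\<in>I. a t * layer i t x)
    \<le> sqrt (martingale_const q) * sqrt (\<Sum>t\<in>I. (a t)\<^sup>2) * scale_dep q i"
proof -
  have "(\<lambda>x. \<Sum>t\<in>I. a t * layer i t x) = (\<lambda>x. \<Sum>j\<in>scale i. \<Sum>t\<in>I. a t * innov (t - int j) (X t) x)"
    unfolding layer_def sum_distrib_left by (subst sum.swap) simp
  hence "Lp_norm P q (\<lambda>x. \<Sum>t\<in>I. a t * layer i t x)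
      \<le> (\<Sum>j\<in>scale i. Lp_norm P q (\<lambda>x. \<Sum>t\<in>I. a t * innov (t - int j) (X t) x))"
    using q by (simp only:) (intro Lp_norm_sum in_Lp_sum in_Lp_cmult in_Lp_innov in_Lp_X, auto)
  also have "\<dots> \<le> (\<Sum>j\<in>scale i. sqrt (martingale_const q) * sqrt (\<Sum>t\<in>I. (a t)\<^sup>2) * dep q j)"
    using q I by (intro sum_mono Lp_norm_weighted_innov_sum in_Lp_X) (auto simp: coupling_X)
  finally show ?thesis by (simp add: scale_dep_def sum_distrib_left)
qed

text \<open>
  The condition on \<open>k\<close> places the factors at times \<open>t - k\<close> of a block before the innovations that enter the
  layer in that block. Conditionally on them the block is a weighted sum of layers. Its conditional
  variance is at most \<open>(scale_dep 2 i)\<^sup>2\<close> times the sum of the squared weights, and these add up over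
  the blocks to at most the sum of squares over the sample, whatever the lag.
\<close>

lemma
  fixes k T :: int and i n :: nat
  defines "B \<equiv> \<lambda>b x. \<Sum>t\<in>time_block k T (2 ^ i) b. approx n (t - k) x * layer i t x"
  assumes k: "2 * 2 ^ i \<le> k"
  shows lag_block_tail:
    "\<theta> \<ge> 0 \<Longrightarrow> y \<ge> 0 \<Longrightarrow> \<theta> * y \<le> 1 \<Longrightarrow> T - k \<le> 2 * int L \<Longrightarrow>
      prob_le (\<lambda>x. \<bar>\<Sum>t\<in>{k + 1..T}. approx n (t - k) x * layer i t x\<bar> \<ge> 2 * c \<and> (\<forall>b<2 * L. \<bar>B b x\<bar> \<le> y)
          \<and> (\<Sum>t\<in>{1..T}. (approx n t x)\<^sup>2) \<le> V)
        (4 * exp (\<theta>\<^sup>2 * ((scale_dep 2 i)\<^sup>2 * V) - \<theta> * c))"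
    and lag_block_in_Lp: "in_Lp P p (B b)"
    and lag_block_moment: "Lp_norm P p (B b) powr p
      \<le> (sqrt (martingale_const p) * scale_dep p i * Lp_norm P p G) powr p * real (card (time_block k T (2 ^ i) b)) powr (p / 2)"
proof -
  let ?l = "2 ^ i :: int"
  let ?J = "\<lambda>b. {..k + (int b - 1) * ?l}"
  let ?K = "\<lambda>b. {k + (int b - 1) * ?l + 1..}"
  let ?A = "time_block k T ?l"
  have l: "?l \<ge> 1" by simp
  have KJ: "?K b \<inter> ?J b = {}" for b by auto
  have k1: "k \<ge> 1"
  proof -
    have "(1::int) \<le> 2 ^ i" by simp
    thus ?thesis using k by linarith
  qed
  have da: "depends_on (approx n (t - k)) (?J b)" if "t \<in> ?A b" for t b
  proof (rule depends_on_mono[OF depends_on_approx])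
    have "t - k \<le> k + (int b - 1) * ?l" using time_blockD(2)[OF that l] k by (simp add: algebra_simps)
    thus "{t - k - 2 ^ n + 1..t - k} \<subseteq> ?J b" by auto
  qed
  have dY: "depends_on (layer i t) (?K b)" if "t \<in> ?A b" for t b
  proof (rule depends_on_mono[OF depends_on_layer])
    show "{t - 2 ^ i + 1..t} \<subseteq> ?K b" using time_blockD(1)[OF that l] by (auto simp: algebra_simps)
  qed
  have Zp: "in_Lp P p (\<lambda>x. approx n (t - k) x * layer i t x)" if "t \<in> ?A b" for t b
    using p4 by (intro in_Lp_mult_indep[OF _ _ da[OF that] dY[OF that] KJ] in_Lp_approx in_Lp_layer) auto
  have inA: "t \<in> ?A (nat ((t - k - 1) div ?l))" if "t \<in> {k + 1..T}" for t
    using that by (auto simp: time_block_def pos_imp_zdiv_nonneg_iff)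
  show Bp: "in_Lp P p (B b)" for b
    unfolding B_def using Zp p4 by (intro in_Lp_sum) auto
  have cB: "cexp (?J b) (\<lambda>x. \<phi> (B b x)) x = (LINT z|P. \<phi> (\<Sum>t\<in>?A b. approx n (t - k) x * layer i t z))" for \<phi> b x
    unfolding B_def by (rule cexp_frozen[OF da dY KJ])
  have cBid: "cexp (?J b) (B b) x = (LINT z|P. (\<Sum>t\<in>?A b. approx n (t - k) x * layer i t z))" for b x
    using cB[of b "\<lambda>u. u" x] by simp
  have li: "integrable P (layer i t)" for t using in_Lp_layer[of 1] p4 PP.in_Lp_imp_integrable by auto
  let ?w = "\<lambda>b x. \<Sum>t\<in>?A b. (approx n (t - k) x)\<^sup>2"
  have wm[measurable]: "?w b \<in> borel_measurable P" for b
    by (intro borel_measurable_sum borel_measurable_power measurable_approx)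
  show "prob_le (\<lambda>x. \<bar>\<Sum>t\<in>{k + 1..T}. approx n (t - k) x * layer i t x\<bar> \<ge> 2 * c \<and> (\<forall>b<2 * L. \<bar>B b x\<bar> \<le> y)
          \<and> (\<Sum>t\<in>{1..T}. (approx n t x)\<^sup>2) \<le> V)
        (4 * exp (\<theta>\<^sup>2 * ((scale_dep 2 i)\<^sup>2 * V) - \<theta> * c))"
    if lam: "\<theta> \<ge> 0" "y \<ge> 0" "\<theta> * y \<le> 1" and L: "T - k \<le> 2 * int L"
  proof -
    have "prob_le (\<lambda>x. \<bar>\<Sum>t\<in>{k + 1..T}. approx n (t - k) x * layer i t x\<bar> \<ge> 2 * c
        \<and> (\<forall>b<2 * L. \<bar>\<Sum>t\<in>?A b. approx n (t - k) x * layer i t x\<bar> \<le> y)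
        \<and> (\<Sum>b<2 * L. (scale_dep 2 i)\<^sup>2 * ?w b x) \<le> (scale_dep 2 i)\<^sup>2 * V)
        (4 * exp (\<theta>\<^sup>2 * ((scale_dep 2 i)\<^sup>2 * V) - \<theta> * c))"
    proof (rule alternating_block_tail[OF l L lam])
      fix t assume t: "t \<in> {k + 1..T}"
      show "in_Lp P 2 (\<lambda>x. approx n (t - k) x * layer i t x)"
        using PP.in_Lp_less[OF Zp[OF inA[OF t]], of 2] p4 by simp
      show "depends_on (\<lambda>x. approx n (t - k) x * layer i t x) {..t}"
        by (rule depends_on_comp2; rule depends_on_mono[OF depends_on_approx] depends_on_mono[OF depends_on_layer])
           (use k1 in auto)
    next
      fix b
      show "(\<lambda>x. (scale_dep 2 i)\<^sup>2 * ?w b x) \<in> borel_measurable P" by measurable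
      show "depends_on (\<lambda>x. (scale_dep 2 i)\<^sup>2 * ?w b x) (?J b)"
        by (intro depends_on_comp[OF depends_on_sum] depends_on_comp[OF da])
      show "AE x in P. cexp (?J b) (\<lambda>x. \<Sum>t\<in>?A b. approx n (t - k) x * layer i t x) x = 0"
        using cBid[of b] unfolding B_def by (simp add: li integral_layer)
      show "AE x in P. cexp (?J b) (\<lambda>x. (\<Sum>t\<in>?A b. approx n (t - k) x * layer i t x)\<^sup>2) x \<le> (scale_dep 2 i)\<^sup>2 * ?w b x"
      proof (rule AE_I2)
        fix x
        have "cexp (?J b) (\<lambda>x. (\<Sum>t\<in>?A b. approx n (t - k) x * layer i t x)\<^sup>2) x
            = (Lp_norm P 2 (\<lambda>z. \<Sum>t\<in>?A b. approx n (t - k) x * layer i t z))\<^sup>2"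
          using cB[of b "\<lambda>u. u\<^sup>2" x] unfolding B_def by (simp add: Lp_norm_2)
        also have "\<dots> \<le> (sqrt (?w b x) * scale_dep 2 i)\<^sup>2"
          using Lp_norm_weighted_layer_sum[of 2 "?A b" "\<lambda>t. approx n (t - k) x" i] p4 by (intro power_mono) auto
        also have "\<dots> = (scale_dep 2 i)\<^sup>2 * ?w b x" by (simp add: power_mult_distrib sum_nonneg)
        finally show "cexp (?J b) (\<lambda>x. (\<Sum>t\<in>?A b. approx n (t - k) x * layer i t x)\<^sup>2) x \<le> (scale_dep 2 i)\<^sup>2 * ?w b x" .
      qed
    next
      fix b x show "0 \<le> (scale_dep 2 i)\<^sup>2 * ?w b x" by (intro mult_nonneg_nonneg sum_nonneg) auto
    qed
    thus ?thesis
    proof (rule prob_le_mono)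
      fix x assume x: "\<bar>\<Sum>t\<in>{k + 1..T}. approx n (t - k) x * layer i t x\<bar> \<ge> 2 * c \<and> (\<forall>b<2 * L. \<bar>B b x\<bar> \<le> y)
          \<and> (\<Sum>t\<in>{1..T}. (approx n t x)\<^sup>2) \<le> V"
      have "(\<Sum>b<2 * L. ?w b x) = (\<Sum>t\<in>{k + 1..T}. (approx n (t - k) x)\<^sup>2)"
        using L by (intro sum_time_blocks) auto
      also have "\<dots> = (\<Sum>t\<in>{1..T - k}. (approx n t x)\<^sup>2)"
        by (rule sum.reindex_bij_witness[of _ "\<lambda>t. t + k" "\<lambda>t. t - k"]) auto
      also have "\<dots> \<le> (\<Sum>t\<in>{1..T}. (approx n t x)\<^sup>2)" using k1 by (intro sum_mono2) auto
      also have "\<dots> \<le> V" using x by simp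
      finally have "(\<Sum>b<2 * L. (scale_dep 2 i)\<^sup>2 * ?w b x) \<le> (scale_dep 2 i)\<^sup>2 * V"
        unfolding sum_distrib_left[symmetric] by (intro mult_left_mono) auto
      thus "\<bar>\<Sum>t\<in>{k + 1..T}. approx n (t - k) x * layer i t x\<bar> \<ge> 2 * c
        \<and> (\<forall>b<2 * L. \<bar>\<Sum>t\<in>?A b. approx n (t - k) x * layer i t x\<bar> \<le> y)
        \<and> (\<Sum>b<2 * L. (scale_dep 2 i)\<^sup>2 * ?w b x) \<le> (scale_dep 2 i)\<^sup>2 * V"
        using x by (simp add: B_def)
    qed simp
  qed
  show "Lp_norm P p (B b) powr p \<le> (sqrt (martingale_const p) * scale_dep p i * Lp_norm P p G) powr p * real (card (?A b)) powr (p / 2)" for b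
  proof -
    let ?C = "sqrt (martingale_const p) * scale_dep p i"
    have C: "?C \<ge> 0" using martingale_const_ge_1[of p] p4 by simp
    have p0: "p > 0" "p / 2 \<ge> 1" "p / 2 > 0" using p4 by auto
    have w: "in_Lp P (p / 2) (\<lambda>x. (approx n (t - k) x)\<^sup>2)" for t
      using in_Lp_mult[of P "p / 2" "approx n (t - k)" "approx n (t - k)"] in_Lp_approx[of p] p4 by (simp add: power2_eq_square)
    have ww: "in_Lp P (p / 2) (?w b)" using w p0 by (intro in_Lp_sum) auto
    have "Lp_norm P p (B b) powr p = (LINT x|P. \<bar>B b x\<bar> powr p)" using p0 by (simp add: Lp_norm_powr)
    also have "\<dots> = (LINT x|P. cexp (?J b) (\<lambda>x. \<bar>B b x\<bar> powr p) x)"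
      by (rule integral_cexp[symmetric]) (use Bp in \<open>simp add: in_Lp_def\<close>)
    also have "\<dots> \<le> (LINT x|P. ?C powr p * \<bar>?w b x\<bar> powr (p / 2))"
    proof (rule integral_mono)
      show "integrable P (cexp (?J b) (\<lambda>x. \<bar>B b x\<bar> powr p))"
        by (rule integrable_cexp) (use Bp in \<open>simp add: in_Lp_def\<close>)
      show "integrable P (\<lambda>x. ?C powr p * \<bar>?w b x\<bar> powr (p / 2))" using ww by (simp add: in_Lp_def)
      fix x
      have "cexp (?J b) (\<lambda>x. \<bar>B b x\<bar> powr p) x = Lp_norm P p (\<lambda>z. \<Sum>t\<in>?A b. approx n (t - k) x * layer i t z) powr p"
        using cB[of b "\<lambda>u. \<bar>u\<bar> powr p" x] p0 by (simp add: Lp_norm_powr)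
      also have "\<dots> \<le> (sqrt (martingale_const p) * sqrt (?w b x) * scale_dep p i) powr p"
        using p4 by (intro powr_mono2 Lp_norm_weighted_layer_sum) auto
      also have "\<dots> = (?C * sqrt (?w b x)) powr p" by (simp add: mult_ac)
      also have "\<dots> = ?C powr p * (sqrt (?w b x)) powr p" by (rule powr_mult)
      also have "(sqrt (?w b x)) powr p = \<bar>?w b x\<bar> powr (p / 2)"
        by (simp add: powr_half_sqrt[symmetric] powr_powr sum_nonneg)
      finally show "cexp (?J b) (\<lambda>x. \<bar>B b x\<bar> powr p) x \<le> ?C powr p * \<bar>?w b x\<bar> powr (p / 2)" .
    qed
    also have "\<dots> = ?C powr p * Lp_norm P (p / 2) (?w b) powr (p / 2)" using p0 by (simp add: Lp_norm_powr)
    also have "\<dots> \<le> ?C powr p * (real (card (?A b)) * (Lp_norm P p G)\<^sup>2) powr (p / 2)"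
    proof (intro mult_left_mono powr_mono2)
      have "Lp_norm P (p / 2) (?w b) \<le> (\<Sum>t\<in>?A b. Lp_norm P (p / 2) (\<lambda>x. (approx n (t - k) x)\<^sup>2))"
        using w p0 by (intro Lp_norm_sum) auto
      also have "\<dots> \<le> (\<Sum>t\<in>?A b. (Lp_norm P p G)\<^sup>2)"
      proof (rule sum_mono)
        fix t
        have "Lp_norm P (p / 2) (\<lambda>x. (approx n (t - k) x)\<^sup>2) \<le> Lp_norm P p (approx n (t - k)) * Lp_norm P p (approx n (t - k))"
          using Lp_norm_mult[of P "p / 2" "approx n (t - k)" "approx n (t - k)"] in_Lp_approx[of p] p4 by (simp add: power2_eq_square)
        also have "\<dots> \<le> Lp_norm P p G * Lp_norm P p G"
          using p4 by (intro mult_mono Lp_norm_approx_le) auto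
        finally show "Lp_norm P (p / 2) (\<lambda>x. (approx n (t - k) x)\<^sup>2) \<le> (Lp_norm P p G)\<^sup>2" by (simp add: power2_eq_square)
      qed
      finally show "Lp_norm P (p / 2) (?w b) \<le> real (card (?A b)) * (Lp_norm P p G)\<^sup>2" by simp
    qed (use p0 in auto)
    also have "\<dots> = (?C * Lp_norm P p G) powr p * real (card (?A b)) powr (p / 2)"
    proof -
      have "((Lp_norm P p G)\<^sup>2) powr (p / 2) = Lp_norm P p G powr p"
        by (cases "Lp_norm P p G = 0") (use Lp_norm_nonneg[of P p G] in \<open>auto simp: powr_powr simp flip: powr_numeral\<close>)
      thus ?thesis by (simp add: powr_mult)
    qed
    finally show ?thesis .
  qed
qed

end

section \<open>The short-memory part of the sample autocovariances at large lags\<close>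

lemma card_dyadic_le:
  fixes T :: nat assumes "T \<ge> 1"
  shows "finite {i. (2::nat) ^ i \<le> T}" "real (card {i. (2::nat) ^ i \<le> T}) \<le> 2 * ln (real T) + 1"
proof -
  have sub: "{i. (2::nat) ^ i \<le> T} \<subseteq> {..nat \<lfloor>log 2 (real T)\<rfloor>}"
  proof
    fix i assume "i \<in> {i. (2::nat) ^ i \<le> T}"
    hence "(2::real) ^ i \<le> real T" by (simp add: numeral_power_le_of_nat_cancel_iff)
    hence "real i \<le> log 2 (real T)" using assms by (simp add: le_log_iff powr_realpow)
    thus "i \<in> {..nat \<lfloor>log 2 (real T)\<rfloor>}" by (simp add: le_nat_floor)
  qed
  show fin: "finite {i. (2::nat) ^ i \<le> T}" by (rule finite_subset[OF sub]) simp
  have "card {i. (2::nat) ^ i \<le> T} \<le> card {..nat \<lfloor>log 2 (real T)\<rfloor>}" using sub by (rule card_mono[rotated]) simp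
  hence "real (card {i. (2::nat) ^ i \<le> T}) \<le> real (nat \<lfloor>log 2 (real T)\<rfloor>) + 1" by simp
  also have "real (nat \<lfloor>log 2 (real T)\<rfloor>) \<le> log 2 (real T)" using assms by (simp add: of_nat_nat)
  also have "log 2 (real T) \<le> 2 * ln (real T)"
  proof -
    have "ln 2 \<ge> (1/2 :: real)" using ln2_ge_two_thirds by simp
    hence "ln (real T) * 1 \<le> ln (real T) * (2 * ln 2)" using assms by (intro mult_left_mono) auto
    thus ?thesis by (simp add: log_def divide_simps)
  qed
  finally show "real (card {i. (2::nat) ^ i \<le> T}) \<le> 2 * ln (real T) + 1" by simp
qed

context causal_process begin

definition norm4 :: real where "norm4 = Lp_norm P 4 G"
definition sum_dep4 :: real where "sum_dep4 = (\<Sum>j. dep 4 j)"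

lemma summable_dep4: "summable (dep 4)"
  using summable_dep[of 4] p4 by simp

lemma sum_dep4_nonneg: "sum_dep4 \<ge> 0"
  unfolding sum_dep4_def using summable_dep4 by (intro suminf_nonneg) auto

lemma norm4_nonneg: "norm4 \<ge> 0"
  by (simp add: norm4_def)

text \<open>
  In particular a vanishing sum of the dependence coefficients leaves only the zero process.
\<close>

lemma norm4_le_sum_dep4: "norm4 \<le> sqrt (martingale_const 4) * sum_dep4"
proof -
  have "Lp_norm P 4 (\<lambda>x. \<Sum>t\<in>{0}. G (tshift t x) - (LINT x|P. G x)) \<le> sqrt (martingale_const 4) * sqrt (real (card {0::int})) * (\<Sum>j. coupling 4 G (- int j))"
    using summable_dep4 p4 by (intro Lp_norm_stationary_sum in_Lp_G causal) (auto simp: dep_def[abs_def])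
  thus ?thesis using centred by (simp add: norm4_def sum_dep4_def dep_def tshift_def)
qed

lemma approx_shift: "approx i t x = approx i 0 (tshift t x)"
proof -
  have "(\<lambda>i. i - t) ` {t - 2 ^ i + 1..} = {0 - 2 ^ i + 1..}"
  proof (intro equalityI subsetI)
    fix j :: int assume "j \<in> {0 - 2 ^ i + 1..}"
    thus "j \<in> (\<lambda>i. i - t) ` {t - 2 ^ i + 1..}" by (intro image_eqI[of _ _ "j + t"]) auto
  qed auto
  moreover have "tshift 0 y = y" for y by (simp add: tshift_def)
  ultimately show ?thesis unfolding approx_def
    using cexp_shift[OF measurable_G, of "{t - 2 ^ i + 1..}" t x] by (simp add: X_def[abs_def])
qed

text \<open>
  The variance bound must hold for all lags at once. A second moment bound is enough for this, because the
  sum depends on the lag only through the memory \<open>n\<close>, of which logarithmically many values occur.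
\<close>

lemma approx_square_sum_tail:
  assumes T: "T \<ge> (1::nat)" and s: "norm4 > 0"
  shows "prob_le (\<lambda>x. (\<Sum>t\<in>{1..int T}. (approx n t x)\<^sup>2) > 2 * real T * norm4\<^sup>2)
     (4 * sum_dep4\<^sup>2 / norm4\<^sup>2 / real T)"
proof -
  let ?f = "\<lambda>x. approx n 0 x * approx n 0 x"
  have a4: "in_Lp P (2 * 2) (approx n 0)" using in_Lp_approx[of 4] p4 by simp
  have f: "in_Lp P 2 ?f" by (rule in_Lp_mult[OF a4 a4]) simp
  have fD: "depends_on ?f {..0}"
    by (rule depends_on_comp2; rule depends_on_mono[OF depends_on_approx]) auto
  have nle: "Lp_norm P 4 (approx n 0) \<le> norm4" unfolding norm4_def using p4 by (intro Lp_norm_approx_le) auto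
  have cf: "coupling 2 ?f (- int j) \<le> 2 * norm4 * dep 4 j" for j
  proof -
    have "coupling 2 ?f (- int j) \<le> Lp_norm P 4 (approx n 0) * coupling 4 (approx n 0) (- int j)
        + Lp_norm P 4 (approx n 0) * coupling 4 (approx n 0) (- int j)"
      using coupling_mult_le[OF a4 a4, of "- int j"] by simp
    also have "\<dots> \<le> norm4 * dep 4 j + norm4 * dep 4 j"
      using coupling_approx_le[of 4 n 0 "- int j"] coupling_X[of 4 0 j] p4 norm4_nonneg nle
      by (intro add_mono mult_mono) auto
    finally show ?thesis by simp
  qed
  have S: "summable (\<lambda>j. 2 * norm4 * dep 4 j)" using summable_dep4 by (intro summable_mult)
  have S': "summable (\<lambda>j. coupling 2 ?f (- int j))"
    by (rule summable_comparison_test'[OF S]) (use cf in simp)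
  have "(\<Sum>j. coupling 2 ?f (- int j)) \<le> (\<Sum>j. 2 * norm4 * dep 4 j)" by (rule suminf_le[OF cf S' S])
  also have "\<dots> = 2 * norm4 * sum_dep4" using summable_dep4 by (simp add: suminf_mult sum_dep4_def)
  finally have Sle: "(\<Sum>j. coupling 2 ?f (- int j)) \<le> 2 * norm4 * sum_dep4" .
  let ?W = "\<lambda>x. \<Sum>t\<in>{1..int T}. ?f (tshift t x) - (LINT x|P. ?f x)"
  have "Lp_norm P 2 ?W \<le> sqrt (martingale_const 2) * sqrt (real (card {1..int T})) * (\<Sum>j. coupling 2 ?f (- int j))"
    by (rule Lp_norm_stationary_sum[OF f _ fD _ S']) auto
  also have "\<dots> \<le> sqrt (real T) * (2 * norm4 * sum_dep4)" using Sle by (simp add: mult_left_mono)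
  finally have W: "Lp_norm P 2 ?W \<le> sqrt (real T) * (2 * norm4 * sum_dep4)" .
  have WL: "in_Lp P 2 ?W" using in_Lp_shift[OF f] by (intro in_Lp_sum in_Lp_diff) auto
  have Ef: "(LINT x|P. ?f x) \<le> norm4\<^sup>2"
  proof -
    have "(LINT x|P. ?f x) = (Lp_norm P 2 (approx n 0))\<^sup>2"
      unfolding Lp_norm_2 by (simp add: power2_eq_square)
    also have "\<dots> \<le> (Lp_norm P 4 (approx n 0))\<^sup>2"
      using in_Lp_approx[of 4 n 0] p4 by (intro power_mono PP.Lp_norm_less) auto
    also have "\<dots> \<le> norm4\<^sup>2" using nle by (intro power_mono) auto
    finally show ?thesis .
  qed
  have "prob_le (\<lambda>x. \<bar>?W x\<bar> \<ge> real T * norm4\<^sup>2) ((Lp_norm P 2 ?W / (real T * norm4\<^sup>2)) powr 2)"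
    using WL T s by (intro prob_le_Markov) auto
  thus ?thesis
  proof (rule prob_le_mono)
    fix x assume x: "(\<Sum>t\<in>{1..int T}. (approx n t x)\<^sup>2) > 2 * real T * norm4\<^sup>2"
    have "?W x = (\<Sum>t\<in>{1..int T}. (approx n t x)\<^sup>2) - real T * (LINT x|P. ?f x)"
      by (simp add: sum_subtractf approx_shift[of n _ x, symmetric] power2_eq_square)
    moreover have "real T * (LINT x|P. ?f x) \<le> real T * norm4\<^sup>2" using Ef by (intro mult_left_mono) auto
    ultimately show "\<bar>?W x\<bar> \<ge> real T * norm4\<^sup>2" using x by linarith
  next
    have "(Lp_norm P 2 ?W / (real T * norm4\<^sup>2)) powr 2 \<le> (sqrt (real T) * (2 * norm4 * sum_dep4) / (real T * norm4\<^sup>2)) powr 2"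
      using W T s by (intro powr_mono2 divide_right_mono) auto
    also have "\<dots> = (sqrt (real T) * (2 * norm4 * sum_dep4))\<^sup>2 / (real T * norm4\<^sup>2)\<^sup>2"
      using sum_dep4_nonneg norm4_nonneg by (simp add: power_divide)
    also have "\<dots> = 4 * sum_dep4\<^sup>2 / norm4\<^sup>2 / real T"
      using T s by (simp add: power_mult_distrib field_simps power2_eq_square)
    finally show "(Lp_norm P 2 ?W / (real T * norm4\<^sup>2)) powr 2 \<le> 4 * sum_dep4\<^sup>2 / norm4\<^sup>2 / real T" .
  qed
qed

text \<open>
  The exponential parameter \<open>\<theta>\<close> makes the variance term at most \<open>2 ln T\<close> and the linear term equal to
  \<open>5 ln T\<close>, which leaves \<open>T powr (- 3)\<close>. The second summand is Markov's inequality of order \<open>p\<close> for the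
  event that some block exceeds the truncation level \<open>1 / \<theta>\<close>.
\<close>

lemma layer_sum_tail:
  fixes T k :: nat
  assumes T: "T \<ge> 3" and s: "norm4 > 0" and w: "w > 0" "scale_dep 4 i \<le> w"
    and k: "2 * 2 ^ i \<le> k"
  shows "prob_le (\<lambda>x. \<bar>\<Sum>t\<in>{int k + 1..int T}. approx n (t - int k) x * layer i t x\<bar> \<ge> 10 * norm4 * w * sqrt (real T * ln (real T))
          \<and> (\<Sum>t\<in>{1..int T}. (approx n t x)\<^sup>2) \<le> 2 * real T * norm4\<^sup>2)
     (4 * real T powr (- 3)
       + (sqrt (martingale_const p) * scale_dep p i * Lp_norm P p G / (norm4 * w)) powr p
         * (2 ^ i) powr (p / 2 - 1) * real T * (ln (real T) / real T) powr (p / 2))"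
proof -
  have lT: "ln (real T) > 0" using T by simp
  define \<theta> where "\<theta> = sqrt (ln (real T) / real T) / (norm4 * w)"
  have th: "\<theta> > 0" using lT T s w by (simp add: \<theta>_def)
  define y where "y = 1 / \<theta>"
  have y: "y > 0" "\<theta> * y = 1" using th by (auto simp: y_def)
  let ?B = "\<lambda>b x. \<Sum>t\<in>time_block (int k) (int T) (2 ^ i) b. approx n (t - int k) x * layer i t x"
  have k': "2 * 2 ^ i \<le> int k" 
  proof -
    have "int (2 * 2 ^ i) \<le> int k" using k by (simp only: of_nat_le_iff)
    thus ?thesis by simp
  qed
  have p0: "p > 0" "p \<ge> 2" using p4 by auto
  let ?c = "5 * norm4 * w * sqrt (real T * ln (real T))" and ?V = "2 * real T * norm4\<^sup>2"
  let ?K = "sqrt (martingale_const p) * scale_dep p i * Lp_norm P p G"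
  have K0: "?K \<ge> 0" using martingale_const_ge_1[OF p0(2)] by simp
  have "prob_le (\<lambda>x. \<bar>\<Sum>t\<in>{int k + 1..int T}. approx n (t - int k) x * layer i t x\<bar> \<ge> 2 * ?c \<and> (\<forall>b<2 * T. \<bar>?B b x\<bar> \<le> y)
          \<and> (\<Sum>t\<in>{1..int T}. (approx n t x)\<^sup>2) \<le> ?V)
        (4 * exp (\<theta>\<^sup>2 * ((scale_dep 2 i)\<^sup>2 * ?V) - \<theta> * ?c))"
    using k' th y by (intro lag_block_tail) auto
  moreover have "4 * exp (\<theta>\<^sup>2 * ((scale_dep 2 i)\<^sup>2 * ?V) - \<theta> * ?c) \<le> 4 * real T powr (- 3)"
  proof -
    have "scale_dep 2 i \<le> scale_dep 4 i" unfolding scale_dep_def using p4 by (intro sum_mono dep_mono) auto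
    hence "scale_dep 2 i \<le> w" using w by simp
    hence "\<theta>\<^sup>2 * ((scale_dep 2 i)\<^sup>2 * ?V) \<le> \<theta>\<^sup>2 * (w\<^sup>2 * ?V)" by (intro mult_left_mono mult_right_mono power_mono) auto
    also have "\<dots> = 2 * ln (real T)" using lT T s w by (simp add: \<theta>_def power_divide power_mult_distrib field_simps)
    finally have 1: "\<theta>\<^sup>2 * ((scale_dep 2 i)\<^sup>2 * ?V) \<le> 2 * ln (real T)" .
    have "\<theta> * ?c = 5 * (sqrt (ln (real T) / real T) * sqrt (real T * ln (real T)))"
      using s w by (simp add: \<theta>_def)
    also have "sqrt (ln (real T) / real T) * sqrt (real T * ln (real T)) = sqrt ((ln (real T))\<^sup>2)"
      using T unfolding real_sqrt_mult[symmetric] by (simp add: power2_eq_square)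
    also have "\<dots> = ln (real T)" using lT by simp
    finally have 2: "\<theta> * ?c = 5 * ln (real T)" .
    have "exp (\<theta>\<^sup>2 * ((scale_dep 2 i)\<^sup>2 * ?V) - \<theta> * ?c) \<le> exp (- 3 * ln (real T))" using 1 2 by simp
    also have "\<dots> = real T powr (- 3)" using T by (simp add: powr_def)
    finally show ?thesis by simp
  qed
  moreover have "prob_le (\<lambda>x. \<exists>b\<in>{..<2 * T}. \<bar>?B b x\<bar> \<ge> y) (\<Sum>b<2 * T. (Lp_norm P p (?B b) / y) powr p)"
    using p0 y lag_block_in_Lp[OF k'] by (intro prob_le_ex prob_le_Markov) auto
  moreover have "(\<Sum>b<2 * T. (Lp_norm P p (?B b) / y) powr p)
      \<le> (?K / (norm4 * w)) powr p * (2 ^ i) powr (p / 2 - 1) * real T * (ln (real T) / real T) powr (p / 2)"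
  proof -
    have th_p: "\<theta> powr p = (ln (real T) / real T) powr (p / 2) / (norm4 * w) powr p"
      using lT T s w by (simp add: \<theta>_def powr_divide powr_mult powr_half_sqrt[symmetric] powr_powr)
    let ?A = "\<lambda>b. time_block (int k) (int T) (2 ^ i) b"
    have "(\<Sum>b<2 * T. (Lp_norm P p (?B b) / y) powr p) = (\<Sum>b<2 * T. \<theta> powr p * Lp_norm P p (?B b) powr p)"
      using th by (simp add: y_def powr_mult mult.commute)
    also have "\<dots> \<le> (\<Sum>b<2 * T. \<theta> powr p * (?K powr p * ((2 ^ i) powr (p / 2 - 1) * real (card (?A b)))))"
    proof (intro sum_mono mult_left_mono)
      fix b
      have c: "real (card (?A b)) \<le> 2 ^ i"
        using card_time_block_le[of "2 ^ i" "int k" "int T" b] by (simp add: of_nat_le_iff flip: of_nat_power) 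
      have "real (card (?A b)) powr (p / 2) \<le> (2 ^ i) powr (p / 2 - 1) * real (card (?A b))"
      proof (cases "card (?A b) = 0")
        case False
        have "real (card (?A b)) powr (p / 2) = real (card (?A b)) powr (p / 2 - 1) * real (card (?A b))"
          using False by (simp add: powr_diff)
        also have "\<dots> \<le> (2 ^ i) powr (p / 2 - 1) * real (card (?A b))"
          using c p4 by (intro mult_right_mono powr_mono2) auto
        finally show ?thesis .
      qed simp
      thus "Lp_norm P p (?B b) powr p \<le> ?K powr p * ((2 ^ i) powr (p / 2 - 1) * real (card (?A b)))"
        using lag_block_moment[OF k', of n "int T" b] by (meson mult_left_mono order_trans powr_ge_zero)
    qed simp
    also have "\<dots> = \<theta> powr p * (?K powr p * ((2 ^ i) powr (p / 2 - 1) * (\<Sum>b<2 * T. real (card (?A b)))))"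
      by (simp add: sum_distrib_left)
    also have "(\<Sum>b<2 * T. real (card (?A b))) \<le> real T"
    proof -
      have "(\<Sum>b<2 * T. real (card (?A b))) = (\<Sum>b<2 * T. \<Sum>t\<in>?A b. 1)" by simp
      also have "\<dots> = (\<Sum>t\<in>{int k + 1..int T}. 1)" by (rule sum_time_blocks) auto
      also have "\<dots> \<le> real T" by simp
      finally show ?thesis .
    qed
    also have "\<theta> powr p * (?K powr p * ((2 ^ i) powr (p / 2 - 1) * real T))
      = (?K / (norm4 * w)) powr p * (2 ^ i) powr (p / 2 - 1) * real T * (ln (real T) / real T) powr (p / 2)"
      using K0 s w by (simp add: th_p powr_divide mult_ac)
    finally show ?thesis by (simp add: mult_left_mono)
  qed
  ultimately have "prob_le (\<lambda>x. (\<bar>\<Sum>t\<in>{int k + 1..int T}. approx n (t - int k) x * layer i t x\<bar> \<ge> 2 * ?c \<and> (\<forall>b<2 * T. \<bar>?B b x\<bar> \<le> y)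
          \<and> (\<Sum>t\<in>{1..int T}. (approx n t x)\<^sup>2) \<le> ?V) \<or> (\<exists>b\<in>{..<2 * T}. \<bar>?B b x\<bar> \<ge> y))
     (4 * real T powr (- 3) + (?K / (norm4 * w)) powr p * (2 ^ i) powr (p / 2 - 1) * real T * (ln (real T) / real T) powr (p / 2))"
    by (intro prob_le_disj) (auto elim: prob_le_mono)
  thus ?thesis
    by (rule prob_le_mono) (force simp: not_le intro: less_imp_le)+
qed

end

text \<open>
  Both regimes of the theorem imply \<open>\<alpha> p > 2\<close>: the first one since \<open>p > 4\<close>, the second since
  \<open>\<alpha> \<ge> \<alpha>'\<close>.
\<close>

locale causal_process_rate = causal_process +
  fixes \<alpha> D :: real
  assumes alpha: "\<alpha> > 0" "\<alpha> * p > 2" and D: "D > 0"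
    and tail: "\<And>m. m \<ge> 1 \<Longrightarrow> (\<Sum>j. dep p (j + m)) \<le> D * real m powr (- \<alpha>)"
begin

lemma scale_dep_le_rate: "scale_dep p (Suc i) \<le> D * (2 ^ i) powr (- \<alpha>)"
proof -
  have S: "summable (\<lambda>j. dep p (j + 2 ^ i))" using summable_dep[of p] p4 by (intro summable_ignore_initial_segment) auto
  have "scale_dep p (Suc i) = (\<Sum>j\<in>{0 + 2 ^ i..<2 ^ i + 2 ^ i}. dep p j)" by (simp add: scale_dep_def scale_def mult_2)
  also have "\<dots> = (\<Sum>j\<in>{0..<2 ^ i}. dep p (j + 2 ^ i))" by (rule sum.shift_bounds_nat_ivl)
  also have "\<dots> \<le> (\<Sum>j. dep p (j + 2 ^ i))" using S by (intro sum_le_suminf) auto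
  also have "\<dots> \<le> D * real (2 ^ i) powr (- \<alpha>)" by (rule tail) simp
  finally show ?thesis by simp
qed

text \<open>
  The summand \<open>dep p 0\<close> accounts for the layer 0, which is not part of any tail.
\<close>

definition scale_const :: real where
  "scale_const = dep p 0 + D * 2 powr \<alpha>"

lemma scale_const_pos: "scale_const > 0"
  unfolding scale_const_def using D by (intro add_nonneg_pos) auto

lemma scale_dep_le: "scale_dep p i \<le> scale_const * (2 ^ i) powr (- \<alpha>)"
proof (cases i)
  case 0
  have "scale_dep p 0 = dep p 0" by (simp add: scale_dep_def scale_def)
  thus ?thesis using 0 D by (simp add: scale_const_def)
next
  case (Suc n)
  have "scale_dep p i \<le> D * (2 ^ n) powr (- \<alpha>)" using scale_dep_le_rate Suc by simp
  also have "\<dots> = D * 2 powr \<alpha> * (2 ^ i) powr (- \<alpha>)"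
    by (simp add: Suc powr_mult powr_minus field_simps)
  also have "\<dots> \<le> scale_const * (2 ^ i) powr (- \<alpha>)" unfolding scale_const_def by (intro mult_right_mono) auto
  finally show ?thesis .
qed

lemma geometric_layers: "summable (\<lambda>i. (2 ^ i) powr (- \<beta>))" if "\<beta> > 0" for \<beta> :: real
proof -
  have "(2 ^ i) powr (- \<beta>) = (2 powr (- \<beta>)) ^ i" for i
    by (simp add: powr_powr powr_realpow[symmetric] mult.commute)
  moreover have "summable (\<lambda>i. ((2::real) powr (- \<beta>)) ^ i)"
    using that powr_less_one[of 2 "- \<beta>"] by (intro summable_geometric) auto
  ultimately show ?thesis by (simp only:)
qed

text \<open>
  The admissible deviation is distributed over the layers in proportion to weights \<open>w i\<close>, so their sum
  determines the constant. A layer with a small weight is truncated at a low level. Hence the weights must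
  not fall below a fixed geometric sequence, or else the exceedance probabilities could not be bounded by
  the moments of the layers; the sequence that is added for this purpose at most doubles their sum.
\<close>

theorem main_part_large_lags:
  assumes s: "norm4 > 0" and lv: "\<And>k. k \<ge> 2 \<Longrightarrow> 2 * 2 ^ lv k \<le> k"
  shows "\<exists>\<epsilon>. \<epsilon> \<longlonglongrightarrow> 0 \<and> (\<forall>T\<ge>3. prob_le (\<lambda>x. \<exists>k\<in>{2..<T}.
      \<bar>\<Sum>t\<in>{int k + 1..int T}. approx (lv k) t x * approx (lv k) (t - int k) x\<bar>
        \<ge> 20 * norm4 * sum_dep4 * sqrt (real T * ln (real T))) (\<epsilon> T))"
proof -
  have S4: "sum_dep4 > 0"
  proof (rule ccontr)
    assume "\<not> sum_dep4 > 0"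
    hence "sum_dep4 = 0" using sum_dep4_nonneg by simp
    thus False using norm4_le_sum_dep4 s by simp
  qed
  have a2: "\<alpha> / 2 > 0" using alpha by simp
  define Z where "Z = (\<Sum>i. (2 ^ i :: real) powr (- (\<alpha> / 2)))"
  have Zpos: "Z > 0" unfolding Z_def using geometric_layers[OF a2] by (intro suminf_pos) auto
  \<comment> \<open>Normalises the geometric sequence to the total weight \<open>sum_dep4\<close>; the exponent \<open>\<alpha> / 2\<close> still
    leaves a geometric decay in the quotient of \<open>scale_dep p i\<close> and \<open>w i\<close>.\<close>
  define \<zeta> where "\<zeta> = sum_dep4 / Z"
  have zpos: "\<zeta> > 0" using S4 Zpos by (simp add: \<zeta>_def)
  define w where "w i = scale_dep 4 i + \<zeta> * (2 ^ i) powr (- (\<alpha> / 2))" for i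
  have wpos: "w i > 0" for i unfolding w_def using zpos by (intro add_nonneg_pos) auto
  have sum_w: "(\<Sum>i\<le>n. w i) \<le> 2 * sum_dep4" for n
  proof -
    have "(\<Sum>i\<le>n. scale_dep 4 i) = (\<Sum>j<2 ^ n. dep 4 j)" unfolding scale_dep_def by (rule sum_scale)
    also have "\<dots> \<le> sum_dep4" unfolding sum_dep4_def using summable_dep4 by (intro sum_le_suminf) auto
    finally have 1: "(\<Sum>i\<le>n. scale_dep 4 i) \<le> sum_dep4" .
    have "(\<Sum>i\<le>n. (2 ^ i :: real) powr (- (\<alpha> / 2))) \<le> Z"
      unfolding Z_def using geometric_layers[OF a2] by (intro sum_le_suminf) auto
    hence "\<zeta> * (\<Sum>i\<le>n. (2 ^ i) powr (- (\<alpha> / 2))) \<le> \<zeta> * Z" using zpos by (intro mult_left_mono) auto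
    also have "\<dots> = sum_dep4" using Zpos by (simp add: \<zeta>_def)
    finally show ?thesis using 1 by (simp add: w_def sum.distrib sum_distrib_left)
  qed
  define C where "C = (sqrt (martingale_const p) * (scale_const / \<zeta>) * Lp_norm P p G / norm4) powr p"
  \<comment> \<open>The exceedance probability is largest at one of the extreme layers: the first one leaves the
    margin \<open>p / 2 - 2\<close>, the last one \<open>\<alpha> p / 2 - 1\<close>.\<close>
  define \<eta> where "\<eta> = min (p / 2 - 2) (\<alpha> * p / 2 - 1)"
  have eta: "\<eta> > 0" using p4 alpha by (simp add: \<eta>_def)
  let ?\<epsilon>i = "\<lambda>T::nat. 4 * real T powr (- 3) + C * real T powr (- 1 - \<eta>) * ln (real T) powr (p / 2)"
  have layer: "prob_le (\<lambda>x. \<bar>\<Sum>t\<in>{int k + 1..int T}. approx (lv k) (t - int k) x * layer i t x\<bar> \<ge> 10 * norm4 * w i * sqrt (real T * ln (real T))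
          \<and> (\<Sum>t\<in>{1..int T}. (approx (lv k) t x)\<^sup>2) \<le> 2 * real T * norm4\<^sup>2) (?\<epsilon>i T)"
    if T: "T \<ge> 3" and k: "k \<in> {2..<T}" and i: "i \<le> lv k" for T k i
  proof -
    have k2: "2 * 2 ^ i \<le> k"
    proof -
      have "(2::nat) ^ i \<le> 2 ^ lv k" using i by (intro power_increasing) auto
      moreover have "2 * 2 ^ lv k \<le> k" using lv[of k] k by simp
      ultimately show ?thesis by linarith
    qed
    have iT: "(2::real) ^ i \<le> real T"
    proof -
      have "(2::nat) ^ i \<le> T" using k2 k by simp
      thus ?thesis by (simp add: numeral_power_le_of_nat_cancel_iff)
    qed
    have lT: "ln (real T) > 0" using T by simp
    let ?e = "p / 2 - 1 - \<alpha> * p / 2"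
    have "(sqrt (martingale_const p) * scale_dep p i * Lp_norm P p G / (norm4 * w i)) powr p
       \<le> (sqrt (martingale_const p) * (scale_const / \<zeta>) * Lp_norm P p G / norm4 * (2 ^ i) powr (- (\<alpha> / 2))) powr p"
    proof (rule powr_mono2)
      have "scale_dep p i / w i \<le> scale_const * (2 ^ i) powr (- \<alpha>) / (\<zeta> * (2 ^ i) powr (- (\<alpha> / 2)))"
        using scale_dep_le[of i] scale_const_pos zpos wpos[of i] by (intro frac_le) (auto simp: w_def)
      also have "\<dots> = scale_const / \<zeta> * ((2 ^ i) powr (- \<alpha>) / (2 ^ i) powr (- (\<alpha> / 2)))" by simp
      also have "(2 ^ i :: real) powr (- \<alpha>) / (2 ^ i) powr (- (\<alpha> / 2)) = (2 ^ i) powr (- (\<alpha> / 2))"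
        by (simp flip: powr_diff)
      finally have "sqrt (martingale_const p) * (scale_dep p i / w i) * Lp_norm P p G / norm4
          \<le> sqrt (martingale_const p) * (scale_const / \<zeta> * (2 ^ i) powr (- (\<alpha> / 2))) * Lp_norm P p G / norm4"
        using martingale_const_ge_1[of p] p4 s by (intro divide_right_mono mult_right_mono mult_left_mono) auto
      thus "sqrt (martingale_const p) * scale_dep p i * Lp_norm P p G / (norm4 * w i)
          \<le> sqrt (martingale_const p) * (scale_const / \<zeta>) * Lp_norm P p G / norm4 * (2 ^ i) powr (- (\<alpha> / 2))"
        by (simp add: mult_ac)
      show "0 \<le> sqrt (martingale_const p) * scale_dep p i * Lp_norm P p G / (norm4 * w i)"
        using martingale_const_ge_1[of p] p4 s wpos[of i] by (intro divide_nonneg_pos mult_nonneg_nonneg mult_pos_pos) auto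
    qed (use p4 in auto)
    also have "\<dots> = C * (2 ^ i) powr (- (\<alpha> * p / 2))"
      unfolding C_def by (subst powr_mult) (simp add: powr_powr)
    finally have "(sqrt (martingale_const p) * scale_dep p i * Lp_norm P p G / (norm4 * w i)) powr p
         * (2 ^ i) powr (p / 2 - 1) * real T * (ln (real T) / real T) powr (p / 2)
       \<le> C * (2 ^ i) powr (- (\<alpha> * p / 2)) * (2 ^ i) powr (p / 2 - 1) * real T * (ln (real T) / real T) powr (p / 2)"
      by (intro mult_right_mono) auto
    also have "\<dots> = C * ((2 ^ i) powr ?e * real T powr (1 - p / 2)) * ln (real T) powr (p / 2)"
    proof -
      have "(2 ^ i :: real) powr (- (\<alpha> * p / 2)) * (2 ^ i) powr (p / 2 - 1) = (2 ^ i) powr ?e"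
        unfolding powr_add[symmetric] by (simp add: algebra_simps)
      moreover have "real T * (ln (real T) / real T) powr (p / 2) = real T powr (1 - p / 2) * ln (real T) powr (p / 2)"
        using T lT by (simp add: powr_divide powr_diff)
      ultimately show ?thesis by (simp add: mult.assoc[symmetric])
    qed
    also have "(2 ^ i) powr ?e * real T powr (1 - p / 2) \<le> real T powr (- 1 - \<eta>)"
    proof (cases "?e \<ge> 0")
      case True
      have "(2 ^ i) powr ?e * real T powr (1 - p / 2) \<le> real T powr ?e * real T powr (1 - p / 2)"
        using iT True by (intro mult_right_mono powr_mono2) auto
      also have "\<dots> = real T powr (- (\<alpha> * p / 2))" using T by (simp flip: powr_add)
      also have "\<dots> \<le> real T powr (- 1 - \<eta>)" using T by (intro powr_mono) (auto simp: \<eta>_def)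
      finally show ?thesis .
    next
      case False
      have "(2 ^ i) powr ?e \<le> (1::real) powr ?e" using False by (intro powr_mono2') auto
      hence "(2 ^ i) powr ?e * real T powr (1 - p / 2) \<le> 1 * real T powr (1 - p / 2)" by (intro mult_right_mono) auto
      also have "\<dots> \<le> real T powr (- 1 - \<eta>)" using T by (auto intro!: powr_mono simp: \<eta>_def)
      finally show ?thesis .
    qed
    finally have "(sqrt (martingale_const p) * scale_dep p i * Lp_norm P p G / (norm4 * w i)) powr p
         * (2 ^ i) powr (p / 2 - 1) * real T * (ln (real T) / real T) powr (p / 2)
       \<le> C * real T powr (- 1 - \<eta>) * ln (real T) powr (p / 2)" by (simp add: C_def mult_left_mono mult_right_mono)
    note bound = this
    have "scale_dep 4 i \<le> w i" using zpos by (simp add: w_def)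
    from layer_sum_tail[OF T s wpos[of i] this k2, of "lv k"] show ?thesis
      by (rule prob_le_mono) (use bound in auto)
  qed
  let ?I = "\<lambda>T::nat. {i. (2::nat) ^ i \<le> T}"
  define \<epsilon> where "\<epsilon> T = (2 * ln (real T) + 1) * (4 * sum_dep4\<^sup>2 / norm4\<^sup>2 / real T) + real T * ((2 * ln (real T) + 1) * ?\<epsilon>i T)" for T :: nat
  have "\<epsilon> \<longlonglongrightarrow> 0"
  proof -
    have l1: "(\<lambda>T. (2 * ln (real T) + 1) / real T) \<longlonglongrightarrow> 0" by real_asymp
    have l2: "(\<lambda>T. real T * (2 * ln (real T) + 1) * real T powr (- 3)) \<longlonglongrightarrow> 0" by real_asymp
    have l3: "(\<lambda>T. real T * (2 * ln (real T) + 1) * (real T powr (- 1 - \<eta>) * ln (real T) powr (p / 2))) \<longlonglongrightarrow> 0"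
      using eta by real_asymp
    have "(\<lambda>T. (4 * sum_dep4\<^sup>2 / norm4\<^sup>2) * ((2 * ln (real T) + 1) / real T)
        + (4 * (real T * (2 * ln (real T) + 1) * real T powr (- 3))
          + C * (real T * (2 * ln (real T) + 1) * (real T powr (- 1 - \<eta>) * ln (real T) powr (p / 2)))))
        \<longlonglongrightarrow> (4 * sum_dep4\<^sup>2 / norm4\<^sup>2) * 0 + (4 * 0 + C * 0)"
      by (intro tendsto_intros l1 l2 l3)
    thus ?thesis unfolding \<epsilon>_def by (simp add: algebra_simps)
  qed
  moreover have "prob_le (\<lambda>x. \<exists>k\<in>{2..<T}.
      \<bar>\<Sum>t\<in>{int k + 1..int T}. approx (lv k) t x * approx (lv k) (t - int k) x\<bar>
        \<ge> 20 * norm4 * sum_dep4 * sqrt (real T * ln (real T))) (\<epsilon> T)" if T: "T \<ge> 3" for T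
  proof -
    let ?bad = "\<lambda>n x. (\<Sum>t\<in>{1..int T}. (approx n t x)\<^sup>2) > 2 * real T * norm4\<^sup>2"
    let ?lay = "\<lambda>k i x. \<bar>\<Sum>t\<in>{int k + 1..int T}. approx (lv k) (t - int k) x * layer i t x\<bar> \<ge> 10 * norm4 * w i * sqrt (real T * ln (real T))
          \<and> (\<Sum>t\<in>{1..int T}. (approx (lv k) t x)\<^sup>2) \<le> 2 * real T * norm4\<^sup>2"
    have T1: "T \<ge> 1" using T by simp
    note cI = card_dyadic_le[OF T1]
    have lvI: "lv k \<in> ?I T" if "k \<in> {2..<T}" for k using lv[of k] that by auto
    have eps0: "?\<epsilon>i T \<ge> 0" by (simp add: C_def)
    have b: "prob_le (\<lambda>x. \<exists>n\<in>?I T. ?bad n x) (\<Sum>n\<in>?I T. 4 * sum_dep4\<^sup>2 / norm4\<^sup>2 / real T)"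
      by (intro prob_le_ex cI(1) approx_square_sum_tail T1 s)
    have l: "prob_le (\<lambda>x. \<exists>k\<in>{2..<T}. \<exists>i\<in>{..lv k}. ?lay k i x) (\<Sum>k\<in>{2..<T}. \<Sum>i\<in>{..lv k}. ?\<epsilon>i T)"
      using T by (intro prob_le_ex layer) auto
    show ?thesis
    proof (rule prob_le_mono[OF prob_le_disj[OF b l]])
      fix x assume "\<exists>k\<in>{2..<T}. \<bar>\<Sum>t\<in>{int k + 1..int T}. approx (lv k) t x * approx (lv k) (t - int k) x\<bar>
        \<ge> 20 * norm4 * sum_dep4 * sqrt (real T * ln (real T))"
      then obtain k where k: "k \<in> {2..<T}" "\<bar>\<Sum>t\<in>{int k + 1..int T}. approx (lv k) t x * approx (lv k) (t - int k) x\<bar>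
        \<ge> 20 * norm4 * sum_dep4 * sqrt (real T * ln (real T))" by auto
      show "(\<exists>n\<in>?I T. ?bad n x) \<or> (\<exists>k\<in>{2..<T}. \<exists>i\<in>{..lv k}. ?lay k i x)"
      proof (rule ccontr)
        assume "\<not> ?thesis"
        hence no: "\<not> ?bad (lv k) x" "\<And>i. i \<le> lv k \<Longrightarrow> \<not> ?lay k i x" using k(1) lvI by auto
        have "(\<Sum>t\<in>{int k + 1..int T}. approx (lv k) t x * approx (lv k) (t - int k) x)
            = (\<Sum>t\<in>{int k + 1..int T}. \<Sum>i\<le>lv k. approx (lv k) (t - int k) x * layer i t x)"
        proof (rule sum.cong[OF refl])
          fix t
          show "approx (lv k) t x * approx (lv k) (t - int k) x = (\<Sum>i\<le>lv k. approx (lv k) (t - int k) x * layer i t x)"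
            unfolding sum_distrib_left[symmetric] approx_eq_sum_layer[of "lv k" t x, symmetric] by simp
        qed
        also have "\<dots> = (\<Sum>i\<le>lv k. \<Sum>t\<in>{int k + 1..int T}. approx (lv k) (t - int k) x * layer i t x)" by (rule sum.swap)
        finally have "\<bar>\<Sum>t\<in>{int k + 1..int T}. approx (lv k) t x * approx (lv k) (t - int k) x\<bar>
            \<le> (\<Sum>i\<le>lv k. \<bar>\<Sum>t\<in>{int k + 1..int T}. approx (lv k) (t - int k) x * layer i t x\<bar>)"
          by (simp only: sum_abs)
        also have "\<dots> < (\<Sum>i\<le>lv k. 10 * norm4 * w i * sqrt (real T * ln (real T)))"
          using no by (intro sum_strict_mono) (auto simp: not_le not_less)
        also have "\<dots> = 10 * norm4 * sqrt (real T * ln (real T)) * (\<Sum>i\<le>lv k. w i)"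
          unfolding sum_distrib_left by (intro sum.cong) (auto simp: mult_ac)
        also have "\<dots> \<le> 10 * norm4 * sqrt (real T * ln (real T)) * (2 * sum_dep4)"
          using sum_w s T by (intro mult_left_mono) auto
        finally show False using k(2) by (simp add: mult_ac)
      qed
    next
      have "(\<Sum>n\<in>?I T. 4 * sum_dep4\<^sup>2 / norm4\<^sup>2 / real T) \<le> (2 * ln (real T) + 1) * (4 * sum_dep4\<^sup>2 / norm4\<^sup>2 / real T)"
        using cI(2) by (simp add: mult_right_mono divide_right_mono)
      moreover have "(\<Sum>k\<in>{2..<T}. \<Sum>i\<in>{..lv k}. ?\<epsilon>i T) \<le> (\<Sum>k\<in>{2..<T}. (2 * ln (real T) + 1) * ?\<epsilon>i T)"
      proof (rule sum_mono)
        fix k assume k: "k \<in> {2..<T}"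
        have "{..lv k} \<subseteq> ?I T"
        proof
          fix i assume "i \<in> {..lv k}"
          hence "(2::nat) ^ i \<le> 2 ^ lv k" by (intro power_increasing) auto
          moreover have "(2::nat) ^ lv k \<le> T" using lvI[OF k] by simp
          ultimately have "(2::nat) ^ i \<le> T" by (rule order_trans)
          thus "i \<in> ?I T" by simp
        qed
        hence "card {..lv k} \<le> card (?I T)" using cI(1) by (rule card_mono[rotated])
        hence "real (card {..lv k}) \<le> 2 * ln (real T) + 1" using cI(2) by linarith
        hence "real (card {..lv k}) * ?\<epsilon>i T \<le> (2 * ln (real T) + 1) * ?\<epsilon>i T" using eps0 by (rule mult_right_mono)
        thus "(\<Sum>i\<in>{..lv k}. ?\<epsilon>i T) \<le> (2 * ln (real T) + 1) * ?\<epsilon>i T" by (simp only: sum_constant)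
      qed
      moreover have "(\<Sum>k\<in>{2..<T}. (2 * ln (real T) + 1) * ?\<epsilon>i T) \<le> real T * ((2 * ln (real T) + 1) * ?\<epsilon>i T)"
        using eps0 T unfolding sum_constant by (intro mult_right_mono mult_nonneg_nonneg) auto
      ultimately show "(\<Sum>n\<in>?I T. 4 * sum_dep4\<^sup>2 / norm4\<^sup>2 / real T) + (\<Sum>k\<in>{2..<T}. \<Sum>i\<in>{..lv k}. ?\<epsilon>i T) \<le> \<epsilon> T"
        unfolding \<epsilon>_def by linarith
    qed
  qed
  ultimately show ?thesis by (intro exI[of _ \<epsilon>]) auto
qed

end

section \<open>Remainders of the lagged products: decay of \<open>\<Delta>\<close>\<close>

lemma
  fixes h :: "nat \<Rightarrow> real"
  assumes "summable h"
  shows summable_delay: "summable (\<lambda>j. if k \<le> j then h (j - k) else 0)"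
    and suminf_delay: "(\<Sum>j. if k \<le> j then h (j - k) else 0) = (\<Sum>j. h j)"
proof -
  let ?f = "\<lambda>j. if k \<le> j then h (j - k) else 0"
  show S: "summable ?f"
    using assms by (subst summable_iff_shift[of ?f k, symmetric]) simp
  show "(\<Sum>j. ?f j) = (\<Sum>j. h j)"
    using suminf_split_initial_segment[OF S, of k] by simp
qed

lemma tsums_square_le:
  fixes d :: "nat \<Rightarrow> real"
  assumes d: "summable d" "\<And>j. d j \<ge> 0"
  shows "summable (\<lambda>j. (d j)\<^sup>2)" "sqrt (\<Sum>j. (d j)\<^sup>2) \<le> (\<Sum>j. d j)"
proof -
  have le: "d j \<le> (\<Sum>j. d j)" for j
    using sum_le_suminf[OF d(1), of "{j}"] d(2) by auto
  have sq: "(d j)\<^sup>2 \<le> (\<Sum>j. d j) * d j" for j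
    using le[of j] d(2)[of j] by (simp add: power2_eq_square mult_right_mono)
  have S: "summable (\<lambda>j. (\<Sum>j. d j) * d j)" using d by (intro summable_mult)
  show S2: "summable (\<lambda>j. (d j)\<^sup>2)" by (rule summable_comparison_test'[OF S]) (use sq in auto)
  have "(\<Sum>j. (d j)\<^sup>2) \<le> (\<Sum>j. (\<Sum>j. d j) * d j)" by (rule suminf_le[OF sq S2 S])
  also have "\<dots> = (\<Sum>j. d j)\<^sup>2" using d by (simp add: suminf_mult power2_eq_square)
  finally show "sqrt (\<Sum>j. (d j)\<^sup>2) \<le> (\<Sum>j. d j)"
    using suminf_nonneg[OF d] by (intro real_le_lsqrt) auto
qed

context causal_process begin

definition rest :: "nat \<Rightarrow> int \<Rightarrow> (int \<Rightarrow> real) \<Rightarrow> real" where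
  "rest n t x = X t x - approx n t x"

lemma in_Lp_rest: "1 \<le> q \<Longrightarrow> q \<le> p \<Longrightarrow> in_Lp P q (rest n t)"
  unfolding rest_def[abs_def] by (intro in_Lp_diff in_Lp_X in_Lp_approx) auto

lemma coupling_X_at: "coupling q (X t) (t - 2 ^ n + 1 - 1 - int j) = dep q (j + 2 ^ n)"
proof -
  have "t - 2 ^ n + 1 - 1 - int j = t - int (j + 2 ^ n)" by simp
  thus ?thesis using coupling_X by metis
qed

lemma Lp_norm_rest_Theta:
  assumes "1 \<le> q" "q \<le> p" shows "Lp_norm P q (rest n t) \<le> (\<Sum>j. dep q (j + 2 ^ n))"
  using Lp_norm_cexp_remainder_sum[OF in_Lp_X[of q t], of "t - 2 ^ n + 1"] assms
    summable_ignore_initial_segment[OF summable_dep[of q], of "2 ^ n"]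
  unfolding coupling_X_at rest_def[abs_def] approx_def by simp

lemma Lp_norm_rest_Psi:
  "Lp_norm P p (rest n t) \<le> sqrt (martingale_const p) * Psi_tail (dep p) (2 ^ n)"
proof -
  have S: "summable (\<lambda>j. dep p (j + 2 ^ n))" using summable_dep[of p] p4 by (intro summable_ignore_initial_segment) auto
  show ?thesis
    using Lp_norm_cexp_remainder_square_sum[OF in_Lp_X[of p t], of "t - 2 ^ n + 1"] p4 tsums_square_le(1)[OF S]
    unfolding coupling_X_at rest_def[abs_def] approx_def Psi_tail_def by simp
qed

text \<open>
  The two entries of the minimum in \<open>\<Delta>\<close>: resampling changes the remainder by no more than it changes the
  process and its approximation, and by no more than twice the remainder itself.
\<close>

lemma coupling_rest_le:
  "coupling p (rest n t) (t - int j)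
    \<le> 2 * sqrt (martingale_const p) * min (sqrt (p - 1) * Psi_tail (dep p) (2 ^ n)) (dep p j)"
proof -
  have mc: "sqrt (martingale_const p) \<ge> 1" using martingale_const_ge_1[of p] p4 by simp
  have psi: "Psi_tail (dep p) (2 ^ n) \<ge> 0"
  proof -
    have S: "summable (\<lambda>j. dep p (j + 2 ^ n))" using summable_dep[of p] p4 by (intro summable_ignore_initial_segment) auto
    show ?thesis unfolding Psi_tail_def using tsums_square_le(1)[OF S] by (auto intro!: suminf_nonneg)
  qed
  have sp: "sqrt (p - 1) \<ge> 1" using p4 by simp
  have "coupling p (rest n t) (t - int j) \<le> coupling p (X t) (t - int j) + coupling p (approx n t) (t - int j)"
    unfolding rest_def[abs_def] using p4 by (intro coupling_diff_le in_Lp_X in_Lp_approx) auto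
  also have "\<dots> \<le> 2 * dep p j" using coupling_approx_le[of p n t "t - int j"] p4 by (simp add: coupling_X)
  also have "\<dots> \<le> 2 * sqrt (martingale_const p) * dep p j"
  proof -
    have "1 * dep p j \<le> sqrt (martingale_const p) * dep p j" using mc by (intro mult_right_mono) auto
    thus ?thesis by simp
  qed
  finally have 1: "coupling p (rest n t) (t - int j) \<le> 2 * sqrt (martingale_const p) * dep p j" .
  have "coupling p (rest n t) (t - int j) \<le> 2 * Lp_norm P p (rest n t)"
    using p4 by (intro coupling_le_2_norm in_Lp_rest) auto
  also have "\<dots> \<le> 2 * sqrt (martingale_const p) * (1 * Psi_tail (dep p) (2 ^ n))"
    using Lp_norm_rest_Psi[of n t] by simp
  also have "\<dots> \<le> 2 * sqrt (martingale_const p) * (sqrt (p - 1) * Psi_tail (dep p) (2 ^ n))"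
    using mc psi sp by (intro mult_left_mono mult_right_mono) auto
  finally show ?thesis using 1 by (auto simp: min_def)
qed

definition acov :: "nat \<Rightarrow> real" where
  "acov k = (LINT x|P. X 0 x * X (int k) x)"

lemma acov_shift: "(LINT x|P. X t x * X (t - int k) x) = acov k"
proof -
  have [measurable]: "X s \<in> borel_measurable P" for s unfolding X_def[abs_def] by measurable
  have "X s (tshift u x) = X (s + u) x" for s u x by (simp add: X_def tshift_def algebra_simps)
  hence "(LINT x|P. X t x * X (t - int k) x) = (LINT x|P. (\<lambda>x. X 0 x * X (int k) x) (tshift (t - int k) x))"
    by (simp add: mult.commute)
  also have "\<dots> = acov k" unfolding acov_def by (rule integral_shift) measurable
  finally show ?thesis .
qed

lemma X_tshift: "X s (tshift u x) = X (s + u) x"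
  by (simp add: X_def tshift_def algebra_simps)

lemma approx_tshift: "approx n s (tshift u x) = approx n (s + u) x"
  unfolding approx_shift[of n s] approx_shift[of n "s + u"] by (simp add: tshift_def algebra_simps)

lemma measurable_X [measurable]: "X t \<in> borel_measurable P"
  unfolding X_def[abs_def] by measurable

lemma integrable_mult_L2: "in_Lp P 2 u \<Longrightarrow> in_Lp P 2 v \<Longrightarrow> integrable P (\<lambda>x. u x * v x)"
  using in_Lp_mult[of P 1 u v] PP.in_Lp_imp_integrable[of 1] by auto

lemma integral_approx: "(LINT x|P. approx n t x) = 0"
  unfolding approx_def by (simp add: integral_cexp integrable_X integral_X)

text \<open>
  With memory at most \<open>k\<close> the two factors have no innovation in common.
\<close>

lemma integral_approx_mult:
  assumes "2 ^ n \<le> k" shows "(LINT x|P. approx n t x * approx n (t - int k) x) = 0"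
proof -
  have "2 ^ n \<le> int k"
  proof -
    have "int (2 ^ n) \<le> int k" using assms by (simp only: of_nat_le_iff)
    thus ?thesis by simp
  qed
  hence disj: "{t - 2 ^ n + 1..t} \<inter> {..t - int k} = {}" by auto
  have "(LINT x|P. approx n (t - int k) x * approx n t x) = 0"
  proof (rule integral_mult_cexp_eq_0)
    show "depends_on (approx n (t - int k)) {..t - int k}" by (rule depends_on_mono[OF depends_on_approx]) auto
    show "AE x in P. cexp {..t - int k} (approx n t) x = 0"
      by (simp add: cexp_indep[OF depends_on_approx disj] integral_approx)
    show "integrable P (\<lambda>x. approx n (t - int k) x * approx n t x)"
      using p4 by (intro integrable_mult_L2 in_Lp_approx) auto
  qed
  thus ?thesis by (simp add: mult.commute)
qed

text \<open>
  The approximations are uncorrelated at lag \<open>k\<close> when \<open>2 ^ n \<le> k\<close>, so the whole autocovariance belongs to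
  the remainder.
\<close>

definition lag_rest :: "nat \<Rightarrow> nat \<Rightarrow> nat \<Rightarrow> (int \<Rightarrow> real) \<Rightarrow> real" where
  "lag_rest n k T x = (\<Sum>t\<in>{int k + 1..int T}.
     X t x * X (t - int k) x - acov k - approx n t x * approx n (t - int k) x)"

text \<open>
  Writing the difference of the products as \<open>rest * X + approx * rest\<close> gives two stationary products in
  which one factor is a remainder. By the product rule for couplings the remainder contributes either
  its norm, of the order \<open>\<Psi>\<close>, or its own couplings, which sum to \<open>\<Delta>\<close>. Couplings of the factor at time \<open>- k\<close>
  are delayed by \<open>k\<close>, which does not change their sum.
\<close>

lemma Lp_norm_lag_rest:
  assumes k: "2 ^ n \<le> k"
  defines "S \<equiv> (\<Sum>j. dep p j)" and "N \<equiv> Lp_norm P p G" and "M \<equiv> 2 * sqrt (martingale_const p)"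
  shows "in_Lp P (p / 2) (lag_rest n k T)"
    and "Lp_norm P (p / 2) (lag_rest n k T) \<le> sqrt (martingale_const (p / 2)) * sqrt (real T)
      * (M * S * Psi_tail (dep p) (2 ^ n) + 2 * N * M * Delta_tail p (dep p) (2 ^ n))"
proof -
  let ?q = "p / 2" and ?\<psi> = "Psi_tail (dep p) (2 ^ n)" and ?X' = "X (- int k)"
  have q: "?q \<ge> 2" "?q \<ge> 1" "2 * ?q = p" using p4 by auto
  have Sd: "summable (dep p)" using summable_dep[of p] p4 by simp
  define m where "m j = min (sqrt (p - 1) * ?\<psi>) (dep p j)" for j
  have psi: "?\<psi> \<ge> 0"
    unfolding Psi_tail_def using tsums_square_le(1)[OF summable_ignore_initial_segment[OF Sd, of "2 ^ n"]]
    by (auto intro!: suminf_nonneg)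
  have m0: "m j \<ge> 0" for j using psi p4 by (simp add: m_def)
  have Sm: "summable m" by (rule summable_comparison_test'[OF Sd]) (use m0 in \<open>auto simp: m_def\<close>)
  have Delta: "(\<Sum>j. m j) = Delta_tail p (dep p) (2 ^ n)" by (simp add: m_def Delta_tail_def)
  have M: "M \<ge> 0" using martingale_const_ge_1[of p] p4 by (simp add: M_def)
  have N: "N \<ge> 0" by (simp add: N_def)
  let ?g1 = "\<lambda>x. rest n 0 x * ?X' x" and ?g2 = "\<lambda>x. approx n 0 x * rest n (- int k) x"
  let ?f = "\<lambda>x. ?g1 x + ?g2 x"
  have L: "in_Lp P (2 * ?q) (rest n t)" "in_Lp P (2 * ?q) (X t)" "in_Lp P (2 * ?q) (approx n t)" for t
    unfolding q(3) using p4 by (auto intro!: in_Lp_rest in_Lp_X in_Lp_approx)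
  have g: "in_Lp P ?q ?g1" "in_Lp P ?q ?g2"
    using p4 by (auto intro!: in_Lp_mult[OF L(1) L(2)] in_Lp_mult[OF L(3) L(1)])
  have fL: "in_Lp P ?q ?f" using g p4 by (intro in_Lp_add) auto
  have f: "?f x = X 0 x * ?X' x - approx n 0 x * approx n (- int k) x" for x
    by (simp add: rest_def algebra_simps)
  have fD: "depends_on ?f {..0}"
    unfolding f
    by (intro depends_on_comp2[where h = minus] depends_on_comp2[where h = times])
       (rule depends_on_mono[OF depends_on_X] depends_on_mono[OF depends_on_approx]; auto)+
  define d1 where "d1 = (\<lambda>j. if k \<le> j then dep p (j - k) else 0)"
  define m1 where "m1 = (\<lambda>j. if k \<le> j then m (j - k) else 0)"
  have delay: "- int j = - int k - int (j - k)" if "k \<le> j" for j using that by simp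
  have cX: "coupling p ?X' (- int j) \<le> d1 j" for j
  proof (cases "k \<le> j")
    case True thus ?thesis using coupling_X[of p "- int k" "j - k"] by (simp add: d1_def)
  next
    case False
    thus ?thesis using coupling_eq_0[OF depends_on_X[of "- int k"], of "- int j"] by (simp add: d1_def)
  qed
  have cR: "coupling p (rest n (- int k)) (- int j) \<le> M * m1 j" for j
  proof (cases "k \<le> j")
    case True thus ?thesis using coupling_rest_le[of n "- int k" "j - k"] by (simp add: m1_def m_def M_def)
  next
    case False
    have "depends_on (rest n (- int k)) {..- int k}"
      unfolding rest_def[abs_def]
      by (intro depends_on_comp2[where h = minus] depends_on_X depends_on_mono[OF depends_on_approx]) auto
    thus ?thesis using coupling_eq_0[of _ "{..- int k}" "- int j"] False by (simp add: m1_def)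
  qed
  have cR0: "coupling p (rest n 0) (- int j) \<le> M * m j" for j
    using coupling_rest_le[of n 0 j] by (simp add: m_def M_def)
  have cA0: "coupling p (approx n 0) (- int j) \<le> dep p j" for j
    using coupling_approx_le[of p n 0 "- int j"] coupling_X[of p 0 j] p4 by simp
  have nR: "Lp_norm P p (rest n t) \<le> M / 2 * ?\<psi>" for t using Lp_norm_rest_Psi[of n t] by (simp add: M_def)
  have nA: "Lp_norm P p (approx n t) \<le> N" for t unfolding N_def using p4 by (intro Lp_norm_approx_le) auto
  define bd where "bd j = M / 2 * ?\<psi> * d1 j + N * (M * m j) + (N * (M * m1 j) + M / 2 * ?\<psi> * dep p j)" for j
  have cf: "coupling ?q ?f (- int j) \<le> bd j" for j
  proof -
    have "coupling ?q ?f (- int j) \<le> coupling ?q ?g1 (- int j) + coupling ?q ?g2 (- int j)"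
      using g q by (intro coupling_add_le) auto
    also have "coupling ?q ?g1 (- int j) \<le> Lp_norm P p (rest n 0) * coupling p ?X' (- int j) + Lp_norm P p ?X' * coupling p (rest n 0) (- int j)"
      using coupling_mult_le[OF L(1) L(2) q(2)] unfolding q(3) .
    also have "\<dots> \<le> M / 2 * ?\<psi> * d1 j + N * (M * m j)"
      using nR cX cR0 M psi N unfolding Lp_norm_X N_def[symmetric]
      by (intro add_mono mult_mono) auto
    also have "coupling ?q ?g2 (- int j) \<le> Lp_norm P p (approx n 0) * coupling p (rest n (- int k)) (- int j) + Lp_norm P p (rest n (- int k)) * coupling p (approx n 0) (- int j)"
      using coupling_mult_le[OF L(3) L(1) q(2)] unfolding q(3) .
    also have "\<dots> \<le> N * (M * m1 j) + M / 2 * ?\<psi> * dep p j"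
      using nR nA cR cA0 M psi N by (intro add_mono mult_mono) auto
    finally show ?thesis by (simp add: bd_def)
  qed
  have S1: "summable d1" "summable m1" "suminf d1 = S" "suminf m1 = (\<Sum>j. m j)"
    unfolding d1_def m1_def S_def using summable_delay suminf_delay Sd Sm by auto
  have Sbd: "summable bd" unfolding bd_def using S1 Sm Sd by (intro summable_add summable_mult) auto
  have Scf: "summable (\<lambda>j. coupling ?q ?f (- int j))"
    by (rule summable_comparison_test'[OF Sbd]) (use cf in simp)
  have "(\<Sum>j. coupling ?q ?f (- int j)) \<le> (\<Sum>j. bd j)" by (rule suminf_le[OF cf Scf Sbd])
  also have "(\<Sum>j. bd j) = M / 2 * ?\<psi> * S + N * (M * (\<Sum>j. m j)) + (N * (M * (\<Sum>j. m j)) + M / 2 * ?\<psi> * S)"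
  proof -
    have "d1 sums S" "m1 sums (\<Sum>j. m j)" "m sums (\<Sum>j. m j)" "dep p sums S"
      using S1 Sm Sd by (auto simp: sums_iff S_def)
    hence "bd sums (M / 2 * ?\<psi> * S + N * (M * (\<Sum>j. m j)) + (N * (M * (\<Sum>j. m j)) + M / 2 * ?\<psi> * S))"
      unfolding bd_def by (intro sums_add sums_mult)
    thus ?thesis by (simp add: sums_iff)
  qed
  also have "\<dots> = M * S * ?\<psi> + 2 * N * M * Delta_tail p (dep p) (2 ^ n)"
    unfolding Delta by (simp add: algebra_simps)
  finally have sumle: "(\<Sum>j. coupling ?q ?f (- int j)) \<le> M * S * ?\<psi> + 2 * N * M * Delta_tail p (dep p) (2 ^ n)" .
  have Ef: "(LINT x|P. ?f x) = acov k"
  proof -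
    have "(LINT x|P. ?f x) = (LINT x|P. X 0 x * X (0 - int k) x) - (LINT x|P. approx n 0 x * approx n (0 - int k) x)"
      unfolding f using p4 by (subst Bochner_Integration.integral_diff)
        (auto intro!: integrable_mult_L2 in_Lp_X in_Lp_approx)
    thus ?thesis unfolding acov_shift integral_approx_mult[OF k] by simp
  qed
  have eq: "lag_rest n k T = (\<lambda>x. \<Sum>t\<in>{int k + 1..int T}. ?f (tshift t x) - (LINT x|P. ?f x))"
  proof
    fix x
    have ft: "?f (tshift t x) = X t x * X (t - int k) x - approx n t x * approx n (t - int k) x" for t
      using f[of "tshift t x"] by (simp add: X_tshift approx_tshift)
    show "lag_rest n k T x = (\<Sum>t\<in>{int k + 1..int T}. ?f (tshift t x) - (LINT x|P. ?f x))"
      unfolding Ef ft lag_rest_def by (intro sum.cong) auto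
  qed
  show "in_Lp P ?q (lag_rest n k T)"
    unfolding eq using in_Lp_shift[OF fL] p4 by (intro in_Lp_sum in_Lp_diff) auto
  have "Lp_norm P ?q (lag_rest n k T) \<le> sqrt (martingale_const ?q) * sqrt (real (card {int k + 1..int T})) * (\<Sum>j. coupling ?q ?f (- int j))"
    unfolding eq by (rule Lp_norm_stationary_sum[OF fL q(1) fD _ Scf]) simp
  also have "\<dots> \<le> sqrt (martingale_const ?q) * sqrt (real T) * (M * S * ?\<psi> + 2 * N * M * Delta_tail p (dep p) (2 ^ n))"
    using sumle suminf_nonneg[OF Scf] martingale_const_ge_1[OF q(1)] by (intro mult_mono) auto
  finally show "Lp_norm P ?q (lag_rest n k T) \<le> sqrt (martingale_const ?q) * sqrt (real T)
      * (M * S * ?\<psi> + 2 * N * M * Delta_tail p (dep p) (2 ^ n))" .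
qed

end

context causal_process_rate begin

text \<open>
  Markov's inequality of order \<open>p / 2\<close> bounds the probability at lag \<open>k\<close> by a multiple of
  \<open>k powr (- \<alpha>' p / 2)\<close>. The exponent is below \<open>- 1\<close>, so the lags from \<open>m T\<close> on contribute the tail of a
  convergent series.
\<close>

theorem lag_rest_tail_Delta:
  fixes m :: "nat \<Rightarrow> nat"
  assumes \<alpha>': "\<alpha>' > 0" "\<alpha>' \<le> \<alpha>" "\<alpha>' * p > 2" and D': "D' > 0"
    and Delta: "\<And>m. m \<ge> 1 \<Longrightarrow> Delta_tail p (dep p) m \<le> D' * real m powr (- \<alpha>')"
    and lv: "\<And>k. k \<ge> 2 \<Longrightarrow> 2 * 2 ^ lv k \<le> k \<and> k < 4 * 2 ^ lv k"
    and m: "filterlim m at_top sequentially" and c: "c > 0"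
  shows "\<exists>\<epsilon>. \<epsilon> \<longlonglongrightarrow> 0 \<and> (\<forall>\<^sub>F T in sequentially. prob_le (\<lambda>x. \<exists>k\<in>{m T..<T}.
      \<bar>lag_rest (lv k) k T x\<bar> \<ge> c * sqrt (real T * ln (real T))) (\<epsilon> T))"
proof -
  let ?q = "p / 2"
  define S N M where "S = (\<Sum>j. dep p j)" and "N = Lp_norm P p G" and "M = 2 * sqrt (martingale_const p)"
  have mc: "martingale_const p \<ge> 1" "martingale_const ?q \<ge> 1" using p4 by (auto intro!: martingale_const_ge_1)
  have Sd: "summable (dep p)" using summable_dep[of p] p4 by simp
  have nn: "S \<ge> 0" "N \<ge> 0" "M > 0" unfolding S_def N_def M_def using mc Sd by (auto intro!: suminf_nonneg)
  define K where "K = sqrt (martingale_const ?q) * (M * S * D + 2 * N * M * D') * 4 powr \<alpha>'"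
  have K0: "K \<ge> 0" unfolding K_def using mc nn D D' by (intro mult_nonneg_nonneg add_nonneg_nonneg) auto
  have norm: "Lp_norm P ?q (lag_rest (lv k) k T) \<le> K * sqrt (real T) * real k powr (- \<alpha>')" if k: "k \<ge> 2" for k T
  proof -
    let ?n = "lv k"
    have le: "2 ^ ?n \<le> k" using lv[OF k] by linarith
    have n1: "real (2 ^ ?n) \<ge> 1" by simp
    have "Psi_tail (dep p) (2 ^ ?n) \<le> (\<Sum>j. dep p (j + 2 ^ ?n))"
      unfolding Psi_tail_def by (intro tsums_square_le(2) summable_ignore_initial_segment Sd) simp
    also have "\<dots> \<le> D * real (2 ^ ?n) powr (- \<alpha>)" by (rule tail) simp
    also have "\<dots> \<le> D * real (2 ^ ?n) powr (- \<alpha>')" using D \<alpha>' n1 by (intro mult_left_mono powr_mono) auto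
    finally have psi: "Psi_tail (dep p) (2 ^ ?n) \<le> D * real (2 ^ ?n) powr (- \<alpha>')" .
    have del: "Delta_tail p (dep p) (2 ^ ?n) \<le> D' * real (2 ^ ?n) powr (- \<alpha>')" by (rule Delta) simp
    have "real k \<le> 4 * real (2 ^ ?n)"
    proof -
      have "k \<le> 4 * 2 ^ ?n" using lv[OF k] by linarith
      hence "real k \<le> real (4 * 2 ^ ?n)" by (simp only: of_nat_le_iff)
      thus ?thesis by simp
    qed
    hence "(4 * real (2 ^ ?n)) powr (- \<alpha>') \<le> real k powr (- \<alpha>')" using k \<alpha>' by (intro powr_mono2') auto
    hence kn: "real (2 ^ ?n) powr (- \<alpha>') \<le> 4 powr \<alpha>' * real k powr (- \<alpha>')"
      unfolding powr_mult by (simp add: powr_minus field_simps)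
    have "Lp_norm P ?q (lag_rest ?n k T) \<le> sqrt (martingale_const ?q) * sqrt (real T)
      * (M * S * Psi_tail (dep p) (2 ^ ?n) + 2 * N * M * Delta_tail p (dep p) (2 ^ ?n))"
      using Lp_norm_lag_rest(2)[OF le, of T] by (simp add: S_def N_def M_def)
    also have "\<dots> \<le> sqrt (martingale_const ?q) * sqrt (real T)
      * (M * S * (D * real (2 ^ ?n) powr (- \<alpha>')) + 2 * N * M * (D' * real (2 ^ ?n) powr (- \<alpha>')))"
      using psi del nn mc by (intro mult_left_mono add_mono) auto
    also have "\<dots> = sqrt (martingale_const ?q) * sqrt (real T) * (M * S * D + 2 * N * M * D') * real (2 ^ ?n) powr (- \<alpha>')"
      by (simp add: algebra_simps)
    also have "\<dots> \<le> sqrt (martingale_const ?q) * sqrt (real T) * (M * S * D + 2 * N * M * D') * (4 powr \<alpha>' * real k powr (- \<alpha>'))"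
      using kn nn mc D D' by (intro mult_left_mono) auto
    also have "\<dots> = K * sqrt (real T) * real k powr (- \<alpha>')" by (simp add: K_def)
    finally show ?thesis .
  qed
  define C where "C = (K / c) powr ?q"
  define h where "h k = C * real k powr (- (\<alpha>' * p / 2))" for k :: nat
  have Sh: "summable h" unfolding h_def using \<alpha>' summable_real_powr_iff[of "- (\<alpha>' * p / 2)"] by (intro summable_mult) simp
  have h0: "h k \<ge> 0" for k by (simp add: h_def C_def)
  define \<epsilon> where "\<epsilon> T = (\<Sum>j. h (j + m T))" for T
  have "\<epsilon> \<longlonglongrightarrow> 0"
    unfolding \<epsilon>_def using filterlim_compose[OF suminf_exist_split2[OF Sh] m] .
  moreover have "\<forall>\<^sub>F T in sequentially. prob_le (\<lambda>x. \<exists>k\<in>{m T..<T}.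
      \<bar>lag_rest (lv k) k T x\<bar> \<ge> c * sqrt (real T * ln (real T))) (\<epsilon> T)"
  proof -
    have "\<forall>\<^sub>F T in sequentially. m T \<ge> 2" using m by (simp add: filterlim_at_top)
    moreover have "\<forall>\<^sub>F T in sequentially. T \<ge> 3" by (rule eventually_ge_at_top)
    ultimately show ?thesis
    proof eventually_elim
      case (elim T)
      have lT: "ln (real T) \<ge> 1"
      proof -
        have "exp 1 \<le> real T" using elim(2) exp_le by linarith
        thus ?thesis using elim(2) by (subst ln_ge_iff) auto
      qed
      let ?x = "c * sqrt (real T * ln (real T))"
      have x0: "?x > 0" using c elim lT by simp
      have "prob_le (\<lambda>x. \<exists>k\<in>{m T..<T}. \<bar>lag_rest (lv k) k T x\<bar> \<ge> ?x) (\<Sum>k\<in>{m T..<T}. h k)"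
      proof (rule prob_le_ex)
        fix k assume k: "k \<in> {m T..<T}"
        hence k2: "k \<ge> 2" using elim by auto
        have le: "2 ^ lv k \<le> k" using lv[OF k2] by linarith
        have "prob_le (\<lambda>x. \<bar>lag_rest (lv k) k T x\<bar> \<ge> ?x) ((Lp_norm P ?q (lag_rest (lv k) k T) / ?x) powr ?q)"
          using p4 x0 by (intro prob_le_Markov Lp_norm_lag_rest(1)[OF le]) auto
        thus "prob_le (\<lambda>x. \<bar>lag_rest (lv k) k T x\<bar> \<ge> ?x) (h k)"
        proof (rule prob_le_mono)
          have "Lp_norm P ?q (lag_rest (lv k) k T) / ?x \<le> K * sqrt (real T) * real k powr (- \<alpha>') / (c * sqrt (real T))"
          proof (rule frac_le)
            have "sqrt (real T) * 1 \<le> sqrt (real T) * sqrt (ln (real T))" using lT by (intro mult_left_mono) auto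
            thus "c * sqrt (real T) \<le> ?x" using c by (simp add: real_sqrt_mult)
          qed (use norm[OF k2, of T] K0 c elim in auto)
          also have "\<dots> = K / c * real k powr (- \<alpha>')" using elim c by simp
          finally have "(Lp_norm P ?q (lag_rest (lv k) k T) / ?x) powr ?q \<le> (K / c * real k powr (- \<alpha>')) powr ?q"
            using x0 p4 by (intro powr_mono2) auto
          also have "\<dots> = h k" using k2 unfolding powr_mult by (simp add: h_def C_def powr_powr)
          finally show "(Lp_norm P ?q (lag_rest (lv k) k T) / ?x) powr ?q \<le> h k" .
        qed
      qed simp
      moreover have "(\<Sum>k\<in>{m T..<T}. h k) \<le> \<epsilon> T"
      proof -
        have "(\<Sum>k\<in>{m T..<T}. h k) \<le> (\<Sum>k\<in>{0 + m T..<T + m T}. h k)" using h0 by (intro sum_mono2) auto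
        also have "\<dots> = (\<Sum>j\<in>{0..<T}. h (j + m T))" by (rule sum.shift_bounds_nat_ivl)
        also have "\<dots> \<le> \<epsilon> T" unfolding \<epsilon>_def using h0 summable_ignore_initial_segment[OF Sh] by (intro sum_le_suminf) auto
        finally show ?thesis .
      qed
      ultimately show ?case by (auto elim: prob_le_mono)
    qed
  qed
  ultimately show ?thesis by blast
qed

end

section \<open>Remainders of the lagged products: decay of \<open>\<Theta>\<close>\<close>

lemma abs_mult_le_weighted_squares:
  fixes a b \<sigma> :: real assumes "\<sigma> > 0" shows "\<bar>a * b\<bar> \<le> (a\<^sup>2 / \<sigma> + \<sigma> * b\<^sup>2) / 2"
proof -
  have "0 \<le> (\<bar>a\<bar> / sqrt \<sigma> - sqrt \<sigma> * \<bar>b\<bar>)\<^sup>2" by simp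
  also have "\<dots> = a\<^sup>2 / \<sigma> + \<sigma> * b\<^sup>2 - 2 * \<bar>a * b\<bar>"
    using assms by (simp add: power2_diff power_divide power_mult_distrib abs_mult)
  finally show ?thesis by simp
qed

context causal_process_rate begin

text \<open>
  The increment of the lagged product when its memory doubles. It is dominated, up to shifts in
  time, by a single sequence that is independent of the lag.
\<close>

definition product_increment :: "nat \<Rightarrow> nat \<Rightarrow> int \<Rightarrow> (int \<Rightarrow> real) \<Rightarrow> real" where
  "product_increment i k t x =
     approx (Suc i) t x * approx (Suc i) (t - int k) x - approx i t x * approx i (t - int k) x"

text \<open>
  The bound on the \<open>L\<^sup>p\<close> norm of the layers; it serves as the weight between the two factors of a
  product.
\<close>

definition level :: "nat \<Rightarrow> real" where
  "level i = D * (2 ^ i) powr (- \<alpha>)"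

lemma level_pos: "level i > 0"
  using D by (simp add: level_def)

definition increment_bound :: "nat \<Rightarrow> int \<Rightarrow> (int \<Rightarrow> real) \<Rightarrow> real" where
  "increment_bound i t x = (layer (Suc i) t x)\<^sup>2 / level i
     + level i * ((approx (Suc i) t x)\<^sup>2 + (approx i t x)\<^sup>2)"

text \<open>
  The summand 1 stands for the layer normalised by its level, the others for the two approximations.
\<close>

definition moment_factor :: real where
  "moment_factor = 1 + 2 * (Lp_norm P p G)\<^sup>2"

lemma moment_factor_ge_1: "moment_factor \<ge> 1"
  by (simp add: moment_factor_def)

lemma approx_Suc: "approx (Suc i) t x = approx i t x + layer (Suc i) t x"
  unfolding approx_eq_sum_layer by simp

lemma abs_product_increment_le:
  "\<bar>product_increment i k t x\<bar> \<le> (increment_bound i t x + increment_bound i (t - int k) x) / 2"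
proof -
  let ?l = "level i" and ?s = "t - int k"
  have "product_increment i k t x = layer (Suc i) t x * approx (Suc i) ?s x + layer (Suc i) ?s x * approx i t x"
    unfolding product_increment_def by (simp add: approx_Suc algebra_simps)
  hence "\<bar>product_increment i k t x\<bar> \<le> \<bar>layer (Suc i) t x * approx (Suc i) ?s x\<bar> + \<bar>layer (Suc i) ?s x * approx i t x\<bar>"
    by simp
  moreover have "\<bar>layer (Suc i) t x * approx (Suc i) ?s x\<bar> \<le> ((layer (Suc i) t x)\<^sup>2 / ?l + ?l * (approx (Suc i) ?s x)\<^sup>2) / 2"
    "\<bar>layer (Suc i) ?s x * approx i t x\<bar> \<le> ((layer (Suc i) ?s x)\<^sup>2 / ?l + ?l * (approx i t x)\<^sup>2) / 2"
    by (rule abs_mult_le_weighted_squares[OF level_pos])+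
  moreover have "0 \<le> ?l * (approx (Suc i) t x)\<^sup>2" "0 \<le> ?l * (approx i ?s x)\<^sup>2"
    using level_pos[of i] by auto
  ultimately show ?thesis unfolding increment_bound_def distrib_left by argo
qed

lemma increment_bound_nonneg: "increment_bound i t x \<ge> 0"
  unfolding increment_bound_def using level_pos[of i] by (intro add_nonneg_nonneg mult_nonneg_nonneg) auto

lemma p_half: "p / 2 \<ge> 2" "p / 2 \<ge> 1" "2 * (p / 2) = p" "p / 2 > 0"
  using p4 by auto

lemma weighted_square_moment:
  assumes u: "in_Lp P p u" "Lp_norm P p u \<le> l" and v: "in_Lp P p v" "Lp_norm P p v \<le> Lp_norm P p G"
    and w: "in_Lp P p w" "Lp_norm P p w \<le> Lp_norm P p G" and l: "l > 0"
  shows "in_Lp P (p / 2) (\<lambda>x. (u x)\<^sup>2 / l + l * ((v x)\<^sup>2 + (w x)\<^sup>2))"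
    and "Lp_norm P (p / 2) (\<lambda>x. (u x)\<^sup>2 / l + l * ((v x)\<^sup>2 + (w x)\<^sup>2)) \<le> l * moment_factor"
proof -
  have sq: "in_Lp P (p / 2) (\<lambda>x. (f x)\<^sup>2) \<and> Lp_norm P (p / 2) (\<lambda>x. (f x)\<^sup>2) \<le> c\<^sup>2"
    if "in_Lp P p f" "Lp_norm P p f \<le> c" for f c
  proof -
    have "Lp_norm P (p / 2) (\<lambda>x. f x * f x) \<le> Lp_norm P p f * Lp_norm P p f"
      using Lp_norm_mult[of P "p / 2" f f] that p4 by simp
    also have "\<dots> \<le> c * c" using that order_trans[OF Lp_norm_nonneg that(2)] by (intro mult_mono) auto
    finally show ?thesis using in_Lp_mult[of P "p / 2" f f] that p4 by (simp add: power2_eq_square)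
  qed
  have a: "in_Lp P (p / 2) (\<lambda>x. 1 / l * (u x)\<^sup>2)" using sq[OF u] by (intro in_Lp_cmult) auto
  have vw: "in_Lp P (p / 2) (\<lambda>x. (v x)\<^sup>2 + (w x)\<^sup>2)" using sq[OF v] sq[OF w] p_half by (intro in_Lp_add) auto
  have b: "in_Lp P (p / 2) (\<lambda>x. l * ((v x)\<^sup>2 + (w x)\<^sup>2))" by (rule in_Lp_cmult[OF vw])
  show "in_Lp P (p / 2) (\<lambda>x. (u x)\<^sup>2 / l + l * ((v x)\<^sup>2 + (w x)\<^sup>2))"
    using in_Lp_add[OF a b] p_half by simp
  have "Lp_norm P (p / 2) (\<lambda>x. 1 / l * (u x)\<^sup>2 + l * ((v x)\<^sup>2 + (w x)\<^sup>2))
      \<le> Lp_norm P (p / 2) (\<lambda>x. 1 / l * (u x)\<^sup>2) + Lp_norm P (p / 2) (\<lambda>x. l * ((v x)\<^sup>2 + (w x)\<^sup>2))"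
    by (rule Lp_norm_triangle[OF a b p_half(2)])
  also have "\<dots> = 1 / l * Lp_norm P (p / 2) (\<lambda>x. (u x)\<^sup>2) + l * Lp_norm P (p / 2) (\<lambda>x. (v x)\<^sup>2 + (w x)\<^sup>2)"
    using p_half l by (simp only: Lp_norm_cmult) simp
  also have "\<dots> \<le> 1 / l * l\<^sup>2 + l * ((Lp_norm P p G)\<^sup>2 + (Lp_norm P p G)\<^sup>2)"
    using sq[OF u] sq[OF v] sq[OF w] l p_half
    by (intro add_mono mult_left_mono order_trans[OF Lp_norm_triangle]) auto
  also have "\<dots> = l * moment_factor" using l by (simp add: moment_factor_def power2_eq_square algebra_simps)
  finally show "Lp_norm P (p / 2) (\<lambda>x. (u x)\<^sup>2 / l + l * ((v x)\<^sup>2 + (w x)\<^sup>2)) \<le> l * moment_factor" by simp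
qed

lemma Lp_norm_layer_le: "Lp_norm P p (layer (Suc i) t) \<le> level i"
proof -
  have "Lp_norm P p (layer (Suc i) t) \<le> (\<Sum>j\<in>scale (Suc i). Lp_norm P p (innov (t - int j) (X t)))"
    unfolding layer_def[abs_def] using p4 by (intro Lp_norm_sum in_Lp_innov in_Lp_X) auto
  also have "\<dots> \<le> (\<Sum>j\<in>scale (Suc i). dep p j)"
    unfolding coupling_X[of p t, symmetric] using p4 by (intro sum_mono Lp_norm_innov_le in_Lp_X) auto
  also have "\<dots> \<le> level i" using scale_dep_le_rate[of i] by (simp add: scale_dep_def level_def)
  finally show ?thesis .
qed

lemma
  shows in_Lp_increment_bound: "in_Lp P (p / 2) (increment_bound i t)"
    and Lp_norm_increment_bound: "Lp_norm P (p / 2) (increment_bound i t) \<le> level i * moment_factor"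
  unfolding increment_bound_def[abs_def] using p4
  by (intro weighted_square_moment in_Lp_layer in_Lp_approx Lp_norm_layer_le Lp_norm_approx_le level_pos; simp)+

lemma
  shows in_Lp_product_increment: "in_Lp P (p / 2) (product_increment i k t)"
    and Lp_norm_product_increment: "Lp_norm P (p / 2) (product_increment i k t) \<le> level i * moment_factor"
proof -
  let ?h = "\<lambda>x. 1 / 2 * (increment_bound i t x + increment_bound i (t - int k) x)"
  have m: "product_increment i k t \<in> borel_measurable P"
    unfolding product_increment_def[abs_def] by measurable
  have h: "in_Lp P (p / 2) ?h" using p_half by (intro in_Lp_cmult in_Lp_add in_Lp_increment_bound) auto
  have le: "AE x in P. \<bar>product_increment i k t x\<bar> \<le> \<bar>?h x\<bar>"
    by (rule AE_I2) (use abs_product_increment_le[of i k t] increment_bound_nonneg in \<open>simp add: order_trans[OF _ abs_ge_self]\<close>)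
  show "in_Lp P (p / 2) (product_increment i k t)" by (rule in_Lp_bound[OF h m le p_half(4)])
  have "Lp_norm P (p / 2) (product_increment i k t) \<le> Lp_norm P (p / 2) ?h" by (rule Lp_norm_mono[OF h m le p_half(4)])
  also have "\<dots> = 1 / 2 * Lp_norm P (p / 2) (\<lambda>x. increment_bound i t x + increment_bound i (t - int k) x)"
    by (subst Lp_norm_cmult[OF p_half(4)]) simp
  also have "\<dots> \<le> 1 / 2 * (level i * moment_factor + level i * moment_factor)"
    using Lp_norm_triangle[OF in_Lp_increment_bound[of i t] in_Lp_increment_bound[of i "t - int k"] p_half(2)]
      Lp_norm_increment_bound[of i t] Lp_norm_increment_bound[of i "t - int k"] by simp
  finally show "Lp_norm P (p / 2) (product_increment i k t) \<le> level i * moment_factor" by simp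
qed

definition increment_mean :: "nat \<Rightarrow> nat \<Rightarrow> real" where
  "increment_mean i k = (LINT x|P. product_increment i k 0 x)"

lemma integral_product_increment: "(LINT x|P. product_increment i k t x) = increment_mean i k"
proof -
  have "product_increment i k 0 (tshift t x) = product_increment i k t x" for x
    unfolding product_increment_def approx_tshift by (simp add: algebra_simps)
  moreover have "product_increment i k 0 \<in> borel_measurable P"
    unfolding product_increment_def[abs_def] by measurable
  ultimately show ?thesis using integral_shift[of "product_increment i k 0" t] by (simp add: increment_mean_def)
qed

lemma abs_increment_mean_le: "\<bar>increment_mean i k\<bar> \<le> level i * moment_factor"
  using integral_abs_bound[of P "product_increment i k 0"]
    PP.abs_integral_le_Lp_norm[OF in_Lp_product_increment[of i k 0] p_half(2)] Lp_norm_product_increment[of i k 0]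
  unfolding increment_mean_def by linarith

text \<open>
  Contains the \<open>b\<close>-th block of length \<open>6 * 2 ^ i\<close> together with its translates by all lags below
  \<open>4 * 2 ^ i\<close>.
\<close>

definition increment_block :: "nat \<Rightarrow> nat \<Rightarrow> int set" where
  "increment_block i b = {int b * (6 * 2 ^ i) - 4 * 2 ^ i..(int b + 1) * (6 * 2 ^ i)}"

lemma card_increment_block: "real (card (increment_block i b)) \<le> 11 * 2 ^ i"
proof -
  have "card (increment_block i b) = nat (10 * 2 ^ i + 1)" by (simp add: increment_block_def algebra_simps)
  also have "\<dots> \<le> nat (11 * 2 ^ i)" by (intro nat_mono) simp
  finally have "card (increment_block i b) \<le> 11 * 2 ^ i" by (simp add: nat_mult_distrib nat_power_eq)
  hence "real (card (increment_block i b)) \<le> real (11 * 2 ^ i)" by (simp only: of_nat_le_iff)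
  thus ?thesis by simp
qed

definition block_bound :: "nat \<Rightarrow> nat \<Rightarrow> (int \<Rightarrow> real) \<Rightarrow> real" where
  "block_bound i b x = (\<Sum>t\<in>increment_block i b. increment_bound i t x + level i * moment_factor)"

lemma
  shows in_Lp_block_bound: "in_Lp P (p / 2) (block_bound i b)"
    and Lp_norm_block_bound: "Lp_norm P (p / 2) (block_bound i b) \<le> 22 * 2 ^ i * level i * moment_factor"
proof -
  have L: "in_Lp P (p / 2) (\<lambda>x. increment_bound i t x + level i * moment_factor)" for t
    using p_half by (intro in_Lp_add in_Lp_increment_bound) auto
  show "in_Lp P (p / 2) (block_bound i b)"
    unfolding block_bound_def[abs_def] using L p_half by (intro in_Lp_sum) auto
  have lm: "level i * moment_factor \<ge> 0" using level_pos[of i] moment_factor_ge_1 by simp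
  have "Lp_norm P (p / 2) (block_bound i b) \<le> (\<Sum>t\<in>increment_block i b. Lp_norm P (p / 2) (\<lambda>x. increment_bound i t x + level i * moment_factor))"
    unfolding block_bound_def[abs_def] using L p_half by (intro Lp_norm_sum) auto
  also have "\<dots> \<le> (\<Sum>t\<in>increment_block i b. 2 * (level i * moment_factor))"
  proof (rule sum_mono)
    fix t
    have "Lp_norm P (p / 2) (\<lambda>x. increment_bound i t x + level i * moment_factor)
        \<le> Lp_norm P (p / 2) (increment_bound i t) + Lp_norm P (p / 2) (\<lambda>x. level i * moment_factor)"
      using p_half by (intro Lp_norm_triangle in_Lp_increment_bound) auto
    thus "Lp_norm P (p / 2) (\<lambda>x. increment_bound i t x + level i * moment_factor) \<le> 2 * (level i * moment_factor)"
      using Lp_norm_increment_bound[of i t] PP.Lp_norm_const[OF p_half(4), of "level i * moment_factor"] lm by simp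
  qed
  also have "\<dots> = real (card (increment_block i b)) * (2 * (level i * moment_factor))" by simp
  also have "\<dots> \<le> (11 * 2 ^ i) * (2 * (level i * moment_factor))"
    using lm by (intro mult_right_mono card_increment_block) auto
  finally show "Lp_norm P (p / 2) (block_bound i b) \<le> 22 * 2 ^ i * level i * moment_factor" by (simp add: mult_ac)
qed

text \<open>
  At lags below four times \<open>2 ^ i\<close>, blocks of length \<open>6 * 2 ^ i\<close> with the same parity are
  independent. A single bound for the block sums at all these lags replaces a union bound
  over the lags, which their few moments would not support.
\<close>

lemma increment_sum_tail:
  fixes T k :: nat
  assumes k: "k < 4 * 2 ^ i" and th: "\<theta> \<ge> 0" "y \<ge> 0" "\<theta> * y \<le> 1"
  shows "prob_le (\<lambda>x. \<bar>\<Sum>t\<in>{int k + 1..int T}. product_increment i k t x - increment_mean i k\<bar> \<ge> 2 * c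
      \<and> (\<forall>b<2 * T. b * (6 * 2 ^ i) < T \<longrightarrow> block_bound i b x \<le> y))
    (4 * exp (\<theta>\<^sup>2 * (24 * 2 ^ i * (level i * moment_factor)\<^sup>2 * real T) - \<theta> * c))"
proof -
  let ?N = "2 ^ i :: int"
  let ?l = "6 * ?N"
  let ?u = "level i * moment_factor"
  have kN: "int k < 4 * ?N"
  proof -
    have "int k < int (4 * 2 ^ i)" using k by (simp only: of_nat_less_iff)
    thus ?thesis by simp
  qed
  have u0: "?u \<ge> 0" using level_pos[of i] moment_factor_ge_1 by simp
  have N1: "?N \<ge> 1" by simp
  have l: "?l \<ge> 1" using N1 by linarith
  define Z where "Z t = (\<lambda>x. if t > int k then product_increment i k t x - increment_mean i k else 0)" for t
  let ?A = "time_block 0 (int T) ?l"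
  let ?B = "\<lambda>b x. \<Sum>t\<in>?A b. Z t x"
  let ?v = "\<lambda>b (x :: int \<Rightarrow> real). 24 * 2 ^ i * ?u\<^sup>2 * real (card (?A b))"
  have dep: "depends_on (Z t) {t - ?l + 2..t}" for t
  proof (cases "t > int k")
    case True
    have "depends_on (product_increment i k t) {t - ?l + 2..t}"
      unfolding product_increment_def[abs_def]
    proof (intro depends_on_comp2[where h = minus] depends_on_comp2[where h = times] depends_on_mono[OF depends_on_approx])
    qed (use kN N1 in auto)
    from depends_on_comp[OF this, of "\<lambda>u. u - increment_mean i k"] show ?thesis using True by (simp add: Z_def)
  qed (simp add: Z_def)
  have Zq: "in_Lp P (p / 2) (Z t) \<and> Lp_norm P (p / 2) (Z t) \<le> 2 * ?u" for t
  proof (cases "t > int k")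
    case True
    have "Lp_norm P (p / 2) (\<lambda>x. product_increment i k t x - increment_mean i k)
      \<le> Lp_norm P (p / 2) (product_increment i k t) + Lp_norm P (p / 2) (\<lambda>x. increment_mean i k)"
      using p_half by (intro Lp_norm_triangle_diff in_Lp_product_increment) auto
    also have "\<dots> \<le> 2 * ?u" using Lp_norm_product_increment[of i k t] abs_increment_mean_le[of i k]
        PP.Lp_norm_const[OF p_half(4), of "increment_mean i k"] by simp
    finally show ?thesis using True p_half by (auto simp: Z_def intro!: in_Lp_diff in_Lp_product_increment)
  qed (use u0 in \<open>simp add: Z_def\<close>)
  have Z2: "in_Lp P 2 (Z t)" "Lp_norm P 2 (Z t) \<le> 2 * ?u" for t
    using Zq[of t] PP.in_Lp_less[of "p / 2" "Z t" 2] PP.Lp_norm_less[of "p / 2" "Z t" 2] p_half by auto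
  have Zi: "integrable P (Z t)" for t using Z2(1) PP.in_Lp_imp_integrable by force
  have EZ: "(LINT x|P. Z t x) = 0" for t
    using PP.in_Lp_imp_integrable[OF in_Lp_product_increment p_half(2)]
    by (cases "t > int k") (simp_all add: Z_def integral_product_increment)
  have depB: "depends_on (?B b) {0 + (int b - 1) * ?l + 1..}" for b
  proof (rule depends_on_sum)
    fix t assume t: "t \<in> ?A b"
    show "depends_on (Z t) {0 + (int b - 1) * ?l + 1..}"
      by (rule depends_on_mono[OF dep]) (use time_blockD(1)[OF t l] in \<open>auto simp: algebra_simps\<close>)
  qed
  have disj: "{0 + (int b - 1) * ?l + 1..} \<inter> {..0 + (int b - 1) * ?l} = {}" for b by auto
  have "prob_le (\<lambda>x. \<bar>\<Sum>t\<in>{0 + 1..int T}. Z t x\<bar> \<ge> 2 * c \<and> (\<forall>b<2 * T. \<bar>?B b x\<bar> \<le> y) \<and> (\<Sum>b<2 * T. ?v b x) \<le> 24 * 2 ^ i * ?u\<^sup>2 * real T)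
    (4 * exp (\<theta>\<^sup>2 * (24 * 2 ^ i * ?u\<^sup>2 * real T) - \<theta> * c))"
  proof (rule alternating_block_tail[OF l _ th])
    show "int T - 0 \<le> 2 * int T" by simp
    show "in_Lp P 2 (Z t)" for t by (rule Z2)
    show "depends_on (Z t) {..t}" for t by (rule depends_on_mono[OF dep]) auto
    fix b
    have "(LINT x|P. ?B b x) = 0" using Zi by (simp add: EZ)
    thus "AE x in P. cexp {..0 + (int b - 1) * ?l} (?B b) x = 0"
      by (intro AE_I2) (simp only: cexp_indep[OF depB disj])
    have "cexp {..0 + (int b - 1) * ?l} (\<lambda>x. (?B b x)\<^sup>2) x = (Lp_norm P 2 (?B b))\<^sup>2" for x
      unfolding Lp_norm_2 by (rule cexp_indep[OF depends_on_comp[OF depB] disj])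
    also have "(Lp_norm P 2 (?B b))\<^sup>2 \<le> 24 * 2 ^ i * ?u\<^sup>2 * real (card (?A b))"
    proof -
      have "Lp_norm P 2 (?B b) \<le> (\<Sum>t\<in>?A b. Lp_norm P 2 (Z t))" by (intro Lp_norm_sum Z2) auto
      also have "\<dots> \<le> (\<Sum>t\<in>?A b. 2 * ?u)" by (intro sum_mono Z2)
      also have "\<dots> = real (card (?A b)) * (2 * ?u)" by simp
      finally have "(Lp_norm P 2 (?B b))\<^sup>2 \<le> (real (card (?A b)) * (2 * ?u))\<^sup>2" by (intro power_mono) auto
      also have "\<dots> = real (card (?A b)) * (4 * ?u\<^sup>2 * real (card (?A b)))" by (simp add: power2_eq_square)
      also have "\<dots> \<le> (6 * 2 ^ i) * (4 * ?u\<^sup>2 * real (card (?A b)))"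
      proof (rule mult_right_mono)
        have "int (card (?A b)) \<le> 6 * 2 ^ i" by (rule card_time_block_le[OF l])
        hence "real_of_int (int (card (?A b))) \<le> real_of_int (6 * 2 ^ i)" by (simp only: of_int_le_iff)
        thus "real (card (?A b)) \<le> 6 * 2 ^ i" by simp
      qed simp
      finally show ?thesis by (simp add: mult_ac)
    qed
    finally show "AE x in P. cexp {..0 + (int b - 1) * ?l} (\<lambda>x. (?B b x)\<^sup>2) x \<le> ?v b x" by simp
  qed auto
  thus ?thesis
  proof (rule prob_le_mono)
    fix x assume x: "\<bar>\<Sum>t\<in>{int k + 1..int T}. product_increment i k t x - increment_mean i k\<bar> \<ge> 2 * c
      \<and> (\<forall>b<2 * T. b * (6 * 2 ^ i) < T \<longrightarrow> block_bound i b x \<le> y)"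
    have "(\<Sum>t\<in>{0 + 1..int T}. Z t x) = (\<Sum>t\<in>{int k + 1..int T}. product_increment i k t x - increment_mean i k)"
      unfolding Z_def by (intro sum.mono_neutral_cong_right) auto
    moreover have "(\<Sum>b<2 * T. ?v b x) \<le> 24 * 2 ^ i * ?u\<^sup>2 * real T"
    proof -
      have "(\<Sum>b<2 * T. real (card (?A b))) = (\<Sum>b<2 * T. \<Sum>t\<in>?A b. 1)" by simp
      also have "\<dots> = (\<Sum>t\<in>{0 + 1..int T}. 1)" by (rule sum_time_blocks[OF l]) simp
      also have "\<dots> = real T" by simp
      finally show ?thesis unfolding sum_distrib_left[symmetric] by simp
    qed
    moreover have "\<bar>?B b x\<bar> \<le> y" if b: "b < 2 * T" for b
    proof (cases "?A b = {}")
      case True thus ?thesis using th by simp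
    next
      case False
      then obtain t0 where t0: "t0 \<in> ?A b" by auto
      have "int b * ?l < int T" using time_blockD(1,4)[OF t0 l] by linarith
      hence "int (b * (6 * 2 ^ i)) < int T" by simp
      hence bT: "b * (6 * 2 ^ i) < T" by (simp only: of_nat_less_iff)
      let ?E = "increment_block i b"
      have sub: "?A b \<subseteq> ?E" "{t \<in> ?A b. t > int k} \<subseteq> ?A b" "(\<lambda>t. t - int k) ` ?A b \<subseteq> ?E"
        using time_blockD[OF _ l, of _ 0 "int T" b] kN by (fastforce simp: increment_block_def)+
      have fin: "finite ?E" by (simp add: increment_block_def)
      have "\<bar>?B b x\<bar> \<le> (\<Sum>t\<in>?A b. \<bar>Z t x\<bar>)" by (rule sum_abs)
      also have "\<dots> \<le> (\<Sum>t\<in>?A b. (increment_bound i t x + ?u) / 2 + (increment_bound i (t - int k) x + ?u) / 2)"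
      proof (rule sum_mono)
        fix t
        have "\<bar>product_increment i k t x - increment_mean i k\<bar> \<le> \<bar>product_increment i k t x\<bar> + \<bar>increment_mean i k\<bar>" by simp
        also have "\<dots> \<le> (increment_bound i t x + increment_bound i (t - int k) x) / 2 + ?u"
          by (intro add_mono abs_product_increment_le abs_increment_mean_le)
        finally show "\<bar>Z t x\<bar> \<le> (increment_bound i t x + ?u) / 2 + (increment_bound i (t - int k) x + ?u) / 2"
          using increment_bound_nonneg[of i t x] increment_bound_nonneg[of i "t - int k" x] u0
          by (auto simp: Z_def field_simps)
      qed
      also have "\<dots> = (\<Sum>t\<in>?A b. increment_bound i t x + ?u) / 2 + (\<Sum>t\<in>(\<lambda>t. t - int k) ` ?A b. increment_bound i t x + ?u) / 2"
      proof -
        have inj: "inj_on (\<lambda>t. t - int k) (?A b)" by (simp add: inj_on_def)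
        show ?thesis by (simp only: sum.reindex[OF inj] o_def sum_divide_distrib sum.distrib[symmetric])
      qed
      also have "\<dots> \<le> block_bound i b x / 2 + block_bound i b x / 2"
        unfolding block_bound_def using sub fin increment_bound_nonneg u0
        by (intro add_mono divide_right_mono sum_mono2) auto
      also have "\<dots> \<le> y" using x b bT by simp
      finally show ?thesis .
    qed
    ultimately show "\<bar>\<Sum>t\<in>{0 + 1..int T}. Z t x\<bar> \<ge> 2 * c \<and> (\<forall>b<2 * T. \<bar>?B b x\<bar> \<le> y)
        \<and> (\<Sum>b<2 * T. ?v b x) \<le> 24 * 2 ^ i * ?u\<^sup>2 * real T"
      using x by auto
  qed simp
qed

text \<open>
  At most \<open>2 T / 2 ^ i\<close> blocks meet the sample, and by the triangle inequality each of them has norm of the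
  order \<open>2 ^ i * level i\<close>.
\<close>

lemma block_bound_tail:
  fixes T :: nat
  assumes y: "y > 0" and T: "2 ^ i \<le> T"
  shows "prob_le (\<lambda>x. \<not> (\<forall>b<2 * T. b * (6 * 2 ^ i) < T \<longrightarrow> block_bound i b x \<le> y))
    (2 * real T / 2 ^ i * (22 * 2 ^ i * level i * moment_factor / y) powr (p / 2))"
proof -
  let ?I = "{b. b * (6 * 2 ^ i) < T}"
  let ?e = "(22 * 2 ^ i * level i * moment_factor / y) powr (p / 2)"
  have sub: "?I \<subseteq> {..T div 2 ^ i}"
  proof
    fix b assume "b \<in> ?I"
    hence "b * 2 ^ i \<le> T" by simp
    thus "b \<in> {..T div 2 ^ i}" by (simp add: less_eq_div_iff_mult_less_eq)
  qed
  have fin: "finite ?I" by (rule finite_subset[OF sub]) simp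
  have "card ?I \<le> card {..T div 2 ^ i}" using sub by (rule card_mono[rotated]) simp
  hence "real (card ?I) \<le> real (T div 2 ^ i) + 1" by simp
  also have "real (T div 2 ^ i) \<le> real T / 2 ^ i" using of_nat_div_le_of_nat[of T "2 ^ i", where 'a = real] by simp
  also have "1 \<le> real T / 2 ^ i" using T by (simp add: divide_simps numeral_power_le_of_nat_cancel_iff)
  finally have card: "real (card ?I) \<le> 2 * real T / 2 ^ i" by simp
  have "prob_le (\<lambda>x. \<exists>b\<in>?I. \<bar>block_bound i b x\<bar> \<ge> y) (\<Sum>b\<in>?I. ?e)"
  proof (rule prob_le_ex[OF fin])
    fix b
    show "prob_le (\<lambda>x. \<bar>block_bound i b x\<bar> \<ge> y) ?e"
    proof (rule prob_le_mono[OF prob_le_Markov[OF in_Lp_block_bound[of i b] p_half(4) y]])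
      show "(Lp_norm P (p / 2) (block_bound i b) / y) powr (p / 2) \<le> ?e"
        using y p_half Lp_norm_block_bound[of i b] by (intro powr_mono2 divide_right_mono) auto
    qed
  qed
  thus ?thesis
  proof (rule prob_le_mono)
    have "(\<Sum>b\<in>?I. ?e) = real (card ?I) * ?e" by simp
    also have "\<dots> \<le> 2 * real T / 2 ^ i * ?e" using card by (intro mult_right_mono) auto
    finally show "(\<Sum>b\<in>?I. ?e) \<le> 2 * real T / 2 ^ i * ?e" .
  qed force
qed

text \<open>Memory longer than the sample is negligible uniformly in the lag, by the Cauchy-Schwarz inequality alone.\<close>

definition far_bound :: "nat \<Rightarrow> real \<Rightarrow> int \<Rightarrow> (int \<Rightarrow> real) \<Rightarrow> real" where
  "far_bound n l t x = (rest n t x)\<^sup>2 / l + l * ((X t x)\<^sup>2 + (approx n t x)\<^sup>2)"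

lemma abs_far_product_le:
  assumes "l > 0"
  shows "\<bar>X t x * X s x - approx n t x * approx n s x\<bar> \<le> (far_bound n l t x + far_bound n l s x) / 2"
proof -
  have "X t x * X s x - approx n t x * approx n s x = rest n t x * X s x + rest n s x * approx n t x"
    by (simp add: rest_def algebra_simps)
  hence "\<bar>X t x * X s x - approx n t x * approx n s x\<bar> \<le> \<bar>rest n t x * X s x\<bar> + \<bar>rest n s x * approx n t x\<bar>"
    by simp
  moreover have "\<bar>rest n t x * X s x\<bar> \<le> ((rest n t x)\<^sup>2 / l + l * (X s x)\<^sup>2) / 2"
    "\<bar>rest n s x * approx n t x\<bar> \<le> ((rest n s x)\<^sup>2 / l + l * (approx n t x)\<^sup>2) / 2"
    by (rule abs_mult_le_weighted_squares[OF assms])+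
  moreover have "0 \<le> l * (X t x)\<^sup>2" "0 \<le> l * (approx n s x)\<^sup>2" using assms by auto
  ultimately show ?thesis unfolding far_bound_def distrib_left by argo
qed

lemma far_bound_nonneg: "l > 0 \<Longrightarrow> far_bound n l t x \<ge> 0"
  unfolding far_bound_def by (intro add_nonneg_nonneg mult_nonneg_nonneg) auto

lemma
  assumes l: "l > 0" "D * (2 ^ n) powr (- \<alpha>) \<le> l"
  shows integrable_far_bound: "integrable P (far_bound n l t)"
    and integral_far_bound: "(LINT x|P. far_bound n l t x) \<le> l * moment_factor"
proof -
  have "Lp_norm P p (rest n t) \<le> (\<Sum>j. dep p (j + 2 ^ n))" using p4 by (intro Lp_norm_rest_Theta) auto
  also have "\<dots> \<le> D * real (2 ^ n) powr (- \<alpha>)" by (rule tail) simp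
  also have "\<dots> \<le> l" using l by simp
  finally have r: "Lp_norm P p (rest n t) \<le> l" .
  have L: "in_Lp P p (X t)" "in_Lp P p (approx n t)" "in_Lp P p (rest n t)"
    using p4 by (auto intro: in_Lp_X in_Lp_approx in_Lp_rest)
  have N: "Lp_norm P p (X t) \<le> Lp_norm P p G" "Lp_norm P p (approx n t) \<le> Lp_norm P p G"
    using p4 by (auto simp: Lp_norm_X intro: Lp_norm_approx_le)
  note w = weighted_square_moment[OF L(3) r L(1) N(1) L(2) N(2) l(1)]
  have fL: "in_Lp P (p / 2) (far_bound n l t)" unfolding far_bound_def[abs_def] by (rule w(1))
  show "integrable P (far_bound n l t)" by (rule PP.in_Lp_imp_integrable[OF fL p_half(2)])
  have "(LINT x|P. far_bound n l t x) = (LINT x|P. \<bar>far_bound n l t x\<bar>)" using far_bound_nonneg[OF l(1)] by simp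
  also have "\<dots> \<le> Lp_norm P (p / 2) (far_bound n l t)" by (rule PP.abs_integral_le_Lp_norm[OF fL p_half(2)])
  also have "\<dots> \<le> l * moment_factor" using w(2) unfolding far_bound_def[abs_def] .
  finally show "(LINT x|P. far_bound n l t x) \<le> l * moment_factor" .
qed

text \<open>
  The increments telescope from the memory \<open>2 ^ n\<close> to \<open>2 ^ I\<close>. Since the approximations with memory
  \<open>2 ^ n\<close> are uncorrelated, the autocovariance is the sum of the means of the increments and the mean of the
  part with longer memory.
\<close>

lemma lag_rest_decompose:
  fixes T k :: nat
  assumes k: "2 ^ n \<le> k" and n: "n \<le> I" and l: "l > 0" "D * (2 ^ I) powr (- \<alpha>) \<le> l"
  shows "\<bar>lag_rest n k T x\<bar> \<le> (\<Sum>i\<in>{n..<I}. \<bar>\<Sum>t\<in>{int k + 1..int T}. product_increment i k t x - increment_mean i k\<bar>)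
     + (\<Sum>t\<in>{1 - int T..int T}. far_bound I l t x) + real T * (l * moment_factor)"
proof -
  let ?A = "\<lambda>i t x. approx i t x * approx i (t - int k) x"
  let ?F = "\<lambda>t x. X t x * X (t - int k) x - ?A I t x"
  have tele: "?A I t y - ?A n t y = (\<Sum>i\<in>{n..<I}. product_increment i k t y)" for t y
    using sum_Suc_diff'[OF n, of "\<lambda>i. ?A i t y"] by (simp add: product_increment_def)
  have i2: "integrable P (\<lambda>x. X t x * X (t - int k) x)" "integrable P (\<lambda>x. ?A i t x)" for i t
    using p4 by (auto intro!: integrable_mult_L2 in_Lp_X in_Lp_approx)
  have Fi: "integrable P (?F t)" for t using i2 by simp
  have "(LINT x|P. ?A I 0 x) - (LINT x|P. ?A n 0 x) = (\<Sum>i\<in>{n..<I}. increment_mean i k)"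
  proof -
    have "(LINT x|P. ?A I 0 x) - (LINT x|P. ?A n 0 x) = (LINT x|P. ?A I 0 x - ?A n 0 x)"
      by (rule Bochner_Integration.integral_diff[symmetric]; rule i2(2))
    also have "\<dots> = (\<Sum>i\<in>{n..<I}. (LINT x|P. product_increment i k 0 x))"
      unfolding tele using PP.in_Lp_imp_integrable[OF in_Lp_product_increment p_half(2)]
      by (intro Bochner_Integration.integral_sum)
    finally show ?thesis by (simp add: increment_mean_def)
  qed
  moreover have "(LINT x|P. ?A n 0 x) = 0" by (rule integral_approx_mult[OF k])
  moreover have "(LINT x|P. ?F 0 x) = acov k - (LINT x|P. ?A I 0 x)"
    using Bochner_Integration.integral_diff[OF i2(1)[of 0] i2(2)[of I 0]] acov_shift[of 0 k] by simp
  ultimately have mean: "acov k = (LINT x|P. ?F 0 x) + (\<Sum>i\<in>{n..<I}. increment_mean i k)" by simp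
  have EF: "\<bar>LINT x|P. ?F 0 x\<bar> \<le> l * moment_factor"
  proof -
    have "\<bar>LINT x|P. ?F 0 x\<bar> \<le> (LINT x|P. \<bar>?F 0 x\<bar>)" by (rule integral_abs_bound)
    also have "\<dots> \<le> (LINT x|P. (far_bound I l 0 x + far_bound I l (0 - int k) x) / 2)"
    proof (rule integral_mono)
      show "integrable P (\<lambda>x. \<bar>?F 0 x\<bar>)" by (rule integrable_abs[OF Fi])
      show "integrable P (\<lambda>x. (far_bound I l 0 x + far_bound I l (0 - int k) x) / 2)"
        using integrable_far_bound[OF l] by simp
    qed (rule abs_far_product_le[OF l(1)])
    also have "\<dots> = ((LINT x|P. far_bound I l 0 x) + (LINT x|P. far_bound I l (0 - int k) x)) / 2"
      using integrable_far_bound[OF l] by simp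
    also have "\<dots> \<le> l * moment_factor" using integral_far_bound[OF l, of 0] integral_far_bound[OF l, of "0 - int k"] by simp
    finally show ?thesis .
  qed
  let ?J = "{int k + 1..int T}"
  have "lag_rest n k T x = (\<Sum>t\<in>?J. (\<Sum>i\<in>{n..<I}. product_increment i k t x - increment_mean i k) + ?F t x - (LINT x|P. ?F 0 x))"
    unfolding lag_rest_def mean by (intro sum.cong) (auto simp: sum_subtractf tele[symmetric])
  also have "\<dots> = (\<Sum>i\<in>{n..<I}. \<Sum>t\<in>?J. product_increment i k t x - increment_mean i k) + (\<Sum>t\<in>?J. ?F t x) - real (card ?J) * (LINT x|P. ?F 0 x)"
    by (simp add: sum.distrib sum_subtractf sum.swap[of _ "{n..<I}" ?J] sum_distrib_left)
  finally have eq: "lag_rest n k T x = (\<Sum>i\<in>{n..<I}. \<Sum>t\<in>?J. product_increment i k t x - increment_mean i k) + (\<Sum>t\<in>?J. ?F t x) - real (card ?J) * (LINT x|P. ?F 0 x)" .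
  have 1: "\<bar>\<Sum>i\<in>{n..<I}. \<Sum>t\<in>?J. product_increment i k t x - increment_mean i k\<bar>
      \<le> (\<Sum>i\<in>{n..<I}. \<bar>\<Sum>t\<in>?J. product_increment i k t x - increment_mean i k\<bar>)" by (rule sum_abs)
  have 2: "\<bar>\<Sum>t\<in>?J. ?F t x\<bar> \<le> (\<Sum>t\<in>{1 - int T..int T}. far_bound I l t x)"
  proof -
    have "\<bar>\<Sum>t\<in>?J. ?F t x\<bar> \<le> (\<Sum>t\<in>?J. \<bar>?F t x\<bar>)" by (rule sum_abs)
    also have "\<dots> \<le> (\<Sum>t\<in>?J. (far_bound I l t x + far_bound I l (t - int k) x) / 2)"
      by (intro sum_mono abs_far_product_le l)
    also have "\<dots> = ((\<Sum>t\<in>?J. far_bound I l t x) + (\<Sum>t\<in>(\<lambda>t. t - int k) ` ?J. far_bound I l t x)) / 2"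
    proof -
      have inj: "inj_on (\<lambda>t. t - int k) ?J" by (simp add: inj_on_def)
      show ?thesis by (simp only: sum.reindex[OF inj] o_def sum_divide_distrib sum.distrib[symmetric])
    qed
    also have "\<dots> \<le> ((\<Sum>t\<in>{1 - int T..int T}. far_bound I l t x) + (\<Sum>t\<in>{1 - int T..int T}. far_bound I l t x)) / 2"
      using far_bound_nonneg[OF l(1)] by (intro divide_right_mono add_mono sum_mono2) auto
    finally show ?thesis by simp
  qed
  have 3: "\<bar>real (card ?J) * (LINT x|P. ?F 0 x)\<bar> \<le> real T * (l * moment_factor)"
    unfolding abs_mult using EF by (intro mult_mono) auto
  show ?thesis using 1 2 3 unfolding eq by linarith
qed

text \<open>
  At memory length \<open>N = 2 ^ i\<close> the increments have level \<open>N powr (- \<alpha>)\<close>, so the block sums have variance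
  at most of the order \<open>N powr (1 - 2 \<alpha>)\<close> per unit of time. This decays exactly when \<open>\<alpha> > 1 / 2\<close>, and then the deviations can be summed
  over the memory lengths. Only lengths comparable to \<open>m T\<close> or larger occur.
\<close>

theorem lag_rest_tail_Theta:
  fixes m :: "nat \<Rightarrow> nat"
  assumes \<alpha>2: "\<alpha> > 1 / 2"
    and lv: "\<And>k. k \<ge> 2 \<Longrightarrow> 2 * 2 ^ lv k \<le> k \<and> k < 4 * 2 ^ lv k"
    and m: "b > 0" "\<forall>\<^sub>F T in sequentially. real (m T) \<ge> real T powr b" and c: "c > 0"
  shows "\<exists>\<epsilon>. \<epsilon> \<longlonglongrightarrow> 0 \<and> (\<forall>\<^sub>F T in sequentially. prob_le (\<lambda>x. \<exists>k\<in>{m T..<T}.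
      \<bar>lag_rest (lv k) k T x\<bar> \<ge> c * sqrt (real T * ln (real T))) (\<epsilon> T))"
proof -
  \<comment> \<open>Half of the margin is spent on the truncation level, and the other half keeps the variance term small.\<close>
  define a where "a = (\<alpha> - 1 / 2) / 2"
  have a: "a > 0" "\<alpha> = 1 / 2 + 2 * a" using \<alpha>2 by (auto simp: a_def field_simps)
  let ?q = "p / 2" and ?F = "moment_factor"
  define C1 where "C1 = 24 * (D * ?F)\<^sup>2"
  define C3 where "C3 = 2 * (22 * D * ?F) powr ?q"
  define g where "g i = (2 ^ i :: real) powr (- (a / 2))" for i :: nat
  have Sg: "summable g" unfolding g_def using geometric_layers[of "a / 2"] a by simp
  have g0: "g i \<ge> 0" for i by (simp add: g_def)
  have pow_top: "filterlim (\<lambda>i. (2::real) ^ i) at_top sequentially" by real_asymp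
  have "\<forall>\<^sub>F z :: real in at_top. C1 * z powr (- (2 * a)) + 3 \<le> z powr (a / 2)" using a by real_asymp
  hence "\<forall>\<^sub>F i in sequentially. C1 * (2 ^ i) powr (- (2 * a)) + 3 \<le> (2 ^ i) powr (a / 2)"
    by (rule eventually_compose_filterlim[OF _ pow_top])
  moreover have "\<forall>\<^sub>F n in sequentially. (\<Sum>i. g (i + n)) < c / 8"
    using order_tendstoD(2)[OF suminf_exist_split2[OF Sg], of "c / 8"] c by simp
  ultimately have "\<forall>\<^sub>F n in sequentially. C1 * (2 ^ n) powr (- (2 * a)) + 3 \<le> (2 ^ n) powr (a / 2) \<and> (\<Sum>i. g (i + n)) < c / 8"
    by (rule eventually_conj)
  then obtain n0 where "\<forall>n\<ge>n0. C1 * (2 ^ n) powr (- (2 * a)) + 3 \<le> (2 ^ n) powr (a / 2) \<and> (\<Sum>i. g (i + n)) < c / 8"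
    unfolding eventually_sequentially by blast
  hence n0: "\<And>i. i \<ge> n0 \<Longrightarrow> C1 * (2 ^ i) powr (- (2 * a)) + 3 \<le> (2 ^ i) powr (a / 2)"
      "\<And>n. n \<ge> n0 \<Longrightarrow> (\<Sum>i. g (i + n)) < c / 8"
    by auto
  let ?I = "\<lambda>T::nat. {i. (2::nat) ^ i \<le> T}"
  define l where "l T = D * real T powr (- \<alpha>)" for T :: nat
  define \<epsilon> where "\<epsilon> T = (2 * ln (real T) + 1) * (C3 * (real T powr b / 4) powr (- (a * ?q)) * ln (real T) powr ?q)
      + real T * ((2 * ln (real T) + 1) * (4 * real T powr (- 3)))
      + 2 * real T * (l T * ?F) / (c / 4 * sqrt (real T * ln (real T)))" for T :: nat
  have q0: "?q > 0" using p_half by simp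
  have "\<epsilon> \<longlonglongrightarrow> 0"
  proof -
    have aq: "a * ?q > 0" using a q0 by simp
    define e where "e = b * (a * ?q)"
    have e0: "e > 0" unfolding e_def using aq m(1) by simp
    have l1: "(\<lambda>T. (2 * ln (real T) + 1) * (real T powr (- e) * ln (real T) powr ?q)) \<longlonglongrightarrow> 0"
      using e0 by real_asymp
    have l2: "(\<lambda>T. real T * ((2 * ln (real T) + 1) * real T powr (- 3))) \<longlonglongrightarrow> 0" by real_asymp
    have l3: "(\<lambda>T. real T * real T powr (- (1 / 2 + 2 * a)) / sqrt (real T * ln (real T))) \<longlonglongrightarrow> 0"
      using a(1) by real_asymp
    have eq: "\<epsilon> T = C3 * (1 / 4) powr (- (a * ?q)) * ((2 * ln (real T) + 1) * (real T powr (- e) * ln (real T) powr ?q))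
        + 4 * (real T * ((2 * ln (real T) + 1) * real T powr (- 3)))
        + 8 * D * ?F / c * (real T * real T powr (- (1 / 2 + 2 * a)) / sqrt (real T * ln (real T)))" for T
    proof -
      have "(real T powr b / 4) powr (- (a * ?q)) = (1 / 4) powr (- (a * ?q)) * real T powr (- e)"
        using powr_mult[of "1 / 4" "real T powr b" "- (a * ?q)"] by (simp add: powr_powr e_def)
      thus ?thesis unfolding \<epsilon>_def l_def a(2)[symmetric] using c by (simp add: field_simps)
    qed
    have "(\<lambda>T. C3 * (1 / 4) powr (- (a * ?q)) * ((2 * ln (real T) + 1) * (real T powr (- e) * ln (real T) powr ?q))
        + 4 * (real T * ((2 * ln (real T) + 1) * real T powr (- 3)))
        + 8 * D * ?F / c * (real T * real T powr (- (1 / 2 + 2 * a)) / sqrt (real T * ln (real T))))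
        \<longlonglongrightarrow> C3 * (1 / 4) powr (- (a * ?q)) * 0 + 4 * 0 + 8 * D * ?F / c * 0"
      by (intro tendsto_add tendsto_mult tendsto_const l1 l2 l3)
    thus ?thesis unfolding eq by simp
  qed
  moreover have "\<forall>\<^sub>F T in sequentially. prob_le (\<lambda>x. \<exists>k\<in>{m T..<T}.
      \<bar>lag_rest (lv k) k T x\<bar> \<ge> c * sqrt (real T * ln (real T))) (\<epsilon> T)"
  proof -
    have "\<forall>\<^sub>F T in sequentially. real T powr b \<ge> 4 * 2 ^ n0 + 2" using m(1) by real_asymp
    moreover have "\<forall>\<^sub>F T in sequentially. real T * (D * real T powr (- (1 / 2 + 2 * a)) * ?F) < c / 4 * sqrt (real T * ln (real T))"
    proof -
      have DF: "D * ?F > 0" using D moment_factor_ge_1 by simp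
      have "(\<lambda>T. real T * real T powr (- (1 / 2 + 2 * a)) / sqrt (real T * ln (real T))) \<longlonglongrightarrow> 0"
        using a(1) by real_asymp
      hence "\<forall>\<^sub>F T in sequentially. real T * real T powr (- (1 / 2 + 2 * a)) / sqrt (real T * ln (real T)) < c / 4 / (D * ?F)"
        using order_tendstoD(2)[of _ 0 sequentially "c / 4 / (D * ?F)"] c DF by simp
      thus ?thesis using eventually_ge_at_top[of 3]
      proof eventually_elim
        case (elim T)
        have "sqrt (real T * ln (real T)) > 0" using elim by simp
        thus ?case using elim(1) DF by (simp add: divide_less_eq less_divide_eq mult_ac)
      qed
    qed
    moreover have "\<forall>\<^sub>F T in sequentially. T \<ge> 3" by (rule eventually_ge_at_top)
    ultimately show ?thesis using m(2)
    proof eventually_elim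
      case (elim T)
      have T3: "T \<ge> 3" "T \<ge> 1" using elim by auto
      have lT: "ln (real T) > 0" using T3 by simp
      let ?s = "sqrt (real T * ln (real T))"
      have s0: "?s > 0" using T3 lT by simp
      have lT0: "l T > 0" using D T3 by (simp add: l_def)
      have mT: "real (m T) \<ge> 4 * 2 ^ n0 + 2" using elim by linarith
      obtain I0 where I0: "2 ^ I0 \<le> T" "T < 2 ^ (I0 + 1)" using ex_power_ivl1[of 2 T] T3 by auto
      define I where "I = Suc I0"
      have I: "i < I \<Longrightarrow> 2 ^ i \<le> T" for i
      proof -
        assume "i < I"
        hence "(2::nat) ^ i \<le> 2 ^ I0" by (intro power_increasing) (auto simp: I_def)
        thus "2 ^ i \<le> T" using I0 by linarith
      qed
      have TI: "real T \<le> 2 ^ I"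
      proof -
        have "T \<le> 2 ^ I" using I0 by (simp add: I_def)
        hence "real T \<le> real (2 ^ I)" by (simp only: of_nat_le_iff)
        thus ?thesis by simp
      qed
      have lI: "D * (2 ^ I) powr (- \<alpha>) \<le> l T"
        unfolding l_def using TI T3 D alpha by (intro mult_left_mono powr_mono2') auto
      have lvk: "k \<ge> 2" "2 ^ lv k \<le> k" "real T powr b / 4 \<le> 2 ^ lv k" "lv k \<ge> n0" "lv k \<le> I" if k: "k \<in> {m T..<T}" for k
      proof -
        have km: "real (m T) \<le> real k" using k by simp
        moreover have "(2::real) ^ n0 > 0" by simp
        ultimately have "real k \<ge> 2" using mT by linarith
        thus k2: "k \<ge> 2" by simp
        show kk: "2 ^ lv k \<le> k" using lv[OF k2] by linarith
        have "k \<le> 4 * 2 ^ lv k" using lv[OF k2] by linarith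
        hence "real k \<le> real (4 * 2 ^ lv k)" by (simp only: of_nat_le_iff)
        hence k4: "real k \<le> 4 * 2 ^ lv k" by simp
        thus "real T powr b / 4 \<le> 2 ^ lv k" using km elim by simp
        have "(2::real) ^ n0 < 2 ^ lv k" using k4 km mT by linarith
        thus "lv k \<ge> n0" by simp
        have "(2::nat) ^ lv k < 2 ^ I" using kk k I0 by (simp add: I_def)
        thus "lv k \<le> I" by simp
      qed
      \<comment> \<open>The truncation level \<open>1 / \<theta> i\<close> is high enough to be rarely exceeded, and \<open>\<theta> i\<close> is large enough for
        the summable thresholds \<open>g i\<close> to outweigh the variance term by \<open>3 ln T\<close>.\<close>
      define \<theta> where "\<theta> i = (2 ^ i) powr a * sqrt (ln (real T) / real T)" for i :: nat
      have th: "\<theta> i > 0" for i unfolding \<theta>_def using lT T3 by simp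
      define y where "y i = 1 / \<theta> i" for i
      have y: "y i > 0" "\<theta> i * y i \<le> 1" for i using th[of i] by (auto simp: y_def)
      let ?ok = "\<lambda>i x. \<forall>b<2 * T. b * (6 * 2 ^ i) < T \<longrightarrow> block_bound i b x \<le> y i"
      let ?S = "\<lambda>i k x. \<bar>\<Sum>t\<in>{int k + 1..int T}. product_increment i k t x - increment_mean i k\<bar>"
      let ?J = "{i. i < I \<and> real T powr b / 4 \<le> 2 ^ i}"
      have finJ: "finite ?J" by simp
      have cJ: "real (card ?J) \<le> 2 * ln (real T) + 1"
      proof -
        have "card ?J \<le> card (?I T)" using I by (intro card_mono card_dyadic_le(1) T3) auto
        thus ?thesis using card_dyadic_le(2)[OF T3(2)] by linarith
      qed
      let ?e1 = "C3 * (real T powr b / 4) powr (- (a * ?q)) * ln (real T) powr ?q"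
      have bad1: "prob_le (\<lambda>x. \<exists>i\<in>?J. \<not> ?ok i x) (\<Sum>i\<in>?J. ?e1)"
      proof (rule prob_le_ex[OF finJ])
        fix i assume i: "i \<in> ?J"
        let ?N = "2 ^ i :: real"
        have NT: "?N \<le> real T" using I[of i] i by (simp add: numeral_power_le_of_nat_cancel_iff)
        have pb: "real T powr b / 4 > 0" using T3 by simp
        have "prob_le (\<lambda>x. \<not> ?ok i x) (2 * real T / 2 ^ i * (22 * 2 ^ i * level i * ?F / y i) powr ?q)"
          using I i by (intro block_bound_tail y) auto
        moreover have "2 * real T / 2 ^ i * (22 * 2 ^ i * level i * ?F / y i) powr ?q \<le> ?e1"
        proof -
          have "22 * 2 ^ i * level i * ?F / y i = 22 * D * ?F * (?N * ?N powr (- \<alpha>) * ?N powr a) * sqrt (ln (real T) / real T)"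
            by (simp add: y_def level_def \<theta>_def)
          also have "?N * ?N powr (- \<alpha>) * ?N powr a = ?N powr (1 / 2 - a)"
          proof -
            have "?N powr 1 * ?N powr (- \<alpha>) * ?N powr a = ?N powr (1 / 2 - a)"
              unfolding powr_add[symmetric] a(2) by (simp add: algebra_simps)
            thus ?thesis by simp
          qed
          finally have "(22 * 2 ^ i * level i * ?F / y i) powr ?q
              = (22 * D * ?F) powr ?q * ?N powr ((1 / 2 - a) * ?q) * (ln (real T) / real T) powr (?q / 2)"
            using lT T3 by (simp add: powr_mult powr_powr powr_half_sqrt[symmetric])
          hence "2 * real T / 2 ^ i * (22 * 2 ^ i * level i * ?F / y i) powr ?q
              = C3 * (real T / ?N * ?N powr ((1 / 2 - a) * ?q) * (ln (real T) / real T) powr (?q / 2))"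
            by (simp add: C3_def)
          also have "real T / ?N * ?N powr ((1 / 2 - a) * ?q) * (ln (real T) / real T) powr (?q / 2)
              = (?N powr (- 1) * ?N powr ((1 / 2 - a) * ?q)) * (real T powr 1 / real T powr (?q / 2)) * ln (real T) powr (?q / 2)"
          proof -
            have A: "(ln (real T) / real T) powr (?q / 2) = ln (real T) powr (?q / 2) / real T powr (?q / 2)"
              by (rule powr_divide)
            have B: "?N powr (- 1) = 1 / ?N" by (simp add: powr_minus_divide)
            have C: "real T powr 1 = real T" by simp
            have "t / n * u * (l / v) = (1 / n * u) * (t / v) * l" for t n u l v :: real by simp
            thus ?thesis unfolding A B C .
          qed
          also have "\<dots> = (?N powr (?q / 2 - 1) * ?N powr (- (a * ?q))) * real T powr (1 - ?q / 2) * ln (real T) powr (?q / 2)"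
            unfolding powr_add[symmetric] powr_diff[symmetric] by (simp add: algebra_simps)
          also have "\<dots> \<le> (real T powr (?q / 2 - 1) * (real T powr b / 4) powr (- (a * ?q))) * real T powr (1 - ?q / 2) * ln (real T) powr (?q / 2)"
            using NT i p4 a q0 pb by (intro mult_right_mono mult_mono powr_mono2 powr_mono2') auto
          also have "\<dots> = (real T powr b / 4) powr (- (a * ?q)) * (real T powr (?q / 2 - 1) * real T powr (1 - ?q / 2)) * ln (real T) powr (?q / 2)"
            by (simp add: mult_ac)
          also have "real T powr (?q / 2 - 1) * real T powr (1 - ?q / 2) = 1" using T3 unfolding powr_add[symmetric] by simp
          also have "(real T powr b / 4) powr (- (a * ?q)) * 1 * ln (real T) powr (?q / 2) \<le> (real T powr b / 4) powr (- (a * ?q)) * 1 * ln (real T) powr ?q"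
          proof (intro mult_left_mono powr_mono)
            have "exp 1 \<le> real T" using T3 exp_le by linarith
            thus "1 \<le> ln (real T)" using T3 by (subst ln_ge_iff) auto
          qed (use q0 in auto)
          finally show ?thesis by (simp add: C3_def mult_left_mono)
        qed
        ultimately show "prob_le (\<lambda>x. \<not> ?ok i x) ?e1" by (auto elim: prob_le_mono)
      qed
      have bad2: "prob_le (\<lambda>x. \<exists>k\<in>{m T..<T}. \<exists>i\<in>{lv k..<I}. ?S i k x \<ge> 2 * (g i * ?s) \<and> ?ok i x)
          (\<Sum>k\<in>{m T..<T}. \<Sum>i\<in>{lv k..<I}. 4 * real T powr (- 3))"
      proof (intro prob_le_ex)
        fix k i assume k: "k \<in> {m T..<T}" and i: "i \<in> {lv k..<I}"
        let ?N = "2 ^ i :: real"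
        have i0: "i \<ge> n0" using lvk(4)[OF k] i by simp
        have k4: "k < 4 * 2 ^ i"
        proof -
          have "(2::nat) ^ lv k \<le> 2 ^ i" using i by (intro power_increasing) auto
          thus ?thesis using lv[OF lvk(1)[OF k]] by linarith
        qed
        have "prob_le (\<lambda>x. ?S i k x \<ge> 2 * (g i * ?s) \<and> ?ok i x)
          (4 * exp ((\<theta> i)\<^sup>2 * (24 * 2 ^ i * (level i * ?F)\<^sup>2 * real T) - \<theta> i * (g i * ?s)))"
          using th[of i] y[of i] by (intro increment_sum_tail k4) auto
        moreover have "exp ((\<theta> i)\<^sup>2 * (24 * 2 ^ i * (level i * ?F)\<^sup>2 * real T) - \<theta> i * (g i * ?s)) \<le> real T powr (- 3)"
        proof -
          have "(\<theta> i)\<^sup>2 * (24 * 2 ^ i * (level i * ?F)\<^sup>2 * real T)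
              = C1 * (?N powr a * ?N powr a * ?N powr 1 * ?N powr (- \<alpha>) * ?N powr (- \<alpha>)) * ln (real T)"
          proof -
            have "(\<theta> i)\<^sup>2 = (?N powr a * ?N powr a) * (ln (real T) / real T)"
              using lT unfolding \<theta>_def power_mult_distrib by (simp add: power2_eq_square)
            thus ?thesis using T3 by (simp add: level_def C1_def power2_eq_square)
          qed
          also have "?N powr a * ?N powr a * ?N powr 1 * ?N powr (- \<alpha>) * ?N powr (- \<alpha>) = ?N powr (- (2 * a))"
            unfolding powr_add[symmetric] a(2) by (simp add: algebra_simps)
          finally have e1: "(\<theta> i)\<^sup>2 * (24 * 2 ^ i * (level i * ?F)\<^sup>2 * real T) = C1 * ?N powr (- (2 * a)) * ln (real T)" .
          have "\<theta> i * (g i * ?s) = (?N powr a * ?N powr (- (a / 2))) * (sqrt (ln (real T) / real T) * ?s)"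
            by (simp add: \<theta>_def g_def)
          also have "?N powr a * ?N powr (- (a / 2)) = ?N powr (a / 2)"
            unfolding powr_add[symmetric] by simp
          also have "sqrt (ln (real T) / real T) * ?s = sqrt ((ln (real T))\<^sup>2)"
            using T3 unfolding real_sqrt_mult[symmetric] by (simp add: power2_eq_square)
          also have "\<dots> = ln (real T)" using lT by simp
          finally have e2: "\<theta> i * (g i * ?s) = ?N powr (a / 2) * ln (real T)" .
          have "(C1 * ?N powr (- (2 * a)) + 3) * ln (real T) \<le> ?N powr (a / 2) * ln (real T)"
            using n0(1)[OF i0] lT by (intro mult_right_mono) auto
          hence "exp ((\<theta> i)\<^sup>2 * (24 * 2 ^ i * (level i * ?F)\<^sup>2 * real T) - \<theta> i * (g i * ?s)) \<le> exp (- 3 * ln (real T))"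
            unfolding e1 e2 by (simp add: algebra_simps)
          also have "\<dots> = real T powr (- 3)" using T3 by (simp add: powr_def)
          finally show ?thesis .
        qed
        ultimately show "prob_le (\<lambda>x. ?S i k x \<ge> 2 * (g i * ?s) \<and> ?ok i x) (4 * real T powr (- 3))"
          by (elim prob_le_mono) auto
      qed auto
      let ?H = "\<lambda>x. \<Sum>t\<in>{1 - int T..int T}. far_bound I (l T) t x"
      have Hi: "integrable P ?H" using integrable_far_bound[OF lT0 lI] by (intro Bochner_Integration.integrable_sum) auto
      have H0: "?H x \<ge> 0" for x using far_bound_nonneg[OF lT0] by (intro sum_nonneg) auto
      have bad3: "prob_le (\<lambda>x. ?H x \<ge> c / 4 * ?s) (2 * real T * (l T * ?F) / (c / 4 * ?s))"
      proof (rule prob_le_mono)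
        show "prob_le (\<lambda>x. \<bar>?H x\<bar> \<ge> c / 4 * ?s) ((Lp_norm P 1 ?H / (c / 4 * ?s)) powr 1)"
          using Hi c s0 by (intro prob_le_Markov) (auto simp: in_Lp_def)
        have "Lp_norm P 1 ?H = (LINT x|P. ?H x)" using H0 by (simp add: Lp_norm_def integral_nonneg_AE)
        also have "\<dots> = (\<Sum>t\<in>{1 - int T..int T}. LINT x|P. far_bound I (l T) t x)"
          using integrable_far_bound[OF lT0 lI] by (intro Bochner_Integration.integral_sum)
        also have "\<dots> \<le> (\<Sum>t\<in>{1 - int T..int T}. l T * ?F)" by (intro sum_mono integral_far_bound lT0 lI)
        also have "\<dots> = 2 * real T * (l T * ?F)" by simp
        finally show "(Lp_norm P 1 ?H / (c / 4 * ?s)) powr 1 \<le> 2 * real T * (l T * ?F) / (c / 4 * ?s)"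
          using c s0 by (simp add: divide_right_mono)
      qed (use H0 in auto)
      show ?case
      proof (rule prob_le_mono[OF prob_le_disj[OF prob_le_disj[OF bad1 bad2] bad3]])
        fix x assume "\<exists>k\<in>{m T..<T}. \<bar>lag_rest (lv k) k T x\<bar> \<ge> c * ?s"
        then obtain k where k: "k \<in> {m T..<T}" "\<bar>lag_rest (lv k) k T x\<bar> \<ge> c * ?s" by auto
        show "((\<exists>i\<in>?J. \<not> ?ok i x) \<or> (\<exists>k\<in>{m T..<T}. \<exists>i\<in>{lv k..<I}. ?S i k x \<ge> 2 * (g i * ?s) \<and> ?ok i x)) \<or> ?H x \<ge> c / 4 * ?s"
        proof (rule ccontr)
          assume no: "\<not> ?thesis"
          have okJ: "?ok i x" if i: "i \<in> {lv k..<I}" for i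
          proof -
            have "(2::real) ^ lv k \<le> 2 ^ i" using i by (intro power_increasing) auto
            hence "real T powr b / 4 \<le> 2 ^ i" using lvk(3)[OF k(1)] by linarith
            hence "i \<in> ?J" using i by simp
            thus ?thesis using no by blast
          qed
          have S: "?S i k x \<le> 2 * (g i * ?s)" if i: "i \<in> {lv k..<I}" for i
            using no okJ[OF i] k(1) i by (meson linear)
          have "(\<Sum>i\<in>{lv k..<I}. ?S i k x) \<le> (\<Sum>i\<in>{lv k..<I}. 2 * (g i * ?s))" by (rule sum_mono[OF S])
          also have "\<dots> = 2 * ?s * (\<Sum>i\<in>{lv k..<I}. g i)"
            unfolding sum_distrib_left by (intro sum.cong) auto
          also have "\<dots> \<le> 2 * ?s * (c / 8)"
          proof (intro mult_left_mono)
            have "(\<Sum>i\<in>{lv k..<I}. g i) \<le> (\<Sum>i\<in>{0 + lv k..<I + lv k}. g i)" using g0 by (intro sum_mono2) auto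
            also have "\<dots> = (\<Sum>i\<in>{0..<I}. g (i + lv k))" by (rule sum.shift_bounds_nat_ivl)
            also have "\<dots> \<le> (\<Sum>i. g (i + lv k))" using g0 summable_ignore_initial_segment[OF Sg] by (intro sum_le_suminf) auto
            also have "\<dots> \<le> c / 8" using n0(2)[OF lvk(4)[OF k(1)]] by simp
            finally show "(\<Sum>i\<in>{lv k..<I}. g i) \<le> c / 8" .
          qed (use s0 in auto)
          finally have 1: "(\<Sum>i\<in>{lv k..<I}. ?S i k x) \<le> c / 4 * ?s" by simp
          have 2: "?H x < c / 4 * ?s" using no by (simp add: not_le)
          have 3: "real T * (l T * ?F) < c / 4 * ?s" using elim(2) unfolding l_def a(2) .
          have "\<bar>lag_rest (lv k) k T x\<bar> \<le> (\<Sum>i\<in>{lv k..<I}. ?S i k x) + ?H x + real T * (l T * ?F)"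
            by (rule lag_rest_decompose[OF lvk(2)[OF k(1)] lvk(5)[OF k(1)] lT0 lI])
          hence "\<bar>lag_rest (lv k) k T x\<bar> < c * ?s" 
          proof -
            have "c * ?s > 0" using c s0 by simp
            moreover have "c / 4 * ?s = c * ?s / 4" by simp
            ultimately show ?thesis using 1 2 3 \<open>\<bar>lag_rest (lv k) k T x\<bar> \<le> _\<close> by linarith
          qed
          thus False using k(2) by simp
        qed
      next
        have "(\<Sum>i\<in>?J. ?e1) \<le> (2 * ln (real T) + 1) * ?e1"
          using cJ unfolding sum_constant by (intro mult_right_mono) (auto simp: C3_def)
        moreover have "(\<Sum>k\<in>{m T..<T}. \<Sum>i\<in>{lv k..<I}. 4 * real T powr (- 3)) \<le> real T * ((2 * ln (real T) + 1) * (4 * real T powr (- 3)))"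
        proof -
          have "(\<Sum>k\<in>{m T..<T}. \<Sum>i\<in>{lv k..<I}. 4 * real T powr (- 3)) \<le> (\<Sum>k\<in>{m T..<T}. (2 * ln (real T) + 1) * (4 * real T powr (- 3)))"
          proof (rule sum_mono)
            fix k
            have "card {lv k..<I} \<le> card (?I T)" using I by (intro card_mono card_dyadic_le(1) T3) auto
            hence "real (card {lv k..<I}) \<le> 2 * ln (real T) + 1" using card_dyadic_le(2)[OF T3(2)] by linarith
            thus "(\<Sum>i\<in>{lv k..<I}. 4 * real T powr (- 3)) \<le> (2 * ln (real T) + 1) * (4 * real T powr (- 3))"
              unfolding sum_constant by (intro mult_right_mono) auto
          qed
          also have "\<dots> \<le> real T * ((2 * ln (real T) + 1) * (4 * real T powr (- 3)))"
            using lT unfolding sum_constant by (intro mult_right_mono) auto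
          finally show ?thesis .
        qed
        ultimately show "(\<Sum>i\<in>?J. ?e1) + (\<Sum>k\<in>{m T..<T}. \<Sum>i\<in>{lv k..<I}. 4 * real T powr (- 3))
          + 2 * real T * (l T * ?F) / (c / 4 * ?s) \<le> \<epsilon> T" unfolding \<epsilon>_def by linarith
      qed
    qed
  qed
  ultimately show ?thesis by blast
qed

end

section \<open>Total error of the thresholded autocovariances\<close>

context causal_process begin

definition lag_sum :: "nat \<Rightarrow> nat \<Rightarrow> (int \<Rightarrow> real) \<Rightarrow> real" where
  "lag_sum k T x = (\<Sum>t\<in>{int k + 1..int T}. X t x * X (t - int k) x - acov k)"

lemma lag_sum_eq: "lag_sum k T x = lag_rest n k T x + (\<Sum>t\<in>{int k + 1..int T}. approx n t x * approx n (t - int k) x)"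
  unfolding lag_sum_def lag_rest_def sum.distrib[symmetric] by simp

text \<open>
  By the product rule each of the two factors contributes \<open>norm4 * sum_dep4\<close>, independently of the lag.
\<close>

lemma lag_sum_moment:
  shows "in_Lp P 2 (lag_sum k T)"
    and "Lp_norm P 2 (lag_sum k T) \<le> sqrt (real T) * (2 * norm4 * sum_dep4)"
proof -
  let ?f = "\<lambda>x. X 0 x * X (- int k) x"
  have L: "in_Lp P (2 * 2) (X t)" for t using in_Lp_X[of 4] p4 by simp
  have f: "in_Lp P 2 ?f" by (rule in_Lp_mult[OF L L]) simp
  have fD: "depends_on ?f {..0}"
    by (rule depends_on_comp2; rule depends_on_mono[OF depends_on_X]) auto
  define d where "d = (\<lambda>j. if k \<le> j then dep 4 (j - k) else 0)"
  have cX: "coupling 4 (X (- int k)) (- int j) \<le> d j" for j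
  proof (cases "k \<le> j")
    case True
    hence "- int j = - int k - int (j - k)" by simp
    thus ?thesis using True coupling_X[of 4 "- int k" "j - k"] by (simp add: d_def)
  next
    case False
    thus ?thesis using coupling_eq_0[OF depends_on_X[of "- int k"], of "- int j"] by (simp add: d_def)
  qed
  have n4: "Lp_norm P 4 (X t) = norm4" for t by (simp add: Lp_norm_X norm4_def)
  have cf: "coupling 2 ?f (- int j) \<le> norm4 * d j + norm4 * dep 4 j" for j
  proof -
    have "coupling 2 ?f (- int j) \<le> norm4 * coupling 4 (X (- int k)) (- int j) + norm4 * coupling 4 (X 0) (- int j)"
      using coupling_mult_le[OF L L, of 0 "- int k" "- int j"] by (simp add: n4)
    also have "\<dots> \<le> norm4 * d j + norm4 * dep 4 j"
      using cX[of j] coupling_X[of 4 0 j] norm4_nonneg by (intro add_mono mult_left_mono) auto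
    finally show ?thesis .
  qed
  have ds: "d sums sum_dep4" "dep 4 sums sum_dep4"
    using summable_delay[OF summable_dep4, of k] suminf_delay[OF summable_dep4, of k] summable_dep4
    by (auto simp: d_def sums_iff sum_dep4_def)
  have B: "(\<lambda>j. norm4 * d j + norm4 * dep 4 j) sums (norm4 * sum_dep4 + norm4 * sum_dep4)"
    by (intro sums_add sums_mult ds)
  have S: "summable (\<lambda>j. coupling 2 ?f (- int j))"
    by (rule summable_comparison_test'[OF sums_summable[OF B]]) (use cf in simp)
  have Sle: "(\<Sum>j. coupling 2 ?f (- int j)) \<le> 2 * norm4 * sum_dep4"
    using suminf_le[OF cf S sums_summable[OF B]] sums_unique[OF B] by simp
  have Ef: "(LINT x|P. ?f x) = acov k" using acov_shift[of 0 k] by simp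
  have eq: "lag_sum k T = (\<lambda>x. \<Sum>t\<in>{int k + 1..int T}. ?f (tshift t x) - (LINT x|P. ?f x))"
    unfolding Ef lag_sum_def X_tshift by (simp add: fun_eq_iff)
  show "in_Lp P 2 (lag_sum k T)" unfolding eq using in_Lp_shift[OF f] by (intro in_Lp_sum in_Lp_diff) auto
  have "Lp_norm P 2 (lag_sum k T) \<le> sqrt (martingale_const 2) * sqrt (real (card {int k + 1..int T})) * (\<Sum>j. coupling 2 ?f (- int j))"
    unfolding eq by (rule Lp_norm_stationary_sum[OF f _ fD _ S]) auto
  also have "\<dots> \<le> sqrt (real T) * (2 * norm4 * sum_dep4)"
    using Sle suminf_nonneg[OF S] by (simp add: mult_mono)
  finally show "Lp_norm P 2 (lag_sum k T) \<le> sqrt (real T) * (2 * norm4 * sum_dep4)" .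
qed

text \<open>
  Innovation \<open>- j\<close> has age \<open>j\<close> in \<open>X 0\<close> and age \<open>j + k\<close> in \<open>X k\<close>.
\<close>

lemma abs_acov_le:
  shows "summable (\<lambda>j. dep p j * dep p (j + k))" "\<bar>acov k\<bar> \<le> (\<Sum>j. dep p j * dep p (j + k))"
proof -
  have Sp: "summable (dep p)" "summable (dep 2)" using summable_dep[of p] summable_dep[of 2] p4 by auto
  have bd: "dep p j \<le> (\<Sum>j. dep p j)" for j using sum_le_suminf[OF Sp(1), of "{j}"] by auto
  have Sm: "summable (\<lambda>j. dep p j * (\<Sum>j. dep p j))" by (rule summable_mult2[OF Sp(1)])
  show S: "summable (\<lambda>j. dep p j * dep p (j + k))"
    by (rule summable_comparison_test'[OF Sm]) (simp add: bd mult_left_mono)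
  have le: "dep 2 j * dep 2 (j + k) \<le> dep p j * dep p (j + k)" for j
    using p4 by (intro mult_mono dep_mono) auto
  have S2: "summable (\<lambda>j. dep 2 j * dep 2 (j + k))"
    by (rule summable_comparison_test'[OF S]) (simp add: le)
  have c: "coupling 2 (X 0) (- int j) = dep 2 j" "coupling 2 (X (int k)) (- int j) = dep 2 (j + k)" for j
    using coupling_X[of 2 0 j] coupling_X[of 2 "int k" "j + k"] by simp_all
  have "\<bar>acov k\<bar> \<le> (\<Sum>j. coupling 2 (X 0) (- int j) * coupling 2 (X (int k)) (- int j))"
    unfolding acov_def using Sp(2) S2 p4 depends_on_X[of 0] integral_X[of 0]
    by (intro abs_integral_mult_le_coupling in_Lp_X) (auto simp: c)
  also have "\<dots> \<le> (\<Sum>j. dep p j * dep p (j + k))" unfolding c by (rule suminf_le[OF le S2 S])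
  finally show "\<bar>acov k\<bar> \<le> (\<Sum>j. dep p j * dep p (j + k))" .
qed

lemma sum_abs_acov_le:
  assumes D: "\<And>j. (\<Sum>i. dep p (i + (j + m))) \<le> d"
  shows "(\<Sum>k\<in>{m..<n}. \<bar>acov k\<bar>) \<le> (\<Sum>j. dep p j) * d"
proof -
  have Sp: "summable (dep p)" using summable_dep[of p] p4 by auto
  have "(\<Sum>k\<in>{m..<n}. \<bar>acov k\<bar>) \<le> (\<Sum>k\<in>{m..<n}. \<Sum>j. dep p j * dep p (j + k))"
    by (intro sum_mono abs_acov_le)
  also have "\<dots> = (\<Sum>j. \<Sum>k\<in>{m..<n}. dep p j * dep p (j + k))"
    by (rule suminf_sum[symmetric]) (rule abs_acov_le)
  also have "\<dots> \<le> (\<Sum>j. dep p j * d)"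
  proof (rule suminf_le)
    fix j
    have "(\<Sum>k\<in>{m..<n}. dep p (j + k)) \<le> (\<Sum>k\<in>{0 + m..<n + m}. dep p (j + k))" by (intro sum_mono2) auto
    also have "\<dots> = (\<Sum>i\<in>{0..<n}. dep p (i + (j + m)))" unfolding sum.shift_bounds_nat_ivl by (simp add: algebra_simps)
    also have "\<dots> \<le> (\<Sum>i. dep p (i + (j + m)))"
      by (intro sum_le_suminf summable_ignore_initial_segment Sp) auto
    also have "\<dots> \<le> d" by (rule D)
    finally have "dep p j * (\<Sum>k\<in>{m..<n}. dep p (j + k)) \<le> dep p j * d" by (rule mult_left_mono) simp
    thus "(\<Sum>k\<in>{m..<n}. dep p j * dep p (j + k)) \<le> dep p j * d" by (simp add: sum_distrib_left)
  next
    show "summable (\<lambda>j. \<Sum>k\<in>{m..<n}. dep p j * dep p (j + k))" by (intro summable_sum abs_acov_le)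
    show "summable (\<lambda>j. dep p j * d)" by (rule summable_mult2[OF Sp])
  qed
  also have "\<dots> = (\<Sum>j. dep p j) * d" by (rule suminf_mult2[symmetric, OF Sp])
  finally show ?thesis .
qed

definition sac :: "nat \<Rightarrow> nat \<Rightarrow> (int \<Rightarrow> real) \<Rightarrow> real" where
  "sac T k x = (1 / real T) * (\<Sum>t\<in>{int k + 1..int T}. X (t - int k) x * X t x)"

definition thresholded_sac :: "real \<Rightarrow> nat \<Rightarrow> nat \<Rightarrow> (int \<Rightarrow> real) \<Rightarrow> real" where
  "thresholded_sac A T k x = (if k = 0 \<or> \<bar>sac T k x\<bar> \<ge> A then sac T k x else 0)"

lemma sac_minus_acov:
  assumes "k < T" shows "sac T k x = lag_sum k T x / real T + (1 - real k / real T) * acov k"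
proof -
  have "(\<Sum>t\<in>{int k + 1..int T}. X (t - int k) x * X t x) = lag_sum k T x + (real T - real k) * acov k"
    using assms by (simp add: lag_sum_def sum_subtractf of_nat_diff mult.commute)
  thus ?thesis using assms by (simp add: sac_def field_simps)
qed

lemma thresholded_sac_error_any_lag:
  assumes k: "k < T" and A: "A \<ge> 0"
  shows "\<bar>thresholded_sac A T k x - acov k\<bar> \<le> \<bar>lag_sum k T x\<bar> / real T + real k / real T * \<bar>acov k\<bar> + A"
proof -
  have "sac T k x - acov k = lag_sum k T x / real T - real k / real T * acov k"
    using sac_minus_acov[OF k, of x] by (simp add: algebra_simps)
  hence "\<bar>sac T k x - acov k\<bar> \<le> \<bar>lag_sum k T x\<bar> / real T + real k / real T * \<bar>acov k\<bar>"
    using abs_triangle_ineq4[of "lag_sum k T x / real T" "real k / real T * acov k"] by (simp add: abs_mult)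
  thus ?thesis using A unfolding thresholded_sac_def by auto
qed

text \<open>
  If every deviation is below half the threshold, a surviving entry has an expectation at least as large as
  its deviation, and an entry set to zero costs its true value.
\<close>

lemma thresholded_sac_error_good_lag:
  assumes k: "0 < k" "k < T" and good: "\<bar>lag_sum k T x\<bar> \<le> A / 2 * real T"
  shows "\<bar>thresholded_sac A T k x - acov k\<bar> \<le> \<bar>acov k\<bar>"
proof (cases "\<bar>sac T k x\<bar> \<ge> A")
  case False thus ?thesis using k by (simp add: thresholded_sac_def)
next
  case True
  let ?d = "lag_sum k T x / real T" and ?r = "real k / real T"
  have r: "0 \<le> ?r" "?r \<le> 1" using k by auto
  have d: "\<bar>?d\<bar> \<le> A / 2" using good k by (simp add: divide_le_eq)
  have s: "sac T k x = ?d + (1 - ?r) * acov k" by (rule sac_minus_acov[OF k(2)])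
  have "\<bar>sac T k x\<bar> \<le> \<bar>?d\<bar> + (1 - ?r) * \<bar>acov k\<bar>"
    unfolding s using abs_triangle_ineq[of ?d "(1 - ?r) * acov k"] r by (simp add: abs_mult)
  hence "\<bar>?d\<bar> \<le> (1 - ?r) * \<bar>acov k\<bar>" using True d by linarith
  moreover have "sac T k x - acov k = ?d - ?r * acov k" unfolding s by (simp add: algebra_simps)
  hence "\<bar>sac T k x - acov k\<bar> \<le> \<bar>?d\<bar> + ?r * \<bar>acov k\<bar>"
    using abs_triangle_ineq4[of ?d "?r * acov k"] r by (simp add: abs_mult)
  ultimately have "\<bar>sac T k x - acov k\<bar> \<le> \<bar>acov k\<bar>" by (simp add: algebra_simps)
  thus ?thesis using True by (simp add: thresholded_sac_def)
qed

text \<open>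
  A quarter of the lag bounds the memory from below, so that decay in the memory becomes decay in the lag.
\<close>

lemma dyadic_levels: "\<exists>lv :: nat \<Rightarrow> nat. \<forall>k\<ge>2. 2 * 2 ^ lv k \<le> k \<and> k < 4 * 2 ^ lv k"
proof -
  have "\<exists>n :: nat. 2 * 2 ^ n \<le> k \<and> k < 4 * 2 ^ n" if "k \<ge> 2" for k :: nat
  proof -
    have "2 div 2 \<le> k div 2" using that by (rule div_le_mono)
    then obtain n where "2 ^ n \<le> k div 2" "k div 2 < 2 ^ (n + 1)" using ex_power_ivl1[of 2 "k div 2"] by auto
    hence "2 * 2 ^ n \<le> k \<and> k < 4 * 2 ^ n" by auto
    thus ?thesis by blast
  qed
  thus ?thesis by metis
qed

end

context causal_process_rate begin

abbreviation rate :: "nat \<Rightarrow> real" where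
  "rate T \<equiv> (ln (real T) / real T) powr (\<alpha> / (2 * (1 + \<alpha>)))"

text \<open>
  At the cutoff \<open>m = (T / ln T) powr (1 / (2 (1 + \<alpha>)))\<close> the stochastic error of the first \<open>m\<close> lags,
  of order \<open>sqrt (ln T / T)\<close> each, balances the sum \<open>m powr (- \<alpha>)\<close> of the remaining autocovariances.
\<close>

theorem thresholded_sac_total_error:
  assumes c: "c \<ge> 21 * norm4 * sum_dep4"
    and regime: "\<alpha> > 1 / 2 \<or> (\<exists>\<alpha>' D'. 0 < \<alpha>' \<and> \<alpha>' \<le> \<alpha> \<and> \<alpha>' * p > 2 \<and> D' > 0
          \<and> (\<forall>m\<ge>1. Delta_tail p (dep p) m \<le> D' * real m powr (- \<alpha>')))"
    and s: "norm4 > 0" and e: "e > 0"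
  shows "\<exists>C>0. \<forall>\<^sub>F T in sequentially. prob_le (\<lambda>x.
     (\<Sum>k<T. \<bar>thresholded_sac (2 * c * sqrt (ln (real T) / real T)) T k x - acov k\<bar>) > C * rate T) e"
proof -
  define \<beta> where "\<beta> = 1 / (2 * (1 + \<alpha>))"
  have beta: "\<beta> > 0" "\<alpha> * \<beta> = \<alpha> / (2 * (1 + \<alpha>))" "\<beta> - 1 / 2 = - (\<alpha> / (2 * (1 + \<alpha>)))"
    using alpha by (auto simp: \<beta>_def field_simps)
  define m where "m T = nat \<lceil>(real T / ln (real T)) powr \<beta>\<rceil>" for T :: nat
  obtain lv :: "nat \<Rightarrow> nat" where lv: "\<And>k. k \<ge> 2 \<Longrightarrow> 2 * 2 ^ lv k \<le> k \<and> k < 4 * 2 ^ lv k"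
    using dyadic_levels by blast
  have m_ge: "real (m T) \<ge> (real T / ln (real T)) powr \<beta>" for T unfolding m_def by linarith
  have m_big: "\<forall>\<^sub>F T in sequentially. real (m T) \<ge> real T powr (\<beta> / 2)"
  proof -
    have "\<forall>\<^sub>F T in sequentially. (real T / ln (real T)) powr \<beta> \<ge> real T powr (\<beta> / 2)" using beta(1) by real_asymp
    thus ?thesis by eventually_elim (use m_ge order_trans in blast)
  qed
  have m_top: "filterlim m at_top sequentially"
  proof -
    have "filterlim (\<lambda>T. real T powr (\<beta> / 2)) at_top sequentially" using beta(1) by real_asymp
    hence "filterlim (\<lambda>T. real (m T)) at_top sequentially" by (rule filterlim_at_top_mono[OF _ m_big])
    thus ?thesis by (simp add: filterlim_sequentially_iff_filterlim_real)
  qed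
  define u where "u = norm4 * sum_dep4"
  have S4: "sum_dep4 > 0"
  proof (rule ccontr)
    assume "\<not> sum_dep4 > 0"
    hence "sum_dep4 = 0" using sum_dep4_nonneg by simp
    thus False using norm4_le_sum_dep4 s by simp
  qed
  have u: "u > 0" using S4 s by (simp add: u_def)
  have c0: "c > 0" "c \<ge> 21 * u" using c u unfolding u_def by (auto simp: mult.assoc)
  obtain \<epsilon>1 where e1: "\<epsilon>1 \<longlonglongrightarrow> 0" "\<And>T. T \<ge> 3 \<Longrightarrow> prob_le (\<lambda>x. \<exists>k\<in>{2..<T}.
      \<bar>\<Sum>t\<in>{int k + 1..int T}. approx (lv k) t x * approx (lv k) (t - int k) x\<bar>
        \<ge> 20 * norm4 * sum_dep4 * sqrt (real T * ln (real T))) (\<epsilon>1 T)"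
    using main_part_large_lags[OF s, of lv] lv by blast
  have "\<exists>\<epsilon>. \<epsilon> \<longlonglongrightarrow> 0 \<and> (\<forall>\<^sub>F T in sequentially. prob_le (\<lambda>x. \<exists>k\<in>{m T..<T}.
      \<bar>lag_rest (lv k) k T x\<bar> \<ge> u * sqrt (real T * ln (real T))) (\<epsilon> T))"
    using regime
  proof
    assume "\<alpha> > 1 / 2"
    thus ?thesis using beta(1) m_big u by (intro lag_rest_tail_Theta[of lv "\<beta> / 2"] lv) auto
  next
    assume "\<exists>\<alpha>' D'. 0 < \<alpha>' \<and> \<alpha>' \<le> \<alpha> \<and> \<alpha>' * p > 2 \<and> D' > 0 \<and> (\<forall>m\<ge>1. Delta_tail p (dep p) m \<le> D' * real m powr (- \<alpha>'))"
    then obtain \<alpha>' D' where "0 < \<alpha>'" "\<alpha>' \<le> \<alpha>" "\<alpha>' * p > 2" "D' > 0"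
      "\<And>m. m \<ge> 1 \<Longrightarrow> Delta_tail p (dep p) m \<le> D' * real m powr (- \<alpha>')" by auto
    thus ?thesis using u m_top by (intro lag_rest_tail_Delta[of \<alpha>' D' lv] lv) auto
  qed
  then obtain \<epsilon>2 where e2: "\<epsilon>2 \<longlonglongrightarrow> 0" "\<forall>\<^sub>F T in sequentially. prob_le (\<lambda>x. \<exists>k\<in>{m T..<T}.
      \<bar>lag_rest (lv k) k T x\<bar> \<ge> u * sqrt (real T * ln (real T))) (\<epsilon>2 T)" by blast
  define S where "S = (\<Sum>j. dep p j)"
  have Sp: "summable (dep p)" using summable_dep[of p] p4 by simp
  have S0: "S \<ge> 0" unfolding S_def by (intro suminf_nonneg Sp) auto
  have acov_tail: "(\<Sum>k\<in>{M..<n}. \<bar>acov k\<bar>) \<le> S * (D * real M powr (- \<alpha>))" if "M \<ge> 1" for M n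
    unfolding S_def
  proof (rule sum_abs_acov_le)
    fix j
    have "(\<Sum>i. dep p (i + (j + M))) \<le> D * real (j + M) powr (- \<alpha>)" using that by (intro tail) auto
    also have "\<dots> \<le> D * real M powr (- \<alpha>)" using that D alpha by (intro mult_left_mono powr_mono2') auto
    finally show "(\<Sum>i. dep p (i + (j + M))) \<le> D * real M powr (- \<alpha>)" .
  qed
  have acov_all: "(\<Sum>k<n. \<bar>acov k\<bar>) \<le> S * S" for n
  proof -
    have "(\<Sum>k\<in>{0..<n}. \<bar>acov k\<bar>) \<le> (\<Sum>j. dep p j) * S"
    proof (rule sum_abs_acov_le)
      fix j
      have "S = (\<Sum>i. dep p (i + (j + 0))) + sum (dep p) {..<j}"
        unfolding S_def using suminf_split_initial_segment[OF Sp, of j] by simp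
      moreover have "sum (dep p) {..<j} \<ge> 0" by (intro sum_nonneg) auto
      ultimately show "(\<Sum>i. dep p (i + (j + 0))) \<le> S" by linarith
    qed
    thus ?thesis by (simp add: S_def atLeast0LessThan)
  qed
  \<comment> \<open>The expected deviation of the first \<open>m T\<close> lags is at most \<open>4 * u * rate T\<close>; with this \<open>K\<close> Markov's
    inequality gives probability \<open>e / 4\<close>.\<close>
  define K where "K = 16 * u / e"
  have K: "K > 0" using u e by (simp add: K_def)
  \<comment> \<open>Deviations, bias and threshold at the lags below \<open>m T\<close>, and the autocovariances above it.\<close>
  define C where "C = K + 2 * (S * S) + 4 * c + S * D"
  have C: "C > 0" unfolding C_def using K S0 c0 D by (intro add_pos_nonneg) auto
  have "\<forall>\<^sub>F T in sequentially. \<epsilon>1 T < e / 4" using order_tendstoD(2)[OF e1(1), of "e / 4"] e by simp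
  moreover have "\<forall>\<^sub>F T in sequentially. \<epsilon>2 T < e / 4" using order_tendstoD(2)[OF e2(1), of "e / 4"] e by simp
  moreover have "\<forall>\<^sub>F T in sequentially. m T \<ge> 2" using m_top by (simp add: filterlim_at_top)
  moreover have "\<forall>\<^sub>F T in sequentially. T \<ge> 3" by (rule eventually_ge_at_top)
  ultimately have "\<forall>\<^sub>F T in sequentially. prob_le (\<lambda>x.
     (\<Sum>k<T. \<bar>thresholded_sac (2 * c * sqrt (ln (real T) / real T)) T k x - acov k\<bar>) > C * rate T) e"
    using e2(2)
  proof eventually_elim
    case (elim T)
    let ?A = "2 * c * sqrt (ln (real T) / real T)" and ?r = "rate T" and ?sq = "sqrt (ln (real T) / real T)"
    have T: "T \<ge> 3" "real T \<ge> 1" "real T > 0" using elim by auto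
    have lT: "ln (real T) \<ge> 1"
    proof -
      have "exp 1 \<le> real T" using T(1) exp_le by linarith
      thus ?thesis using T by (subst ln_ge_iff) auto
    qed
    have r: "?r > 0" using T lT by simp
    let ?z = "real T / ln (real T)"
    have z: "?z > 0" using T lT by simp
    have zr: "?z powr (- (\<alpha> * \<beta>)) = ?r"
      unfolding beta(2) using T lT by (simp add: powr_minus powr_divide field_simps)
    have m_le: "real (m T) \<le> 2 * ?z powr \<beta>"
    proof -
      have "real (m T) \<le> ?z powr \<beta> + 1" unfolding m_def using powr_ge_zero[of ?z \<beta>] by linarith
      moreover have "?z \<ge> 1" using ln_le_minus_one[of "real T"] T lT by (simp add: le_divide_eq)
      hence "?z powr \<beta> \<ge> 1" using beta(1) by (intro ge_one_powr_ge_zero) auto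
      ultimately show ?thesis by linarith
    qed
    have msq: "real (m T) * ?sq \<le> 2 * ?r"
    proof -
      have "?sq = ?z powr (- 1 / 2)" using T lT by (simp add: powr_half_sqrt[symmetric] powr_minus powr_divide field_simps)
      hence "real (m T) * ?sq \<le> 2 * ?z powr \<beta> * ?z powr (- 1 / 2)" using m_le by (simp add: mult_right_mono)
      also have "\<dots> = 2 * ?z powr (\<beta> - 1 / 2)" unfolding mult.assoc powr_add[symmetric] by simp
      also have "\<dots> = 2 * ?r" using zr beta(2) unfolding beta(3) by simp
      finally show ?thesis .
    qed
    have isq: "1 / sqrt (real T) \<le> ?sq" using T lT by (simp add: real_sqrt_divide divide_right_mono)
    have iT: "1 / real T \<le> ?sq"
    proof -
      have "1 * sqrt (real T) \<le> sqrt (real T) * sqrt (real T)" using T by (intro mult_right_mono) auto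
      hence "sqrt (real T) \<le> real T" using T by simp
      hence "1 / real T \<le> 1 / sqrt (real T)" using T by (intro divide_left_mono) auto
      thus ?thesis using isq by linarith
    qed
    have malpha: "real (m T) powr (- \<alpha>) \<le> ?r"
    proof -
      have "real (m T) powr (- \<alpha>) \<le> (?z powr \<beta>) powr (- \<alpha>)" using m_ge[of T] alpha T lT by (intro powr_mono2') auto
      also have "\<dots> = ?r" using zr by (simp add: powr_powr mult.commute)
      finally show ?thesis .
    qed
    let ?W = "\<lambda>x. \<Sum>k<m T. \<bar>lag_sum k T x\<bar> / real T"
    have W: "prob_le (\<lambda>x. ?W x \<ge> K * ?r) (e / 2)"
    proof (rule prob_le_mono)
      have Li: "integrable P (lag_sum k T)" for k using PP.in_Lp_imp_integrable[OF lag_sum_moment(1)] by simp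
      have Wi: "in_Lp P 1 ?W" using Li by (simp add: in_Lp_def)
      show "prob_le (\<lambda>x. \<bar>?W x\<bar> \<ge> K * ?r) ((Lp_norm P 1 ?W / (K * ?r)) powr 1)"
        by (rule prob_le_Markov[OF Wi]) (use K r in auto)
      have "Lp_norm P 1 ?W = (LINT x|P. ?W x)" by (simp add: Lp_norm_def sum_nonneg integral_nonneg_AE)
      also have "\<dots> = (\<Sum>k<m T. (LINT x|P. \<bar>lag_sum k T x\<bar>) / real T)" using Li by simp
      also have "\<dots> \<le> (\<Sum>k<m T. sqrt (real T) * (2 * u) / real T)"
      proof (intro sum_mono divide_right_mono)
        fix k
        show "(LINT x|P. \<bar>lag_sum k T x\<bar>) \<le> sqrt (real T) * (2 * u)"
          using PP.abs_integral_le_Lp_norm[OF lag_sum_moment(1)[of k T]] lag_sum_moment(2)[of k T] by (simp add: u_def)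
      qed simp
      also have "\<dots> = 2 * u * (real (m T) * (1 / sqrt (real T)))"
        using T by (simp add: real_div_sqrt field_simps)
      also have "\<dots> \<le> 2 * u * (2 * ?r)"
        using isq msq u by (intro mult_left_mono order_trans[OF mult_left_mono msq]) auto
      finally have "Lp_norm P 1 ?W \<le> 4 * u * ?r" by simp
      hence "Lp_norm P 1 ?W / (K * ?r) \<le> 4 * u * ?r / (K * ?r)" using K r by (intro divide_right_mono) auto
      also have "\<dots> \<le> e / 2" using r u e by (simp add: K_def)
      finally show "(Lp_norm P 1 ?W / (K * ?r)) powr 1 \<le> e / 2" using K r by simp
    qed auto
    show ?case
    proof (rule prob_le_mono[OF prob_le_disj[OF prob_le_disj[OF W e1(2)[OF T(1)]] elim(5)]])
      fix x assume big: "(\<Sum>k<T. \<bar>thresholded_sac ?A T k x - acov k\<bar>) > C * ?r"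
      show "(?W x \<ge> K * ?r \<or> (\<exists>k\<in>{2..<T}. \<bar>\<Sum>t\<in>{int k + 1..int T}. approx (lv k) t x * approx (lv k) (t - int k) x\<bar>
          \<ge> 20 * norm4 * sum_dep4 * sqrt (real T * ln (real T))))
        \<or> (\<exists>k\<in>{m T..<T}. \<bar>lag_rest (lv k) k T x\<bar> \<ge> u * sqrt (real T * ln (real T)))"
      proof (rule ccontr)
        assume no: "\<not> ?thesis"
        let ?q = "sqrt (real T * ln (real T))"
        have q: "?sq * real T = ?q"
          using T lT by (simp add: real_sqrt_divide real_sqrt_mult field_simps)
        have A0: "?A \<ge> 0" using c0 T lT by (intro mult_nonneg_nonneg) auto
        have good: "\<bar>thresholded_sac ?A T k x - acov k\<bar> \<le> \<bar>acov k\<bar>" if k: "k \<in> {m T..<T}" for k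
        proof (rule thresholded_sac_error_good_lag)
          have k2: "k \<in> {2..<T}" using k elim(3) by auto
          have "\<bar>lag_sum k T x\<bar> \<le> \<bar>lag_rest (lv k) k T x\<bar> + \<bar>\<Sum>t\<in>{int k + 1..int T}. approx (lv k) t x * approx (lv k) (t - int k) x\<bar>"
            unfolding lag_sum_eq[of k T x "lv k"] by (rule abs_triangle_ineq)
          also have "\<dots> \<le> u * ?q + 20 * u * ?q"
            using no k k2 unfolding u_def by (intro add_mono) (auto simp: not_le mult.assoc intro: less_imp_le)
          also have "\<dots> = 21 * u * ?q" by simp
          also have "\<dots> \<le> c * ?q" using c0 T lT by (intro mult_right_mono) auto
          also have "\<dots> = ?A / 2 * real T" unfolding q[symmetric] by simp
          finally show "\<bar>lag_sum k T x\<bar> \<le> ?A / 2 * real T" .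
        qed (use k elim(3) in auto)
        have small: "(\<Sum>k\<in>{..<T} \<inter> {..<m T}. \<bar>thresholded_sac ?A T k x - acov k\<bar>) \<le> K * ?r + 2 * (S * S) * ?r + 4 * c * ?r"
        proof -
          have "(\<Sum>k\<in>{..<T} \<inter> {..<m T}. \<bar>thresholded_sac ?A T k x - acov k\<bar>)
             \<le> (\<Sum>k\<in>{..<T} \<inter> {..<m T}. \<bar>lag_sum k T x\<bar> / real T + real (m T) * (1 / real T) * \<bar>acov k\<bar> + ?A)"
          proof (rule sum_mono)
            fix k assume k: "k \<in> {..<T} \<inter> {..<m T}"
            have "real k / real T \<le> real (m T) * (1 / real T)" using k T by (simp add: divide_right_mono)
            hence "real k / real T * \<bar>acov k\<bar> \<le> real (m T) * (1 / real T) * \<bar>acov k\<bar>" by (rule mult_right_mono) simp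
            thus "\<bar>thresholded_sac ?A T k x - acov k\<bar> \<le> \<bar>lag_sum k T x\<bar> / real T + real (m T) * (1 / real T) * \<bar>acov k\<bar> + ?A"
              using thresholded_sac_error_any_lag[of k T ?A x] k A0 by simp
          qed
          also have "\<dots> \<le> (\<Sum>k<m T. \<bar>lag_sum k T x\<bar> / real T + real (m T) * (1 / real T) * \<bar>acov k\<bar> + ?A)"
            using A0 by (intro sum_mono2) (auto intro!: add_nonneg_nonneg)
          also have "\<dots> = ?W x + real (m T) * (1 / real T) * (\<Sum>k<m T. \<bar>acov k\<bar>) + real (m T) * ?A"
            by (simp add: sum.distrib sum_distrib_left)
          also have "\<dots> \<le> K * ?r + (2 * ?r) * (S * S) + 2 * c * (2 * ?r)"
          proof (intro add_mono)
            show "?W x \<le> K * ?r" using no by linarith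
            have mT1: "real (m T) * (1 / real T) \<le> 2 * ?r" using order_trans[OF mult_left_mono[OF iT] msq] by simp
            show "real (m T) * (1 / real T) * (\<Sum>k<m T. \<bar>acov k\<bar>) \<le> (2 * ?r) * (S * S)"
              by (rule mult_mono[OF mT1 acov_all]) (use r in \<open>auto intro!: sum_nonneg\<close>)
            have "2 * c * (real (m T) * ?sq) \<le> 2 * c * (2 * ?r)" using msq c0 by (intro mult_left_mono) auto
            thus "real (m T) * ?A \<le> 2 * c * (2 * ?r)" by (simp add: mult_ac)
          qed
          finally show ?thesis by (simp add: mult_ac)
        qed
        have large: "(\<Sum>k\<in>{m T..<T}. \<bar>thresholded_sac ?A T k x - acov k\<bar>) \<le> S * D * ?r"
        proof -
          have "(\<Sum>k\<in>{m T..<T}. \<bar>thresholded_sac ?A T k x - acov k\<bar>) \<le> (\<Sum>k\<in>{m T..<T}. \<bar>acov k\<bar>)"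
            by (rule sum_mono[OF good])
          also have "\<dots> \<le> S * (D * real (m T) powr (- \<alpha>))" using elim(3) by (intro acov_tail) auto
          also have "\<dots> \<le> S * (D * ?r)" using malpha S0 D by (intro mult_left_mono) auto
          finally show ?thesis by simp
        qed
        have "{..<T} = ({..<T} \<inter> {..<m T}) \<union> {m T..<T}" by auto
        hence "(\<Sum>k<T. \<bar>thresholded_sac ?A T k x - acov k\<bar>)
           = (\<Sum>k\<in>({..<T} \<inter> {..<m T}) \<union> {m T..<T}. \<bar>thresholded_sac ?A T k x - acov k\<bar>)" by simp
        also have "\<dots> = (\<Sum>k\<in>{..<T} \<inter> {..<m T}. \<bar>thresholded_sac ?A T k x - acov k\<bar>) + (\<Sum>k\<in>{m T..<T}. \<bar>thresholded_sac ?A T k x - acov k\<bar>)"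
          by (rule sum.union_disjoint) auto
        also have "\<dots> \<le> C * ?r" using small large by (simp add: C_def algebra_simps)
        finally show False using big by simp
      qed
    next
      show "e / 2 + \<epsilon>1 T + \<epsilon>2 T \<le> e" using elim(1,2) by linarith
    qed
  qed
  thus ?thesis using C by blast
qed

text \<open>
  The zero process, for which the normalisation of the exponential parameter by \<open>norm4\<close> breaks down, is
  estimated without error.
\<close>

lemma thresholded_sac_degenerate:
  assumes "norm4 = 0" and "B > 0"
  shows "prob_le (\<lambda>x. (\<Sum>k<T. \<bar>thresholded_sac A T k x - acov k\<bar>) > B) 0"
proof -
  have "in_Lp P 4 G" using in_Lp_G[of 4] p4 by simp
  hence i: "integrable P (\<lambda>x. \<bar>G x\<bar> powr 4)" by (simp add: in_Lp_def)
  have "(LINT x|P. \<bar>G x\<bar> powr 4) = norm4 powr 4" unfolding norm4_def by (rule Lp_norm_powr[symmetric]) simp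
  hence "(LINT x|P. \<bar>G x\<bar> powr 4) = 0" using assms by simp
  hence "AE x in P. \<bar>G x\<bar> powr 4 = 0" using i by (subst (asm) integral_nonneg_eq_0_iff_AE) auto
  hence "AE x in P. G x = 0" by eventually_elim simp
  hence "AE x in distr P P (tshift t). G x = 0" for t unfolding distr_shift .
  hence Xt: "AE x in P. X t x = 0" for t unfolding X_def using AE_distrD[OF measurable_shift] by blast
  hence all: "AE x in P. \<forall>t. X t x = 0" by (subst AE_all_countable) auto
  have ac: "acov k = 0" for k
  proof -
    have "acov k = (LINT x|P. 0)" unfolding acov_def
      by (rule integral_cong_AE) (use Xt[of 0] in \<open>auto elim: eventually_mono\<close>)
    thus ?thesis by simp
  qed
  from all obtain N where N: "N \<in> sets P" "measure P N = 0" "{x. \<not> (\<forall>t. X t x = 0)} \<subseteq> N"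
    by (auto elim!: AE_E simp: PP.emeasure_eq_measure)
  have "{x. (\<Sum>k<T. \<bar>thresholded_sac A T k x - acov k\<bar>) > B} \<subseteq> {x. \<not> (\<forall>t. X t x = 0)}"
  proof
    fix x assume x: "x \<in> {x. (\<Sum>k<T. \<bar>thresholded_sac A T k x - acov k\<bar>) > B}"
    show "x \<in> {x. \<not> (\<forall>t. X t x = 0)}"
    proof (rule ccontr)
      assume "x \<notin> {x. \<not> (\<forall>t. X t x = 0)}"
      hence "thresholded_sac A T k x = 0" for k by (simp add: thresholded_sac_def sac_def)
      thus False using x assms(2) by (simp add: ac)
    qed
  qed
  thus ?thesis unfolding prob_le_def using N by (intro bexI[of _ N]) auto
qed

end

section \<open>The operator norm\<close>

text \<open>
  Vectors as functions on the natural numbers, of which only the first \<open>n\<close> values matter: sums are easier to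
  handle than entries of vectors with a carrier.
\<close>

definition quad_norm :: "nat \<Rightarrow> (nat \<Rightarrow> real) \<Rightarrow> real" where
  "quad_norm n x = sqrt (\<Sum>i<n. (x i)\<^sup>2)"

definition mat_apply :: "nat \<Rightarrow> (nat \<Rightarrow> nat \<Rightarrow> real) \<Rightarrow> (nat \<Rightarrow> real) \<Rightarrow> nat \<Rightarrow> real" where
  "mat_apply n a x s = (\<Sum>t<n. a s t * x t)"

lemma vec_eucl_norm_eq: "v \<in> carrier_vec n \<Longrightarrow> vec_eucl_norm v = quad_norm n (\<lambda>i. v $ i)"
  by (simp add: vec_eucl_norm_def quad_norm_def scalar_prod_def power2_eq_square atLeast0LessThan)

lemma vec_eucl_norm_mat_mult:
  assumes "v \<in> carrier_vec n"
  shows "vec_eucl_norm (mat n n (\<lambda>(s, t). a s t) *\<^sub>v v) = quad_norm n (mat_apply n a (\<lambda>i. v $ i))"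
proof -
  have "(mat n n (\<lambda>(s, t). a s t) *\<^sub>v v) $ s = mat_apply n a (\<lambda>i. v $ i) s" if "s < n" for s
    using assms that by (simp add: mat_apply_def scalar_prod_def atLeast0LessThan)
  hence "quad_norm n (\<lambda>s. (mat n n (\<lambda>(s, t). a s t) *\<^sub>v v) $ s) = quad_norm n (mat_apply n a (\<lambda>i. v $ i))"
    unfolding quad_norm_def by (intro arg_cong[where f = sqrt] sum.cong) auto
  moreover have "mat n n (\<lambda>(s, t). a s t) *\<^sub>v v \<in> carrier_vec n"
    by (rule mult_mat_vec_carrier[OF mat_carrier assms])
  ultimately show ?thesis by (simp only: vec_eucl_norm_eq)
qed

lemma mat_op_norm_eq:
  "mat_op_norm (mat n n (\<lambda>(s, t). a s t)) = Sup {quad_norm n (mat_apply n a x) | x. quad_norm n x = 1}"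
proof -
  have "{vec_eucl_norm (mat n n (\<lambda>(s, t). a s t) *\<^sub>v v) | v. v \<in> carrier_vec n \<and> vec_eucl_norm v = 1}
     = {quad_norm n (mat_apply n a x) | x. quad_norm n x = 1}"
  proof (intro equalityI subsetI)
    fix y assume "y \<in> {vec_eucl_norm (mat n n (\<lambda>(s, t). a s t) *\<^sub>v v) | v. v \<in> carrier_vec n \<and> vec_eucl_norm v = 1}"
    thus "y \<in> {quad_norm n (mat_apply n a x) | x. quad_norm n x = 1}"
      using vec_eucl_norm_mat_mult[of _ n a] vec_eucl_norm_eq[of _ n] by force
  next
    fix y assume "y \<in> {quad_norm n (mat_apply n a x) | x. quad_norm n x = 1}"
    then obtain x where x: "y = quad_norm n (mat_apply n a x)" "quad_norm n x = 1" by auto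
    let ?v = "vec n x"
    have v: "?v \<in> carrier_vec n" by simp
    have "quad_norm n (\<lambda>i. ?v $ i) = quad_norm n x" by (simp add: quad_norm_def)
    moreover have "mat_apply n a (\<lambda>i. ?v $ i) = mat_apply n a x" by (simp add: mat_apply_def fun_eq_iff)
    ultimately have "y = vec_eucl_norm (mat n n (\<lambda>(s, t). a s t) *\<^sub>v ?v)" "vec_eucl_norm ?v = 1"
      using x by (simp_all add: vec_eucl_norm_mat_mult[OF v] vec_eucl_norm_eq[OF v])
    thus "y \<in> {vec_eucl_norm (mat n n (\<lambda>(s, t). a s t) *\<^sub>v v) | v. v \<in> carrier_vec n \<and> vec_eucl_norm v = 1}"
      using v by blast
  qed
  thus ?thesis by (simp add: mat_op_norm_def)
qed

lemma quad_norm_nonneg [simp]: "0 \<le> quad_norm n x"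
  by (simp add: quad_norm_def sum_nonneg)

lemma quad_norm_scale: "quad_norm n (\<lambda>i. c * x i) = \<bar>c\<bar> * quad_norm n x"
  by (simp add: quad_norm_def power_mult_distrib sum_distrib_left[symmetric] real_sqrt_mult)

lemma mat_apply_scale: "mat_apply n a (\<lambda>i. c * x i) = (\<lambda>s. c * mat_apply n a x s)"
  by (rule ext) (simp add: mat_apply_def sum_distrib_left mult_ac)

text \<open>Schur's test: bounds on the row sums and on the column sums bound the operator norm.\<close>

lemma Schur_test:
  assumes row: "\<And>s. s < n \<Longrightarrow> (\<Sum>t<n. \<bar>a s t\<bar>) \<le> R" and col: "\<And>t. t < n \<Longrightarrow> (\<Sum>s<n. \<bar>a s t\<bar>) \<le> R"
    and R: "R \<ge> 0"
  shows "quad_norm n (mat_apply n a x) \<le> R * quad_norm n x"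
proof -
  have 1: "(mat_apply n a x s)\<^sup>2 \<le> R * (\<Sum>t<n. \<bar>a s t\<bar> * (x t)\<^sup>2)" if s: "s < n" for s
  proof -
    have "\<bar>mat_apply n a x s\<bar> \<le> (\<Sum>t<n. sqrt \<bar>a s t\<bar> * (sqrt \<bar>a s t\<bar> * \<bar>x t\<bar>))"
      unfolding mat_apply_def by (rule order_trans[OF sum_abs]) (simp add: abs_mult mult.assoc[symmetric])
    hence "(mat_apply n a x s)\<^sup>2 \<le> (\<Sum>t<n. sqrt \<bar>a s t\<bar> * (sqrt \<bar>a s t\<bar> * \<bar>x t\<bar>))\<^sup>2"
      by (metis abs_ge_zero power2_abs power_mono)
    also have "\<dots> \<le> (\<Sum>t<n. (sqrt \<bar>a s t\<bar>)\<^sup>2) * (\<Sum>t<n. (sqrt \<bar>a s t\<bar> * \<bar>x t\<bar>)\<^sup>2)"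
      by (rule Cauchy_Schwarz_ineq_sum)
    also have "\<dots> = (\<Sum>t<n. \<bar>a s t\<bar>) * (\<Sum>t<n. \<bar>a s t\<bar> * (x t)\<^sup>2)"
      by (simp add: power_mult_distrib)
    also have "\<dots> \<le> R * (\<Sum>t<n. \<bar>a s t\<bar> * (x t)\<^sup>2)"
      using row[OF s] by (intro mult_right_mono sum_nonneg) auto
    finally show ?thesis .
  qed
  have "(\<Sum>s<n. (mat_apply n a x s)\<^sup>2) \<le> (\<Sum>s<n. R * (\<Sum>t<n. \<bar>a s t\<bar> * (x t)\<^sup>2))"
    using 1 by (intro sum_mono) auto
  also have "\<dots> = R * (\<Sum>t<n. (\<Sum>s<n. \<bar>a s t\<bar>) * (x t)\<^sup>2)"
    unfolding sum_distrib_left[symmetric] sum_distrib_right by (subst sum.swap) simp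
  also have "\<dots> \<le> R * (\<Sum>t<n. R * (x t)\<^sup>2)"
    using col R by (intro mult_left_mono sum_mono mult_right_mono) auto
  also have "\<dots> = R\<^sup>2 * (\<Sum>t<n. (x t)\<^sup>2)" by (simp add: sum_distrib_left power2_eq_square mult.assoc)
  finally have "sqrt (\<Sum>s<n. (mat_apply n a x s)\<^sup>2) \<le> sqrt (R\<^sup>2 * (\<Sum>t<n. (x t)\<^sup>2))" by (rule real_sqrt_le_mono)
  thus ?thesis using R by (simp add: quad_norm_def real_sqrt_mult)
qed

lemma unit_vector: "n \<ge> 1 \<Longrightarrow> quad_norm n (\<lambda>i. if i = 0 then 1 else 0) = 1"
proof -
  assume n: "n \<ge> 1"
  have "(\<Sum>i<n. (if i = 0 then 1 else 0 :: real)\<^sup>2) = (\<Sum>i<n. if i = 0 then 1 else 0)"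
    by (intro sum.cong) auto
  also have "\<dots> = 1" using n by simp
  finally have "(\<Sum>i<n. (if i = 0 then 1 else 0 :: real)\<^sup>2) = 1" .
  thus ?thesis by (simp add: quad_norm_def)
qed

lemma abs_mat_op_norm_le:
  assumes n: "n \<ge> 1"
    and row: "\<And>s. s < n \<Longrightarrow> (\<Sum>t<n. \<bar>a s t\<bar>) \<le> R" and col: "\<And>t. t < n \<Longrightarrow> (\<Sum>s<n. \<bar>a s t\<bar>) \<le> R"
  shows "\<bar>mat_op_norm (mat n n (\<lambda>(s, t). a s t))\<bar> \<le> R"
proof -
  let ?V = "{quad_norm n (mat_apply n a x) | x. quad_norm n x = 1}"
  have R: "R \<ge> 0"
  proof -
    have "0 \<le> (\<Sum>t<n. \<bar>a 0 t\<bar>)" by (simp add: sum_nonneg)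
    also have "\<dots> \<le> R" using n by (intro row) auto
    finally show ?thesis .
  qed
  have schur: "quad_norm n (mat_apply n a x) \<le> R * quad_norm n x" for x
    by (rule Schur_test) (use row col R in auto)
  have ne: "?V \<noteq> {}" using unit_vector[OF n] by auto
  have le: "y \<le> R" if y: "y \<in> ?V" for y
  proof -
    obtain x where "y = quad_norm n (mat_apply n a x)" "quad_norm n x = 1" using y by auto
    thus ?thesis using schur[of x] by simp
  qed
  have "Sup ?V \<le> R" by (rule cSup_least[OF ne le])
  moreover have "Sup ?V \<ge> 0"
  proof -
    obtain y where y: "y \<in> ?V" using ne by auto
    hence "0 \<le> y" by auto
    also have "y \<le> Sup ?V" using le by (intro cSup_upper[OF y]) (auto simp: bdd_above_def)
    finally show ?thesis .
  qed
  ultimately show ?thesis unfolding mat_op_norm_eq by simp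
qed

text \<open>Vectors with rational entries suffice for the supremum, which makes the operator norm a countable
  supremum of measurable functions.\<close>

lemma mat_op_norm_eq_rational:
  assumes n: "n \<ge> 1"
  defines "v \<equiv> \<lambda>(l :: rat list) i. real_of_rat (l ! i)"
  shows "bdd_above ((\<lambda>l. quad_norm n (mat_apply n a (v l)) / quad_norm n (v l)) ` UNIV)"
    and "mat_op_norm (mat n n (\<lambda>(s, t). a s t)) = (SUP l. quad_norm n (mat_apply n a (v l)) / quad_norm n (v l))"
proof -
  let ?F = "\<lambda>x. quad_norm n (mat_apply n a x) / quad_norm n x"
  let ?V = "{quad_norm n (mat_apply n a x) | x. quad_norm n x = 1}"
  define R where "R = (\<Sum>s<n. \<Sum>t<n. \<bar>a s t\<bar>)"
  have R: "R \<ge> 0" by (simp add: R_def sum_nonneg)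
  have row: "(\<Sum>t<n. \<bar>a s t\<bar>) \<le> R" if "s < n" for s
    unfolding R_def using that by (intro member_le_sum[of s "{..<n}" "\<lambda>s. \<Sum>t<n. \<bar>a s t\<bar>"]) (auto simp: sum_nonneg)
  have col: "(\<Sum>s<n. \<bar>a s t\<bar>) \<le> R" if "t < n" for t
    unfolding R_def using that by (intro sum_mono member_le_sum) auto
  have schur: "quad_norm n (mat_apply n a x) \<le> R * quad_norm n x" for x
    by (rule Schur_test) (use row col R in auto)
  have FR: "?F x \<le> R" for x
  proof (cases "quad_norm n x = 0")
    case False
    hence "quad_norm n x > 0" using quad_norm_nonneg[of n x] by linarith
    thus ?thesis using schur[of x] by (simp add: divide_le_eq)
  qed (use R in simp)
  show bdd: "bdd_above ((\<lambda>l. ?F (v l)) ` UNIV)" using FR by (auto simp: bdd_above_def)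
  have bddV: "bdd_above ?V"
  proof (rule bdd_aboveI[of _ R])
    fix y assume "y \<in> ?V"
    then obtain x where "y = quad_norm n (mat_apply n a x)" "quad_norm n x = 1" by auto
    thus "y \<le> R" using schur[of x] by simp
  qed
  have neV: "?V \<noteq> {}" using unit_vector[OF n] by auto
  have "Sup ?V \<le> (SUP l. ?F (v l))"
  proof (rule cSup_least[OF neV])
    fix y assume "y \<in> ?V"
    then obtain x where x: "y = quad_norm n (mat_apply n a x)" "quad_norm n x = 1" by auto
    have "\<exists>l :: rat list. \<forall>i<n. \<bar>v l i - x i\<bar> < 1 / real (Suc m)" for m
    proof -
      have "\<exists>r :: rat. \<bar>real_of_rat r - x i\<bar> < 1 / real (Suc m)" for i
      proof -
        obtain r where "x i < real_of_rat r" "real_of_rat r < x i + 1 / real (Suc m)"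
          using of_rat_dense[of "x i" "x i + 1 / real (Suc m)"] by auto
        thus ?thesis by (intro exI[of _ r]) auto
      qed
      then obtain r :: "nat \<Rightarrow> rat" where r: "\<And>i. \<bar>real_of_rat (r i) - x i\<bar> < 1 / real (Suc m)" by metis
      show ?thesis using r by (intro exI[of _ "map r [0..<n]"]) (auto simp: v_def)
    qed
    then obtain l :: "nat \<Rightarrow> rat list" where l: "\<And>m i. i < n \<Longrightarrow> \<bar>v (l m) i - x i\<bar> < 1 / real (Suc m)" by metis
    have conv: "(\<lambda>m. v (l m) i) \<longlonglongrightarrow> x i" if "i < n" for i
    proof (rule LIM_zero_cancel, rule Lim_null_comparison)
      show "\<forall>\<^sub>F m in sequentially. norm (v (l m) i - x i) \<le> 1 / real (Suc m)"
        using l[OF that] by (intro always_eventually) (auto intro: less_imp_le)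
      show "(\<lambda>m. 1 / real (Suc m)) \<longlonglongrightarrow> 0" using LIMSEQ_inverse_real_of_nat by (simp add: inverse_eq_divide)
    qed
    have "(\<lambda>m. ?F (v (l m))) \<longlonglongrightarrow> ?F x"
      unfolding quad_norm_def mat_apply_def using conv x(2)
      by (intro tendsto_divide tendsto_real_sqrt tendsto_sum tendsto_power tendsto_mult tendsto_const) (auto simp: quad_norm_def)
    hence "?F x \<le> (SUP l. ?F (v l))"
      by (rule LIMSEQ_le_const2) (use bdd in \<open>auto intro!: cSUP_upper\<close>)
    thus "y \<le> (SUP l. ?F (v l))" using x by simp
  qed
  moreover have "(SUP l. ?F (v l)) \<le> Sup ?V"
  proof (rule cSUP_least)
    fix l :: "rat list"
    show "?F (v l) \<le> Sup ?V"
    proof (cases "quad_norm n (v l) = 0")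
      case True
      obtain y where y: "y \<in> ?V" using neV by auto
      hence "0 \<le> y" by auto
      also have "y \<le> Sup ?V" by (rule cSup_upper[OF y bddV])
      finally show ?thesis using True by simp
    next
      case False
      let ?c = "1 / quad_norm n (v l)" and ?w = "\<lambda>i. 1 / quad_norm n (v l) * v l i"
      have w: "quad_norm n ?w = 1" using False by (simp only: quad_norm_scale) simp
      have "quad_norm n (mat_apply n a ?w) = ?F (v l)"
        unfolding mat_apply_scale quad_norm_scale by simp
      hence "?F (v l) \<in> ?V" using w by (intro CollectI exI[of _ ?w]) auto
      thus ?thesis by (rule cSup_upper[OF _ bddV])
    qed
  qed simp
  ultimately show "mat_op_norm (mat n n (\<lambda>(s, t). a s t)) = (SUP l. ?F (v l))"
    unfolding mat_op_norm_eq by (rule antisym)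
qed

lemma measurable_mat_op_norm:
  assumes "\<And>s t. s < n \<Longrightarrow> t < n \<Longrightarrow> (\<lambda>\<omega>. a \<omega> s t) \<in> borel_measurable M"
  shows "(\<lambda>\<omega>. mat_op_norm (mat n n (\<lambda>(s, t). a \<omega> s t))) \<in> borel_measurable M"
proof (cases "n = 0")
  case True thus ?thesis by (simp add: mat_op_norm_eq quad_norm_def)
next
  case False
  hence n: "n \<ge> 1" by simp
  let ?v = "\<lambda>(l :: rat list) i. real_of_rat (l ! i)"
  have "(\<lambda>\<omega>. SUP l. quad_norm n (mat_apply n (a \<omega>) (?v l)) / quad_norm n (?v l)) \<in> borel_measurable M"
  proof (rule borel_measurable_cSUP)
    fix l :: "rat list"
    show "(\<lambda>\<omega>. quad_norm n (mat_apply n (a \<omega>) (?v l)) / quad_norm n (?v l)) \<in> borel_measurable M"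
      unfolding quad_norm_def mat_apply_def using assms
      by (intro borel_measurable_divide borel_measurable_sqrt borel_measurable_sum borel_measurable_power
          borel_measurable_times borel_measurable_const) auto
  qed (use mat_op_norm_eq_rational(1)[OF n] in auto)
  thus ?thesis by (simp only: mat_op_norm_eq_rational(2)[OF n])
qed

text \<open>
  At most two entries of a row have the same distance from the diagonal.
\<close>

lemma Toeplitz_row_sum_le:
  fixes h :: "nat \<Rightarrow> real"
  assumes h: "\<And>k. h k \<ge> 0" and s: "s < n"
  shows "(\<Sum>t<n. h (nat \<bar>int s - int t\<bar>)) \<le> 2 * (\<Sum>k<n. h k)"
proof -
  have "(\<Sum>t<n. h (nat \<bar>int s - int t\<bar>)) \<le> (\<Sum>t\<in>{..s} \<union> {s..<n}. h (nat \<bar>int s - int t\<bar>))"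
    using h by (intro sum_mono2) auto
  also have "\<dots> \<le> (\<Sum>t\<in>{..s}. h (nat \<bar>int s - int t\<bar>)) + (\<Sum>t\<in>{s..<n}. h (nat \<bar>int s - int t\<bar>))"
  proof -
    have "(\<Sum>t\<in>{..s} \<inter> {s..<n}. h (nat \<bar>int s - int t\<bar>)) \<ge> 0" using h by (intro sum_nonneg)
    moreover have "finite {..s}" "finite {s..<n}" by auto
    ultimately show ?thesis
      using sum.union_inter[of "{..s}" "{s..<n}" "\<lambda>t. h (nat \<bar>int s - int t\<bar>)"] by linarith
  qed
  also have "(\<Sum>t\<in>{..s}. h (nat \<bar>int s - int t\<bar>)) = (\<Sum>k\<in>{..s}. h k)"
    by (rule sum.reindex_bij_witness[of _ "\<lambda>k. s - k" "\<lambda>t. s - t"]) (auto intro!: arg_cong[where f = h])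
  also have "\<dots> \<le> (\<Sum>k<n. h k)" using s h by (intro sum_mono2) auto
  also have "(\<Sum>t\<in>{s..<n}. h (nat \<bar>int s - int t\<bar>)) = (\<Sum>k\<in>{..<n - s}. h k)"
    by (rule sum.reindex_bij_witness[of _ "\<lambda>k. k + s" "\<lambda>t. t - s"]) (auto intro!: arg_cong[where f = h])
  also have "\<dots> \<le> (\<Sum>k<n. h k)" using h by (intro sum_mono2) auto
  finally show ?thesis by simp
qed

section \<open>From the product space to the given process\<close>

text \<open>
  Finitely many exceptional arguments only enlarge the constant, since \<open>real m powr (- a)\<close> is positive.
\<close>

lemma bigo_powr_uniform:
  fixes f :: "nat \<Rightarrow> real"
  assumes "f \<in> O(\<lambda>m. real m powr (- a))"
  shows "\<exists>D>0. \<forall>m\<ge>1. f m \<le> D * real m powr (- a)"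
proof -
  obtain C where C: "C > 0" "\<forall>\<^sub>F m in sequentially. norm (f m) \<le> C * norm (real m powr (- a))"
    using landau_o.bigE[OF assms] by blast
  then obtain M where M: "\<And>m. m \<ge> M \<Longrightarrow> \<bar>f m\<bar> \<le> C * real m powr (- a)"
    by (auto simp: eventually_sequentially)
  define E where "E = (\<Sum>m\<in>{1..<M}. \<bar>f m\<bar> / real m powr (- a))"
  have E: "E \<ge> 0" by (simp add: E_def sum_nonneg)
  have "f m \<le> (C + E) * real m powr (- a)" if m: "m \<ge> 1" for m
  proof -
    have pos: "real m powr (- a) > 0" using m by simp
    show ?thesis
    proof (cases "m \<ge> M")
      case True
      have "f m \<le> C * real m powr (- a)" using M[OF True] by linarith
      also have "\<dots> \<le> (C + E) * real m powr (- a)" using E pos by (intro mult_right_mono) auto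
      finally show ?thesis .
    next
      case False
      have "\<bar>f m\<bar> / real m powr (- a) \<le> E"
        unfolding E_def using False m by (intro member_le_sum[of m "{1..<M}" "\<lambda>m. \<bar>f m\<bar> / real m powr (- a)"]) auto
      hence "\<bar>f m\<bar> / real m powr (- a) \<le> C + E" using C by simp
      hence "\<bar>f m\<bar> \<le> (C + E) * real m powr (- a)" using pos by (simp add: divide_le_eq)
      thus ?thesis by linarith
    qed
  qed
  thus ?thesis using C E by (intro exI[of _ "C + E"]) auto
qed

text \<open>
  The joint law of the innovations and their copies is a product measure over the disjoint union of two
  index sets, which splits into the product of two path spaces.
\<close>

lemma
  fixes M :: "'a measure" and eps eps' :: "int \<Rightarrow> 'a \<Rightarrow> real"
  assumes "prob_space M"
    and indep: "prob_space.indep_vars M (\<lambda>_. borel) (case_sum eps eps') UNIV"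
    and ident: "\<And>t. distr M borel (eps t) = distr M borel (eps 0)"
    and ident': "\<And>t. distr M borel (eps' t) = distr M borel (eps 0)"
  defines "\<nu> \<equiv> distr M borel (eps 0)"
  shows innovations_of_iid: "innovations \<nu>"
    and measurable_innovation_paths: "(\<lambda>\<omega>. (\<lambda>i. eps i \<omega>, \<lambda>i. eps' i \<omega>)) \<in> measurable M (innovations.P \<nu> \<Otimes>\<^sub>M innovations.P \<nu>)"
    and distr_innovation_paths: "distr M (innovations.P \<nu> \<Otimes>\<^sub>M innovations.P \<nu>) (\<lambda>\<omega>. (\<lambda>i. eps i \<omega>, \<lambda>i. eps' i \<omega>))
        = innovations.P \<nu> \<Otimes>\<^sub>M innovations.P \<nu>"
proof -
  interpret M: prob_space M by fact
  have rv: "case_sum eps eps' i \<in> borel_measurable M" for i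
    using indep unfolding M.indep_vars_def by auto
  have m: "eps i \<in> borel_measurable M" "eps' i \<in> borel_measurable M" for i
    using rv[of "Inl i"] rv[of "Inr i"] by auto
  show I: "innovations \<nu>"
  proof -
    interpret N: prob_space \<nu> unfolding \<nu>_def by (rule M.prob_space_distr[OF m(1)])
    show ?thesis by unfold_locales (simp add: \<nu>_def)
  qed
  interpret I: innovations \<nu> by fact
  show pm: "(\<lambda>\<omega>. (\<lambda>i. eps i \<omega>, \<lambda>i. eps' i \<omega>)) \<in> measurable M (I.P \<Otimes>\<^sub>M I.P)"
    using m by (intro measurable_Pair I.measurable_into_P) auto
  let ?W = "\<Pi>\<^sub>M i\<in>(UNIV :: (int + int) set). \<nu>"
  have "distr M (PiM UNIV (\<lambda>_. borel)) (\<lambda>\<omega>. \<lambda>i\<in>UNIV. case_sum eps eps' i \<omega>) = PiM UNIV (\<lambda>i. distr M borel (case_sum eps eps' i))"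
    using M.indep_vars_iff_distr_eq_PiM[of UNIV "case_sum eps eps'" "\<lambda>_. borel"] indep rv by simp
  also have "(\<lambda>i. distr M borel (case_sum eps eps' i)) = (\<lambda>_. \<nu>)"
    using ident ident' by (auto simp: fun_eq_iff \<nu>_def split: sum.splits)
  finally have W: "distr M (PiM UNIV (\<lambda>_. borel)) (\<lambda>\<omega> i. case_sum eps eps' i \<omega>) = ?W" by (simp add: restrict_def)
  have sets: "sets (PiM (UNIV :: (int + int) set) (\<lambda>_. borel :: real measure)) = sets ?W"
    by (rule sets_PiM_cong) (simp_all add: \<nu>_def)
  have wm: "(\<lambda>\<omega> i. case_sum eps eps' i \<omega>) \<in> measurable M (PiM UNIV (\<lambda>_. borel))"
    by (rule measurable_PiM_single') (use rv in auto)
  let ?s = "\<lambda>w :: int + int \<Rightarrow> real. (\<lambda>i. w (Inl i), \<lambda>i. w (Inr i))"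
  have sm: "?s \<in> measurable (PiM UNIV (\<lambda>_. borel)) (I.P \<Otimes>\<^sub>M I.P)"
    using I.measurable_split_pair by (simp add: measurable_cong_sets[OF sets refl])
  have "I.P \<Otimes>\<^sub>M I.P = distr ?W (I.P \<Otimes>\<^sub>M I.P) ?s" by (rule I.distr_split_pair[symmetric])
  also have "\<dots> = distr M (I.P \<Otimes>\<^sub>M I.P) (?s \<circ> (\<lambda>\<omega> i. case_sum eps eps' i \<omega>))"
    unfolding W[symmetric] by (rule distr_distr[OF sm wm])
  also have "?s \<circ> (\<lambda>\<omega> i. case_sum eps eps' i \<omega>) = (\<lambda>\<omega>. (\<lambda>i. eps i \<omega>, \<lambda>i. eps' i \<omega>))"
    by (simp add: fun_eq_iff)
  finally show "distr M (I.P \<Otimes>\<^sub>M I.P) (\<lambda>\<omega>. (\<lambda>i. eps i \<omega>, \<lambda>i. eps' i \<omega>)) = I.P \<Otimes>\<^sub>M I.P" ..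
qed

theorem theorem5:
  fixes M :: "'a measure"
    and eps eps' :: "int \<Rightarrow> 'a \<Rightarrow> real"
    and g :: "(nat \<Rightarrow> real) \<Rightarrow> real"
    and p \<alpha> \<alpha>' :: real
  defines "X \<equiv> process g eps"
    and "\<delta> \<equiv> dep_coeff M g eps eps'"
  defines "c \<equiv> 6 * (p + 4) * exp (p / 4) * Lp_norm M 4 (X 0) * Theta_tail (\<delta> 4) 0"
  defines "A \<equiv> \<lambda>T::nat. 2 * c * sqrt (ln (real T) / real T)"
  assumes "prob_space M"
    and indep: "prob_space.indep_vars M (\<lambda>_. borel) (case_sum eps eps') UNIV"
    and ident: "\<And>t. distr M borel (eps t) = distr M borel (eps 0)"
    and ident': "\<And>t. distr M borel (eps' t) = distr M borel (eps 0)"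
    and g: "g \<in> borel_measurable (Pi\<^sub>M UNIV (\<lambda>_. borel))"
    and "p > 4"
    and Lp: "\<And>t. in_Lp M p (X t)"
    and mean: "\<And>t. (LINT \<omega>|M. X t \<omega>) = 0"
    and summ: "summable (\<delta> p)"
    and "\<alpha> \<ge> \<alpha>'" and "\<alpha>' > 0"
    and Theta: "Theta_tail (\<delta> p) \<in> O(\<lambda>m. real m powr (- \<alpha>))"
    and Delta: "Delta_tail p (\<delta> p) \<in> O(\<lambda>m. real m powr (- \<alpha>'))"
    and "\<alpha> > 1 / 2 \<or> \<alpha>' * p > 2"
  shows "bigO_P M
           (\<lambda>T \<omega>. mat_op_norm (thresholded_autocov_mat X T (A T) \<omega> - autocov_mat M X T))
           (\<lambda>T. (ln (real T) / real T) powr (\<alpha> / (2 * (1 + \<alpha>))))"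
proof -
  interpret M: prob_space M by fact
  define \<nu> where "\<nu> = distr M borel (eps 0)"
  interpret I: innovations \<nu> unfolding \<nu>_def by (rule innovations_of_iid[OF \<open>prob_space M\<close> indep ident ident'])
  define E where "E \<omega> = (\<lambda>i. eps i \<omega>)" for \<omega>
  define E' where "E' \<omega> = (\<lambda>i. eps' i \<omega>)" for \<omega>
  have pairm: "(\<lambda>\<omega>. (E \<omega>, E' \<omega>)) \<in> measurable M (I.P \<Otimes>\<^sub>M I.P)"
    unfolding E_def E'_def \<nu>_def by (rule measurable_innovation_paths[OF \<open>prob_space M\<close> indep ident ident'])
  have paird: "distr M (I.P \<Otimes>\<^sub>M I.P) (\<lambda>\<omega>. (E \<omega>, E' \<omega>)) = I.P \<Otimes>\<^sub>M I.P"
    unfolding E_def E'_def \<nu>_def by (rule distr_innovation_paths[OF \<open>prob_space M\<close> indep ident ident'])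
  have Em: "E \<in> measurable M I.P"
    using measurable_compose[OF pairm measurable_fst] by simp
  have Ed: "distr M I.P E = I.P"
  proof -
    have f: "(\<lambda>z. patch UNIV (fst z) (snd z)) \<in> measurable (I.P \<Otimes>\<^sub>M I.P) I.P" by simp
    have "I.P = distr (distr M (I.P \<Otimes>\<^sub>M I.P) (\<lambda>\<omega>. (E \<omega>, E' \<omega>))) I.P (\<lambda>(x, y). patch UNIV x y)"
      unfolding paird by (rule I.distr_patch[symmetric])
    also have "\<dots> = distr M I.P E"
      by (subst distr_distr[OF _ pairm]) (auto simp: o_def case_prod_unfold f)
    finally show ?thesis ..
  qed
  define G where "G x = g (\<lambda>i. x (- int i))" for x :: "int \<Rightarrow> real"
  have Gm: "G \<in> borel_measurable I.P"
  proof -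
    have "(\<lambda>x i. x (- int i)) \<in> measurable I.P (Pi\<^sub>M UNIV (\<lambda>_. borel))"
      by (rule measurable_PiM_single') auto
    from measurable_compose[OF this g] show ?thesis by (simp add: G_def[abs_def])
  qed
  have XG: "X t \<omega> = G (tshift t (E \<omega>))" for t \<omega>
    by (simp add: X_def process_def G_def tshift_def E_def add.commute)
  have GLp: "in_Lp I.P p G"
  proof -
    have "X 0 = (\<lambda>\<omega>. G (E \<omega>))" by (rule ext) (simp add: XG tshift_def)
    hence "in_Lp M p (\<lambda>\<omega>. G (E \<omega>))" using Lp[of 0] by simp
    thus ?thesis using in_Lp_distr[OF Em Gm, of p] Ed by simp
  qed
  have dep_eq: "\<delta> q j = I.coupling q G (- int j)" for q j
  proof -
    let ?f = "\<lambda>(x, y). G (tshift (int j) x) - G (tshift (int j) (patch (- {0}) x y))"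
    have fm: "?f \<in> borel_measurable (I.P \<Otimes>\<^sub>M I.P)"
    proof -
      have Gs: "(\<lambda>x. G (tshift (int j) x)) \<in> borel_measurable I.P" by (rule I.measurable_shift_comp[OF Gm])
      show ?thesis unfolding case_prod_unfold
        using measurable_compose[OF measurable_fst Gs] measurable_compose[OF I.measurable_patch(1)[of "- {0}"] Gs]
        by (intro borel_measurable_diff) (auto simp: case_prod_unfold)
    qed
    have co: "coupled_process g eps eps' (int j) \<omega> = G (tshift (int j) (patch (- {0}) (E \<omega>) (E' \<omega>)))" for \<omega>
      unfolding coupled_process_def process_def G_def E_def E'_def tshift_def patch_def
      by (intro arg_cong[where f = g]) (auto simp: fun_eq_iff)
    have "\<delta> q j = Lp_norm M q (\<lambda>\<omega>. ?f (E \<omega>, E' \<omega>))"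
      unfolding \<delta>_def dep_coeff_def co XG[unfolded X_def] by simp
    also have "\<dots> = Lp_norm (I.P \<Otimes>\<^sub>M I.P) q ?f"
      using Lp_norm_distr[OF pairm fm, of q] paird by simp
    also have "\<dots> = I.coupling q (\<lambda>x. G (tshift (int j) x)) 0" by (simp add: I.coupling_def)
    also have "\<dots> = I.coupling q G (- int j)" by (simp add: I.coupling_shift[OF Gm])
    finally show ?thesis .
  qed
  interpret CP: causal_process \<nu> G p
  proof
    show "depends_on G {..0}"
      unfolding depends_on_def G_def by (auto intro!: arg_cong[where f = g])
    show "in_Lp I.P p G" by (rule GLp)
    show "p > 4" by fact
    have "(LINT x|distr M I.P E. G x) = (LINT \<omega>|M. G (E \<omega>))" by (rule integral_distr[OF Em Gm])
    also have "\<dots> = (LINT \<omega>|M. X 0 \<omega>)" by (simp add: XG tshift_def)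
    finally show "(LINT x|I.P. G x) = 0" using mean[of 0] Ed by simp
    show "summable (\<lambda>j. I.coupling p G (- int j))" using summ unfolding dep_eq[abs_def] .
  qed
  have dep: "\<delta> q = CP.dep q" for q by (simp add: fun_eq_iff dep_eq CP.dep_def)
  have XE: "X t \<omega> = CP.X t (E \<omega>)" for t \<omega> by (simp add: XG CP.X_def)
  obtain D where D: "D > 0" "\<And>m. m \<ge> 1 \<Longrightarrow> Theta_tail (\<delta> p) m \<le> D * real m powr (- \<alpha>)"
    using bigo_powr_uniform[OF Theta] by blast
  obtain D' where D': "D' > 0" "\<And>m. m \<ge> 1 \<Longrightarrow> Delta_tail p (\<delta> p) m \<le> D' * real m powr (- \<alpha>')"
    using bigo_powr_uniform[OF Delta] by blast
  have ap: "\<alpha> > 0" "\<alpha> * p > 2"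
  proof -
    show a: "\<alpha> > 0" using \<open>\<alpha> \<ge> \<alpha>'\<close> \<open>\<alpha>' > 0\<close> by simp
    show "\<alpha> * p > 2"
      using \<open>\<alpha> > 1 / 2 \<or> \<alpha>' * p > 2\<close>
    proof
      assume "\<alpha> > 1 / 2"
      hence "\<alpha> * p > 1 / 2 * p" using \<open>p > 4\<close> by (intro mult_strict_right_mono) auto
      moreover have "1 / 2 * p > 2" using \<open>p > 4\<close> by simp
      ultimately show ?thesis by linarith
    next
      assume "\<alpha>' * p > 2"
      moreover have "\<alpha>' * p \<le> \<alpha> * p" using \<open>\<alpha> \<ge> \<alpha>'\<close> \<open>p > 4\<close> by (intro mult_right_mono) auto
      ultimately show ?thesis by linarith
    qed
  qed
  interpret R: causal_process_rate \<nu> G p \<alpha> D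
  proof
    fix m :: nat assume "m \<ge> 1"
    thus "(\<Sum>j. CP.dep p (j + m)) \<le> D * real m powr (- \<alpha>)"
      using D(2)[of m] by (simp add: Theta_tail_def dep)
  qed (use ap D in auto)
  have cc: "c \<ge> 21 * CP.norm4 * CP.sum_dep4"
  proof -
    have "Lp_norm M 4 (X 0) = CP.norm4"
    proof -
      have "Lp_norm M 4 (X 0) = Lp_norm M 4 (\<lambda>\<omega>. G (E \<omega>))" by (simp add: XG[abs_def] tshift_def)
      also have "\<dots> = Lp_norm I.P 4 G" using Lp_norm_distr[OF Em Gm, of 4] Ed by simp
      finally show ?thesis by (simp add: CP.norm4_def)
    qed
    moreover have "Theta_tail (\<delta> 4) 0 = CP.sum_dep4" by (simp add: Theta_tail_def dep CP.sum_dep4_def)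
    ultimately have c: "c = 6 * (p + 4) * exp (p / 4) * (CP.norm4 * CP.sum_dep4)" by (simp add: c_def)
    \<comment> \<open>In units of \<open>norm4 * sum_dep4\<close>, half the threshold must cover the constant 20 of the main part and an
      arbitrarily small one, here 1, for the remainder.\<close>
    have "21 \<le> 6 * (p + 4) * 1" using \<open>p > 4\<close> by simp
    also have "\<dots> \<le> 6 * (p + 4) * exp (p / 4)" using \<open>p > 4\<close> by (intro mult_left_mono) auto
    finally have "21 * (CP.norm4 * CP.sum_dep4) \<le> 6 * (p + 4) * exp (p / 4) * (CP.norm4 * CP.sum_dep4)"
      using CP.norm4_nonneg CP.sum_dep4_nonneg by (intro mult_right_mono) auto
    thus ?thesis by (simp add: c)
  qed
  define err where "err T x = (\<Sum>k<T. \<bar>CP.thresholded_sac (A T) T k x - CP.acov k\<bar>)" for T x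
  let ?r = "\<lambda>T. (ln (real T) / real T) powr (\<alpha> / (2 * (1 + \<alpha>)))"
  have err_bound: "\<exists>C>0. \<forall>\<^sub>F T in sequentially. I.prob_le (\<lambda>x. err T x > C * ?r T) e" if e: "e > 0" for e
  proof (cases "CP.norm4 = 0")
    case True
    have "\<forall>\<^sub>F T in sequentially. I.prob_le (\<lambda>x. err T x > 1 * ?r T) e"
      using eventually_ge_at_top[of 3]
    proof eventually_elim
      case (elim T)
      have "?r T > 0" using elim by simp
      from R.thresholded_sac_degenerate[OF True this, of "A T" T]
      have "I.prob_le (\<lambda>x. err T x > ?r T) 0" unfolding err_def .
      thus ?case by (rule I.prob_le_mono) (use e in auto)
    qed
    thus ?thesis by (intro exI[of _ 1]) simp
  next
    case False
    hence "CP.norm4 > 0" using CP.norm4_nonneg by simp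
    moreover have "\<alpha> > 1 / 2 \<or> (\<exists>\<alpha>' D'. 0 < \<alpha>' \<and> \<alpha>' \<le> \<alpha> \<and> \<alpha>' * p > 2 \<and> D' > 0
          \<and> (\<forall>m\<ge>1. Delta_tail p (CP.dep p) m \<le> D' * real m powr (- \<alpha>')))"
      using \<open>\<alpha> > 1 / 2 \<or> \<alpha>' * p > 2\<close> \<open>\<alpha> \<ge> \<alpha>'\<close> \<open>\<alpha>' > 0\<close> D' unfolding dep by blast
    ultimately show ?thesis
      unfolding err_def A_def using R.thresholded_sac_total_error[OF cc _ _ e] by blast
  qed
  define a where "a T \<omega> s t = (if s = t \<or> \<bar>sample_autocov X T (int s - int t) \<omega>\<bar> \<ge> A T
      then sample_autocov X T (int s - int t) \<omega> else 0) - autocov M X (int s - int t)" for T \<omega> and s t :: nat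
  have mat: "thresholded_autocov_mat X T (A T) \<omega> - autocov_mat M X T = mat T T (\<lambda>(s, t). a T \<omega> s t)" for T \<omega>
    by (rule eq_matI) (auto simp: thresholded_autocov_mat_def autocov_mat_def a_def)
  have sac: "sample_autocov X T k \<omega> = CP.sac T (nat \<bar>k\<bar>) (E \<omega>)" for T k \<omega>
    by (simp add: sample_autocov_def CP.sac_def XE)
  have acov: "autocov M X k = CP.acov (nat \<bar>k\<bar>)" for k
  proof -
    have m: "(\<lambda>x. CP.X 0 x * CP.X k x) \<in> borel_measurable I.P" by measurable
    have "autocov M X k = (LINT x|I.P. CP.X 0 x * CP.X k x)"
      unfolding autocov_def XE using integral_distr[OF Em m] Ed by simp
    also have "\<dots> = CP.acov (nat \<bar>k\<bar>)"
    proof (cases "k \<ge> 0")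
      case True thus ?thesis by (simp add: CP.acov_def)
    next
      case False
      hence k: "0 - int (nat \<bar>k\<bar>) = k" by simp
      show ?thesis using CP.acov_shift[of 0 "nat \<bar>k\<bar>"] unfolding k .
    qed
    finally show ?thesis .
  qed
  have a_eq: "\<bar>a T \<omega> s t\<bar> = \<bar>CP.thresholded_sac (A T) T (nat \<bar>int s - int t\<bar>) (E \<omega>) - CP.acov (nat \<bar>int s - int t\<bar>)\<bar>" for T \<omega> s t
    unfolding a_def sac acov CP.thresholded_sac_def by auto
  have norm_le: "\<bar>mat_op_norm (mat T T (\<lambda>(s, t). a T \<omega> s t))\<bar> \<le> 2 * err T (E \<omega>)" if T: "T \<ge> 1" for T \<omega>
  proof (rule abs_mat_op_norm_le[OF T])
    let ?h = "\<lambda>k. \<bar>CP.thresholded_sac (A T) T k (E \<omega>) - CP.acov k\<bar>"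
    fix s assume s: "s < T"
    show "(\<Sum>t<T. \<bar>a T \<omega> s t\<bar>) \<le> 2 * err T (E \<omega>)"
      unfolding a_eq err_def by (rule Toeplitz_row_sum_le[of ?h, OF _ s]) simp
    have "(\<Sum>t<T. \<bar>a T \<omega> t s\<bar>) = (\<Sum>t<T. ?h (nat \<bar>int s - int t\<bar>))"
      unfolding a_eq by (simp add: abs_minus_commute)
    also have "\<dots> \<le> 2 * err T (E \<omega>)" unfolding err_def by (rule Toeplitz_row_sum_le[of ?h, OF _ s]) simp
    finally show "(\<Sum>t<T. \<bar>a T \<omega> t s\<bar>) \<le> 2 * err T (E \<omega>)" .
  qed
  have Ym: "(\<lambda>\<omega>. mat_op_norm (mat T T (\<lambda>(s, t). a T \<omega> s t))) \<in> borel_measurable M" for T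
  proof (rule measurable_mat_op_norm)
    fix s t :: nat
    have Xm[measurable]: "X u \<in> borel_measurable M" for u using Lp[of u] by (simp add: in_Lp_def)
    have [measurable]: "(\<lambda>\<omega>. sample_autocov X T k \<omega>) \<in> borel_measurable M" for k
      unfolding sample_autocov_def by measurable
    show "(\<lambda>\<omega>. a T \<omega> s t) \<in> borel_measurable M" unfolding a_def by measurable
  qed
  show ?thesis
    unfolding bigO_P_def mat
  proof (intro conjI allI impI Ym)
    fix e :: real assume e: "e > 0"
    obtain C where C: "C > 0" "\<forall>\<^sub>F T in sequentially. I.prob_le (\<lambda>x. err T x > C * ?r T) (e / 2)"
      using err_bound[of "e / 2"] e by auto
    show "\<exists>C>0. \<forall>\<^sub>F T in sequentially.
        measure M {\<omega> \<in> space M. \<bar>mat_op_norm (mat T T (\<lambda>(s, t). a T \<omega> s t))\<bar> > C * ?r T} < e"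
    proof (intro exI[of _ "2 * C"] conjI)
      show "\<forall>\<^sub>F T in sequentially.
        measure M {\<omega> \<in> space M. \<bar>mat_op_norm (mat T T (\<lambda>(s, t). a T \<omega> s t))\<bar> > 2 * C * ?r T} < e"
        using C(2) eventually_ge_at_top[of 1]
      proof eventually_elim
        case (elim T)
        obtain S where S: "S \<in> sets I.P" "{x. err T x > C * ?r T} \<subseteq> S" "measure I.P S \<le> e / 2"
          using elim(1) by (auto simp: I.prob_le_def)
        have "measure M {\<omega> \<in> space M. \<bar>mat_op_norm (mat T T (\<lambda>(s, t). a T \<omega> s t))\<bar> > 2 * C * ?r T}
           \<le> measure M (E -` S \<inter> space M)"
        proof (rule M.finite_measure_mono)
          show "{\<omega> \<in> space M. \<bar>mat_op_norm (mat T T (\<lambda>(s, t). a T \<omega> s t))\<bar> > 2 * C * ?r T} \<subseteq> E -` S \<inter> space M"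
          proof
            fix \<omega> assume w: "\<omega> \<in> {\<omega> \<in> space M. \<bar>mat_op_norm (mat T T (\<lambda>(s, t). a T \<omega> s t))\<bar> > 2 * C * ?r T}"
            hence "2 * C * ?r T < 2 * err T (E \<omega>)" using norm_le[OF elim(2), of \<omega>] by simp
            hence "E \<omega> \<in> {x. err T x > C * ?r T}" by simp
            thus "\<omega> \<in> E -` S \<inter> space M" using S(2) w by auto
          qed
          show "E -` S \<inter> space M \<in> sets M" by (rule measurable_sets[OF Em S(1)])
        qed
        also have "\<dots> = measure (distr M I.P E) S" by (rule measure_distr[OF Em S(1), symmetric])
        also have "\<dots> \<le> e / 2" using S(3) Ed by simp
        also have "\<dots> < e" using e by simp
        finally show ?case .
      qed
    qed (use C in simp)
  qed
qed

end
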